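(* Let $\Omega\subset\mathbb{R}^d$ be bounded open, $1<p<\infty$, $0<s\le1$, let $v,\lambda_\pm$ satisfy the standing assumptions and $f\in L^{p^\#_s}(\Omega)$. Then there exist $(u,\chi_>,\chi_<)\in\Lambda^{s,p}_0(\Omega)\times L^\infty(\Omega)\times L^\infty(\Omega)$ which form a solution of the two-phase problem for $(f,\lambda_\pm,v)$ (in the sense defined below). Moreover, $u$ is the unique solution of the variational inequality $\Psi_v(w)-\Psi_v(u)\ge\langle f+\Delta^s_pu,w-u\rangle_{\Lambda^{-s,p'}(\Omega)\times\Lambda^{s,p}_0(\Omega)}$ for all $w\in\Lambda^{s,p}_0(\Omega)$, and $$\zeta_v=\lambda_+\chi_>-\lambda_-\chi_<\in L^q(\Omega)$$ is the unique element of $\partial\Psi_v(u)$ with $\zeta_v=f+\Delta^s_p u$.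
   Context: Fractional gradient: for $0<s<1$ and $\varphi\in C^\infty_c(\mathbb{R}^d)$, $D^s\varphi=D(I_{1-s}\varphi)$, where $I_{1-s}\varphi(x)=c_{d,s}\int_{\mathbb{R}^d}\varphi(y)|x-y|^{-(d+s-1)}\,dy$ is the Riesz potential of order $1-s$ with its standard positive normalizing constant; $D^s$ extends distributionally via $\int\varphi\, D^s\cdot\Phi=-\int\Phi\cdot D^s\varphi$. For $0<s<1$, $\Lambda^{s,p}_0(\Omega)$ is the closure of $C^\infty_c(\Omega)$ in the norm $(\|f\|^p_{L^p(\mathbb{R}^d)}+\|D^sf\|^p_{L^p(\mathbb{R}^d;\mathbb{R}^d)})^{1/p}$ (functions extended by zero). For $s=1$, $D^1=D$ (set to $0$ outside $\Omega$) and $\Lambda^{1,p}_0(\Omega)=W^{1,p}_0(\Omega)$. $\Lambda^{-s,p'}(\Omega)$ is the dual space, $p'=p/(p-1)$, and $\langle-\Delta^s_p u,w\rangle=\int_{\mathbb{R}^d}|D^su|^{p-2}D^su\cdot D^sw\,dx$. Exponents: $p^*_s=dp/(d-sp)$ if $sp<d$, $\infty$ otherwise; $p^\#_s=(p^*_s)'$, i.e. $dp/[d(p-1)+sp]$ if $sp<d$, $1$ if $sp>d$, some fixed number $>1$ if $sp=d$. Standing assumptions: $p^\#_s<q\le\infty$, $q'=q/(q-1)$, $v\in L^{q'}(\Omega)$, $\lambda_\pm\in L^q(\Omega)$, $\lambda_\pm\ge0$ a.e. $\Psi_v(w)=\int_\Omega[\lambda_+(w-v)^++\lambda_-(w-v)^-]\,dx$,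 $t^\pm=\max\{\pm t,0\}$. Solution of the two-phase problem for $(f,\lambda_\pm,v)$ with operator $-\Delta^s_p$: a triple $(u,\chi_>,\chi_<)\in\Lambda^{s,p}_0(\Omega)\times L^\infty(\Omega)\times L^\infty(\Omega)$ such that a.e. in $\Omega$: $\chi_{\{u>v\}}\le\chi_>\le\chi_{\{u\ge v\}}$ and $\chi_{\{u<v\}}\le\chi_<\le\chi_{\{u\le v\}}$ (quasi-characteristic functions), and $\int_{\mathbb{R}^d}|D^su|^{p-2}D^su\cdot D^sw\,dx+\int_\Omega(\lambda_+\chi_>-\lambda_-\chi_<)w\,dx=\int_\Omega fw\,dx$ for all $w\in\Lambda^{s,p}_0(\Omega)$ (i.e. $-\Delta^s_pu+\lambda_+\chi_>-\lambda_-\chi_<=f$ in $\Omega$, $u=0$ on $\mathbb{R}^d\setminus\Omega$). *)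

theory Defs
  imports "HOL-Analysis.Analysis"
begin

definition Lp_on :: "real \<Rightarrow> 'a::euclidean_space set \<Rightarrow> ('a \<Rightarrow> real) \<Rightarrow> bool" where
  "Lp_on t S f \<longleftrightarrow>
     (\<lambda>x. indicator S x * f x) \<in> borel_measurable lebesgue \<and>
     integrable lebesgue (\<lambda>x. indicator S x * \<bar>f x\<bar> powr t)"

definition Linf_on :: "'a::euclidean_space set \<Rightarrow> ('a \<Rightarrow> real) \<Rightarrow> bool" where
  "Linf_on S f \<longleftrightarrow>
     (\<lambda>x. indicator S x * f x) \<in> borel_measurable lebesgue \<and>
     (\<exists>C. AE x in lebesgue. x \<in> S \<longrightarrow> \<bar>f x\<bar> \<le> C)"

definition Lq_on :: "ereal \<Rightarrow> 'a::euclidean_space set \<Rightarrow> ('a \<Rightarrow> real) \<Rightarrow> bool" where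
  "Lq_on q S f \<longleftrightarrow> (if q = \<infinity> then Linf_on S f else Lp_on (real_of_ereal q) S f)"

definition conj_exp :: "ereal \<Rightarrow> ereal" where
  "conj_exp q = (if q = \<infinity> then 1 else ereal (real_of_ereal q / (real_of_ereal q - 1)))"

definition Lp_vec :: "real \<Rightarrow> ('a::euclidean_space \<Rightarrow> 'a) \<Rightarrow> bool" where
  "Lp_vec t G \<longleftrightarrow> G \<in> borel_measurable lebesgue \<and>
     integrable lebesgue (\<lambda>x. norm (G x) powr t)"

text \<open>p^#_s; in the borderline case s p = d it is a fixed number r > 1 (parameter).\<close>
definition pSharp :: "nat \<Rightarrow> real \<Rightarrow> real \<Rightarrow> real \<Rightarrow> real" where
  "pSharp d s p r =
     (if s * p < real d then real d * p / (real d * (p - 1) + s * p)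
      else if s * p > real d then 1 else r)"

definition partial_dir :: "'a::euclidean_space \<Rightarrow> ('a \<Rightarrow> real) \<Rightarrow> ('a \<Rightarrow> real)" where
  "partial_dir b g = (\<lambda>x. frechet_derivative g (at x) b)"

definition smooth_fun :: "('a::euclidean_space \<Rightarrow> real) \<Rightarrow> bool" where
  "smooth_fun g \<longleftrightarrow>
     (\<forall>bs. set bs \<subseteq> Basis \<longrightarrow> (\<forall>x. fold partial_dir bs g differentiable (at x)))"

definition test_fun :: "'a::euclidean_space set \<Rightarrow> ('a \<Rightarrow> real) \<Rightarrow> bool" where
  "test_fun \<Omega> \<phi> \<longleftrightarrow> smooth_fun \<phi> \<and> compact (closure {x. \<phi> x \<noteq> 0})
      \<and> closure {x. \<phi> x \<noteq> 0} \<subseteq> \<Omega>"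

definition grad :: "('a::euclidean_space \<Rightarrow> real) \<Rightarrow> 'a \<Rightarrow> 'a" where
  "grad g x = (\<Sum>b\<in>Basis. frechet_derivative g (at x) b *\<^sub>R b)"

definition riesz_const :: "nat \<Rightarrow> real \<Rightarrow> real" where
  "riesz_const d \<alpha> = Gamma ((real d - \<alpha>) / 2) / (pi powr (real d / 2) * 2 powr \<alpha> * Gamma (\<alpha> / 2))"

definition riesz :: "real \<Rightarrow> ('a::euclidean_space \<Rightarrow> real) \<Rightarrow> 'a \<Rightarrow> real" where
  "riesz \<alpha> \<phi> x = riesz_const DIM('a) \<alpha> *
     (LINT y|lebesgue. \<phi> y * norm (x - y) powr (-(real DIM('a) - \<alpha>)))"

definition frac_grad :: "real \<Rightarrow> ('a::euclidean_space \<Rightarrow> real) \<Rightarrow> 'a \<Rightarrow> 'a" where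
  "frac_grad s \<phi> = (if s = 1 then grad \<phi> else grad (riesz (1 - s) \<phi>))"

text \<open>u \<in> \<Lambda>^{s,p}_0(\<Omega>) with fractional gradient D^s u = G: (u, G) is the L^p-limit of
  (\<phi>_n, D^s \<phi>_n) for test functions \<phi>_n \<in> C^\<infinity>_c(\<Omega>) (i.e. u lies in the closure of
  C^\<infinity>_c(\<Omega>) in the \<Lambda>^{s,p} norm, and G is its fractional gradient).\<close>
definition Lambda0 :: "real \<Rightarrow> real \<Rightarrow> 'a::euclidean_space set \<Rightarrow> ('a \<Rightarrow> real) \<Rightarrow> ('a \<Rightarrow> 'a) \<Rightarrow> bool" where
  "Lambda0 s p \<Omega> u G \<longleftrightarrow> Lp_on p UNIV u \<and> Lp_vec p G \<and>
     (\<exists>\<phi> :: nat \<Rightarrow> 'a \<Rightarrow> real. (\<forall>n. test_fun \<Omega> (\<phi> n)) \<and>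
        (\<lambda>n. LINT x|lebesgue. \<bar>\<phi> n x - u x\<bar> powr p) \<longlonglongrightarrow> 0 \<and>
        (\<lambda>n. LINT x|lebesgue. norm (frac_grad s (\<phi> n) x - G x) powr p) \<longlonglongrightarrow> 0)"

text \<open>\<langle>-\<Delta>^s_p u, w\<rangle>, given the fractional gradients Gu, Gw.\<close>
definition plap_pair :: "real \<Rightarrow> ('a::euclidean_space \<Rightarrow> 'a) \<Rightarrow> ('a \<Rightarrow> 'a) \<Rightarrow> real" where
  "plap_pair p Gu Gw = (LINT x|lebesgue. norm (Gu x) powr (p - 2) * (Gu x \<bullet> Gw x))"

definition Psi :: "'a::euclidean_space set \<Rightarrow> ('a \<Rightarrow> real) \<Rightarrow> ('a \<Rightarrow> real) \<Rightarrow> ('a \<Rightarrow> real)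
     \<Rightarrow> ('a \<Rightarrow> real) \<Rightarrow> real" where
  "Psi \<Omega> lp lm v w = (LINT x|lebesgue. indicator \<Omega> x *
      (lp x * max (w x - v x) 0 + lm x * max (-(w x - v x)) 0))"

definition two_phase_solution ::
  "real \<Rightarrow> real \<Rightarrow> 'a::euclidean_space set \<Rightarrow> ('a \<Rightarrow> real) \<Rightarrow> ('a \<Rightarrow> real) \<Rightarrow> ('a \<Rightarrow> real)
   \<Rightarrow> ('a \<Rightarrow> real) \<Rightarrow> ('a \<Rightarrow> real) \<Rightarrow> ('a \<Rightarrow> 'a) \<Rightarrow> ('a \<Rightarrow> real) \<Rightarrow> ('a \<Rightarrow> real) \<Rightarrow> bool" where
  "two_phase_solution s p \<Omega> f lp lm v u Gu cg cl \<longleftrightarrow>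
     Lambda0 s p \<Omega> u Gu \<and> Linf_on \<Omega> cg \<and> Linf_on \<Omega> cl \<and>
     (AE x in lebesgue. x \<in> \<Omega> \<longrightarrow>
        indicator {y. u y > v y} x \<le> cg x \<and> cg x \<le> indicator {y. u y \<ge> v y} x \<and>
        indicator {y. u y < v y} x \<le> cl x \<and> cl x \<le> indicator {y. u y \<le> v y} x) \<and>
     (\<forall>w Gw. Lambda0 s p \<Omega> w Gw \<longrightarrow>
        plap_pair p Gu Gw + (LINT x|lebesgue. indicator \<Omega> x * ((lp x * cg x - lm x * cl x) * w x))
          = (LINT x|lebesgue. indicator \<Omega> x * (f x * w x)))"

definition var_ineq ::
  "real \<Rightarrow> real \<Rightarrow> 'a::euclidean_space set \<Rightarrow> ('a \<Rightarrow> real) \<Rightarrow> ('a \<Rightarrow> real) \<Rightarrow> ('a \<Rightarrow> real)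
   \<Rightarrow> ('a \<Rightarrow> real) \<Rightarrow> ('a \<Rightarrow> real) \<Rightarrow> ('a \<Rightarrow> 'a) \<Rightarrow> bool" where
  "var_ineq s p \<Omega> f lp lm v u Gu \<longleftrightarrow>
     Lambda0 s p \<Omega> u Gu \<and>
     (\<forall>w Gw. Lambda0 s p \<Omega> w Gw \<longrightarrow>
        Psi \<Omega> lp lm v w - Psi \<Omega> lp lm v u \<ge>
          (LINT x|lebesgue. indicator \<Omega> x * (f x * (w x - u x)))
          - plap_pair p Gu (\<lambda>x. Gw x - Gu x))"

text \<open>\<zeta> (an L^q function acting by integration on \<Omega>) belongs to the subdifferential
  \<partial>\<Psi>_v(u) \<subseteq> \<Lambda>^{-s,p'}(\<Omega>).\<close>
definition in_subdiff ::
  "real \<Rightarrow> real \<Rightarrow> 'a::euclidean_space set \<Rightarrow> ('a \<Rightarrow> real) \<Rightarrow> ('a \<Rightarrow> real) \<Rightarrow> ('a \<Rightarrow> real)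
   \<Rightarrow> ('a \<Rightarrow> real) \<Rightarrow> ('a \<Rightarrow> real) \<Rightarrow> bool" where
  "in_subdiff s p \<Omega> lp lm v u \<zeta> \<longleftrightarrow>
     (\<forall>w Gw. Lambda0 s p \<Omega> w Gw \<longrightarrow>
        Psi \<Omega> lp lm v w - Psi \<Omega> lp lm v u \<ge> (LINT x|lebesgue. indicator \<Omega> x * (\<zeta> x * (w x - u x))))"

end

theory Submission
  imports Defs
begin

text \<open>The two-phase term is replaced by a convex \<open>C\<^sup>1\<close> approximation of \<open>t \<mapsto> max t 0\<close> whose slopes
lie in the unit interval. The approximating energies are coercive by the fractional Sobolev and Poincare
inequalities, and by the uniform convexity of the \<open>p\<close>-energy their minimisers form a Cauchy sequence, so
they converge strongly. Their slopes are bounded, hence convex combinations of them converge almost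
everywhere; the limit is the quasi-characteristic function of the positive phase. Subtracting it from one
gives that of the negative phase. Uniqueness of \<open>u\<close> is strict monotonicity of the \<open>p\<close>-Laplacian.

The fractional inequalities are derived by hand: for test functions \<open>D\<^sup>s \<phi>\<close> is a Riesz potential of the
gradient, composing Riesz kernels represents \<open>\<phi>\<close> by \<open>D\<^sup>s \<phi>\<close>, and the potential is estimated through the
maximal function (Hedberg).\<close>

text \<open>The slopes of the regularised problems need not converge where the solution touches
  \<open>v\<close>. The equation is affine in the slope, and its nonlinear term already converges
  strongly; so convex combinations of late slopes can replace the slopes without disturbing the
  other terms, and almost everywhere convergence of such combinations is enough. One unknown serves
  both phases because \<open>max (- t) 0 = max t 0 - t\<close>: a slope c of the positive part is a
  slope c - 1 of the negative part. In the inequalities the derivative in D^s \<phi> is read in two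
  ways. Put on \<phi>, it yields the representation; put on the kernel, away from the support, it
  yields decay controlled by the integral of |\<phi>| alone, so that the far part of the potential
  can be absorbed. The remaining potential lives on a ball, where the exponent p may be lowered:
  this is how sp = d is reached. The composition of kernels is found without computing its constant,
  since isometries and dilations determine the resulting vector field up to a positive
  factor.\<close>

section \<open>Lebesgue measure under affine maps and isometries; radial integrals without polar
  coordinates\<close>

lemma nn_integral_lborel_affine:
 fixes f :: "'a::euclidean_space \<Rightarrow> ennreal"
 assumes [measurable]: "f \<in> borel_measurable borel" and c: "c \<noteq> 0"
 shows "(\<integral>\<^sup>+x. f x \<partial>lborel) = ennreal (\<bar>c\<bar> ^ DIM('a)) * (\<integral>\<^sup>+x. f (t + c *\<^sub>R x) \<partial>lborel)"
 by (subst lborel_affine[OF c, of t])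
   (simp add: nn_integral_density nn_integral_distr nn_integral_cmult)

lemma nn_integral_lborel_translate:
 fixes f :: "'a::euclidean_space \<Rightarrow> ennreal"
 assumes [measurable]: "f \<in> borel_measurable borel"
 shows "(\<integral>\<^sup>+x. f (t + x) \<partial>lborel) = (\<integral>\<^sup>+x. f x \<partial>lborel)"
 using nn_integral_lborel_affine[OF assms, of 1 t] by simp

lemma nn_integral_lborel_reflect:
 fixes f :: "'a::euclidean_space \<Rightarrow> ennreal"
 assumes [measurable]: "f \<in> borel_measurable borel"
 shows "(\<integral>\<^sup>+x. f (t - x) \<partial>lborel) = (\<integral>\<^sup>+x. f x \<partial>lborel)"
 using nn_integral_lborel_affine[OF assms, of "-1" t] by simp

text \<open>Uniqueness of the translation-invariant measure, by computing the integral of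
 \<open>(x, y) \<mapsto> A (T x) B (T x + y)\<close> in both orders.\<close>

lemma emeasure_lborel_isometry:
 fixes T :: "'a::euclidean_space \<Rightarrow> 'a"
 assumes T: "orthogonal_transformation T" and A[measurable]: "A \<in> sets borel"
 shows "emeasure lborel (T -` A) = emeasure lborel A"
proof -
 have lin: "linear T" and nrm: "\<And>x. norm (T x) = norm x"
  using T by (auto simp: orthogonal_transformation)
 have [measurable]: "T \<in> borel_measurable borel"
  by (intro borel_measurable_continuous_onI linear_continuous_on linear_conv_bounded_linear[THEN iffD1] lin)
 have surj: "surj T" using T by (simp add: orthogonal_transformation_surj)
 \<comment> \<open>The unit ball is a set whose preimage under \<open>T\<close> is known in advance.
   It enters as a common factor and is cancelled at the end, its measure being positive and
   finite.\<close>
 define B :: "'a set" where "B = ball 0 1"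
 have [measurable]: "B \<in> sets borel" by (simp add: B_def)
 have TB: "T -` B = B" by (auto simp: B_def nrm)
 have vA: "(\<integral>\<^sup>+x. indicator A (T x) \<partial>lborel) = emeasure lborel (T -` A)"
 proof -
  have "(\<integral>\<^sup>+x. indicator A (T x) \<partial>lborel) = (\<integral>\<^sup>+x. indicator (T -` A) x \<partial>lborel)"
   by (simp add: indicator_def)
  also have "\<dots> = emeasure lborel (T -` A)"
   using measurable_sets[of T borel borel A] by (intro nn_integral_indicator) simp
  finally show ?thesis .
 qed
 have vB: "(\<integral>\<^sup>+x. indicator B (T x) \<partial>lborel) = emeasure lborel B"
 proof -
  have "indicator B (T x) = (indicator B x :: ennreal)" for x
   by (simp add: indicator_def B_def nrm)
  then show ?thesis by simp
 qed
 \<comment> \<open>Surjectivity supplies z with T z = y, so a translation by y in the image becomes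
   a translation by z of the integration variable.\<close>
 have eqM: "(\<integral>\<^sup>+x. indicator A (T x) * indicator B (T x + y) \<partial>lborel)
   = (\<integral>\<^sup>+x. indicator A (T x - y) * indicator B (T x) \<partial>lborel)" for y :: 'a
 proof -
  obtain z where z: "y = T z" using surj by (meson surj_def)
  have Tz: "T (x - z) = T x - y" for x
   using linear_diff[OF lin, of x z] by (simp add: z)
  have "(\<integral>\<^sup>+x. indicator A (T (-z + x)) * indicator B (T (-z + x) + y) \<partial>lborel)
   = (\<integral>\<^sup>+x. indicator A (T x) * indicator B (T x + y) \<partial>lborel)"
   by (rule nn_integral_lborel_translate) measurable
  then show ?thesis by (simp add: Tz)
 qed
 have "emeasure lborel (T -` A) * emeasure lborel B
   = (\<integral>\<^sup>+x. \<integral>\<^sup>+y. indicator A (T x) * indicator B (T x + y) \<partial>lborel \<partial>lborel)"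
 proof -
  have "(\<integral>\<^sup>+y. indicator B (T x + y) \<partial>lborel) = emeasure lborel B" for x
   by (subst nn_integral_lborel_translate) auto
  then show ?thesis by (simp add: nn_integral_cmult nn_integral_multc vA)
 qed
 also have "\<dots> = (\<integral>\<^sup>+y. \<integral>\<^sup>+x. indicator A (T x) * indicator B (T x + y) \<partial>lborel \<partial>lborel)"
  by (rule lborel_pair.Fubini') measurable
 also have "\<dots> = (\<integral>\<^sup>+y. \<integral>\<^sup>+x. indicator A (T x - y) * indicator B (T x) \<partial>lborel \<partial>lborel)"
  by (simp add: eqM)
 also have "\<dots> = (\<integral>\<^sup>+x. \<integral>\<^sup>+y. indicator A (T x - y) * indicator B (T x) \<partial>lborel \<partial>lborel)"
  by (rule lborel_pair.Fubini') measurable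
 also have "\<dots> = emeasure lborel A * emeasure lborel B"
 proof -
  have "(\<integral>\<^sup>+y. indicator A (T x - y) \<partial>lborel) = emeasure lborel A" for x
   by (subst nn_integral_lborel_reflect) auto
  then show ?thesis by (simp add: nn_integral_cmult nn_integral_multc vB)
 qed
 finally have "emeasure lborel B * emeasure lborel (T -` A) = emeasure lborel B * emeasure lborel A"
  by (simp add: mult.commute)
 moreover have "emeasure lborel B \<noteq> 0" "emeasure lborel B \<noteq> \<infinity>"
  using unit_ball_vol_pos[of "real DIM('a)"] by (auto simp: B_def emeasure_ball dest: order.strict_implies_not_eq[symmetric] simp del: unit_ball_vol_pos)
 ultimately show ?thesis
  by (metis ennreal_mult_cancel_left infinity_ennreal_def)
qed

lemma distr_lborel_isometry:
 fixes T :: "'a::euclidean_space \<Rightarrow> 'a"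
 assumes T: "orthogonal_transformation T"
 shows "distr lborel borel T = lborel"
proof (rule measure_eqI)
 have [measurable]: "T \<in> borel_measurable borel"
  using T by (intro borel_measurable_continuous_onI linear_continuous_on linear_conv_bounded_linear[THEN iffD1])
   (simp add: orthogonal_transformation)
 fix A assume "A \<in> sets (distr lborel borel T)"
 then have "A \<in> sets borel" by simp
 then show "emeasure (distr lborel borel T) A = emeasure lborel A"
  using emeasure_lborel_isometry[OF T] by (simp add: emeasure_distr)
qed simp

lemma nn_integral_powr_0:
 assumes c: "c > 0" and \<delta>: "\<delta> \<ge> 0"
 shows "(\<integral>\<^sup>+\<rho>. indicator {0..\<delta>} \<rho> * ennreal (\<rho> powr (c - 1)) \<partial>lborel) = ennreal (\<delta> powr c / c)"
proof -
 have "((\<lambda>x. x powr (c - 1)) has_integral (\<delta> powr c / c)) {0..\<delta>}"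
  using has_integral_powr_from_0[of "c - 1" \<delta>] c \<delta> by simp
 then have "((\<lambda>x. indicator {0..\<delta>} x * x powr (c - 1)) has_integral (\<delta> powr c / c)) UNIV"
  by (subst (asm) has_integral_restrict_UNIV[symmetric], elim has_integral_eq[rotated]) auto
 then have "(\<integral>\<^sup>+\<rho>. ennreal (indicator {0..\<delta>} \<rho> * \<rho> powr (c - 1)) \<partial>lborel) = ennreal (\<delta> powr c / c)"
  by (intro nn_integral_has_integral_lborel) auto
 then show ?thesis by (simp add: ennreal_mult' ennreal_indicator)
qed

lemma nn_integral_powr_inf:
 assumes c: "c > 0" and \<delta>: "\<delta> > 0"
 shows "(\<integral>\<^sup>+\<rho>. indicator {\<delta>..} \<rho> * ennreal (\<rho> powr (- c - 1)) \<partial>lborel) = ennreal (\<delta> powr (- c) / c)"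
proof -
 have "((\<lambda>x. x powr (- c - 1)) has_integral (\<delta> powr (-c) / c)) {\<delta>..}"
  using has_integral_powr_to_inf[of "- c - 1" \<delta>] c \<delta> by (simp add: divide_minus_right)
 then have "((\<lambda>x. indicator {\<delta>..} x * x powr (- c - 1)) has_integral (\<delta> powr (-c) / c)) UNIV"
  by (subst (asm) has_integral_restrict_UNIV[symmetric], elim has_integral_eq[rotated]) auto
 then have "(\<integral>\<^sup>+\<rho>. ennreal (indicator {\<delta>..} \<rho> * \<rho> powr (- c - 1)) \<partial>lborel) = ennreal (\<delta> powr (-c) / c)"
  by (intro nn_integral_has_integral_lborel) auto
 then show ?thesis by (simp add: ennreal_mult' ennreal_indicator)
qed

text \<open>Writes the power as a superposition of indicators of half-lines. Applied with
  \<open>r\<close> a distance, it turns a Riesz kernel into a superposition of indicators of balls,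
  which replaces polar coordinates.\<close>

lemma powr_neg_layer_cake:
 assumes b: "b > 0" and r: "(r::real) > 0"
 shows "ennreal (r powr (- b)) = ennreal b * (\<integral>\<^sup>+\<rho>. indicator {r..} \<rho> * ennreal (\<rho> powr (- b - 1)) \<partial>lborel)"
 using nn_integral_powr_inf[OF b r] b by (simp add: ennreal_mult'[symmetric])

text \<open>At \<open>x = y\<close> the left-hand side is \<open>0 powr (-b) = 0\<close>; this is why equality holds only almost everywhere
 and an inequality is stated.\<close>

lemma norm_powr_le_layer_cake:
 assumes b: "b > 0"
 shows "ennreal (norm (z::'a::real_normed_vector) powr (- b)) \<le> ennreal b * (\<integral>\<^sup>+\<rho>. indicator {0<..} \<rho> * (indicator (cball 0 \<rho>) z * ennreal (\<rho> powr (- b - 1))) \<partial>lborel)"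
proof (cases "z = 0")
 case False
 have "ennreal (norm z powr (- b)) = ennreal b * (\<integral>\<^sup>+\<rho>. indicator {norm z..} \<rho> * ennreal (\<rho> powr (- b - 1)) \<partial>lborel)"
  using powr_neg_layer_cake[OF b, of "norm z"] False by simp
 also have "\<dots> \<le> ennreal b * (\<integral>\<^sup>+\<rho>. indicator {0<..} \<rho> * (indicator (cball 0 \<rho>) z * ennreal (\<rho> powr (- b - 1))) \<partial>lborel)"
  using False by (intro mult_left_mono nn_integral_mono) (auto simp: indicator_def intro: less_le_trans[of 0 "norm z"])
 finally show ?thesis .
qed simp

lemma emeasure_cball_le:
 fixes x :: "'a::euclidean_space"
 assumes "\<rho> \<ge> 0"
 shows "emeasure lborel (cball x \<rho>) = ennreal (unit_ball_vol (real DIM('a)) * \<rho> powr real DIM('a))"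
 using emeasure_cball[OF assms, of x] assms by (cases "\<rho> = 0") (auto simp: powr_realpow)

text \<open>Layer cake in the kernel, then Tonelli. Later facts on powers of the norm come from this
  bound: local integrability and decay by choosing \<open>g\<close> as an indicator, Hedberg's
  estimate by bounding the ball integrals of a general \<open>g\<close>.\<close>

lemma riesz_le_ball_averages:
 fixes g :: "'a::euclidean_space \<Rightarrow> ennreal"
 assumes b: "b > 0" and [measurable]: "g \<in> borel_measurable borel"
 shows "(\<integral>\<^sup>+y. ennreal (norm (x - y) powr (- b)) * g y \<partial>lborel)
  \<le> ennreal b * (\<integral>\<^sup>+\<rho>. indicator {0<..} \<rho> * (ennreal (\<rho> powr (- b - 1)) * (\<integral>\<^sup>+y. indicator (cball x \<rho>) y * g y \<partial>lborel)) \<partial>lborel)"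
proof -
 have [measurable]: "Measurable.pred (borel \<Otimes>\<^sub>M borel) (\<lambda>(\<rho>::real, y::'a). y \<in> cball x \<rho>)"
  unfolding mem_cball by measurable
 have "(\<integral>\<^sup>+y. ennreal (norm (x - y) powr (- b)) * g y \<partial>lborel)
  \<le> (\<integral>\<^sup>+y. (ennreal b * (\<integral>\<^sup>+\<rho>. indicator {0<..} \<rho> * (indicator (cball 0 \<rho>) (x - y) * ennreal (\<rho> powr (- b - 1))) \<partial>lborel)) * g y \<partial>lborel)"
  by (intro nn_integral_mono mult_right_mono norm_powr_le_layer_cake b) simp
 also have "\<dots> = (\<integral>\<^sup>+y. (\<integral>\<^sup>+\<rho>. ennreal b * (indicator {0<..} \<rho> * (ennreal (\<rho> powr (- b - 1)) * (indicator (cball x \<rho>) y * g y))) \<partial>lborel) \<partial>lborel)"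
 proof (intro nn_integral_cong, goal_cases)
  case (1 y)
  have "indicator (cball 0 \<rho>) (x - y) = (indicator (cball x \<rho>) y :: ennreal)" for \<rho>
   by (simp add: indicator_def dist_norm norm_minus_commute)
  then show ?case
   by (simp add: nn_integral_multc[symmetric] nn_integral_cmult[symmetric] mult_ac)
 qed
 also have "\<dots> = (\<integral>\<^sup>+\<rho>. (\<integral>\<^sup>+y. ennreal b * (indicator {0<..} \<rho> * (ennreal (\<rho> powr (- b - 1)) * (indicator (cball x \<rho>) y * g y))) \<partial>lborel) \<partial>lborel)"
  by (rule lborel_pair.Fubini') measurable
 also have "\<dots> = ennreal b * (\<integral>\<^sup>+\<rho>. indicator {0<..} \<rho> * (ennreal (\<rho> powr (- b - 1)) * (\<integral>\<^sup>+y. indicator (cball x \<rho>) y * g y \<partial>lborel)) \<partial>lborel)"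
  by (simp add: nn_integral_cmult)
 finally show ?thesis .
qed
text \<open>Treated as the potential at the origin of the indicator of a ball. Small radii
  contribute the ball volume times \<rho>^(-b-1), integrable at 0 since b < d; large radii see a
  mass capped by a fixed ball, and \<rho>^(-b-1) is integrable at infinity.\<close>

lemma nn_integral_norm_powr_ball:
 assumes b: "0 < b" "b < real DIM('a)"
 shows "(\<integral>\<^sup>+y. indicator (cball 0 \<delta>) y * ennreal (norm (y::'a::euclidean_space) powr (- b)) \<partial>lborel) < \<infinity>"
proof -
 let ?d = "real DIM('a)" and ?D = "max \<delta> 1"
 have [measurable]: "Measurable.pred (borel \<Otimes>\<^sub>M borel) (\<lambda>(\<rho>::real, y::'a). y \<in> cball 0 \<rho>)"
  unfolding mem_cball by measurable
 define I where "I = (\<integral>\<^sup>+\<rho>. indicator {0<..} \<rho> * (ennreal (\<rho> powr (- b - 1)) * (\<integral>\<^sup>+y. indicator (cball (0::'a) \<rho>) y * indicator (cball 0 ?D) y \<partial>lborel)) \<partial>lborel)"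
 have "(\<integral>\<^sup>+y. indicator (cball 0 \<delta>) y * ennreal (norm (y::'a) powr (- b)) \<partial>lborel)
  \<le> (\<integral>\<^sup>+y. ennreal (norm (0 - y) powr (- b)) * indicator (cball 0 ?D) (y::'a) \<partial>lborel)"
  by (intro nn_integral_mono) (auto simp: indicator_def)
 also have "\<dots> \<le> ennreal b * I"
  unfolding I_def by (rule riesz_le_ball_averages) (use b in auto)
 finally have le: "(\<integral>\<^sup>+y. indicator (cball 0 \<delta>) y * ennreal (norm (y::'a) powr (- b)) \<partial>lborel) \<le> ennreal b * I" .
 have "I \<le> (\<integral>\<^sup>+\<rho>. ennreal (unit_ball_vol ?d) * (indicator {0..?D} \<rho> * ennreal (\<rho> powr (?d - b - 1))) + ennreal (unit_ball_vol ?d * (?D + 1) powr ?d) * (indicator {?D..} \<rho> * (indicator {0<..} \<rho> * ennreal (\<rho> powr (-b-1)))) \<partial>lborel)"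
  unfolding I_def
 proof (rule nn_integral_mono)
  fix \<rho> :: real
  have 1: "(\<integral>\<^sup>+y. indicator (cball (0::'a) \<rho>) y * indicator (cball 0 ?D) y \<partial>lborel) \<le> emeasure lborel (cball (0::'a) \<rho>)"
   by (subst nn_integral_indicator[symmetric]) (auto intro!: nn_integral_mono simp del: nn_integral_indicator split: split_indicator)
  have 2: "(\<integral>\<^sup>+y. indicator (cball (0::'a) \<rho>) y * indicator (cball 0 ?D) y \<partial>lborel) \<le> emeasure lborel (cball (0::'a) ?D)"
   by (subst nn_integral_indicator[symmetric]) (auto intro!: nn_integral_mono simp del: nn_integral_indicator split: split_indicator)
  have 3: "emeasure lborel (cball (0::'a) ?D) \<le> ennreal (unit_ball_vol ?d * (?D + 1) powr ?d)"
   by (subst emeasure_cball_le) (auto intro!: ennreal_leI mult_left_mono powr_mono2)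
  consider "\<rho> \<le> 0" | "0 < \<rho>" "\<rho> \<le> ?D" | "0 < \<rho>" "?D < \<rho>" by linarith
  then show "indicator {0<..} \<rho> * (ennreal (\<rho> powr (- b - 1)) * (\<integral>\<^sup>+y. indicator (cball (0::'a) \<rho>) y * indicator (cball 0 ?D) y \<partial>lborel))
   \<le> ennreal (unit_ball_vol ?d) * (indicator {0..?D} \<rho> * ennreal (\<rho> powr (?d - b - 1))) + ennreal (unit_ball_vol ?d * (?D + 1) powr ?d) * (indicator {?D..} \<rho> * (indicator {0<..} \<rho> * ennreal (\<rho> powr (-b-1))))"
  proof cases
   case 2
   have "ennreal (\<rho> powr (- b - 1)) * (\<integral>\<^sup>+y. indicator (cball (0::'a) \<rho>) y * indicator (cball 0 ?D) y \<partial>lborel)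
    \<le> ennreal (\<rho> powr (- b - 1)) * emeasure lborel (cball (0::'a) \<rho>)"
    by (intro mult_left_mono 1) simp
   also have "\<dots> = ennreal (unit_ball_vol ?d * \<rho> powr (?d - b - 1))"
    using 2 powr_add[of \<rho> "- b - 1" ?d]
    by (subst emeasure_cball_le) (auto simp: ennreal_mult'[symmetric] algebra_simps)
   also have "\<dots> = ennreal (unit_ball_vol ?d) * ennreal (\<rho> powr (?d - b - 1))"
    by (simp add: ennreal_mult')
   finally show ?thesis using 2 by (simp add: add_increasing2)
  next
   case 3
   have "ennreal (\<rho> powr (- b - 1)) * (\<integral>\<^sup>+y. indicator (cball (0::'a) \<rho>) y * indicator (cball 0 ?D) y \<partial>lborel)
    \<le> ennreal (\<rho> powr (- b - 1)) * ennreal (unit_ball_vol ?d * (?D + 1) powr ?d)"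
    by (intro mult_left_mono order_trans[OF 2 \<open>emeasure lborel (cball (0::'a) ?D) \<le> _\<close>]) simp
   then show ?thesis using 3 by (simp add: mult.commute add_increasing)
  qed simp
 qed
 also have "\<dots> < \<infinity>"
 proof -
  have True: "?D > 0" by simp
  have "(\<integral>\<^sup>+\<rho>. indicator {?D..} \<rho> * (indicator {0<..} \<rho> * ennreal (\<rho> powr (-b-1))) \<partial>lborel) \<le> ennreal (?D powr (- b) / b)"
   using b True by (subst nn_integral_powr_inf[symmetric]) (auto intro!: nn_integral_mono simp: indicator_def)
  then have "(\<integral>\<^sup>+\<rho>. indicator {?D..} \<rho> * (indicator {0<..} \<rho> * ennreal (\<rho> powr (-b-1))) \<partial>lborel) < \<infinity>"
   by (rule le_less_trans) simp
  moreover have "(\<integral>\<^sup>+\<rho>. indicator {0..?D} \<rho> * ennreal (\<rho> powr (?d - b - 1)) \<partial>lborel) < \<infinity>"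
   using b by (subst nn_integral_powr_0) auto
  ultimately show ?thesis
   by (subst nn_integral_add) (auto simp: nn_integral_cmult ennreal_mult_less_top)
 qed
 finally have "ennreal b * I < \<infinity>"
  by (simp add: ennreal_mult_less_top)
 then show ?thesis by (rule le_less_trans[OF le])
qed
text \<open>A ball of radius \<rho> about the origin meets the outer set only for \<rho> \<ge>
  \<delta>, so the radial integral starts at \<delta>. The constant is displayed because the power
  of \<delta> later supplies the smallness that lets the tail of a potential be absorbed.\<close>

lemma nn_integral_norm_powr_outside:
 assumes b: "real DIM('a) < b" and \<delta>: "\<delta> > 0"
 shows "(\<integral>\<^sup>+y. indicator {y. \<delta> \<le> norm y} y * ennreal (norm (y::'a::euclidean_space) powr (- b)) \<partial>lborel)
  \<le> ennreal (b * unit_ball_vol (real DIM('a)) / (b - real DIM('a)) * \<delta> powr (real DIM('a) - b))"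
proof -
 let ?d = "real DIM('a)"
 let ?S = "{y::'a. \<delta> \<le> norm y}"
 have b0: "b > 0" using b by (meson less_trans DIM_positive of_nat_0_less_iff)
 have "(\<integral>\<^sup>+y. indicator ?S y * ennreal (norm y powr (- b)) \<partial>lborel)
  = (\<integral>\<^sup>+y. ennreal (norm (0 - y) powr (- b)) * indicator ?S y \<partial>lborel)"
  by (simp add: mult.commute)
 also have "\<dots> \<le> ennreal b * (\<integral>\<^sup>+\<rho>. indicator {0<..} \<rho> * (ennreal (\<rho> powr (- b - 1)) * (\<integral>\<^sup>+y. indicator (cball 0 \<rho>) y * indicator ?S y \<partial>lborel)) \<partial>lborel)"
  by (rule riesz_le_ball_averages) (use b0 in auto)
 also have "(\<integral>\<^sup>+\<rho>. indicator {0<..} \<rho> * (ennreal (\<rho> powr (- b - 1)) * (\<integral>\<^sup>+y. indicator (cball 0 \<rho>) y * indicator ?S y \<partial>lborel)) \<partial>lborel)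
  \<le> (\<integral>\<^sup>+\<rho>. ennreal (unit_ball_vol ?d) * (indicator {\<delta>..} \<rho> * ennreal (\<rho> powr (- (b - ?d) - 1))) \<partial>lborel)"
 proof (rule nn_integral_mono)
  fix \<rho> :: real
  show "indicator {0<..} \<rho> * (ennreal (\<rho> powr (- b - 1)) * (\<integral>\<^sup>+y. indicator (cball 0 \<rho>) y * indicator ?S y \<partial>lborel))
   \<le> ennreal (unit_ball_vol ?d) * (indicator {\<delta>..} \<rho> * ennreal (\<rho> powr (- (b - ?d) - 1)))"
  proof (cases "\<delta> \<le> \<rho>")
   case True
   have "(\<integral>\<^sup>+y. indicator (cball (0::'a) \<rho>) y * indicator ?S y \<partial>lborel) \<le> emeasure lborel (cball (0::'a) \<rho>)"
    by (subst nn_integral_indicator[symmetric]) (auto intro!: nn_integral_mono simp del: nn_integral_indicator split: split_indicator)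
   then have "ennreal (\<rho> powr (- b - 1)) * (\<integral>\<^sup>+y. indicator (cball 0 \<rho>) y * indicator ?S y \<partial>lborel)
    \<le> ennreal (\<rho> powr (- b - 1)) * ennreal (unit_ball_vol ?d * \<rho> powr ?d)"
    using True \<delta> by (intro mult_left_mono) (auto simp: emeasure_cball_le)
   also have "\<dots> = ennreal (unit_ball_vol ?d * \<rho> powr (- (b - ?d) - 1))"
    using True \<delta> powr_add[of \<rho> "- b - 1" ?d] by (auto simp: ennreal_mult'[symmetric] algebra_simps)
   finally show ?thesis using True \<delta> by (simp add: ennreal_mult')
  next
   case False
   then have "(\<integral>\<^sup>+y. indicator (cball 0 \<rho>) y * indicator ?S y \<partial>lborel) = (\<integral>\<^sup>+(y::'a). 0 \<partial>lborel)"
    by (intro nn_integral_cong) (auto simp: indicator_def)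
   then show ?thesis by simp
  qed
 qed
 also have "\<dots> = ennreal (unit_ball_vol ?d) * ennreal (\<delta> powr (- (b - ?d)) / (b - ?d))"
  using b \<delta> nn_integral_powr_inf[of "b - ?d" \<delta>] by (subst nn_integral_cmult) auto
 also have "ennreal b * (ennreal (unit_ball_vol ?d) * ennreal (\<delta> powr (- (b - ?d)) / (b - ?d)))
  = ennreal (b * unit_ball_vol ?d / (b - ?d) * \<delta> powr (?d - b))"
  using b b0 by (simp add: ennreal_mult'[symmetric])
 finally show ?thesis by (simp add: mult_left_mono)
qed

lemma unit_ball_vol_neq_0 [simp]: "unit_ball_vol (real n) \<noteq> 0"
 using unit_ball_vol_pos[of "real n"] by linarith

subsection \<open>The Hardy--Littlewood maximal function\<close>

definition ball_mass :: "('a::euclidean_space \<Rightarrow> real) \<Rightarrow> 'a \<Rightarrow> real \<Rightarrow> ennreal" where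
 "ball_mass g x r = (\<integral>\<^sup>+y. indicator (cball x r) y * ennreal (g y) \<partial>lborel)"

lemma borel_measurable_ball_mass[measurable]:
 assumes [measurable]: "g \<in> borel_measurable borel"
 shows "(\<lambda>x. ball_mass g x r) \<in> borel_measurable borel"
proof -
 have [measurable]: "Measurable.pred (borel \<Otimes>\<^sub>M borel) (\<lambda>(x::'a, y::'a). y \<in> cball x r)"
  unfolding mem_cball by measurable
 have "(\<lambda>x. \<integral>\<^sup>+y. indicator (cball x r) y * ennreal (g y) \<partial>lborel) \<in> borel_measurable lborel"
  by measurable
 then show ?thesis by (simp add: ball_mass_def[abs_def])
qed

lemma ball_mass_mono: "r \<le> r' \<Longrightarrow> ball_mass g x r \<le> ball_mass g x r'"
 unfolding ball_mass_def by (intro nn_integral_mono) (auto simp: indicator_def)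

text \<open>Subadditivity over an arbitrary countable index set, the sum being an integral over
  counting measure: the Vitali lemma returns a set of centres, not a sequence.\<close>

lemma emeasure_UN_countable_le:
 assumes sets: "\<And>i. i \<in> I \<Longrightarrow> X i \<in> sets M" and I: "countable I"
 shows "emeasure M (\<Union>i\<in>I. X i) \<le> (\<integral>\<^sup>+i. emeasure M (X i) \<partial>count_space I)"
proof -
 have U: "(\<Union>i\<in>I. X i) \<in> sets M" using sets I by auto
 have "emeasure M (\<Union>i\<in>I. X i) = (\<integral>\<^sup>+x. indicator (\<Union>i\<in>I. X i) x \<partial>M)"
  using U by simp
 also have "\<dots> \<le> (\<integral>\<^sup>+x. \<integral>\<^sup>+i. indicator (X i) x \<partial>count_space I \<partial>M)"
 proof (rule nn_integral_mono)
  fix x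
  show "indicator (\<Union>i\<in>I. X i) x \<le> (\<integral>\<^sup>+i. indicator (X i) x \<partial>count_space I)"
  proof (cases "x \<in> (\<Union>i\<in>I. X i)")
   case True
   then obtain i where "i \<in> I" "x \<in> X i" by blast
   then show ?thesis
    using nn_integral_ge_point[of i I "\<lambda>i. indicator (X i) x"] True by simp
  qed simp
 qed
 also have "\<dots> = (\<integral>\<^sup>+i. \<integral>\<^sup>+x. indicator (X i) x \<partial>M \<partial>count_space I)"
  using sets by (intro nn_integral_count_space_nn_integral I) auto
 also have "\<dots> = (\<integral>\<^sup>+i. emeasure M (X i) \<partial>count_space I)"
  using sets by (intro nn_integral_cong) auto
 finally show ?thesis .
qed

text \<open>Vitali covering: the balls carrying much mass are thinned to a disjoint family whose
  fivefold dilates still cover \<open>E\<close>, whence the factor 5^d; the masses over the disjoint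
  balls add up to at most the total mass. Stated for a set \<open>E\<close> rather than a level set
  of the maximal function of \<open>g\<close>, so that it can be applied to a truncated
  density.\<close>

lemma weak_type_maximal:
 fixes g :: "'a::euclidean_space \<Rightarrow> real"
 assumes [measurable]: "g \<in> borel_measurable borel" and \<alpha>: "\<alpha> > 0"
  and E[measurable]: "E \<in> sets borel"
  and ER: "\<And>x. x \<in> E \<Longrightarrow> \<exists>r>0. ennreal (\<alpha> * r powr real DIM('a)) \<le> ball_mass g x r"
 shows "emeasure lborel E \<le> ennreal (unit_ball_vol (real DIM('a)) * 5 powr real DIM('a) / \<alpha>) * (\<integral>\<^sup>+y. ennreal (g y) \<partial>lborel)"
proof (cases "(\<integral>\<^sup>+y. ennreal (g y) \<partial>lborel) = \<infinity>")
 case True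
 then show ?thesis using \<alpha> by (simp add: ennreal_mult_top)
next
 case False
 let ?d = "real DIM('a)" and ?I = "\<integral>\<^sup>+y. ennreal (g y) \<partial>lborel"
 have dpos: "?d > 0" by simp
 obtain r where r: "\<And>x. x \<in> E \<Longrightarrow> r x > 0" "\<And>x. x \<in> E \<Longrightarrow> ennreal (\<alpha> * r x powr ?d) \<le> ball_mass g x (r x)"
  using ER by metis
 \<comment> \<open>Vitali needs bounded radii: \<alpha> r^d never exceeds the total mass, which is
   finite in this branch.\<close>
 define B where "B = (enn2real ?I / \<alpha>) powr (1 / ?d)"
 have rB: "r x \<le> B" if "x \<in> E" for x
 proof -
  have "ennreal (\<alpha> * r x powr ?d) \<le> ?I"
   using r(2)[OF that] by (rule order_trans) (auto simp: ball_mass_def intro!: nn_integral_mono split: split_indicator)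
  then have "\<alpha> * r x powr ?d \<le> enn2real ?I"
   using False \<alpha> by (metis enn2real_nonneg ennreal_enn2real ennreal_le_iff infinity_ennreal_def less_top)
  then have "r x powr ?d \<le> enn2real ?I / \<alpha>" using \<alpha> by (simp add: field_simps)
  then have "(r x powr ?d) powr (1 / ?d) \<le> B" unfolding B_def by (intro powr_mono2) auto
  then show ?thesis using r(1)[OF that] by (simp add: powr_powr)
 qed
 obtain C where C: "countable C" "C \<subseteq> E"
  "pairwise (\<lambda>i j. disjnt (cball i (r i)) (cball j (r j))) C"
  "E \<subseteq> (\<Union>i\<in>C. cball i (5 * r i))"
 proof (rule Vitali_covering_lemma_cballs[where S=E and K=E and a="\<lambda>x. x" and r=r and B=B])
  show "E \<subseteq> (\<Union>i\<in>E. cball i (r i))"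
  proof
   fix x assume "x \<in> E"
   moreover have "x \<in> cball x (r x)" using r(1)[OF \<open>x \<in> E\<close>] by simp
   ultimately show "x \<in> (\<Union>i\<in>E. cball i (r i))" by blast
  qed
 qed (use r rB in auto)
 let ?w = "unit_ball_vol ?d"
 have "emeasure lborel E \<le> emeasure lborel (\<Union>i\<in>C. cball i (5 * r i))"
  using C(4) by (intro emeasure_mono) (auto intro!: sets.countable_UN'' C(1))
 also have "\<dots> \<le> (\<integral>\<^sup>+i. emeasure lborel (cball i (5 * r i)) \<partial>count_space C)"
  by (rule emeasure_UN_countable_le) (use C in auto)
 also have "\<dots> \<le> (\<integral>\<^sup>+i. ennreal (?w * 5 powr ?d / \<alpha>) * ball_mass g i (r i) \<partial>count_space C)"
 proof (rule nn_integral_mono)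
  fix i assume "i \<in> space (count_space C)"
  then have i: "i \<in> E" using C by auto
  have "emeasure lborel (cball i (5 * r i)) = ennreal (?w * 5 powr ?d / \<alpha>) * ennreal (\<alpha> * r i powr ?d)"
   using r(1)[OF i] \<alpha> by (subst emeasure_cball_le) (auto simp: ennreal_mult'[symmetric] powr_mult)
  also have "\<dots> \<le> ennreal (?w * 5 powr ?d / \<alpha>) * ball_mass g i (r i)"
   by (intro mult_left_mono r(2) i) simp
  finally show "emeasure lborel (cball i (5 * r i)) \<le> ennreal (?w * 5 powr ?d / \<alpha>) * ball_mass g i (r i)" .
 qed
 also have "\<dots> = ennreal (?w * 5 powr ?d / \<alpha>) * (\<integral>\<^sup>+i. ball_mass g i (r i) \<partial>count_space C)"
  by (rule nn_integral_cmult) simp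
 also have "(\<integral>\<^sup>+i. ball_mass g i (r i) \<partial>count_space C) \<le> ?I"
 proof -
  have "(\<integral>\<^sup>+i. ball_mass g i (r i) \<partial>count_space C) = (\<integral>\<^sup>+i. emeasure (density lborel (\<lambda>y. ennreal (g y))) (cball i (r i)) \<partial>count_space C)"
   by (intro nn_integral_cong) (auto simp: ball_mass_def emeasure_density mult.commute)
  also have "\<dots> = emeasure (density lborel (\<lambda>y. ennreal (g y))) (\<Union>i\<in>C. cball i (r i))"
   using C by (intro emeasure_UN_countable[symmetric]) (auto simp: disjoint_family_on_def pairwise_def disjnt_def)
  also have "\<dots> \<le> emeasure (density lborel (\<lambda>y. ennreal (g y))) (space (density lborel (\<lambda>y. ennreal (g y))))"
   by (rule emeasure_space)
  also have "\<dots> = ?I" by (subst emeasure_density) auto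
  finally show ?thesis .
 qed
 finally show ?thesis by (simp add: mult_left_mono)
qed

text \<open>The centred maximal function, normalised by r^d instead of the volume of the ball. Only
  rational radii are used, so the supremum is countable and measurability is immediate.\<close>

definition maximal :: "('a::euclidean_space \<Rightarrow> real) \<Rightarrow> 'a \<Rightarrow> ennreal" where
 "maximal g x = (SUP r\<in>{r\<in>\<rat>. r > 0}. ball_mass g x r * ennreal (r powr (- real DIM('a))))"

lemma borel_measurable_maximal[measurable]:
 assumes [measurable]: "g \<in> borel_measurable borel"
 shows "maximal g \<in> borel_measurable borel"
 unfolding maximal_def[abs_def]
 by (intro borel_measurable_SUP) (auto intro: countable_subset[OF _ countable_rat])

text \<open>A real radius is enlarged to a rational one below \<open>2 * r\<close>; this costs the
  factor 2^d.\<close>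

lemma ball_mass_le_maximal:
 fixes g :: "'a::euclidean_space \<Rightarrow> real"
 assumes r: "r > 0"
 shows "ball_mass g x r \<le> ennreal (2 powr real DIM('a) * r powr real DIM('a)) * maximal g x"
proof -
 let ?d = "real DIM('a)"
 obtain q where q: "q \<in> \<rat>" "r < q" "q < 2 * r"
  using Rats_dense_in_real[of r "2 * r"] r by auto
 have "ball_mass g x r \<le> ball_mass g x q" using q by (intro ball_mass_mono) simp
 also have "\<dots> = ennreal (q powr ?d) * (ball_mass g x q * ennreal (q powr (- ?d)))"
 proof -
  have "ennreal (q powr ?d) * ennreal (q powr (- ?d)) = 1"
   using q r by (subst ennreal_mult'[symmetric]) (auto simp: powr_minus)
  then show ?thesis by (metis mult.left_commute mult.right_neutral)
 qed
 also have "\<dots> \<le> ennreal (q powr ?d) * maximal g x"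
  unfolding maximal_def using q r by (intro mult_left_mono SUP_upper) auto
 also have "\<dots> \<le> ennreal (2 powr ?d * r powr ?d) * maximal g x"
  using q r by (intro mult_right_mono ennreal_leI) (auto simp: powr_mult[symmetric] intro!: powr_mono2)
 finally show ?thesis .
qed

text \<open>The part of \<open>g\<close> below \<alpha>/(2w) adds at most \<alpha>/2 to any quotient
  of ball mass by r^d, so the part above must account for the other \<alpha>/2. Keeping only the
  large part of \<open>g\<close> on the right is what makes the integration over \<alpha> converge
  in the strong type bound.\<close>

lemma emeasure_maximal_gt:
 fixes g :: "'a::euclidean_space \<Rightarrow> real"
 assumes [measurable]: "g \<in> borel_measurable borel" and g0: "\<And>x. g x \<ge> 0" and \<alpha>: "\<alpha> > 0"
 defines "w \<equiv> unit_ball_vol (real DIM('a))"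
 shows "emeasure lborel {x. ennreal \<alpha> < maximal g x} \<le> ennreal (2 * w * 5 powr real DIM('a) / \<alpha>)
   * (\<integral>\<^sup>+y. indicator {y. \<alpha> / (2 * w) < g y} y * ennreal (g y) \<partial>lborel)"
proof -
 let ?d = "real DIM('a)"
 have w: "w > 0" by (simp add: w_def)
 define h where "h y = indicator {y. \<alpha> / (2 * w) < g y} y * g y" for y
 have [measurable]: "h \<in> borel_measurable borel" unfolding h_def[abs_def] by measurable
 have gh: "g y \<le> h y + \<alpha> / (2 * w)" for y using \<alpha> w by (auto simp: h_def indicator_def)
 have h0: "h y \<ge> 0" for y using g0 by (auto simp: h_def)
 have "emeasure lborel {x. ennreal \<alpha> < maximal g x} \<le> ennreal (w * 5 powr ?d / (\<alpha>/2)) * (\<integral>\<^sup>+y. ennreal (h y) \<partial>lborel)"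
  unfolding w_def
 proof (rule weak_type_maximal)
  fix x assume "x \<in> {x. ennreal \<alpha> < maximal g x}"
  then obtain r where r: "r > 0" and lt: "ennreal \<alpha> < ball_mass g x r * ennreal (r powr (- ?d))"
   by (auto simp: maximal_def less_SUP_iff)
  have "ennreal (\<alpha> * r powr ?d) = ennreal \<alpha> * ennreal (r powr ?d)" using \<alpha> by (simp add: ennreal_mult')
  also have "\<dots> \<le> (ball_mass g x r * ennreal (r powr (- ?d))) * ennreal (r powr ?d)"
   using lt by (intro mult_right_mono) auto
  also have "\<dots> = ball_mass g x r"
   using r by (simp add: mult.assoc ennreal_mult'[symmetric] powr_minus)
  also have "\<dots> \<le> (\<integral>\<^sup>+y. indicator (cball x r) y * ennreal (h y) + ennreal (\<alpha> / (2 * w)) * indicator (cball x r) y \<partial>lborel)"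
   unfolding ball_mass_def using gh h0 \<alpha> w
   by (intro nn_integral_mono) (auto simp: ennreal_plus[symmetric] simp del: ennreal_plus intro!: ennreal_leI split: split_indicator)
  also have "\<dots> = ball_mass h x r + ennreal (\<alpha> / (2 * w)) * emeasure lborel (cball x r)"
  proof -
   have [measurable]: "cball x r \<in> sets borel" by simp
   have "(\<lambda>y. indicator (cball x r) y * ennreal (h y)) \<in> borel_measurable lborel" by measurable
   moreover have "(\<lambda>y. ennreal (\<alpha> / (2 * w)) * indicator (cball x r) y) \<in> borel_measurable lborel" by measurable
   ultimately show ?thesis
    unfolding ball_mass_def by (subst nn_integral_add) (simp_all add: nn_integral_cmult_indicator)
  qed
  also have "\<dots> = ball_mass h x r + ennreal (\<alpha> / 2 * r powr ?d)"
   using r w \<alpha> by (subst emeasure_cball_le) (auto simp: w_def[symmetric] ennreal_mult'[symmetric])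
  finally have "ennreal (\<alpha>/2 * r powr ?d) + ennreal (\<alpha>/2 * r powr ?d) \<le> ball_mass h x r + ennreal (\<alpha> / 2 * r powr ?d)"
   using \<alpha> by (simp add: ennreal_plus[symmetric] del: ennreal_plus)
  then have "ennreal (\<alpha>/2 * r powr ?d) \<le> ball_mass h x r"
   using ennreal_add_left_cancel_le[of "ennreal (\<alpha>/2 * r powr ?d)"] by (simp add: add.commute)
  then show "\<exists>r>0. ennreal (\<alpha>/2 * r powr ?d) \<le> ball_mass h x r" using r by blast
 qed (use \<alpha> in auto)
 also have "w * 5 powr ?d / (\<alpha>/2) = 2 * w * 5 powr ?d / \<alpha>" by simp
 finally show ?thesis
  by (simp add: h_def ennreal_mult' ennreal_indicator)
qed
lemma nn_integral_powr_0':
 assumes c: "c > 0" and \<delta>: "\<delta> \<ge> 0"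
 shows "(\<integral>\<^sup>+\<rho>. indicator {0<..<\<delta>} \<rho> * ennreal (\<rho> powr (c - 1)) \<partial>lborel) = ennreal (\<delta> powr c / c)"
proof -
 have "(\<integral>\<^sup>+\<rho>. indicator {0<..<\<delta>} \<rho> * ennreal (\<rho> powr (c - 1)) \<partial>lborel)
  = (\<integral>\<^sup>+\<rho>. indicator {0..\<delta>} \<rho> * ennreal (\<rho> powr (c - 1)) \<partial>lborel)"
  using AE_lborel_singleton[of 0] AE_lborel_singleton[of \<delta>]
  by (intro nn_integral_cong_AE) (auto split: split_indicator)
 then show ?thesis using nn_integral_powr_0[OF assms] by simp
qed

text \<open>Marcinkiewicz interpolation: layer cake in \<alpha>, level set estimate, Tonelli. The
  inner integral of \<alpha>^(p-2) up to 2wg converges because p > 1. Finiteness of the maximal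
  function everywhere lets \<open>enn2real\<close> lose nothing; for bounded \<open>g\<close> it
  comes from \<open>maximal_bounded\<close>.\<close>

lemma ex_maximal_Lp_bound:
 assumes p: "p > 1"
 shows "\<exists>C\<ge>0. \<forall>g::'a::euclidean_space \<Rightarrow> real. g \<in> borel_measurable borel \<longrightarrow> (\<forall>x. 0 \<le> g x) \<longrightarrow> (\<forall>x. maximal g x < \<infinity>) \<longrightarrow>
   (\<integral>\<^sup>+x. ennreal (enn2real (maximal g x) powr p) \<partial>lborel) \<le> ennreal C * (\<integral>\<^sup>+x. ennreal (g x powr p) \<partial>lborel)"
proof -
 let ?d = "real DIM('a)"
 define w where "w = unit_ball_vol (real DIM('a))"
 have w: "w > 0" by (simp add: w_def)
 define C where "C = p * (2 * w * 5 powr ?d) * ((2 * w) powr (p - 1) / (p - 1))"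
 have C0: "C \<ge> 0" using p w by (simp add: C_def)
 have "(\<integral>\<^sup>+x. ennreal (enn2real (maximal g x) powr p) \<partial>lborel) \<le> ennreal C * (\<integral>\<^sup>+x. ennreal (g x powr p) \<partial>lborel)"
  if [measurable]: "g \<in> borel_measurable borel" and g0: "\<And>x. 0 \<le> g x" and fin: "\<And>x. maximal g x < \<infinity>"
  for g :: "'a \<Rightarrow> real"
 proof -
  define m where "m x = enn2real (maximal g x)" for x
  have [measurable]: "m \<in> borel_measurable borel" unfolding m_def[abs_def] by measurable
  have [measurable]: "Measurable.pred (borel \<Otimes>\<^sub>M borel) (\<lambda>z. snd z \<in> {0<..<m (fst z)})"
    "Measurable.pred (borel \<Otimes>\<^sub>M borel) (\<lambda>z. fst z \<in> {0<..<m (snd z)})"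
    "Measurable.pred (borel \<Otimes>\<^sub>M borel) (\<lambda>z. snd z \<in> {0<..<2 * w * g (fst z)})"
    "Measurable.pred (borel \<Otimes>\<^sub>M borel) (\<lambda>z. fst z \<in> {0<..<2 * w * g (snd z)})"
   unfolding greaterThanLessThan_iff by measurable
  have mx: "maximal g x = ennreal (m x)" for x using fin[of x] by (simp add: m_def)
  have m0: "m x \<ge> 0" for x by (simp add: m_def)
  have "(\<integral>\<^sup>+x. ennreal (m x powr p) \<partial>lborel)
   = (\<integral>\<^sup>+x. \<integral>\<^sup>+\<alpha>. ennreal p * (indicator {0<..<m x} \<alpha> * ennreal (\<alpha> powr (p - 1))) \<partial>lborel \<partial>lborel)"
   using p m0 by (intro nn_integral_cong) (simp add: nn_integral_cmult nn_integral_powr_0' ennreal_mult'[symmetric])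
  also have "\<dots> = (\<integral>\<^sup>+\<alpha>. \<integral>\<^sup>+x. ennreal p * (indicator {0<..<m x} \<alpha> * ennreal (\<alpha> powr (p - 1))) \<partial>lborel \<partial>lborel)"
   by (rule lborel_pair.Fubini') measurable
  also have "\<dots> \<le> (\<integral>\<^sup>+\<alpha>. \<integral>\<^sup>+y. ennreal (p * (2 * w * 5 powr ?d) * g y) * (indicator {0<..<2 * w * g y} \<alpha> * ennreal (\<alpha> powr (p - 1 - 1))) \<partial>lborel \<partial>lborel)"
  proof (rule nn_integral_mono)
   fix \<alpha> :: real
   show "(\<integral>\<^sup>+x. ennreal p * (indicator {0<..<m x} \<alpha> * ennreal (\<alpha> powr (p - 1))) \<partial>lborel)
    \<le> (\<integral>\<^sup>+y. ennreal (p * (2 * w * 5 powr ?d) * g y) * (indicator {0<..<2 * w * g y} \<alpha> * ennreal (\<alpha> powr (p - 1 - 1))) \<partial>lborel)"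
   proof (cases "\<alpha> > 0")
    case True
    have "(\<integral>\<^sup>+x. ennreal p * (indicator {0<..<m x} \<alpha> * ennreal (\<alpha> powr (p - 1))) \<partial>lborel)
     = (\<integral>\<^sup>+x. ennreal (p * \<alpha> powr (p - 1)) * indicator {x. ennreal \<alpha> < maximal g x} x \<partial>lborel)"
     using True p by (intro nn_integral_cong) (auto simp: mx ennreal_less_iff ennreal_mult' split: split_indicator)
    also have "\<dots> = ennreal (p * \<alpha> powr (p - 1)) * emeasure lborel {x. ennreal \<alpha> < maximal g x}"
     by (rule nn_integral_cmult_indicator) simp
    also have "\<dots> \<le> ennreal (p * \<alpha> powr (p - 1)) * (ennreal (2 * w * 5 powr ?d / \<alpha>)
      * (\<integral>\<^sup>+y. indicator {y. \<alpha> / (2 * w) < g y} y * ennreal (g y) \<partial>lborel))"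
     unfolding w_def by (intro mult_left_mono emeasure_maximal_gt g0 True) simp_all
    also have "\<dots> = (\<integral>\<^sup>+y. ennreal (p * \<alpha> powr (p - 1)) * (ennreal (2 * w * 5 powr ?d / \<alpha>)
      * (indicator {y. \<alpha> / (2 * w) < g y} y * ennreal (g y))) \<partial>lborel)"
     by (simp add: nn_integral_cmult)
    also have "\<dots> = (\<integral>\<^sup>+y. ennreal (p * (2 * w * 5 powr ?d) * g y) * (indicator {0<..<2 * w * g y} \<alpha> * ennreal (\<alpha> powr (p - 1 - 1))) \<partial>lborel)"
    proof (rule nn_integral_cong)
     fix y
     have "\<alpha> powr (p - 1) / \<alpha> = \<alpha> powr (p - 1 - 1)" using True by (subst (2) powr_diff) simp
     moreover have "(a * b) * ((c / d') * e) = (a * c * e) * (b / d')" for a b c d' e :: real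
      by simp
     ultimately have "(p * \<alpha> powr (p - 1)) * ((2 * w * 5 powr ?d / \<alpha>) * g y) = (p * (2 * w * 5 powr ?d) * g y) * \<alpha> powr (p - 1 - 1)"
      by metis
     then have "ennreal (p * \<alpha> powr (p - 1)) * (ennreal (2 * w * 5 powr ?d / \<alpha>) * ennreal (g y)) = ennreal (p * (2 * w * 5 powr ?d) * g y) * ennreal (\<alpha> powr (p - 1 - 1))"
      using True p w g0[of y] by (simp add: ennreal_mult'[symmetric])
     then show "ennreal (p * \<alpha> powr (p - 1)) * (ennreal (2 * w * 5 powr ?d / \<alpha>)
      * (indicator {y. \<alpha> / (2 * w) < g y} y * ennreal (g y))) = ennreal (p * (2 * w * 5 powr ?d) * g y) * (indicator {0<..<2 * w * g y} \<alpha> * ennreal (\<alpha> powr (p - 1 - 1)))"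
      using True w by (auto simp: field_simps split: split_indicator)
    qed
    finally show ?thesis .
   qed simp
  qed
  also have "\<dots> = (\<integral>\<^sup>+y. \<integral>\<^sup>+\<alpha>. ennreal (p * (2 * w * 5 powr ?d) * g y) * (indicator {0<..<2 * w * g y} \<alpha> * ennreal (\<alpha> powr (p - 1 - 1))) \<partial>lborel \<partial>lborel)"
   by (rule lborel_pair.Fubini') measurable
  also have "\<dots> = (\<integral>\<^sup>+y. ennreal C * ennreal (g y powr p) \<partial>lborel)"
  proof (rule nn_integral_cong)
   fix y
   have e: "(p * (2 * w * 5 powr ?d) * g y) * ((2 * w * g y) powr (p - 1) / (p - 1)) = C * g y powr p"
   proof -
    have "g y * g y powr (p - 1) = g y powr p"
     using g0[of y] powr_mult_base[of "g y" "p - 1"] by simp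
    moreover have "(a * b * c) * ((d' * e) / f) = (a * b * (d' / f)) * (c * e)" for a b c d' e f :: real
     by simp
    ultimately show ?thesis unfolding C_def powr_mult by metis
   qed
   have 1: "(\<integral>\<^sup>+\<alpha>. indicator {0<..<2 * w * g y} \<alpha> * ennreal (\<alpha> powr (p - 1 - 1)) \<partial>lborel) = ennreal ((2 * w * g y) powr (p - 1) / (p - 1))"
    using p w g0 by (intro nn_integral_powr_0') auto
   have "(\<integral>\<^sup>+\<alpha>. ennreal (p * (2 * w * 5 powr ?d) * g y) * (indicator {0<..<2 * w * g y} \<alpha> * ennreal (\<alpha> powr (p - 1 - 1))) \<partial>lborel)
     = ennreal (p * (2 * w * 5 powr ?d) * g y) * ennreal ((2 * w * g y) powr (p - 1) / (p - 1))"
    by (subst nn_integral_cmult) (simp_all only: 1, measurable)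
   also have "\<dots> = ennreal (C * g y powr p)"
    using p w g0[of y] by (subst ennreal_mult'[symmetric]) (simp_all only: e, simp)
   also have "\<dots> = ennreal C * ennreal (g y powr p)" using C0 by (rule ennreal_mult')
   finally show "(\<integral>\<^sup>+\<alpha>. ennreal (p * (2 * w * 5 powr ?d) * g y) * (indicator {0<..<2 * w * g y} \<alpha> * ennreal (\<alpha> powr (p - 1 - 1))) \<partial>lborel) = ennreal C * ennreal (g y powr p)" .
  qed
  also have "\<dots> = ennreal C * (\<integral>\<^sup>+x. ennreal (g x powr p) \<partial>lborel)"
   by (rule nn_integral_cmult) measurable
  finally show ?thesis by (simp add: m_def)
 qed
 then show ?thesis using C0 by blast
qed

text \<open>Norms enter as numbers A and B bounding the integrals by A^p and B^q, which avoids roots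
  of possibly infinite integrals. Young's inequality for f/A and g/B gives the claim when both are
  positive; if one is zero, the product vanishes almost everywhere.\<close>

lemma nn_integral_Holder:
 fixes f g :: "'b \<Rightarrow> real"
 assumes [measurable]: "f \<in> borel_measurable M" "g \<in> borel_measurable M"
  and f0: "\<And>x. 0 \<le> f x" and g0: "\<And>x. 0 \<le> g x"
  and pq: "p > 1" "q > 1" "1 / p + 1 / q = 1"
  and A: "A \<ge> 0" "(\<integral>\<^sup>+x. ennreal (f x powr p) \<partial>M) \<le> ennreal (A powr p)"
  and B: "B \<ge> 0" "(\<integral>\<^sup>+x. ennreal (g x powr q) \<partial>M) \<le> ennreal (B powr q)"
 shows "(\<integral>\<^sup>+x. ennreal (f x * g x) \<partial>M) \<le> ennreal (A * B)"
proof -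
 have zero: "(\<integral>\<^sup>+x. ennreal (f x * g x) \<partial>M) = 0"
  if "(\<integral>\<^sup>+x. ennreal (h x powr r) \<partial>M) \<le> ennreal (0 powr r)" "h = f \<or> h = g" for h r
 proof -
  have [measurable]: "h \<in> borel_measurable M" using that by auto
  have "(\<integral>\<^sup>+x. ennreal (h x powr r) \<partial>M) = 0" using that by simp
  then have "AE x in M. h x powr r \<le> 0" by (subst (asm) nn_integral_0_iff_AE) auto
  then have "AE x in M. h x = 0" by eventually_elim (use powr_gt_zero in \<open>auto simp: not_le[symmetric]\<close>)
  then have "AE x in M. f x * g x = 0" by eventually_elim (use that in auto)
  then show ?thesis by (subst nn_integral_0_iff_AE) auto
 qed
 consider "A = 0" | "B = 0" | "A > 0" "B > 0" using A B by fastforce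
 then show ?thesis
 proof cases
  case 1 then show ?thesis using zero[of f p] A by simp
 next
  case 2 then show ?thesis using zero[of g q] B by simp
 next
  case 3
  have "(\<integral>\<^sup>+x. ennreal (f x * g x) \<partial>M)
   \<le> (\<integral>\<^sup>+x. ennreal (A * B / p / A powr p) * ennreal (f x powr p) + ennreal (A * B / q / B powr q) * ennreal (g x powr q) \<partial>M)"
  proof (rule nn_integral_mono)
   fix x
   have "(f x / A) * (g x / B) \<le> (f x / A) powr p / p + (g x / B) powr q / q"
    by (rule Youngs_inequality) (use pq f0 g0 3 in auto)
   then have "A * B * ((f x / A) * (g x / B)) \<le> A * B * ((f x / A) powr p / p + (g x / B) powr q / q)"
    using 3 by (intro mult_left_mono) auto
   also have "A * B * ((f x / A) * (g x / B)) = f x * g x" using 3 by simp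
   also have "A * B * ((f x / A) powr p / p + (g x / B) powr q / q) = (A * B / p / A powr p) * f x powr p + (A * B / q / B powr q) * g x powr q"
    using f0[of x] g0[of x] 3 by (simp add: powr_divide algebra_simps)
   finally show "ennreal (f x * g x) \<le> ennreal (A * B / p / A powr p) * ennreal (f x powr p) + ennreal (A * B / q / B powr q) * ennreal (g x powr q)"
    using 3 pq by (simp add: ennreal_mult'[symmetric] ennreal_plus[symmetric] ennreal_leI del: ennreal_plus)
  qed
  also have "\<dots> = ennreal (A * B / p / A powr p) * (\<integral>\<^sup>+x. ennreal (f x powr p) \<partial>M) + ennreal (A * B / q / B powr q) * (\<integral>\<^sup>+x. ennreal (g x powr q) \<partial>M)"
   by (simp add: nn_integral_add nn_integral_cmult)
  also have "\<dots> \<le> ennreal (A * B / p / A powr p) * ennreal (A powr p) + ennreal (A * B / q / B powr q) * ennreal (B powr q)"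
   by (intro add_mono mult_left_mono A B) auto
  also have "\<dots> = ennreal (A * B * (1 / p + 1 / q))"
   using 3 pq(1,2) by (simp add: ennreal_mult'[symmetric] ennreal_plus[symmetric] algebra_simps del: ennreal_plus)
  finally show ?thesis using pq by simp
 qed
qed
text \<open>Hedberg's argument: in the radial form of the potential, small balls are controlled by
  the maximal function and large balls by Hoelder and the norm bound \<open>N\<close>; the radius
  separating them is then chosen to balance both parts.\<close>

lemma HLS_pointwise:
 fixes g :: "'a::euclidean_space \<Rightarrow> real"
 assumes [measurable]: "g \<in> borel_measurable borel" and g0: "\<And>x. 0 \<le> g x"
  and p: "p > 1" and s: "0 < s" "s * p < real DIM('a)"
  and fin: "maximal g x < \<infinity>"
  and N: "N \<ge> 0" "(\<integral>\<^sup>+x. ennreal (g x powr p) \<partial>lborel) \<le> ennreal (N powr p)"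
 defines "d \<equiv> real DIM('a)" and "w \<equiv> unit_ball_vol (real DIM('a))"
 shows "(\<integral>\<^sup>+y. ennreal (norm (x - y) powr (- (d - s))) * ennreal (g y) \<partial>lborel)
  \<le> ennreal ((d - s) * (2 powr d / s + w powr (1 - 1 / p) / (d / p - s)) * enn2real (maximal g x) powr (1 - s * p / d) * N powr (s * p / d))"
proof -
 define m where "m = enn2real (maximal g x)"
 have mx: "maximal g x = ennreal m" using fin by (simp add: m_def)
 have m0: "m \<ge> 0" by (simp add: m_def)
 have d: "d > 0" by (simp add: d_def)
 have w: "w > 0" by (simp add: w_def)
 have "s * 1 < s * p" using p s by (intro mult_strict_left_mono) auto
 then have sd: "s < d" using s unfolding d_def by linarith
 have dps: "d / p - s > 0" using s p by (simp add: d_def field_simps)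
 let ?I = "\<integral>\<^sup>+y. ennreal (norm (x - y) powr (- (d - s))) * ennreal (g y) \<partial>lborel"
 have I: "?I \<le> ennreal (d - s) * (\<integral>\<^sup>+\<rho>. indicator {0<..} \<rho> * (ennreal (\<rho> powr (- (d - s) - 1)) * ball_mass g x \<rho>) \<partial>lborel)"
  unfolding ball_mass_def by (rule riesz_le_ball_averages) (use sd in auto)
 have b1: "ball_mass g x \<rho> \<le> ennreal (2 powr d * m * \<rho> powr d)" if "\<rho> > 0" for \<rho>
  using ball_mass_le_maximal[OF that, of g x] m0 that by (simp add: mx d_def ennreal_mult'[symmetric] mult_ac)
 \<comment> \<open>Hoelder against the indicator of the ball, whose norm in the conjugate exponent
   is (w \<rho>^d)^(1-1/p).\<close>
 have b2: "ball_mass g x \<rho> \<le> ennreal (w powr (1 - 1 / p) * N * \<rho> powr (d - d / p))" if "\<rho> > 0" for \<rho>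
 proof -
  have q: "p / (p - 1) > 1" "1 / p + 1 / (p / (p - 1)) = 1" using p by (auto simp: field_simps)
  have "(\<integral>\<^sup>+y. ennreal (g y * indicator (cball x \<rho>) y) \<partial>lborel) \<le> ennreal (N * ((w * \<rho> powr d) powr (1 - 1 / p)))"
  proof (rule nn_integral_Holder[OF _ _ g0 _ p q N])
   have "(\<integral>\<^sup>+y. ennreal (indicator (cball x \<rho>) y powr (p / (p - 1))) \<partial>lborel) = (\<integral>\<^sup>+y. indicator (cball x \<rho>) y \<partial>lborel)"
    by (intro nn_integral_cong) (auto split: split_indicator)
   also have "\<dots> = ennreal (w * \<rho> powr d)"
    using that by (simp add: emeasure_cball_le w_def d_def)
   also have "w * \<rho> powr d = ((w * \<rho> powr d) powr (1 - 1 / p)) powr (p / (p - 1))"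
   proof -
    have "(1 - 1 / p) * (p / (p - 1)) = 1" using p by (simp add: field_simps)
    then show ?thesis using w that by (subst powr_powr) (simp only:, simp)
   qed
   finally show "(\<integral>\<^sup>+y. ennreal (indicator (cball x \<rho>) y powr (p / (p - 1))) \<partial>lborel) \<le> ennreal (((w * \<rho> powr d) powr (1 - 1 / p)) powr (p / (p - 1)))"
    by simp
  qed (auto intro!: borel_measurable_indicator)
  also have "(w * \<rho> powr d) powr (1 - 1 / p) = w powr (1 - 1 / p) * \<rho> powr (d - d / p)"
   using w that by (simp add: powr_mult powr_powr algebra_simps)
  finally show ?thesis
   by (simp add: ball_mass_def ennreal_mult'' ennreal_indicator mult_ac)
 qed
 \<comment> \<open>The separating radius is built from a quotient of \<open>N\<close> and
   \<open>m\<close>, so the case where one of them vanishes is treated apart; all ball masses are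
   then zero.\<close>
 have zero: "?I = 0" if "m = 0 \<or> N = 0"
 proof -
  have "ball_mass g x \<rho> = 0" if "\<rho> > 0" for \<rho>
   using b1[OF that] b2[OF that] \<open>m = 0 \<or> N = 0\<close> by auto
  then have "(\<integral>\<^sup>+\<rho>. indicator {0<..} \<rho> * (ennreal (\<rho> powr (- (d - s) - 1)) * ball_mass g x \<rho>) \<partial>lborel) = (\<integral>\<^sup>+(\<rho>::real). 0 \<partial>lborel)"
   by (intro nn_integral_cong) (auto split: split_indicator)
  with I show ?thesis by simp
 qed
 show ?thesis
 proof (cases "m = 0 \<or> N = 0")
  case True
  show ?thesis unfolding zero[OF True] by simp
 next
  case False
  then have mN: "m > 0" "N > 0" using m0 N by auto
  \<comment> \<open>Solves m \<delta>^s = N \<delta>^(s-d/p): with this radius both parts of the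
    integral become multiples of the same m^(1-sp/d) N^(sp/d).\<close>
  define \<delta> where "\<delta> = (N / m) powr (p / d)"
  have \<delta>: "\<delta> > 0" using mN by (simp add: \<delta>_def)
  have "(\<integral>\<^sup>+\<rho>. indicator {0<..} \<rho> * (ennreal (\<rho> powr (- (d - s) - 1)) * ball_mass g x \<rho>) \<partial>lborel)
   \<le> (\<integral>\<^sup>+\<rho>. ennreal (2 powr d * m) * (indicator {0..\<delta>} \<rho> * ennreal (\<rho> powr (s - 1)))
     + ennreal (w powr (1 - 1 / p) * N) * (indicator {\<delta>..} \<rho> * ennreal (\<rho> powr (- (d / p - s) - 1))) \<partial>lborel)"
  proof (rule nn_integral_mono)
   fix \<rho> :: real
   consider "\<rho> \<le> 0" | "0 < \<rho>" "\<rho> \<le> \<delta>" | "0 < \<rho>" "\<delta> < \<rho>" by linarith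
   then show "indicator {0<..} \<rho> * (ennreal (\<rho> powr (- (d - s) - 1)) * ball_mass g x \<rho>)
    \<le> ennreal (2 powr d * m) * (indicator {0..\<delta>} \<rho> * ennreal (\<rho> powr (s - 1)))
     + ennreal (w powr (1 - 1 / p) * N) * (indicator {\<delta>..} \<rho> * ennreal (\<rho> powr (- (d / p - s) - 1)))"
   proof cases
    case 2
    have "ennreal (\<rho> powr (- (d - s) - 1)) * ball_mass g x \<rho> \<le> ennreal (\<rho> powr (- (d - s) - 1)) * ennreal (2 powr d * m * \<rho> powr d)"
     by (intro mult_left_mono b1 2) simp
    also have "\<dots> = ennreal (2 powr d * m) * ennreal (\<rho> powr (s - 1))"
     using m0 2 powr_add[of \<rho> "- (d - s) - 1" d] by (simp add: ennreal_mult'[symmetric] mult_ac)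
    finally show ?thesis using 2 by (simp add: add_increasing2)
   next
    case 3
    have "ennreal (\<rho> powr (- (d - s) - 1)) * ball_mass g x \<rho> \<le> ennreal (\<rho> powr (- (d - s) - 1)) * ennreal (w powr (1 - 1 / p) * N * \<rho> powr (d - d / p))"
     by (intro mult_left_mono b2 3) simp
    also have "\<dots> = ennreal (w powr (1 - 1 / p) * N) * ennreal (\<rho> powr (- (d / p - s) - 1))"
    proof -
     have "\<rho> powr (- (d - s) - 1) * \<rho> powr (d - d / p) = \<rho> powr (- (d / p - s) - 1)"
      by (subst powr_add[symmetric]) (rule arg_cong[of _ _ "\<lambda>e. \<rho> powr e"], simp)
     then have "\<rho> powr (- (d - s) - 1) * (w powr (1 - 1 / p) * N * \<rho> powr (d - d / p)) = w powr (1 - 1 / p) * N * \<rho> powr (- (d / p - s) - 1)"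
      by (metis mult.assoc mult.commute)
     then show ?thesis using N by (simp add: ennreal_mult'[symmetric])
    qed
    finally show ?thesis using 3 by (simp add: add_increasing)
   qed simp
  qed
  also have "\<dots> = ennreal (2 powr d * m) * ennreal (\<delta> powr s / s) + ennreal (w powr (1 - 1 / p) * N) * ennreal (\<delta> powr (- (d / p - s)) / (d / p - s))"
   using s dps \<delta> nn_integral_powr_inf[of "d / p - s" \<delta>] by (simp add: nn_integral_add nn_integral_cmult nn_integral_powr_0)
  also have "\<dots> = ennreal (2 powr d * (m * \<delta> powr s) / s + w powr (1 - 1 / p) * (N * \<delta> powr (- (d / p - s))) / (d / p - s))"
   using s dps mN by (simp add: ennreal_mult'[symmetric] ennreal_plus[symmetric] mult_ac del: ennreal_plus)
  also have "m * \<delta> powr s = m powr (1 - s * p / d) * N powr (s * p / d)"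
   using mN unfolding \<delta>_def by (simp add: powr_powr powr_divide powr_diff mult_ac)
  also have "N * \<delta> powr (- (d / p - s)) = m powr (1 - s * p / d) * N powr (s * p / d)"
  proof -
   have "p / d * (- (d / p - s)) = s * p / d - 1" using p d by (simp add: field_simps)
   then have "\<delta> powr (- (d / p - s)) = (N / m) powr (s * p / d - 1)"
    unfolding \<delta>_def powr_powr by (simp only:)
   then show ?thesis using mN by (simp add: powr_divide powr_diff field_simps)
  qed
  finally have "ennreal (d - s) * (\<integral>\<^sup>+\<rho>. indicator {0<..} \<rho> * (ennreal (\<rho> powr (- (d - s) - 1)) * ball_mass g x \<rho>) \<partial>lborel)
   \<le> ennreal (d - s) * ennreal (2 powr d * (m powr (1 - s * p / d) * N powr (s * p / d)) / s + w powr (1 - 1 / p) * (m powr (1 - s * p / d) * N powr (s * p / d)) / (d / p - s))"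
   by (intro mult_left_mono) simp_all
  also have "\<dots> = ennreal ((d - s) * (2 powr d / s + w powr (1 - 1 / p) / (d / p - s)) * m powr (1 - s * p / d) * N powr (s * p / d))"
   using sd by (subst ennreal_mult'[symmetric]) (auto simp: algebra_simps)
  finally show ?thesis using I unfolding m_def by (rule order_trans[rotated])
 qed
qed

text \<open>The exponent t is the one with (1 - sp/d) t = p: raising Hedberg's pointwise bound to
  the power t leaves the p-th power of the maximal function, and the powers of \<open>N\<close>
  combine to N^t since (sp/d) t + p = t.\<close>

theorem Hardy_Littlewood_Sobolev:
 assumes p: "p > 1" and s: "0 < s" "s * p < real DIM('a)"
 defines "t \<equiv> real DIM('a) * p / (real DIM('a) - s * p)"
 shows "\<exists>C\<ge>0. \<forall>(g::'a::euclidean_space \<Rightarrow> real) N. g \<in> borel_measurable borel \<longrightarrow> (\<forall>x. 0 \<le> g x) \<longrightarrow> (\<forall>x. maximal g x < \<infinity>) \<longrightarrow>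
   N \<ge> 0 \<longrightarrow> (\<integral>\<^sup>+x. ennreal (g x powr p) \<partial>lborel) \<le> ennreal (N powr p) \<longrightarrow>
   (\<integral>\<^sup>+x. ennreal (enn2real (\<integral>\<^sup>+y. ennreal (norm (x - y) powr (- (real DIM('a) - s))) * ennreal (g y) \<partial>lborel) powr t) \<partial>lborel) \<le> ennreal (C * N powr t)"
proof -
 define d where "d = real DIM('a)"
 define w where "w = unit_ball_vol (real DIM('a))"
 have d: "d > 0" by (simp add: d_def)
 have dsp: "d - s * p > 0" using s by (simp add: d_def)
 have "s * 1 < s * p" using p s by (intro mult_strict_left_mono) auto
 then have sd: "s < d" using s unfolding d_def by linarith
 have dps: "d / p - s > 0" using s p by (simp add: d_def field_simps)
 define A where "A = (d - s) * (2 powr d / s + w powr (1 - 1 / p) / (d / p - s))"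
 have A: "A \<ge> 0" using sd dps s by (auto simp: A_def)
 have t: "t = d * p / (d - s * p)" by (simp add: t_def d_def)
 have t0: "t > 0" using d p dsp by (simp add: t)
 have t1: "(1 - s * p / d) * t = p"
 proof -
  have "1 - s * p / d = (d - s * p) / d" using d by (simp add: field_simps)
  then show ?thesis using d dsp by (simp add: t)
 qed
 have t2: "(s * p / d) * t + p = t"
  using t1 by (simp add: algebra_simps)
 obtain C where C: "C \<ge> 0" "\<And>g::'a \<Rightarrow> real. g \<in> borel_measurable borel \<Longrightarrow> (\<And>x. 0 \<le> g x) \<Longrightarrow> (\<And>x. maximal g x < \<infinity>) \<Longrightarrow>
   (\<integral>\<^sup>+x. ennreal (enn2real (maximal g x) powr p) \<partial>lborel) \<le> ennreal C * (\<integral>\<^sup>+x. ennreal (g x powr p) \<partial>lborel)"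
  using ex_maximal_Lp_bound[OF p, where 'a='a] by blast
 have "(\<integral>\<^sup>+x. ennreal (enn2real (\<integral>\<^sup>+y. ennreal (norm (x - y) powr (- (d - s))) * ennreal (g y) \<partial>lborel) powr t) \<partial>lborel) \<le> ennreal (A powr t * C * N powr t)"
  if [measurable]: "g \<in> borel_measurable borel" and g0: "\<And>x. 0 \<le> g x" and fin: "\<And>x. maximal g x < \<infinity>"
   and N: "N \<ge> 0" "(\<integral>\<^sup>+x. ennreal (g x powr p) \<partial>lborel) \<le> ennreal (N powr p)"
  for g :: "'a \<Rightarrow> real" and N
 proof -
  have "(\<integral>\<^sup>+x. ennreal (enn2real (\<integral>\<^sup>+y. ennreal (norm (x - y) powr (- (d - s))) * ennreal (g y) \<partial>lborel) powr t) \<partial>lborel)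
   \<le> (\<integral>\<^sup>+x. ennreal (A powr t * N powr (s * p / d * t)) * ennreal (enn2real (maximal g x) powr p) \<partial>lborel)"
  proof (rule nn_integral_mono)
   fix x
   let ?I = "\<integral>\<^sup>+y. ennreal (norm (x - y) powr (- (d - s))) * ennreal (g y) \<partial>lborel"
   have "?I \<le> ennreal (A * enn2real (maximal g x) powr (1 - s * p / d) * N powr (s * p / d))"
    unfolding A_def d_def w_def by (rule HLS_pointwise[OF _ g0 p s fin N]) simp
   then have "enn2real ?I \<le> A * enn2real (maximal g x) powr (1 - s * p / d) * N powr (s * p / d)"
    using A by (intro enn2real_leI) auto
   then have "enn2real ?I powr t \<le> (A * enn2real (maximal g x) powr (1 - s * p / d) * N powr (s * p / d)) powr t"
    using t0 by (intro powr_mono2) auto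
   also have "\<dots> = A powr t * N powr (s * p / d * t) * enn2real (maximal g x) powr p"
    using t1 by (simp add: powr_mult powr_powr mult_ac)
   finally show "ennreal (enn2real ?I powr t) \<le> ennreal (A powr t * N powr (s * p / d * t)) * ennreal (enn2real (maximal g x) powr p)"
    by (simp add: ennreal_mult'[symmetric])
  qed
  also have "\<dots> = ennreal (A powr t * N powr (s * p / d * t)) * (\<integral>\<^sup>+x. ennreal (enn2real (maximal g x) powr p) \<partial>lborel)"
   by (rule nn_integral_cmult) measurable
  also have "\<dots> \<le> ennreal (A powr t * N powr (s * p / d * t)) * (ennreal C * ennreal (N powr p))"
   by (intro mult_left_mono order_trans[OF C(2)] N g0 fin) auto
  also have "\<dots> = ennreal (A powr t * C * N powr t)"
   using C(1) t2 powr_add[of N "s * p / d * t" p] by (simp add: ennreal_mult'[symmetric] mult_ac)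
  finally show ?thesis .
 qed
 then show ?thesis unfolding d_def using C(1) by (intro exI[of _ "A powr t * C"]) auto
qed

subsection \<open>Representation of a function by its gradient\<close>

lemma integral_lborel_affine:
 fixes f :: "'a::euclidean_space \<Rightarrow> 'b::{banach, second_countable_topology}"
 assumes [measurable]: "f \<in> borel_measurable borel" and c: "c \<noteq> 0"
 shows "(\<integral>x. f x \<partial>lborel) = (\<bar>c\<bar> ^ DIM('a)) *\<^sub>R (\<integral>x. f (t + c *\<^sub>R x) \<partial>lborel)"
 by (subst lborel_affine[OF c, of t])
   (simp add: integral_density integral_distr)

text \<open>The gradient is a separate argument and only one continuous derivative is asked for.
  \<open>R\<close> bounds the support and is a parameter on which the constants of the inequalities
  may depend, uniformly in \<phi>.\<close>

definition C1c :: "real \<Rightarrow> ('a::euclidean_space \<Rightarrow> real) \<Rightarrow> ('a \<Rightarrow> 'a) \<Rightarrow> bool" where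
 "C1c R \<phi> G \<longleftrightarrow> (\<forall>x. (\<phi> has_derivative (\<lambda>h. G x \<bullet> h)) (at x)) \<and> continuous_on UNIV G \<and>
   (\<forall>x. norm x > R \<longrightarrow> \<phi> x = 0 \<and> G x = 0)"

lemma C1c_continuous: "C1c R \<phi> G \<Longrightarrow> continuous_on UNIV \<phi>"
 unfolding C1c_def by (meson continuous_at_imp_continuous_on has_derivative_continuous)

lemma C1c_borel: "C1c R \<phi> G \<Longrightarrow> \<phi> \<in> borel_measurable borel" "C1c R \<phi> G \<Longrightarrow> G \<in> borel_measurable borel"
 using C1c_continuous[of R \<phi> G] by (auto simp: C1c_def intro: borel_measurable_continuous_onI)

lemma C1c_bounded:
 assumes "C1c R \<phi> G"
 obtains B where "B > 0" "\<And>x. \<bar>\<phi> x\<bar> \<le> B" "\<And>x. norm (G x) \<le> B"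
proof -
 have "compact (\<phi> ` cball 0 R)" "compact (G ` cball 0 R)"
  using C1c_continuous[OF assms] assms unfolding C1c_def
  by (auto intro!: compact_continuous_image intro: continuous_on_subset)
 then have "bounded (\<phi> ` cball 0 R)" "bounded (G ` cball 0 R)" by (auto intro: compact_imp_bounded)
 then obtain B1 B2 where B: "\<And>x. norm x \<le> R \<Longrightarrow> \<bar>\<phi> x\<bar> \<le> B1" "\<And>x. norm x \<le> R \<Longrightarrow> norm (G x) \<le> B2"
  unfolding bounded_iff by (metis image_eqI mem_cball_0 real_norm_def)
 show ?thesis
 proof (rule that[of "\<bar>B1\<bar> + \<bar>B2\<bar> + 1"])
  fix x
  show "\<bar>\<phi> x\<bar> \<le> \<bar>B1\<bar> + \<bar>B2\<bar> + 1" using assms B(1)[of x] by (cases "norm x \<le> R") (auto simp: C1c_def)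
  show "norm (G x) \<le> \<bar>B1\<bar> + \<bar>B2\<bar> + 1" using assms B(2)[of x] by (cases "norm x \<le> R") (auto simp: C1c_def)
 qed simp
qed

text \<open>The fundamental theorem of calculus along the ray from x in direction -w; a speed of at
  least one guarantees that the ray is outside the support at time \<open>T\<close>.\<close>

lemma C1c_ray:
 assumes C: "C1c R \<phi> G" and w: "norm w \<ge> 1" and T: "T \<ge> norm x + \<bar>R\<bar> + 1"
 shows "(\<integral>t. indicator {0..T} t * (G (x - t *\<^sub>R w) \<bullet> w) \<partial>lborel) = \<phi> x"
proof -
 have "norm (x - T *\<^sub>R w) > R"
 proof -
  have "T \<ge> 0" using T norm_ge_zero[of x] by linarith
  then have "norm (T *\<^sub>R w) \<ge> T" using mult_left_mono[OF w, of T] by simp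
  then show ?thesis using norm_triangle_ineq2[of "T *\<^sub>R w" x] T by (simp add: norm_minus_commute)
 qed
 then have T0: "\<phi> (x - T *\<^sub>R w) = 0" using C by (simp add: C1c_def)
 have "(\<integral>t. (G (x - t *\<^sub>R w) \<bullet> w) * indicator {0..T} t \<partial>lborel) = - \<phi> (x - T *\<^sub>R w) - (- \<phi> (x - 0 *\<^sub>R w))"
 proof (rule integral_FTC_Icc_real)
  show "0 \<le> T" using T by (meson add_nonneg_nonneg abs_ge_zero norm_ge_zero order_trans zero_le_one)
  fix t
  have "((\<lambda>t. \<phi> (x - t *\<^sub>R w)) has_derivative (\<lambda>h. G (x - t *\<^sub>R w) \<bullet> (- (h *\<^sub>R w)))) (at t)"
   using C unfolding C1c_def
   by (intro has_derivative_compose[of "\<lambda>t. x - t *\<^sub>R w" _ t UNIV \<phi>]) (auto intro!: derivative_eq_intros)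
  then have "((\<lambda>t. - \<phi> (x - t *\<^sub>R w)) has_derivative (\<lambda>h. - (G (x - t *\<^sub>R w) \<bullet> (- (h *\<^sub>R w))))) (at t)"
   by (rule has_derivative_minus)
  then show "((\<lambda>t. - \<phi> (x - t *\<^sub>R w)) has_real_derivative G (x - t *\<^sub>R w) \<bullet> w) (at t)"
   unfolding has_field_derivative_def by (rule has_derivative_eq_rhs) (auto simp: fun_eq_iff)
  have "continuous_on UNIV (\<lambda>t. G (x - t *\<^sub>R w) \<bullet> w)"
   using C unfolding C1c_def by (auto intro!: continuous_intros continuous_on_compose2[of UNIV G])
  then show "isCont (\<lambda>t. G (x - t *\<^sub>R w) \<bullet> w) t" by (simp add: continuous_on_eq_continuous_at)
 qed
 then show ?thesis using T0 by (simp add: mult.commute)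
qed

text \<open>The condition on z/t confines t to the interval from |z|/2 to |z|, where t^(-d-1)
  integrates to the stated multiple of |z|^(-d). It is the weight with which the point z is visited
  by all rays with directions in the annulus.\<close>

lemma ray_kernel:
 fixes z :: "'a::euclidean_space"
 assumes z: "z \<noteq> 0" "norm z \<le> T"
 defines "d \<equiv> real DIM('a)"
 shows "(\<integral>t. indicator {0<..T} t * t powr (- d - 1) * indicator {w. 1 \<le> norm w \<and> norm w \<le> 2} ((1 / t) *\<^sub>R z) \<partial>lborel)
   = (2 powr d - 1) / d * norm z powr (- d)"
proof -
 have d: "d > 0" by (simp add: d_def)
 let ?n = "norm z"
 have n: "?n > 0" using z by simp
 have "(\<integral>t. indicator {0<..T} t * t powr (- d - 1) * indicator {w. 1 \<le> norm w \<and> norm w \<le> 2} ((1 / t) *\<^sub>R z) \<partial>lborel)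
  = (\<integral>t. t powr (- d - 1) * indicator {?n / 2..?n} t \<partial>lborel)"
 proof (rule Bochner_Integration.integral_cong)
  fix t
  show "indicator {0<..T} t * t powr (- d - 1) * indicator {w. 1 \<le> norm w \<and> norm w \<le> 2} ((1 / t) *\<^sub>R z)
   = t powr (- d - 1) * indicator {?n / 2..?n} t"
  proof (cases "t > 0")
   case True
   then show ?thesis using z by (auto simp: indicator_def field_simps)
  next
   case False
   then have "\<not> ?n / 2 \<le> t" using n by linarith
   with False show ?thesis by simp
  qed
 qed simp
 also have "\<dots> = - (?n powr (- d) / d) - (- ((?n / 2) powr (- d) / d))"
 proof (rule integral_FTC_Icc_real)
  fix t assume "?n / 2 \<le> t" "t \<le> ?n"
  then have t: "t > 0" using n by linarith
  show "((\<lambda>t. - (t powr (- d) / d)) has_real_derivative t powr (- d - 1)) (at t)"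
   using t d by (auto intro!: derivative_eq_intros)
  show "isCont (\<lambda>t. t powr (- d - 1)) t" using t by (intro continuous_intros) auto
 qed (use n in simp)
 also have "\<dots> = (2 powr d - 1) / d * norm z powr (- d)"
  using n d by (simp add: powr_divide powr_minus field_simps)
 finally show ?thesis .
qed

text \<open>Averages the ray formula over directions filling a solid annulus instead of a sphere, so
  that Lebesgue measure suffices; substituting z = t w for fixed t and then integrating over t
  produces the kernel |z|^(-d). The factor d |A| / (2^d - 1) is the surface measure of the unit
  sphere.\<close>

theorem gradient_representation:
 fixes \<phi> :: "'a::euclidean_space \<Rightarrow> real"
 defines "d \<equiv> real DIM('a)"
 defines "A \<equiv> {w::'a. 1 \<le> norm w \<and> norm w \<le> 2}"
 assumes C: "C1c R \<phi> G"
 shows "(\<integral>z. norm z powr (- d) * (G (x - z) \<bullet> z) \<partial>lborel) = d * measure lborel A / (2 powr d - 1) * \<phi> x"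
proof -
 have d: "d > 0" by (simp add: d_def)
 have p2: "2 powr d > 1" using d by simp
 define T where "T = norm x + \<bar>R\<bar> + 1"
 have T: "T > 0" by (simp add: T_def add_nonneg_pos)
 obtain B where B: "B > 0" "\<And>x. norm (G x) \<le> B" using C1c_bounded[OF C] by metis
 have [measurable]: "G \<in> borel_measurable borel" using C by (rule C1c_borel)
 have A[measurable]: "A \<in> sets borel" unfolding A_def by measurable
 have Acb: "A \<subseteq> cball 0 2" by (auto simp: A_def)
 have Afin: "emeasure lborel A < \<infinity>"
  using emeasure_mono[OF Acb, of lborel] by (auto simp: emeasure_cball intro: le_less_trans)
 \<comment> \<open>\<open>K\<close> is the integrand in (t, w), and \<open>H\<close> its counterpart
   in (t, z) under z = t w; the Jacobian is accounted for by
   \<open>H (t, t *\<^sub>R w) * t powr d = K (t, w)\<close>.\<close>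
 define K where "K = (\<lambda>(t, w). indicator {0<..T} t * (indicator A w * (G (x - t *\<^sub>R w) \<bullet> w)))"
 define H where "H = (\<lambda>(t, z). indicator {0<..T} t * (t powr (- d - 1) * (indicator A ((1/t) *\<^sub>R z) * (G (x - z) \<bullet> z))))"
 have [measurable]: "K \<in> borel_measurable (lborel \<Otimes>\<^sub>M lborel)" unfolding K_def by measurable
 have [measurable]: "H \<in> borel_measurable (lborel \<Otimes>\<^sub>M lborel)" unfolding H_def by measurable
 have Kle: "\<bar>K (t, w)\<bar> \<le> 2 * B * (indicator {0<..T} t * indicator A w)" for t w
 proof -
  have "\<bar>G (x - t *\<^sub>R w) \<bullet> w\<bar> \<le> B * 2" if "w \<in> A"
   using that B by (intro order_trans[OF Cauchy_Schwarz_ineq2] mult_mono) (auto simp: A_def)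
  then show ?thesis by (auto simp: K_def abs_mult split: split_indicator)
 qed
 have HK: "H (t, t *\<^sub>R w) * t powr d = K (t, w)" for t w
 proof (cases "t > 0")
  case True
  have "t powr (- d - 1) * t powr d * t = 1"
   using True by (simp add: powr_diff powr_minus)
  then have "t powr (- d - 1) * (t * (t powr d * r)) = r" for r
   by (metis mult.assoc mult.commute mult.right_neutral)
  then show ?thesis using True by (simp add: H_def K_def mult_ac)
 qed (simp add: H_def K_def)
 have Hnn: "(\<integral>\<^sup>+z. ennreal \<bar>H (t, z)\<bar> \<partial>lborel) = (\<integral>\<^sup>+w. ennreal \<bar>K (t, w)\<bar> \<partial>lborel)" for t
 proof (cases "t > 0")
  case True
  have "(\<integral>\<^sup>+z. ennreal \<bar>H (t, z)\<bar> \<partial>lborel) = ennreal (\<bar>t\<bar> ^ DIM('a)) * (\<integral>\<^sup>+w. ennreal \<bar>H (t, 0 + t *\<^sub>R w)\<bar> \<partial>lborel)"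
   using True by (intro nn_integral_lborel_affine) auto
  also have "\<dots> = (\<integral>\<^sup>+w. ennreal (\<bar>t\<bar> ^ DIM('a)) * ennreal \<bar>H (t, t *\<^sub>R w)\<bar> \<partial>lborel)"
   by (simp add: nn_integral_cmult)
  also have "\<dots> = (\<integral>\<^sup>+w. ennreal \<bar>K (t, w)\<bar> \<partial>lborel)"
   using True by (intro nn_integral_cong) (simp add: HK[symmetric] abs_mult ennreal_mult' powr_realpow d_def mult.commute)
  finally show ?thesis .
 qed (simp add: H_def K_def)
 have Hint: "(\<integral>z. H (t, z) \<partial>lborel) = (\<integral>w. K (t, w) \<partial>lborel)" for t
 proof (cases "t > 0")
  case True
  have "(\<integral>z. H (t, z) \<partial>lborel) = (\<bar>t\<bar> ^ DIM('a)) *\<^sub>R (\<integral>w. H (t, 0 + t *\<^sub>R w) \<partial>lborel)"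
   using True by (intro integral_lborel_affine) auto
  also have "\<dots> = (\<integral>w. K (t, w) \<partial>lborel)"
   using True by (simp add: HK[symmetric] powr_realpow d_def)
  finally show ?thesis .
 qed (simp add: H_def K_def)
 have Kfin: "(\<integral>\<^sup>+t. \<integral>\<^sup>+w. ennreal \<bar>K (t, w)\<bar> \<partial>lborel \<partial>lborel) < \<infinity>"
 proof -
  have "(\<integral>\<^sup>+t. \<integral>\<^sup>+w. ennreal \<bar>K (t, w)\<bar> \<partial>lborel \<partial>lborel)
   \<le> (\<integral>\<^sup>+t. \<integral>\<^sup>+w. ennreal (2 * B) * (indicator {0<..T} t * indicator A w) \<partial>lborel \<partial>lborel)"
  proof (intro nn_integral_mono)
   fix t w
   have "ennreal \<bar>K (t, w)\<bar> \<le> ennreal (2 * B * (indicator {0<..T} t * indicator A w))"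
    by (intro ennreal_leI Kle)
   then show "ennreal \<bar>K (t, w)\<bar> \<le> ennreal (2 * B) * (indicator {0<..T} t * indicator A w)"
    using B by (simp add: ennreal_mult' ennreal_indicator)
  qed
  also have "\<dots> = ennreal (2 * B) * (ennreal T * emeasure lborel A)"
   using T by (simp add: nn_integral_cmult nn_integral_multc)
  also have "\<dots> < \<infinity>" using Afin by (simp add: ennreal_mult_less_top)
  finally show ?thesis .
 qed
 have Ki: "integrable (lborel \<Otimes>\<^sub>M lborel) K"
  using Kfin by (simp add: integrable_iff_bounded lborel.nn_integral_fst[symmetric])
 have Hi: "integrable (lborel \<Otimes>\<^sub>M lborel) H"
  using Kfin by (simp add: integrable_iff_bounded lborel.nn_integral_fst[symmetric] Hnn)
 have "(\<integral>z. (\<integral>t. H (t, z) \<partial>lborel) \<partial>lborel) = (\<integral>t. (\<integral>z. H (t, z) \<partial>lborel) \<partial>lborel)"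
  using lborel_pair.Fubini_integral[of "\<lambda>t z. H (t, z)"] Hi by simp
 also have "\<dots> = (\<integral>t. (\<integral>w. K (t, w) \<partial>lborel) \<partial>lborel)" by (simp add: Hint)
 also have "\<dots> = (\<integral>w. (\<integral>t. K (t, w) \<partial>lborel) \<partial>lborel)"
  using lborel_pair.Fubini_integral[of "\<lambda>t z. K (t, z)"] Ki by simp
 also have "\<dots> = (\<integral>w. indicator A w * \<phi> x \<partial>lborel)"
 proof (rule Bochner_Integration.integral_cong)
  fix w
  have "(\<integral>t. K (t, w) \<partial>lborel) = (\<integral>t. indicator A w * (indicator {0..T} t * (G (x - t *\<^sub>R w) \<bullet> w)) \<partial>lborel)"
   using AE_lborel_singleton[of "0::real"]
   by (intro integral_cong_AE) (measurable, auto simp: K_def split: split_indicator elim!: eventually_mono)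
  also have "\<dots> = indicator A w * (\<integral>t. indicator {0..T} t * (G (x - t *\<^sub>R w) \<bullet> w) \<partial>lborel)"
   by (rule integral_mult_right_zero)
  also have "\<dots> = indicator A w * \<phi> x"
   using C1c_ray[OF C, of w x T] by (cases "w \<in> A") (auto simp: A_def T_def)
  finally show "(\<integral>t. K (t, w) \<partial>lborel) = indicator A w * \<phi> x" .
 qed simp
 also have "\<dots> = measure lborel A * \<phi> x" by simp
 finally have 1: "(\<integral>z. (\<integral>t. H (t, z) \<partial>lborel) \<partial>lborel) = measure lborel A * \<phi> x" .
 have "(\<integral>z. (\<integral>t. H (t, z) \<partial>lborel) \<partial>lborel) = (\<integral>z. (2 powr d - 1) / d * (norm z powr (- d) * (G (x - z) \<bullet> z)) \<partial>lborel)"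
 proof (rule Bochner_Integration.integral_cong)
  fix z
  have eq: "(\<integral>t. H (t, z) \<partial>lborel) = (\<integral>t. indicator {0<..T} t * t powr (- d - 1) * indicator A ((1 / t) *\<^sub>R z) \<partial>lborel) * (G (x - z) \<bullet> z)"
   by (subst integral_mult_left_zero[symmetric]) (simp add: H_def mult_ac)
  show "(\<integral>t. H (t, z) \<partial>lborel) = (2 powr d - 1) / d * (norm z powr (- d) * (G (x - z) \<bullet> z))"
  proof (cases "z = 0 \<or> G (x - z) \<bullet> z = 0")
   case True
   then show ?thesis by (auto simp: eq)
  next
   case False
   then have "G (x - z) \<noteq> 0" by auto
   then have "norm (x - z) \<le> R" using C by (force simp: C1c_def)
   then have "norm z \<le> T" using norm_triangle_ineq2[of z x] by (simp add: T_def norm_minus_commute)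
   with False show ?thesis unfolding eq A_def d_def by (subst ray_kernel) auto
  qed
 qed simp
 also have "\<dots> = (2 powr d - 1) / d * (\<integral>z. norm z powr (- d) * (G (x - z) \<bullet> z) \<partial>lborel)"
  by (rule integral_mult_right_zero)
 finally show ?thesis using 1 d p2 by (simp add: field_simps)
qed

subsection \<open>A convolution identity for Riesz kernels\<close>

lemma norm_plus_rev: "norm (a + b) \<ge> norm b - norm (a::'a::real_normed_vector)"
 using norm_triangle_ineq2[of b "-a"] by (simp add: add.commute)

lemma powr_half_minus: "x \<ge> 0 \<Longrightarrow> (x / 2) powr (- b) = x powr (- b) * 2 powr b" for x b :: real
 by (simp add: powr_divide powr_minus field_simps)

text \<open>The kernel |x - w|^(-a) antisymmetrised in w. For a = d + s - 1 this gains one power of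
  |w| at infinity: the bare kernel times |w|^(s-d) decays like |w|^(1-2d), which for d = 1 is not
  integrable, the difference like |w|^(-2d).\<close>

definition riesz_diff :: "real \<Rightarrow> 'a::euclidean_space \<Rightarrow> 'a \<Rightarrow> real" where
 "riesz_diff a x w = norm (x - w) powr (- a) - norm (x + w) powr (- a)"

lemma borel_measurable_riesz_diff[measurable]:
 "(\<lambda>z. riesz_diff a (fst z) (snd z)) \<in> borel_measurable (borel \<Otimes>\<^sub>M borel)"
 unfolding riesz_diff_def by measurable

lemma borel_measurable_riesz_diff1[measurable]: "riesz_diff a x \<in> borel_measurable borel"
 unfolding riesz_diff_def[abs_def] by measurable

text \<open>The integral of the norm of the integrand of \<open>riesz_vec\<close>, in extended
  reals: its scaling and isometry laws are thus available before finiteness, which then has to be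
  shown at unit vectors only.\<close>

definition riesz_mass :: "real \<Rightarrow> 'a::euclidean_space \<Rightarrow> ennreal" where
 "riesz_mass s x = (\<integral>\<^sup>+w. ennreal (norm w powr (s - real DIM('a)) * \<bar>riesz_diff (real DIM('a) + s - 1) x w\<bar>) \<partial>lborel)"

text \<open>The antisymmetrised convolution of |x|^(-(d+s-1)), the kernel of order 1 - s, with the
  odd vector kernel w |w|^(s-d-1) of order s. It turns out to be a multiple of x |x|^(-d), the
  kernel of \<open>gradient_representation\<close>.\<close>

definition riesz_vec :: "real \<Rightarrow> 'a::euclidean_space \<Rightarrow> 'a" where
 "riesz_vec s x = (\<integral>w. (riesz_diff (real DIM('a) + s - 1) x w * norm w powr (s - real DIM('a) - 1)) *\<^sub>R w \<partial>lborel)"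

lemma powr_minus_diff_le:
 fixes a l u v :: real
 assumes "0 < l" "l \<le> u" "l \<le> v" "a > 0"
 shows "\<bar>u powr (- a) - v powr (- a)\<bar> \<le> a * l powr (- a - 1) * \<bar>u - v\<bar>"
proof -
 have *: "\<bar>u powr (- a) - v powr (- a)\<bar> \<le> a * l powr (- a - 1) * \<bar>u - v\<bar>" if "l \<le> u" "u < v" for u v
 proof -
  have "\<exists>z>u. z < v \<and> v powr (- a) - u powr (- a) = (v - u) * ((- a) * z powr (- a - 1))"
   using that assms by (intro MVT2[of u v "\<lambda>x. x powr (- a)" "\<lambda>z. (- a) * z powr (- a - 1)"]) (auto intro!: derivative_eq_intros)
  then obtain z where z: "u < z" "v powr (- a) - u powr (- a) = (v - u) * ((- a) * z powr (- a - 1))" by blast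
  have "z powr (- a - 1) \<le> l powr (- a - 1)" using z that assms by (intro powr_mono2') auto
  then have "\<bar>v - u\<bar> * (a * z powr (- a - 1)) \<le> \<bar>v - u\<bar> * (a * l powr (- a - 1))"
   using assms by (intro mult_left_mono) auto
  moreover have "\<bar>u powr (- a) - v powr (- a)\<bar> = \<bar>v - u\<bar> * (a * z powr (- a - 1))"
   using z assms by (simp add: abs_minus_commute[of "u powr (- a)"] abs_mult)
  ultimately show ?thesis by (simp add: mult_ac abs_minus_commute)
 qed
 consider "u = v" | "u < v" | "v < u" by linarith
 then show ?thesis
  by cases (use *[of u v] *[of v u] assms in \<open>auto simp: abs_minus_commute\<close>)
qed

text \<open>Three regions with one bound each: near 0 only |w|^(s-d) is singular; at intermediate
  distance only the kernels at x and -x are, with exponent below d, and they are moved to the origin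
  by translation and reflection; far away the mean value theorem applied to the difference gives
  |w|^(-2d).\<close>

lemma riesz_mass_finite:
 fixes x :: "'a::euclidean_space"
 assumes s: "0 < s" "s < 1" and x: "norm x = 1"
 shows "riesz_mass s x < \<infinity>"
proof -
 let ?d = "real DIM('a)" and ?a = "real DIM('a) + s - 1"
 have d1: "?d \<ge> 1" by (simp add: Suc_leI)
 have a: "0 < ?a" "?a < ?d" using s d1 by linarith+
 let ?F = "\<lambda>w::'a. ennreal (2 * 2 powr ?a) * (indicator (cball 0 1) w * ennreal (norm w powr (- (?d - s))))"
 let ?L = "\<lambda>w::'a. indicator (cball 0 3) w * ennreal (norm w powr (- ?a))"
 let ?c = "2 powr (?d - s)"
 let ?H = "\<lambda>w::'a. ennreal (?a * 2 powr (?a + 1) * 2) * (indicator {w. 2 \<le> norm w} w * ennreal (norm w powr (- (2 * ?d))))"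
 have [measurable]: "cball (0::'a) 1 \<in> sets borel" "cball (0::'a) 3 \<in> sets borel" "{w::'a. 2 \<le> norm w} \<in> sets borel"
  by (simp_all, measurable)
 have "riesz_mass s x \<le> (\<integral>\<^sup>+w. ?F w + (ennreal ?c * ?L (x - w) + ennreal ?c * ?L (x + w)) + ?H w \<partial>lborel)"
  unfolding riesz_mass_def
 proof (rule nn_integral_mono)
  fix w :: 'a
  consider "norm w \<le> 1 / 2" | "1 / 2 < norm w" "norm w < 2" | "norm w \<ge> 2" by linarith
  then show "ennreal (norm w powr (s - ?d) * \<bar>riesz_diff ?a x w\<bar>) \<le> ?F w + (ennreal ?c * ?L (x - w) + ennreal ?c * ?L (x + w)) + ?H w"
  proof cases
   case 1
   have n: "norm (x - w) \<ge> 1 / 2" "norm (x + w) \<ge> 1 / 2"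
    using norm_triangle_ineq2[of x w] norm_diff_ineq[of x w] 1 x by linarith+
   have "t powr (- ?a) \<le> 2 powr ?a" if "1 / 2 \<le> t" for t
   proof -
    have "t powr (- ?a) \<le> (1/2) powr (- ?a)"
     using a(1) by (intro powr_mono2' that) simp_all
    also have "\<dots> = 2 powr ?a" using powr_half_minus[of 1 ?a] by simp
    finally show ?thesis .
   qed
   from this[OF n(1)] this[OF n(2)] have "\<bar>riesz_diff ?a x w\<bar> \<le> 2 * 2 powr ?a"
    unfolding riesz_diff_def using powr_ge_zero[of "norm (x - w)" "- ?a"] powr_ge_zero[of "norm (x + w)" "- ?a"]
    by linarith
   then have "\<bar>riesz_diff ?a x w\<bar> * norm w powr (s - ?d) \<le> 2 * 2 powr ?a * norm w powr (s - ?d)"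
    by (rule mult_right_mono) (rule powr_ge_zero)
   then have "ennreal (norm w powr (s - ?d) * \<bar>riesz_diff ?a x w\<bar>) \<le> ennreal (2 * 2 powr ?a * norm w powr (s - ?d))"
    by (intro ennreal_leI) (simp only: mult.commute)
   also have "\<dots> = ?F w" using 1 by (subst ennreal_mult') simp_all
   finally show ?thesis by (intro add_increasing2 zero_le)
  next
   case 2
   have n: "norm (x - w) \<le> 3" "norm (x + w) \<le> 3"
    using norm_triangle_ineq4[of x w] norm_triangle_ineq[of x w] 2 x by linarith+
   have "norm w powr (s - ?d) \<le> (1/2) powr (s - ?d)"
    using 2 s d1 by (intro powr_mono2') linarith+
   then have c: "norm w powr (s - ?d) \<le> ?c" using powr_half_minus[of 1 "?d - s"] by simp
   have "norm w powr (s - ?d) * \<bar>riesz_diff ?a x w\<bar> \<le> ?c * (norm (x - w) powr (- ?a) + norm (x + w) powr (- ?a))"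
    using c by (intro mult_mono) (auto simp: riesz_diff_def abs_le_iff)
   then have "ennreal (norm w powr (s - ?d) * \<bar>riesz_diff ?a x w\<bar>) \<le> ennreal (?c * (norm (x - w) powr (- ?a) + norm (x + w) powr (- ?a)))"
    by (rule ennreal_leI)
   also have "\<dots> = ennreal ?c * ?L (x - w) + ennreal ?c * ?L (x + w)"
    using n by (simp add: ennreal_mult' distrib_left)
   finally show ?thesis by (simp add: add_increasing add_increasing2)
  next
   case 3
   have w0: "norm w > 0" using 3 by linarith
   have n: "norm (x - w) \<ge> norm w / 2" "norm (x + w) \<ge> norm w / 2"
    using norm_triangle_ineq2[of w x] norm_plus_rev[of w x] 3 x by (auto simp: norm_minus_commute)
   \<comment> \<open>Here the antisymmetry acts: the two distances differ by at most 2|x|, however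
     large w is.\<close>
   have "\<bar>norm (x - w) - norm (x + w)\<bar> \<le> 2"
   proof -
    have "(w - x) - (x + w) = - (2 *\<^sub>R x)" by (simp add: scaleR_2)
    then have "norm ((w - x) - (x + w)) = 2" using x by (simp only: norm_minus_cancel) simp
    then show ?thesis using norm_triangle_ineq3[of "w - x" "x + w"] by (simp only: norm_minus_commute[of x w])
   qed
   then have "?a * (norm w / 2) powr (- ?a - 1) * \<bar>norm (x - w) - norm (x + w)\<bar> \<le> ?a * (norm w / 2) powr (- ?a - 1) * 2"
    using a by (intro mult_left_mono) auto
   moreover have "\<bar>riesz_diff ?a x w\<bar> \<le> ?a * (norm w / 2) powr (- ?a - 1) * \<bar>norm (x - w) - norm (x + w)\<bar>"
    unfolding riesz_diff_def using w0 n a by (intro powr_minus_diff_le) auto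
   ultimately have "\<bar>riesz_diff ?a x w\<bar> \<le> ?a * (norm w / 2) powr (- ?a - 1) * 2" by linarith
   then have "norm w powr (s - ?d) * \<bar>riesz_diff ?a x w\<bar> \<le> norm w powr (s - ?d) * (?a * (norm w / 2) powr (- ?a - 1) * 2)"
    by (intro mult_left_mono) auto
   also have "(norm w / 2) powr (- ?a - 1) = norm w powr (- ?a - 1) * 2 powr (?a + 1)"
    using powr_half_minus[of "norm w" "?a + 1"] by simp
   also have "norm w powr (s - ?d) * (?a * (norm w powr (- ?a - 1) * 2 powr (?a + 1)) * 2)
     = (?a * 2 powr (?a + 1) * 2) * (norm w powr (s - ?d) * norm w powr (- ?a - 1))" by (simp only: mult_ac)
   also have "norm w powr (s - ?d) * norm w powr (- ?a - 1) = norm w powr (- (2 * ?d))"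
    by (subst powr_add[symmetric]) (simp add: algebra_simps)
   finally have "ennreal (norm w powr (s - ?d) * \<bar>riesz_diff ?a x w\<bar>) \<le> ennreal ((?a * 2 powr (?a + 1) * 2) * norm w powr (- (2 * ?d)))"
    by (rule ennreal_leI)
   also have "\<dots> = ?H w" using 3 a by (simp add: ennreal_mult')
   finally show ?thesis by (simp add: add_increasing)
  qed
 qed
 also have "\<dots> = (\<integral>\<^sup>+w. ?F w \<partial>lborel) + (ennreal ?c * (\<integral>\<^sup>+w. ?L (x - w) \<partial>lborel) + ennreal ?c * (\<integral>\<^sup>+w. ?L (x + w) \<partial>lborel)) + (\<integral>\<^sup>+w. ?H w \<partial>lborel)"
 proof -
  have add3: "(\<integral>\<^sup>+w. f w + (c * g w + c * h w) + k w \<partial>lborel) = (\<integral>\<^sup>+w. f w \<partial>lborel) + (c * (\<integral>\<^sup>+w. g w \<partial>lborel) + c * (\<integral>\<^sup>+w. h w \<partial>lborel)) + (\<integral>\<^sup>+w. k w \<partial>lborel)"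
   if [measurable]: "f \<in> borel_measurable borel" "g \<in> borel_measurable borel" "h \<in> borel_measurable borel" "k \<in> borel_measurable borel"
   for f g h k :: "'a \<Rightarrow> ennreal" and c
   by (simp add: nn_integral_add nn_integral_cmult)
  show ?thesis
   by (rule add3) measurable
 qed
 also have "(\<integral>\<^sup>+w. ?L (x - w) \<partial>lborel) = (\<integral>\<^sup>+w. ?L w \<partial>lborel)"
  by (rule nn_integral_lborel_reflect[of ?L x]) measurable
 also have "(\<integral>\<^sup>+w. ?L (x + w) \<partial>lborel) = (\<integral>\<^sup>+w. ?L w \<partial>lborel)"
  by (rule nn_integral_lborel_translate[of ?L x]) measurable
 also have "(\<integral>\<^sup>+w. ?F w \<partial>lborel) + (ennreal ?c * (\<integral>\<^sup>+w. ?L w \<partial>lborel) + ennreal ?c * (\<integral>\<^sup>+w. ?L w \<partial>lborel)) + (\<integral>\<^sup>+w. ?H w \<partial>lborel) < \<infinity>"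
 proof -
  have "(\<integral>\<^sup>+w. ?L w \<partial>lborel) < \<infinity>" by (intro nn_integral_norm_powr_ball a)
  moreover have "(\<integral>\<^sup>+(w::'a). indicator (cball 0 1) w * ennreal (norm w powr (- (?d - s))) \<partial>lborel) < \<infinity>"
   using s d1 by (intro nn_integral_norm_powr_ball) linarith+
  moreover have "(\<integral>\<^sup>+(w::'a). indicator {w. 2 \<le> norm w} w * ennreal (norm w powr (- (2 * ?d))) \<partial>lborel) < \<infinity>"
   by (rule le_less_trans[OF nn_integral_norm_powr_outside]) auto
  ultimately show ?thesis by (simp add: nn_integral_cmult ennreal_mult_less_top)
 qed
 finally show ?thesis .
qed

lemma riesz_diff_isometry:
 assumes "orthogonal_transformation T"
 shows "riesz_diff a (T x) (T w) = riesz_diff a x w"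
proof -
 have "T x - T w = T (x - w)" "T x + T w = T (x + w)" "\<And>z. norm (T z) = norm z"
  using assms by (auto simp: orthogonal_transformation linear_diff linear_add)
 then show ?thesis by (simp add: riesz_diff_def)
qed

lemma riesz_diff_scale:
 assumes r: "r > 0"
 shows "riesz_diff a (r *\<^sub>R x) (r *\<^sub>R w) = r powr (- a) * riesz_diff a x w"
proof -
 have "r *\<^sub>R x - r *\<^sub>R w = r *\<^sub>R (x - w)" "r *\<^sub>R x + r *\<^sub>R w = r *\<^sub>R (x + w)"
  by (auto simp: algebra_simps)
 then show ?thesis using r by (simp add: riesz_diff_def powr_mult right_diff_distrib del: scaleR_right_diff_distrib scaleR_right_distrib)
qed

lemma riesz_mass_isometry:
 fixes x :: "'a::euclidean_space" and T :: "'a \<Rightarrow> 'a"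
 assumes T: "orthogonal_transformation T"
 shows "riesz_mass s (T x) = riesz_mass s x"
proof -
 have [measurable]: "T \<in> borel_measurable borel"
  using T by (intro borel_measurable_continuous_onI linear_continuous_on linear_conv_bounded_linear[THEN iffD1])
   (simp add: orthogonal_transformation)
 have nT: "norm (T z) = norm z" for z using T by (simp add: orthogonal_transformation)
 have "riesz_mass s (T x) = (\<integral>\<^sup>+w. ennreal (norm w powr (s - real DIM('a)) * \<bar>riesz_diff (real DIM('a) + s - 1) (T x) w\<bar>) \<partial>distr lborel borel T)"
  unfolding riesz_mass_def distr_lborel_isometry[OF T] ..
 also have "\<dots> = riesz_mass s x"
  unfolding riesz_mass_def by (subst nn_integral_distr) (auto simp: riesz_diff_isometry[OF T] nT)
 finally show ?thesis .
qed

text \<open>The degree is d from the volume, s - d from the power of |w| and -(d + s - 1) from the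
  difference of kernels, in sum 1 - d.\<close>

lemma riesz_mass_scale:
 fixes x :: "'a::euclidean_space"
 assumes r: "r > 0"
 shows "riesz_mass s (r *\<^sub>R x) = ennreal (r powr (1 - real DIM('a))) * riesz_mass s x"
proof -
 let ?d = "real DIM('a)" and ?a = "real DIM('a) + s - 1"
 have e: "r powr ?d * (r powr (s - ?d) * r powr (- ?a)) = r powr (1 - ?d)"
  using r by (simp add: powr_add[symmetric])
 have "riesz_mass s (r *\<^sub>R x) = ennreal (\<bar>r\<bar> ^ DIM('a)) * (\<integral>\<^sup>+w. ennreal (norm (0 + r *\<^sub>R w) powr (s - ?d) * \<bar>riesz_diff ?a (r *\<^sub>R x) (0 + r *\<^sub>R w)\<bar>) \<partial>lborel)"
  unfolding riesz_mass_def using r by (intro nn_integral_lborel_affine) auto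
 also have "\<dots> = (\<integral>\<^sup>+w. ennreal (r powr ?d) * ennreal (norm (0 + r *\<^sub>R w) powr (s - ?d) * \<bar>riesz_diff ?a (r *\<^sub>R x) (0 + r *\<^sub>R w)\<bar>) \<partial>lborel)"
  using r by (subst nn_integral_cmult) (auto simp: powr_realpow)
 also have "\<dots> = (\<integral>\<^sup>+w. ennreal (r powr (1 - ?d)) * ennreal (norm w powr (s - ?d) * \<bar>riesz_diff ?a x w\<bar>) \<partial>lborel)"
  using r by (intro nn_integral_cong)
   (simp add: riesz_diff_scale abs_mult powr_mult ennreal_mult'[symmetric] e[symmetric] mult_ac)
 also have "\<dots> = ennreal (r powr (1 - ?d)) * riesz_mass s x"
  unfolding riesz_mass_def by (rule nn_integral_cmult) measurable
 finally show ?thesis .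
qed

text \<open>The Householder reflection along x - y. Isometries thus act transitively on spheres, so
  a quantity compatible with isometries and dilations is known from its value at one unit
  vector.\<close>

lemma unit_vectors_reflection:
 fixes x y :: "'a::euclidean_space"
 assumes "norm x = norm y"
 obtains T where "orthogonal_transformation T" "T x = y"
proof (cases "x = y")
 case True
 then show ?thesis using that[of "\<lambda>x. x"] by (simp add: orthogonal_transformation_id)
next
 case False
 define u where "u = x - y"
 have uu: "u \<bullet> u > 0" using False by (simp add: u_def)
 have xx: "x \<bullet> x = y \<bullet> y" using assms by (simp add: norm_eq_sqrt_inner)
 define T where "T z = z - (2 * (z \<bullet> u) / (u \<bullet> u)) *\<^sub>R u" for z
 have "linear T" unfolding T_def
  by (rule linearI) (auto simp: algebra_simps inner_add_left add_divide_distrib)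
 moreover have "T v \<bullet> T w = v \<bullet> w" for v w
  using uu by (simp add: T_def inner_diff_left inner_diff_right inner_commute field_simps)
 ultimately have "orthogonal_transformation T" by (simp add: orthogonal_transformation_def)
 moreover have "2 * (x \<bullet> u) = u \<bullet> u"
  using xx by (simp add: u_def inner_diff_left inner_diff_right inner_commute)
 then have "T x = y" using uu by (simp add: T_def) (simp add: u_def)
 ultimately show ?thesis by (rule that)
qed

lemma riesz_mass_eq:
 fixes x e :: "'a::euclidean_space"
 assumes x: "x \<noteq> 0" and e: "norm e = 1"
 shows "riesz_mass s x = ennreal (norm x powr (1 - real DIM('a))) * riesz_mass s e"
proof -
 obtain T where T: "orthogonal_transformation T" "T e = (1 / norm x) *\<^sub>R x"
  by (rule unit_vectors_reflection[of e "(1 / norm x) *\<^sub>R x"]) (use x e in auto)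
 have "riesz_mass s x = riesz_mass s (norm x *\<^sub>R T e)" using x by (simp add: T)
 then show ?thesis using x by (simp add: riesz_mass_scale riesz_mass_isometry[OF T(1)])
qed

lemma norm_riesz_vec_integrand:
 fixes w :: "'a::euclidean_space"
 shows "norm ((r * norm w powr (s - real DIM('a) - 1)) *\<^sub>R w) = norm w powr (s - real DIM('a)) * \<bar>r\<bar>"
proof (cases "w = 0")
 case False
 then have "norm w powr (s - real DIM('a) - 1) * norm w = norm w powr (s - real DIM('a))"
  by (simp add: powr_diff)
 then show ?thesis by (simp add: abs_mult mult_ac)
qed simp

lemma integrable_riesz_vec:
 fixes x :: "'a::euclidean_space"
 assumes s: "0 < s" "s < 1"
 shows "integrable lborel (\<lambda>w. (riesz_diff (real DIM('a) + s - 1) x w * norm w powr (s - real DIM('a) - 1)) *\<^sub>R w)"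
proof -
 obtain e :: 'a where e: "norm e = 1" using vector_choose_size[of 1] by auto
 have "riesz_mass s x < \<infinity>"
 proof (cases "x = 0")
  case True
  then show ?thesis by (simp add: riesz_mass_def riesz_diff_def)
 next
  case False
  show ?thesis using riesz_mass_finite[OF s e]
   by (simp add: riesz_mass_eq[OF False e] ennreal_mult_less_top)
 qed
 then show ?thesis
  unfolding integrable_iff_bounded norm_riesz_vec_integrand riesz_mass_def by simp
qed

lemma riesz_vec_isometry:
 fixes x :: "'a::euclidean_space" and T :: "'a \<Rightarrow> 'a"
 assumes T: "orthogonal_transformation T" and s: "0 < s" "s < 1"
 shows "riesz_vec s (T x) = T (riesz_vec s x)"
proof -
 have lin: "bounded_linear T"
  using T by (simp add: orthogonal_transformation linear_conv_bounded_linear)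
 have [measurable]: "T \<in> borel_measurable borel"
  by (intro borel_measurable_continuous_onI linear_continuous_on lin)
 have nT: "norm (T z) = norm z" for z using T by (simp add: orthogonal_transformation)
 have "riesz_vec s (T x) = (\<integral>w. (riesz_diff (real DIM('a) + s - 1) (T x) w * norm w powr (s - real DIM('a) - 1)) *\<^sub>R w \<partial>distr lborel borel T)"
  unfolding riesz_vec_def distr_lborel_isometry[OF T] ..
 also have "\<dots> = (\<integral>w. T ((riesz_diff (real DIM('a) + s - 1) x w * norm w powr (s - real DIM('a) - 1)) *\<^sub>R w) \<partial>lborel)"
  by (subst integral_distr) (auto simp: riesz_diff_isometry[OF T] nT linear_simps(5)[OF lin])
 also have "\<dots> = T (riesz_vec s x)"
  unfolding riesz_vec_def by (rule integral_bounded_linear[OF lin integrable_riesz_vec[OF s]])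
 finally show ?thesis .
qed

lemma riesz_vec_scale:
 fixes x :: "'a::euclidean_space"
 assumes r: "r > 0"
 shows "riesz_vec s (r *\<^sub>R x) = r powr (1 - real DIM('a)) *\<^sub>R riesz_vec s x"
proof -
 let ?d = "real DIM('a)" and ?a = "real DIM('a) + s - 1"
 have e: "r powr ?d * (r powr (- ?a) * (r powr (s - ?d - 1) * r)) = r powr (1 - ?d)"
 proof -
  have "r powr ?d * (r powr (- ?a) * (r powr (s - ?d - 1) * r powr 1)) = r powr (1 - ?d)"
   by (simp only: powr_add[symmetric]) simp
  then show ?thesis using r by simp
 qed
 have "riesz_vec s (r *\<^sub>R x) = (\<bar>r\<bar> ^ DIM('a)) *\<^sub>R (\<integral>w. (riesz_diff ?a (r *\<^sub>R x) (0 + r *\<^sub>R w) * norm (0 + r *\<^sub>R w) powr (s - ?d - 1)) *\<^sub>R (0 + r *\<^sub>R w) \<partial>lborel)"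
  unfolding riesz_vec_def using r by (intro integral_lborel_affine) auto
 also have "\<dots> = (\<integral>w. r powr ?d *\<^sub>R ((riesz_diff ?a (r *\<^sub>R x) (0 + r *\<^sub>R w) * norm (0 + r *\<^sub>R w) powr (s - ?d - 1)) *\<^sub>R (0 + r *\<^sub>R w)) \<partial>lborel)"
  using r by (subst integral_scaleR_right) (auto simp: powr_realpow)
 also have "\<dots> = (\<integral>w. r powr (1 - ?d) *\<^sub>R ((riesz_diff ?a x w * norm w powr (s - ?d - 1)) *\<^sub>R w) \<partial>lborel)"
  using r by (intro Bochner_Integration.integral_cong)
   (auto simp: riesz_diff_scale powr_mult e[symmetric] mult_ac)
 also have "\<dots> = r powr (1 - ?d) *\<^sub>R riesz_vec s x"
  unfolding riesz_vec_def by (rule integral_scaleR_right)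
 finally show ?thesis .
qed

text \<open>The half-turn about the axis x fixes x and negates its orthogonal complement; by
  equivariance it fixes \<open>riesz_vec s x\<close>, which therefore has no component off the
  axis.\<close>

lemma riesz_vec_parallel:
 fixes x :: "'a::euclidean_space"
 assumes s: "0 < s" "s < 1" and x: "norm x = 1"
 shows "riesz_vec s x = (riesz_vec s x \<bullet> x) *\<^sub>R x"
proof -
 have xx: "x \<bullet> x = 1" using x by (simp add: norm_eq_sqrt_inner)
 define T where "T z = (2 * (z \<bullet> x)) *\<^sub>R x - z" for z
 have "linear T" unfolding T_def by (rule linearI) (auto simp: algebra_simps)
 moreover have "T v \<bullet> T w = v \<bullet> w" for v w
  using xx by (simp add: T_def inner_diff_left inner_diff_right inner_commute)
 ultimately have T: "orthogonal_transformation T" by (simp add: orthogonal_transformation_def)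
 have "T x = x" using xx by (simp add: T_def scaleR_2)
 then have "riesz_vec s x = T (riesz_vec s x)"
  using riesz_vec_isometry[OF T s, of x] by simp
 then have "2 *\<^sub>R riesz_vec s x = (2 * (riesz_vec s x \<bullet> x)) *\<^sub>R x"
  by (simp add: T_def scaleR_2 eq_diff_eq)
 then have "2 *\<^sub>R riesz_vec s x = 2 *\<^sub>R ((riesz_vec s x \<bullet> x) *\<^sub>R x)" by simp
 then show ?thesis by (rule scaleR_left_imp_eq[rotated]) simp
qed

text \<open>A point w with w \<bullet> x > 0 is nearer to x than to -x, so the integrand is positive
  there, and it is even in w. The points w = x and w = -x are excluded because a vanishing distance
  raised to a negative power is 0 by convention.\<close>

lemma riesz_vec_pos:
 fixes x :: "'a::euclidean_space"
 assumes s: "0 < s" "s < 1" and x: "norm x = 1"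
 shows "riesz_vec s x \<bullet> x > 0"
proof -
 let ?d = "real DIM('a)" and ?a = "real DIM('a) + s - 1"
 have "?d \<ge> 1" by (simp add: Suc_leI)
 then have a: "?a > 0" using s by linarith
 let ?f = "\<lambda>w::'a. riesz_diff ?a x w * norm w powr (s - ?d - 1) * (w \<bullet> x)"
 have int: "integrable lborel ?f"
  using integrable_inner_left[OF integrable_riesz_vec[OF s, of x], of x] by simp
 have eq: "riesz_vec s x \<bullet> x = integral\<^sup>L lborel ?f"
  unfolding riesz_vec_def using integral_inner_left[OF integrable_riesz_vec[OF s, of x], of x] by simp
 have key: "?f w > 0" if "w \<bullet> x > 0" "x \<noteq> w" "x \<noteq> -w" for w
 proof -
  have "(norm (x - w))\<^sup>2 < (norm (x + w))\<^sup>2"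
   using that by (simp add: power2_norm_eq_inner algebra_simps inner_commute)
  then have "norm (x - w) < norm (x + w)" by (rule power_less_imp_less_base) simp
  then have "norm (x + w) powr (- ?a) < norm (x - w) powr (- ?a)"
   using that a by (intro powr_less_mono2_neg) auto
  moreover have "w \<noteq> 0" using that by auto
  ultimately have "riesz_diff ?a x w > 0" "norm w powr (s - ?d - 1) > 0"
   unfolding riesz_diff_def by (simp_all only: diff_gt_0_iff_gt powr_gt_zero norm_eq_zero not_False_eq_True)
  then show ?thesis using that(1) by (intro mult_pos_pos)
 qed
 have odd: "?f (- w) = ?f w" for w by (simp add: riesz_diff_def algebra_simps)
 have nn: "?f w \<ge> 0" if "x \<noteq> w" "x \<noteq> -w" for w
 proof -
  consider "w \<bullet> x = 0" | "w \<bullet> x > 0" | "(- w) \<bullet> x > 0" by fastforce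
  then show ?thesis
   by cases (use key[of w] key[of "- w"] odd[of w] that in \<open>auto simp: less_imp_le\<close>)
 qed
 have AEnn: "AE w in lborel. 0 \<le> ?f w"
  using AE_lborel_singleton[of x] AE_lborel_singleton[of "- x"]
  by eventually_elim (rule nn, auto)
 have "integral\<^sup>L lborel ?f \<noteq> 0"
 proof
  assume "integral\<^sup>L lborel ?f = 0"
  then have "AE w in lborel. ?f w = 0"
   using integral_nonneg_eq_0_iff_AE[OF int AEnn] by simp
  \<comment> \<open>This ball lies in the half-space and strictly inside the unit sphere, hence
    avoids x and -x; a zero integral would force the positive integrand to vanish on it almost
    everywhere.\<close>
  then have "AE w in lborel. w \<notin> ball ((1/2) *\<^sub>R x) (1/4)"
  proof eventually_elim
   case (elim w)
   show ?case
   proof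
    assume "w \<in> ball ((1/2) *\<^sub>R x) (1/4)"
    then have w: "norm (w - (1/2) *\<^sub>R x) < 1/4" by (simp add: dist_norm norm_minus_commute)
    have "\<bar>(w - (1/2) *\<^sub>R x) \<bullet> x\<bar> < 1/4"
     using Cauchy_Schwarz_ineq2[of "w - (1/2) *\<^sub>R x" x] w x by simp
    moreover have "(w - (1/2) *\<^sub>R x) \<bullet> x = w \<bullet> x - 1/2"
     using x by (simp add: inner_diff_left norm_eq_sqrt_inner)
    ultimately have "w \<bullet> x > 0" by linarith
    moreover have "norm w < 1" using norm_triangle_ineq[of "w - (1/2) *\<^sub>R x" "(1/2) *\<^sub>R x"] w x by simp
    then have "x \<noteq> w" "x \<noteq> - w" using x by auto
    ultimately show False using key[of w] elim by simp
   qed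
  qed
  then have "emeasure lborel (ball ((1/2) *\<^sub>R x) (1/4)) = 0"
   by (subst (asm) AE_iff_null_sets[symmetric]) (auto simp: null_sets_def)
  then show False by (simp add: emeasure_ball)
 qed
 moreover have "integral\<^sup>L lborel ?f \<ge> 0" using AEnn by (rule integral_nonneg_AE)
 ultimately show ?thesis by (simp add: eq)
qed

text \<open>Isometries and dilations reduce the vector to its value at one unit vector, where it is
  parallel to the argument with positive coefficient. Positivity of c matters because the identity
  is later divided by it.\<close>

theorem ex_riesz_vec_eq:
 assumes s: "0 < s" "s < 1"
 shows "\<exists>c>0. \<forall>x::'a::euclidean_space. riesz_vec s x = (c * norm x powr (- real DIM('a))) *\<^sub>R x"
proof -
 obtain e :: 'a where e: "norm e = 1" using vector_choose_size[of 1] by auto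
 let ?c = "riesz_vec s e \<bullet> e"
 have "riesz_vec s x = (?c * norm x powr (- real DIM('a))) *\<^sub>R x" for x :: 'a
 proof (cases "x = 0")
  case True
  then show ?thesis by (simp add: riesz_vec_def riesz_diff_def)
 next
  case False
  define y where "y = (1 / norm x) *\<^sub>R x"
  have y: "norm y = 1" "x = norm x *\<^sub>R y" using False by (auto simp: y_def)
  obtain T where T: "orthogonal_transformation T" "T e = y"
   by (rule unit_vectors_reflection[of e y]) (use y e in auto)
  have "riesz_vec s y \<bullet> y = ?c"
   using T orthogonal_transformation_def[of T] riesz_vec_isometry[OF T(1) s, of e] by auto
  then have "riesz_vec s y = ?c *\<^sub>R y" using riesz_vec_parallel[OF s y(1)] by simp
  then have "riesz_vec s x = norm x powr (1 - real DIM('a)) *\<^sub>R ?c *\<^sub>R y"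
   using riesz_vec_scale[of "norm x" s y] False y(2) by simp
  also have "\<dots> = (?c * norm x powr (- real DIM('a))) *\<^sub>R x"
   using False by (simp add: y_def powr_diff powr_minus divide_simps)
  finally show ?thesis .
 qed
 then show ?thesis using riesz_vec_pos[OF s e] by blast
qed

subsection \<open>The fractional gradient of a test function\<close>

lemma cball_borel [measurable]: "cball (x::'a::metric_space) r \<in> sets borel"
 by simp

lemma abs_integral_le:
 fixes f g :: "'b \<Rightarrow> real"
 assumes "integrable M f" "integrable M g" "\<And>x. \<bar>f x\<bar> \<le> g x"
 shows "\<bar>integral\<^sup>L M f\<bar> \<le> integral\<^sup>L M g"
 by (rule order_trans[OF integral_abs_bound integral_mono]) (use assms in auto)

lemma grad_eqI:
 fixes V :: "'a::euclidean_space"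
 assumes "(g has_derivative (\<lambda>h. V \<bullet> h)) (at x)"
 shows "grad g x = V"
 unfolding grad_def frechet_derivative_at[OF assms, symmetric] by (rule euclidean_representation)

lemma smooth_fun_partial: "smooth_fun g \<Longrightarrow> b \<in> Basis \<Longrightarrow> smooth_fun (partial_dir b g)"
 unfolding smooth_fun_def by (metis fold_simps(2) insert_subset list.simps(15))

lemma smooth_fun_differentiable: "smooth_fun g \<Longrightarrow> g differentiable (at x)"
 unfolding smooth_fun_def by (metis empty_subsetI fold_simps(1) list.set(1))

lemma smooth_fun_has_derivative:
 fixes g :: "'a::euclidean_space \<Rightarrow> real"
 assumes "smooth_fun g"
 shows "(g has_derivative (\<lambda>h. grad g x \<bullet> h)) (at x)"
proof -
 let ?D = "frechet_derivative g (at x)"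
 have D: "(g has_derivative ?D) (at x)"
  using smooth_fun_differentiable[OF assms] by (simp add: frechet_derivative_works)
 then have lin: "linear ?D" by (simp add: has_derivative_linear)
 have "?D h = grad g x \<bullet> h" for h
 proof -
  have "?D h = ?D (\<Sum>b\<in>Basis. (h \<bullet> b) *\<^sub>R b)" by (simp add: euclidean_representation)
  also have "\<dots> = (\<Sum>b\<in>Basis. (h \<bullet> b) * ?D b)"
   by (simp add: linear_sum[OF lin] linear_cmul[OF lin])
  also have "\<dots> = grad g x \<bullet> h" by (simp add: grad_def inner_sum_left inner_commute[of h] mult.commute)
  finally show ?thesis .
 qed
 then have "?D = (\<lambda>h. grad g x \<bullet> h)" by auto
 with D show ?thesis by simp
qed

lemma continuous_on_grad:
 fixes g :: "'a::euclidean_space \<Rightarrow> real"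
 assumes "smooth_fun g"
 shows "continuous_on UNIV (grad g)"
proof -
 have "continuous_on UNIV (\<lambda>x. \<Sum>b\<in>Basis. partial_dir b g x *\<^sub>R b)"
 proof (intro continuous_on_sum continuous_on_scaleR continuous_on_const)
  fix b :: 'a assume "b \<in> Basis"
  then have "partial_dir b g differentiable (at x)" for x
   using smooth_fun_partial[OF assms] by (auto intro: smooth_fun_differentiable)
  then show "continuous_on UNIV (partial_dir b g)"
   by (auto intro!: continuous_at_imp_continuous_on differentiable_imp_continuous_within)
 qed
 moreover have "grad g = (\<lambda>x. \<Sum>b\<in>Basis. partial_dir b g x *\<^sub>R b)"
  by (auto simp: grad_def partial_dir_def)
 ultimately show ?thesis by simp
qed

lemma test_fun_C1c:
 fixes \<phi> :: "'a::euclidean_space \<Rightarrow> real"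
 assumes t: "test_fun \<Omega> \<phi>" and R: "\<Omega> \<subseteq> cball 0 R"
 shows "C1c R \<phi> (grad \<phi>)"
 unfolding C1c_def
proof (intro conjI allI impI)
 have sm: "smooth_fun \<phi>" using t by (simp add: test_fun_def)
 show "(\<phi> has_derivative (\<lambda>h. grad \<phi> x \<bullet> h)) (at x)" for x by (rule smooth_fun_has_derivative[OF sm])
 show "continuous_on UNIV (grad \<phi>)" by (rule continuous_on_grad[OF sm])
 fix x :: 'a assume x: "norm x > R"
 have z: "\<phi> y = 0" if "norm y > R" for y
  using that t R closure_subset[of "{x. \<phi> x \<noteq> 0}"] unfolding test_fun_def by (force simp: subset_iff)
 show "\<phi> x = 0" by (rule z[OF x])
 have "(\<phi> has_derivative (\<lambda>h. 0)) (at x)"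
 proof (rule has_derivative_transform_within_open[of "\<lambda>_. 0"])
  show "open {y. R < norm y}" by (intro open_Collect_less continuous_intros)
 qed (use x z in auto)
 then show "grad \<phi> x = 0" by (intro grad_eqI) simp
qed

text \<open>The definitions integrate against the completed measure, while Tonelli and Fubini are
  applied on the Borel measure; for Borel integrands the two agree.\<close>

lemma borel_integral_lebesgue:
 fixes f :: "'a::euclidean_space \<Rightarrow> 'b::{banach, second_countable_topology}"
 assumes "f \<in> borel_measurable borel"
 shows "integral\<^sup>L lebesgue f = integral\<^sup>L lborel f"
 using assms by (intro integral_completion) simp

lemma ex_nn_integral_norm_powr_cball_bound:
 fixes R b :: real
 assumes b: "0 \<le> b" "b < real DIM('a)"
 shows "\<exists>Q\<ge>0. \<forall>x::'a::euclidean_space. (\<integral>\<^sup>+z. indicator (cball x R) z * ennreal (norm z powr (- b)) \<partial>lborel) \<le> ennreal Q"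
proof -
 define I where "I = (\<integral>\<^sup>+z. indicator (cball 0 1) z * ennreal (norm (z::'a) powr (- b)) \<partial>lborel)"
 have I: "I < \<infinity>"
 proof (cases "b = 0")
  case True
  have "I \<le> (\<integral>\<^sup>+z. indicator (cball (0::'a) 1) z \<partial>lborel)"
   unfolding I_def using True by (intro nn_integral_mono) (auto split: split_indicator)
  then show ?thesis by (auto simp: emeasure_cball intro: le_less_trans)
 next
  case False
  then show ?thesis unfolding I_def using b by (intro nn_integral_norm_powr_ball) auto
 qed
 define V where "V = emeasure lborel (cball (0::'a) \<bar>R\<bar>)"
 have V: "V < \<infinity>" by (simp add: V_def emeasure_cball)
 have "(\<integral>\<^sup>+z. indicator (cball x R) z * ennreal (norm z powr (- b)) \<partial>lborel) \<le> I + V" for x :: 'a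
 proof -
  have "(\<integral>\<^sup>+z. indicator (cball x R) z * ennreal (norm z powr (- b)) \<partial>lborel)
   \<le> (\<integral>\<^sup>+z. indicator (cball 0 1) z * ennreal (norm (z::'a) powr (- b)) + indicator (cball x \<bar>R\<bar>) z \<partial>lborel)"
  proof (rule nn_integral_mono)
   fix z :: 'a
   have "norm z powr (- b) \<le> 1" if "norm z > 1" using that b powr_mono2'[of "- b" 1 "norm z"] by simp
   then show "indicator (cball x R) z * ennreal (norm z powr (- b)) \<le> indicator (cball 0 1) z * ennreal (norm z powr (- b)) + indicator (cball x \<bar>R\<bar>) z"
    by (cases "norm z \<le> 1") (auto split: split_indicator simp: add_increasing2)
  qed
  also have "\<dots> = I + emeasure lborel (cball x \<bar>R\<bar>)"
   unfolding I_def by (subst nn_integral_add) auto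
  also have "emeasure lborel (cball x \<bar>R\<bar>) = V" by (simp add: V_def emeasure_cball)
  finally show ?thesis .
 qed
 moreover have "I + V = ennreal (enn2real (I + V))" using I V by simp
 ultimately show ?thesis by (intro exI[of _ "enn2real (I + V)"]) auto
qed

lemma integrable_powr_convolution:
 fixes F :: "'a::euclidean_space \<Rightarrow> 'b::{banach, second_countable_topology}"
 assumes b: "0 \<le> b" "b < real DIM('a)" and [measurable]: "F \<in> borel_measurable borel"
  and F: "\<And>x. norm (F x) \<le> B" "\<And>x. norm x > R \<Longrightarrow> F x = 0"
 shows "integrable lborel (\<lambda>z. norm z powr (- b) *\<^sub>R F (x - z))"
proof -
 obtain Q where Q: "\<And>x::'a. (\<integral>\<^sup>+z. indicator (cball x R) z * ennreal (norm z powr (- b)) \<partial>lborel) \<le> ennreal Q"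
  using ex_nn_integral_norm_powr_cball_bound[OF b, of R] by blast
 have B: "B \<ge> 0" using F(1)[of 0] norm_ge_zero order_trans by blast
 have "(\<integral>\<^sup>+z. ennreal (norm (norm z powr (- b) *\<^sub>R F (x - z))) \<partial>lborel)
  \<le> (\<integral>\<^sup>+z. ennreal B * (indicator (cball x R) z * ennreal (norm z powr (- b))) \<partial>lborel)"
 proof (rule nn_integral_mono)
  fix z
  show "ennreal (norm (norm z powr (- b) *\<^sub>R F (x - z))) \<le> ennreal B * (indicator (cball x R) z * ennreal (norm z powr (- b)))"
  proof (cases "norm (x - z) \<le> R")
   case True
   have "norm (norm z powr (- b) *\<^sub>R F (x - z)) \<le> B * norm z powr (- b)"
    using F(1)[of "x - z"] by (simp add: mult.commute mult_right_mono)
   then show ?thesis using True B by (simp add: dist_norm ennreal_mult'[symmetric] ennreal_leI)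
  next
   case False
   then show ?thesis using F(2)[of "x - z"] by simp
  qed
 qed
 also have "\<dots> \<le> ennreal B * ennreal Q"
  using Q[of x] by (simp add: nn_integral_cmult mult_left_mono)
 also have "\<dots> < \<infinity>" by (simp add: ennreal_mult_less_top)
 finally show ?thesis by (simp add: integrable_iff_bounded)
qed

text \<open>A remainder estimate uniform in the base point, from uniform continuity of
  \<open>G\<close>. Uniformity allows the remainder to be integrated against a singular kernel, and
  \<delta> \<le> 1 keeps its support in a ball of radius R + 1.\<close>

lemma C1c_uniform_linearization:
 fixes \<phi> :: "'a::euclidean_space \<Rightarrow> real"
 assumes C: "C1c R \<phi> G" and e: "e > 0"
 obtains \<delta> where "0 < \<delta>" "\<delta> \<le> 1" "\<And>y h. norm h < \<delta> \<Longrightarrow> \<bar>\<phi> (y + h) - \<phi> y - G y \<bullet> h\<bar> \<le> e * norm h"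
proof -
 have contG: "continuous_on UNIV G" and G0: "\<And>x. norm x > R \<Longrightarrow> G x = 0" using C by (auto simp: C1c_def)
 have "uniformly_continuous_on (cball 0 (\<bar>R\<bar> + 2)) G"
  by (intro compact_uniformly_continuous continuous_on_subset[OF contG]) auto
 then obtain d where d: "d > 0" "\<And>x x'. norm x \<le> \<bar>R\<bar> + 2 \<Longrightarrow> norm x' \<le> \<bar>R\<bar> + 2 \<Longrightarrow> dist x' x < d \<Longrightarrow> dist (G x') (G x) < e"
  unfolding uniformly_continuous_on_def using e by (metis mem_cball_0)
 let ?\<delta> = "min d 1"
 \<comment> \<open>The ball of radius |R| + 2 leaves room for both points when |y| \<le> |R| + 1;
   otherwise both gradients vanish.\<close>
 have uc: "norm (G (y + k) - G y) \<le> e" if "norm k < ?\<delta>" for y k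
 proof (cases "norm y \<le> \<bar>R\<bar> + 1")
  case True
  then have "norm (y + k) \<le> \<bar>R\<bar> + 2" using norm_triangle_ineq[of y k] that by simp
  then show ?thesis using d(2)[of y "y + k"] True that by (simp add: dist_norm)
 next
  case False
  then have "norm (y + k) > R" using norm_plus_rev[of y k] that by (auto simp: add.commute)
  then show ?thesis using False G0[of y] G0[of "y + k"] e by auto
 qed
 show ?thesis
 proof (rule that[of ?\<delta>])
  fix y h :: 'a assume h: "norm h < ?\<delta>"
  have "norm (\<phi> (y + h) - \<phi> y - G y \<bullet> ((y + h) - y)) \<le> norm ((y + h) - y) * e"
  proof (rule differentiable_bound_linearization[where S="ball y ?\<delta>" and f'="\<lambda>x h. G x \<bullet> h"])
   fix t :: real assume "t \<in> {0..1}"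
   then have "norm (t *\<^sub>R h) \<le> norm h" by (simp add: mult_left_le_one_le)
   then show "y + t *\<^sub>R (y + h - y) \<in> ball y ?\<delta>" using h by (simp add: dist_norm)
  next
   fix x assume "x \<in> ball y ?\<delta>"
   show "(\<phi> has_derivative (\<lambda>h. G x \<bullet> h)) (at x within ball y ?\<delta>)"
    using C by (auto simp: C1c_def intro: has_derivative_at_withinI)
  next
   show "onorm ((\<lambda>h. G x \<bullet> h) - (\<lambda>h. G y \<bullet> h)) \<le> e" if "x \<in> ball y ?\<delta>" for x
   proof (rule onorm_le)
    fix k
    have "norm ((G x - G y) \<bullet> k) \<le> norm (G x - G y) * norm k" by (simp add: Cauchy_Schwarz_ineq2)
    also have "\<dots> \<le> e * norm k"
     using uc[of "x - y" y] that by (intro mult_right_mono) (auto simp: dist_norm norm_minus_commute)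
    finally show "norm (((\<lambda>h. G x \<bullet> h) - (\<lambda>h. G y \<bullet> h)) k) \<le> e * norm k"
     by (simp add: inner_diff_left)
   qed
  next
   show "y \<in> ball y ?\<delta>" using d by simp
  qed
  then show "\<bar>\<phi> (y + h) - \<phi> y - G y \<bullet> h\<bar> \<le> e * norm h" by (simp add: mult.commute)
 qed (use d in auto)
qed

lemma C1c_integrable:
 fixes \<phi> :: "'a::euclidean_space \<Rightarrow> real"
 assumes C: "C1c R \<phi> G"
 shows "integrable lborel \<phi>"
proof -
 have [measurable]: "\<phi> \<in> borel_measurable borel" using C1c_borel[OF C] by simp
 obtain B where B: "B > 0" "\<And>x. \<bar>\<phi> x\<bar> \<le> B" using C1c_bounded[OF C] by metis
 have "(\<integral>\<^sup>+z. ennreal \<bar>\<phi> z\<bar> \<partial>lborel) \<le> (\<integral>\<^sup>+z. ennreal B * indicator (cball (0::'a) \<bar>R\<bar>) z \<partial>lborel)"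
  using B C by (intro nn_integral_mono) (auto simp: C1c_def not_le split: split_indicator intro!: ennreal_leI)
 also have "\<dots> < \<infinity>" by (subst nn_integral_cmult_indicator) (auto simp: emeasure_cball ennreal_mult_less_top)
 finally show ?thesis by (simp add: integrable_iff_bounded)
qed

lemma integrable_lborel_reflect:
 fixes f :: "'a::euclidean_space \<Rightarrow> 'b::{banach, second_countable_topology}"
 assumes f: "integrable lborel f"
 shows "integrable lborel (\<lambda>x. f (t - x))"
proof -
 have [measurable]: "f \<in> borel_measurable borel" using f by auto
 show ?thesis
  using f nn_integral_lborel_reflect[of "\<lambda>x. ennreal (norm (f x))" t]
  by (simp add: integrable_iff_bounded)
qed

text \<open>The Riesz potential of order 1 - s of the vector field \<open>G\<close>, with the
  constant of \<open>riesz\<close>. For \<open>G\<close> the gradient of \<phi> it is the fractional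
  gradient of \<phi>.\<close>

definition riesz_grad :: "real \<Rightarrow> ('a::euclidean_space \<Rightarrow> 'a) \<Rightarrow> 'a \<Rightarrow> 'a" where
 "riesz_grad s G x = riesz_const DIM('a) (1 - s) *\<^sub>R (\<integral>z. norm z powr (- (real DIM('a) + s - 1)) *\<^sub>R G (x - z) \<partial>lborel)"

lemma riesz_eq_convolution:
 fixes \<phi> :: "'a::euclidean_space \<Rightarrow> real"
 assumes [measurable]: "\<phi> \<in> borel_measurable borel"
 shows "riesz (1 - s) \<phi> x = riesz_const DIM('a) (1 - s) * (\<integral>z. norm z powr (- (real DIM('a) + s - 1)) * \<phi> (x - z) \<partial>lborel)"
proof -
 have "(LINT y|lebesgue. \<phi> y * norm (x - y) powr (- (real DIM('a) - (1 - s))))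
   = (LINT y|lborel. \<phi> y * norm (x - y) powr (- (real DIM('a) + s - 1)))"
  by (subst borel_integral_lebesgue) (auto simp: algebra_simps)
 also have "\<dots> = \<bar>-1\<bar> ^ DIM('a) *\<^sub>R (LINT z|lborel. \<phi> (x + (-1) *\<^sub>R z) * norm (x - (x + (-1) *\<^sub>R z)) powr (- (real DIM('a) + s - 1)))"
  by (rule integral_lborel_affine) auto
 also have "\<dots> = (\<integral>z. norm z powr (- (real DIM('a) + s - 1)) * \<phi> (x - z) \<partial>lborel)"
  by (simp add: mult.commute)
 finally show ?thesis by (simp add: riesz_def)
qed

lemma riesz_exponent:
 assumes "0 < s" "s < 1"
 shows "0 < real DIM('a::euclidean_space) + s - 1" "real DIM('a) + s - 1 < real DIM('a)"
proof -
 have "real DIM('a) \<ge> 1" by (simp add: Suc_leI)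
 then show "0 < real DIM('a::euclidean_space) + s - 1" "real DIM('a) + s - 1 < real DIM('a)"
  using assms by linarith+
qed

lemma riesz_const_pos:
 assumes "0 < s" "s < 1"
 shows "riesz_const DIM('a::euclidean_space) (1 - s) > 0"
proof -
 have "real DIM('a) \<ge> 1" by (simp add: Suc_leI)
 then have "real DIM('a) - (1 - s) > 0" using assms by linarith
 then show ?thesis using assms unfolding riesz_const_def
  by (intro divide_pos_pos mult_pos_pos Gamma_real_pos) auto
qed

text \<open>In convolution form the derivative falls on \<phi> and not on the kernel, whose gradient
  of size |z|^(-(d+s)) is not locally integrable. The linearisation error of \<phi>, uniform and
  supported in one ball, is integrated against the locally integrable kernel.\<close>

lemma riesz_has_derivative:
 fixes \<phi> :: "'a::euclidean_space \<Rightarrow> real"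
 assumes C: "C1c R \<phi> G" and s: "0 < s" "s < 1"
 shows "(riesz (1 - s) \<phi> has_derivative (\<lambda>h. riesz_grad s G x \<bullet> h)) (at x)"
proof -
 let ?a = "real DIM('a) + s - 1" and ?c = "riesz_const DIM('a) (1 - s)"
 note a = riesz_exponent[OF s, where 'a='a]
 have [measurable]: "\<phi> \<in> borel_measurable borel" "G \<in> borel_measurable borel" using C1c_borel[OF C] .
 obtain B where B: "B > 0" "\<And>x. \<bar>\<phi> x\<bar> \<le> B" "\<And>x. norm (G x) \<le> B" using C1c_bounded[OF C] by metis
 have i\<phi>: "integrable lborel (\<lambda>z. norm z powr (- ?a) * \<phi> (y - z))" for y
  using integrable_powr_convolution[of ?a \<phi> B R y] a B C by (simp add: C1c_def)
 have iG: "integrable lborel (\<lambda>z. norm z powr (- ?a) *\<^sub>R G (y - z))" for y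
  using integrable_powr_convolution[of ?a G B R y] a B C by (simp add: C1c_def)
 obtain Q where Q: "Q \<ge> 0" "\<And>x::'a. (\<integral>\<^sup>+z. indicator (cball x (R + 1)) z * ennreal (norm z powr (- ?a)) \<partial>lborel) \<le> ennreal Q"
  using ex_nn_integral_norm_powr_cball_bound[of ?a "R + 1", where 'a='a] a by auto
 have iQ: "integrable lborel (\<lambda>z. indicator (cball x (R + 1)) z * norm z powr (- ?a))" for x :: 'a
  using Q(2)[of x] by (auto simp: integrable_iff_bounded ennreal_mult' ennreal_indicator abs_mult intro: le_less_trans)
 have leQ: "(\<integral>z. indicator (cball x (R + 1)) z * norm z powr (- ?a) \<partial>lborel) \<le> Q" for x :: 'a
 proof -
  have "ennreal (\<integral>z. indicator (cball x (R + 1)) z * norm z powr (- ?a) \<partial>lborel) \<le> ennreal Q"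
   using Q(2)[of x] by (subst nn_integral_eq_integral[OF iQ, symmetric]) (simp_all add: ennreal_mult' ennreal_indicator)
  then show ?thesis using Q(1) by simp
 qed
 show ?thesis
  unfolding has_derivative_at_alt
 proof (intro conjI allI impI)
  show "bounded_linear (\<lambda>h. riesz_grad s G x \<bullet> h)" by (rule bounded_linear_inner_right)
  fix e :: real assume e: "e > 0"
  \<comment> \<open>Integration multiplies the uniform error by at most |c| Q, hence this choice;
    the summand 1 prevents division by zero.\<close>
  define e' where "e' = e / (\<bar>?c\<bar> * Q + 1)"
  have pos: "\<bar>?c\<bar> * Q + 1 > 0" using Q(1) by (simp add: add_nonneg_pos)
  have e': "e' > 0" "\<bar>?c\<bar> * (e' * Q) \<le> e"
   using e pos Q(1) by (auto simp: e'_def field_simps)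
  obtain \<delta> where \<delta>: "0 < \<delta>" "\<delta> \<le> 1" "\<And>y h. norm h < \<delta> \<Longrightarrow> \<bar>\<phi> (y + h) - \<phi> y - G y \<bullet> h\<bar> \<le> e' * norm h"
   using C1c_uniform_linearization[OF C e'(1)] by blast
  show "\<exists>d>0. \<forall>y. norm (y - x) < d \<longrightarrow> norm (riesz (1 - s) \<phi> y - riesz (1 - s) \<phi> x - riesz_grad s G x \<bullet> (y - x)) \<le> e * norm (y - x)"
  proof (intro exI[of _ \<delta>] conjI allI impI)
   fix y assume y: "norm (y - x) < \<delta>"
   define h where "h = y - x"
   have yx: "y = x + h" by (simp add: h_def)
   let ?D = "\<lambda>z. norm z powr (- ?a) * (\<phi> (x - z + h) - \<phi> (x - z) - G (x - z) \<bullet> h)"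
   have xz: "x - z + h = (x + h) - z" for z by (simp add: algebra_simps)
   have iGh: "integrable lborel (\<lambda>z. norm z powr (- ?a) * (G (x - z) \<bullet> h))"
    using integrable_inner_left[OF iG[of x], of h] by simp
   have i\<phi>h: "integrable lborel (\<lambda>z. norm z powr (- ?a) * \<phi> (x - z + h))"
    unfolding xz by (rule i\<phi>)
   have "riesz (1 - s) \<phi> y - riesz (1 - s) \<phi> x - riesz_grad s G x \<bullet> h
     = ?c * ((\<integral>z. norm z powr (- ?a) * \<phi> (x - z + h) \<partial>lborel) - (\<integral>z. norm z powr (- ?a) * \<phi> (x - z) \<partial>lborel) - (\<integral>z. norm z powr (- ?a) * (G (x - z) \<bullet> h) \<partial>lborel))"
   proof -
    have "(\<integral>z. norm z powr (- ?a) *\<^sub>R G (x - z) \<partial>lborel) \<bullet> h = (\<integral>z. norm z powr (- ?a) * (G (x - z) \<bullet> h) \<partial>lborel)"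
     using integral_inner_left[OF iG[of x], of h] by simp
    then show ?thesis
     unfolding xz yx riesz_grad_def inner_scaleR_left
     by (simp only: riesz_eq_convolution[OF \<open>\<phi> \<in> borel_measurable borel\<close>] right_diff_distrib)
   qed
   also have "\<dots> = ?c * (\<integral>z. ?D z \<partial>lborel)"
    unfolding right_diff_distrib[of "norm _ powr _"]
    by (simp only: Bochner_Integration.integral_diff[OF Bochner_Integration.integrable_diff[OF i\<phi>h i\<phi>[of x]] iGh]
     Bochner_Integration.integral_diff[OF i\<phi>h i\<phi>[of x]])
   finally have eq: "norm (riesz (1 - s) \<phi> y - riesz (1 - s) \<phi> x - riesz_grad s G x \<bullet> h) = \<bar>?c\<bar> * \<bar>\<integral>z. ?D z \<partial>lborel\<bar>"
    by (simp add: abs_mult)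
   have "\<bar>\<integral>z. ?D z \<partial>lborel\<bar> \<le> (\<integral>z. e' * norm h * (indicator (cball x (R + 1)) z * norm z powr (- ?a)) \<partial>lborel)"
   proof (rule abs_integral_le)
    show "integrable lborel ?D"
     unfolding right_diff_distrib[of "norm _ powr _"]
     by (rule Bochner_Integration.integrable_diff[OF Bochner_Integration.integrable_diff[OF i\<phi>h i\<phi>[of x]] iGh])
    show "integrable lborel (\<lambda>z. e' * norm h * (indicator (cball x (R + 1)) z * norm z powr (- ?a)))"
     by (intro integrable_mult_right iQ)
    fix z :: 'a
    show "\<bar>?D z\<bar> \<le> e' * norm h * (indicator (cball x (R + 1)) z * norm z powr (- ?a))"
    proof (cases "norm (x - z) \<le> R + 1")
     case True
     have "\<bar>?D z\<bar> = norm z powr (- ?a) * \<bar>\<phi> (x - z + h) - \<phi> (x - z) - G (x - z) \<bullet> h\<bar>" by (simp add: abs_mult)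
     also have "\<dots> \<le> norm z powr (- ?a) * (e' * norm h)"
      using \<delta>(3)[of h "x - z"] y by (intro mult_left_mono) (auto simp: h_def)
     finally show ?thesis using True by (simp add: dist_norm mult_ac)
    next
     case False
     have "norm h < 1" using y \<delta>(2) by (simp add: h_def)
     then have "norm (x - z) > R" "norm (x - z + h) > R"
      using False norm_plus_rev[of "x - z" h] by (auto simp: add.commute)
     then have D0: "?D z = 0" using C by (simp add: C1c_def)
     show ?thesis unfolding D0 using e'(1) by simp
    qed
   qed
   also have "\<dots> = e' * norm h * (\<integral>z. indicator (cball x (R + 1)) z * norm z powr (- ?a) \<partial>lborel)"
    by (rule integral_mult_right_zero)
   also have "\<dots> \<le> e' * norm h * Q" using e'(1) by (intro mult_left_mono leQ) simp
   finally have "\<bar>?c\<bar> * \<bar>\<integral>z. ?D z \<partial>lborel\<bar> \<le> \<bar>?c\<bar> * (e' * norm h * Q)" by (rule mult_left_mono) simp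
   also have "\<dots> = \<bar>?c\<bar> * (e' * Q) * norm h" by simp
   also have "\<dots> \<le> e * norm h" by (intro mult_right_mono e') simp
   finally show "norm (riesz (1 - s) \<phi> y - riesz (1 - s) \<phi> x - riesz_grad s G x \<bullet> (y - x)) \<le> e * norm (y - x)"
    using eq by (simp add: h_def)
  qed (rule \<delta>)
 qed
qed

lemma frac_grad_eq:
 fixes \<phi> :: "'a::euclidean_space \<Rightarrow> real"
 assumes C: "C1c R \<phi> G" and s: "0 < s" "s \<le> 1"
 shows "frac_grad s \<phi> = (if s = 1 then G else riesz_grad s G)"
proof (cases "s = 1")
 case True
 then show ?thesis using C by (auto simp: frac_grad_def C1c_def intro!: grad_eqI)
next
 case False
 then show ?thesis using riesz_has_derivative[OF C, of s] s by (auto simp: frac_grad_def intro!: grad_eqI)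
qed

lemma borel_measurable_riesz_grad:
 assumes [measurable]: "G \<in> borel_measurable borel"
 shows "riesz_grad s (G :: 'a::euclidean_space \<Rightarrow> 'a) \<in> borel_measurable borel"
proof -
 have "(\<lambda>x. \<integral>z. norm z powr (- (real DIM('a) + s - 1)) *\<^sub>R G (x - z) \<partial>lborel) \<in> borel_measurable lborel"
  by (rule lborel.borel_measurable_lebesgue_integral) measurable
 then show ?thesis unfolding riesz_grad_def[abs_def] by simp
qed

text \<open>The derivative is tested on a small multiple of its own gradient vector
  \<open>V\<close>. This converts an increment bound for a function into a bound for its gradient
  without a second formula for the gradient.\<close>

lemma has_derivative_norm_le_Lipschitz:
 fixes g :: "'a::euclidean_space \<Rightarrow> real"
 assumes D: "(g has_derivative (\<lambda>h. V \<bullet> h)) (at y)" and d: "d > 0" and L: "L \<ge> 0"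
  and lip: "\<And>h. norm h < d \<Longrightarrow> \<bar>g (y + h) - g y\<bar> \<le> L * norm h"
 shows "norm V \<le> L"
proof (rule field_le_epsilon)
 fix e :: real assume e: "e > 0"
 obtain d' where d': "d' > 0" "\<And>z. norm (z - y) < d' \<Longrightarrow> norm (g z - g y - V \<bullet> (z - y)) \<le> e * norm (z - y)"
  using D e unfolding has_derivative_at_alt by blast
 define t where "t = min d d' / (2 * (norm V + 1))"
 have t: "t > 0" using d d' by (simp add: t_def add_nonneg_pos)
 define h where "h = t *\<^sub>R V"
 have "norm h < min d d'"
 proof -
  have "norm h = t * norm V" using t by (simp add: h_def)
  also have "\<dots> = (min d d' / 2) * (norm V / (norm V + 1))"
  proof -
   have "m / (2 * k) * n = (m / 2) * (n / k)" for m k n :: real by simp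
   then show ?thesis unfolding t_def .
  qed
  also have "\<dots> \<le> (min d d' / 2) * 1" proof (intro mult_left_mono)
   show "norm V / (norm V + 1) \<le> 1" using norm_ge_zero[of V] by (subst divide_le_eq_1_pos) linarith+
  qed (use d d' in auto)
  also have "\<dots> < min d d'"
  proof -
   have "min d d' > 0" using d d' by simp
   then show ?thesis by linarith
  qed
  finally show ?thesis .
 qed
 then have h: "norm h < d" "norm h < d'" by auto
 have "\<bar>V \<bullet> h\<bar> \<le> \<bar>g (y + h) - g y\<bar> + \<bar>g (y + h) - g y - V \<bullet> h\<bar>" by linarith
 also have "\<dots> \<le> (L + e) * norm h"
  using lip[OF h(1)] d'(2)[of "y + h"] h by (simp add: algebra_simps)
 finally have "t * (norm V * norm V) \<le> t * ((L + e) * norm V)"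
  using t by (simp add: h_def power2_norm_eq_inner[symmetric] power2_eq_square mult_ac)
 then have "norm V * norm V \<le> (L + e) * norm V" using t by (simp add: mult_le_cancel_left_pos)
 then show "norm V \<le> L + e" using L e by (cases "norm V = 0") (auto simp: mult_le_cancel_right)
qed

text \<open>Away from the support the increment is put on the kernel, smooth there, instead of on
  \<phi>. So the bound involves the integral of |\<phi>| and not the gradient, which is what permits
  the far part of the potential to be absorbed later.\<close>

lemma ex_riesz_grad_decay:
 assumes s: "0 < s" "s < 1" and R: "R > 0"
 shows "\<exists>C\<ge>0. \<forall>\<phi> G. C1c R \<phi> G \<longrightarrow> (\<forall>y::'a::euclidean_space. 2 * R \<le> norm y \<longrightarrow>
   norm (riesz_grad s G y) \<le> C * (\<integral>x. \<bar>\<phi> x\<bar> \<partial>lborel) * norm y powr (- (real DIM('a) + s)))"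
proof -
 let ?a = "real DIM('a) + s - 1" and ?c = "riesz_const DIM('a) (1 - s)"
 note a = riesz_exponent[OF s, where 'a='a]
 define C where "C = \<bar>?c\<bar> * ?a * 4 powr (?a + 1)"
 have "norm (riesz_grad s G y) \<le> C * (\<integral>x. \<bar>\<phi> x\<bar> \<partial>lborel) * norm y powr (- (real DIM('a) + s))"
  if Cc: "C1c R \<phi> G" and y: "2 * R \<le> norm y" for \<phi> G and y :: 'a
 proof -
  have [measurable]: "\<phi> \<in> borel_measurable borel" using C1c_borel[OF Cc] by simp
  obtain B where B: "B > 0" "\<And>x. \<bar>\<phi> x\<bar> \<le> B" using C1c_bounded[OF Cc] by metis
  have y0: "norm y > 0" using y R by linarith
  define I where "I = (\<integral>x. \<bar>\<phi> x\<bar> \<partial>lborel)"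
  have i\<phi>: "integrable lborel \<phi>" by (rule C1c_integrable[OF Cc])
  have ip: "integrable lborel (\<lambda>z. \<phi> z * norm (x - z) powr (- ?a))" for x
   using integrable_lborel_reflect[OF integrable_powr_convolution[of ?a \<phi> B R x], of x] a B Cc
   by (simp add: C1c_def mult.commute)
  have eq: "riesz (1 - s) \<phi> x = ?c * (\<integral>z. \<phi> z * norm (x - z) powr (- ?a) \<partial>lborel)" for x
   unfolding riesz_def by (subst borel_integral_lebesgue) (auto simp: algebra_simps)
  \<comment> \<open>For |y| \<ge> 2R the support is at least |y|/2 away from y, and a displacement
    below |y|/4 leaves a distance of at least |y|/4; \<open>?L\<close> is the Lipschitz constant of
    the kernel beyond that distance.\<close>
  let ?L = "?a * (norm y / 4) powr (- ?a - 1)"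
  have L0: "?L \<ge> 0" using a by simp
  have "norm (riesz_grad s G y) \<le> \<bar>?c\<bar> * (?L * I)"
  proof (rule has_derivative_norm_le_Lipschitz[OF riesz_has_derivative[OF Cc s]])
   show "norm y / 4 > 0" using y0 by simp
   show "\<bar>?c\<bar> * (?L * I) \<ge> 0" using L0 by (simp add: I_def)
   fix h :: 'a assume h: "norm h < norm y / 4"
   have A: "\<bar>riesz (1 - s) \<phi> (y + h) - riesz (1 - s) \<phi> y\<bar>
    = \<bar>?c\<bar> * \<bar>\<integral>z. \<phi> z * (norm (y + h - z) powr (- ?a) - norm (y - z) powr (- ?a)) \<partial>lborel\<bar>"
   proof -
    have "(\<integral>z. \<phi> z * (norm (y + h - z) powr (- ?a) - norm (y - z) powr (- ?a)) \<partial>lborel)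
     = (\<integral>z. \<phi> z * norm (y + h - z) powr (- ?a) \<partial>lborel) - (\<integral>z. \<phi> z * norm (y - z) powr (- ?a) \<partial>lborel)"
     using Bochner_Integration.integral_diff[OF ip[of "y + h"] ip[of y]] by (simp only: right_diff_distrib)
    then show ?thesis by (simp only: eq right_diff_distrib[symmetric] abs_mult)
   qed
   have "\<bar>\<integral>z. \<phi> z * (norm (y + h - z) powr (- ?a) - norm (y - z) powr (- ?a)) \<partial>lborel\<bar>
    \<le> (\<integral>z. (?L * norm h) * \<bar>\<phi> z\<bar> \<partial>lborel)"
   proof (rule abs_integral_le)
    show "integrable lborel (\<lambda>z. \<phi> z * (norm (y + h - z) powr (- ?a) - norm (y - z) powr (- ?a)))"
     unfolding right_diff_distrib by (rule Bochner_Integration.integrable_diff[OF ip[of "y + h"] ip[of y]])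
    show "integrable lborel (\<lambda>z. (?L * norm h) * \<bar>\<phi> z\<bar>)"
     by (intro integrable_mult_right integrable_abs i\<phi>)
    fix z
    show "\<bar>\<phi> z * (norm (y + h - z) powr (- ?a) - norm (y - z) powr (- ?a))\<bar> \<le> (?L * norm h) * \<bar>\<phi> z\<bar>"
    proof (cases "norm z \<le> R")
     case True
     have 1: "norm (y - z) \<ge> norm y / 4" using norm_triangle_ineq2[of y z] True y y0 by linarith
     have 2: "norm (y + h - z) \<ge> norm y / 4"
      using norm_triangle_ineq2[of "y + h" z] norm_diff_ineq[of y h] True y y0 h by linarith
     have 3: "\<bar>norm (y + h - z) - norm (y - z)\<bar> \<le> norm h"
      using norm_triangle_ineq3[of "y + h - z" "y - z"] by simp
     have "\<bar>norm (y + h - z) powr (- ?a) - norm (y - z) powr (- ?a)\<bar> \<le> ?L * \<bar>norm (y + h - z) - norm (y - z)\<bar>"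
      using y0 1 2 a by (intro powr_minus_diff_le) simp_all
     also have "\<dots> \<le> ?L * norm h" by (intro mult_left_mono 3 L0)
     finally show ?thesis by (simp add: abs_mult mult.commute[of "\<bar>\<phi> z\<bar>"] mult_right_mono)
    next
     case False
     then show ?thesis using Cc L0 by (simp add: C1c_def)
    qed
   qed
   also have "\<dots> = (?L * norm h) * I" unfolding I_def by (rule integral_mult_right_zero)
   finally have B: "\<bar>\<integral>z. \<phi> z * (norm (y + h - z) powr (- ?a) - norm (y - z) powr (- ?a)) \<partial>lborel\<bar> \<le> (?L * norm h) * I" .
   have "\<bar>?c\<bar> * ((?L * norm h) * I) = \<bar>?c\<bar> * (?L * I) * norm h" by (simp only: mult_ac)
   then show "\<bar>riesz (1 - s) \<phi> (y + h) - riesz (1 - s) \<phi> y\<bar> \<le> \<bar>?c\<bar> * (?L * I) * norm h"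
    unfolding A using mult_left_mono[OF B, of "\<bar>?c\<bar>"] by linarith
  qed
  also have "\<bar>?c\<bar> * (?L * I) = C * I * norm y powr (- (real DIM('a) + s))"
  proof -
   have e: "- ?a - 1 = - (real DIM('a) + s)" "?a + 1 = real DIM('a) + s" by simp_all
   have "(norm y / 4) powr (- ?a - 1) = 4 powr (?a + 1) * norm y powr (- (real DIM('a) + s))"
   proof -
    have "(norm y / 4) powr (- b) = 4 powr b * norm y powr (- b)" for b
     by (simp add: powr_divide powr_minus divide_simps)
    then show ?thesis unfolding e .
   qed
   then show ?thesis unfolding C_def by (simp only: mult_ac)
  qed
  finally show ?thesis by (simp only: I_def)
 qed
 moreover have "C \<ge> 0" using a by (simp add: C_def)
 ultimately show ?thesis by blast
qed

text \<open>The operator taking an ordinary gradient to the fractional one, so that the cases s = 1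
  and s < 1 can share one statement.\<close>

definition fgrad :: "real \<Rightarrow> ('a::euclidean_space \<Rightarrow> 'a) \<Rightarrow> 'a \<Rightarrow> 'a" where
 "fgrad s G = (if s = 1 then G else riesz_grad s G)"

lemma borel_measurable_fgrad:
 "G \<in> borel_measurable borel \<Longrightarrow> fgrad s G \<in> borel_measurable borel"
 by (simp add: fgrad_def borel_measurable_riesz_grad)

lemma fgrad_bounded:
 fixes G :: "'a::euclidean_space \<Rightarrow> 'a"
 assumes C: "C1c R \<phi> G" and s: "0 < s" "s \<le> 1"
 obtains B where "B \<ge> 0" "\<And>x. norm (fgrad s G x) \<le> B"
proof (cases "s = 1")
 case True
 then show ?thesis using C1c_bounded[OF C] that by (metis fgrad_def less_imp_le)
next
 case False
 with s have s1: "0 < s" "s < 1" by auto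
 let ?a = "real DIM('a) + s - 1" and ?c = "riesz_const DIM('a) (1 - s)"
 note a = riesz_exponent[OF s1, where 'a='a]
 have [measurable]: "G \<in> borel_measurable borel" using C1c_borel[OF C] by simp
 obtain B where B: "B > 0" "\<And>x. norm (G x) \<le> B" using C1c_bounded[OF C] by metis
 obtain Q where Q: "Q \<ge> 0" "\<And>x::'a. (\<integral>\<^sup>+z. indicator (cball x R) z * ennreal (norm z powr (- ?a)) \<partial>lborel) \<le> ennreal Q"
  using ex_nn_integral_norm_powr_cball_bound[of ?a R, where 'a='a] a by auto
 have "norm (fgrad s G x) \<le> \<bar>?c\<bar> * (B * Q)" for x
 proof -
  have "ennreal (norm (\<integral>z. norm z powr (- ?a) *\<^sub>R G (x - z) \<partial>lborel))
   \<le> (\<integral>\<^sup>+z. ennreal (norm (norm z powr (- ?a) *\<^sub>R G (x - z))) \<partial>lborel)"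
   by (intro integral_norm_bound_ennreal integrable_powr_convolution[of ?a G B R]) (use a B C in \<open>auto simp: C1c_def\<close>)
  also have "\<dots> \<le> (\<integral>\<^sup>+z. ennreal B * (indicator (cball x R) z * ennreal (norm z powr (- ?a))) \<partial>lborel)"
  proof (rule nn_integral_mono)
   fix z
   show "ennreal (norm (norm z powr (- ?a) *\<^sub>R G (x - z))) \<le> ennreal B * (indicator (cball x R) z * ennreal (norm z powr (- ?a)))"
   proof (cases "norm (x - z) \<le> R")
    case True
    have "norm (norm z powr (- ?a) *\<^sub>R G (x - z)) \<le> B * norm z powr (- ?a)"
     using B(2)[of "x - z"] by (simp add: mult.commute mult_right_mono)
    then have "ennreal (norm (norm z powr (- ?a) *\<^sub>R G (x - z))) \<le> ennreal (B * norm z powr (- ?a))"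
     by (rule ennreal_leI)
    then show ?thesis using True B by (simp add: dist_norm ennreal_mult')
   next
    case False
    then have "G (x - z) = 0" using C by (simp add: C1c_def)
    then show ?thesis by simp
   qed
  qed
  also have "\<dots> = ennreal B * (\<integral>\<^sup>+z. indicator (cball x R) z * ennreal (norm z powr (- ?a)) \<partial>lborel)"
   by (rule nn_integral_cmult) measurable
  also have "\<dots> \<le> ennreal B * ennreal Q" by (intro mult_left_mono Q) simp
  also have "\<dots> = ennreal (B * Q)" using B by (simp add: ennreal_mult')
  finally have "norm (\<integral>z. norm z powr (- ?a) *\<^sub>R G (x - z) \<partial>lborel) \<le> B * Q"
   using B Q by simp
  then have "\<bar>?c\<bar> * norm (\<integral>z. norm z powr (- ?a) *\<^sub>R G (x - z) \<partial>lborel) \<le> \<bar>?c\<bar> * (B * Q)"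
   by (rule mult_left_mono) simp
  then show ?thesis using False by (simp only: fgrad_def riesz_grad_def norm_scaleR if_False)
 qed
 then show ?thesis using that[of "\<bar>?c\<bar> * (B * Q)"] B Q by simp
qed

lemma ex_fgrad_decay:
 assumes s: "0 < s" "s \<le> 1" and R: "R > 0"
 shows "\<exists>C\<ge>0. \<forall>\<phi> G. C1c R \<phi> G \<longrightarrow> (\<forall>y::'a::euclidean_space. 2 * R \<le> norm y \<longrightarrow>
   norm (fgrad s G y) \<le> C * (\<integral>x. \<bar>\<phi> x\<bar> \<partial>lborel) * norm y powr (- (real DIM('a) + s)))"
proof (cases "s = 1")
 case True
 then show ?thesis using R by (intro exI[of _ 0]) (auto simp: fgrad_def C1c_def)
next
 case False
 then have "fgrad s = (riesz_grad s :: ('a \<Rightarrow> 'a) \<Rightarrow> _)" by (auto simp: fgrad_def)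
 then show ?thesis using ex_riesz_grad_decay[of s R, where 'a='a] s R False by simp
qed

text \<open>Bounded near the support and of size |x|^(-(d+s)) away from it, where (d + s) p exceeds
  d.\<close>

lemma fgrad_Lp:
 fixes G :: "'a::euclidean_space \<Rightarrow> 'a"
 assumes C: "C1c R \<phi> G" and s: "0 < s" "s \<le> 1" and R: "R > 0" and p: "p > 1"
 shows "(\<integral>\<^sup>+x. ennreal (norm (fgrad s G x) powr p) \<partial>lborel) < \<infinity>"
proof -
 let ?d = "real DIM('a)"
 obtain B where B: "B \<ge> 0" "\<And>x. norm (fgrad s G x) \<le> B" using fgrad_bounded[OF C s] by blast
 obtain D where D: "D \<ge> 0" "\<And>y. 2 * R \<le> norm y \<Longrightarrow> norm (fgrad s G y) \<le> D * (\<integral>x. \<bar>\<phi> x\<bar> \<partial>lborel) * norm y powr (- (?d + s))"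
  using ex_fgrad_decay[OF s R, where 'a='a] C by blast
 define E where "E = D * (\<integral>x. \<bar>\<phi> x\<bar> \<partial>lborel)"
 have E: "E \<ge> 0" using D(1) by (simp add: E_def)
 have dp: "?d < (?d + s) * p"
 proof -
  have "?d * 1 \<le> ?d * p" using p by (intro mult_left_mono) auto
  moreover have "s * p > 0" using s p by simp
  ultimately show ?thesis unfolding distrib_right by linarith
 qed
 have "(\<integral>\<^sup>+x. ennreal (norm (fgrad s G x) powr p) \<partial>lborel)
  \<le> (\<integral>\<^sup>+x. ennreal (B powr p) * indicator (cball 0 (2 * R)) (x::'a)
     + ennreal (E powr p) * (indicator {y. 2 * R \<le> norm y} x * ennreal (norm x powr (- ((?d + s) * p)))) \<partial>lborel)"
 proof (rule nn_integral_mono)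
  fix x :: 'a
  show "ennreal (norm (fgrad s G x) powr p) \<le> ennreal (B powr p) * indicator (cball 0 (2 * R)) x
     + ennreal (E powr p) * (indicator {y. 2 * R \<le> norm y} x * ennreal (norm x powr (- ((?d + s) * p))))"
  proof (cases "norm x \<le> 2 * R")
   case True
   have "norm (fgrad s G x) powr p \<le> B powr p" using B p by (intro powr_mono2) auto
   then have "ennreal (norm (fgrad s G x) powr p) \<le> ennreal (B powr p)" by (rule ennreal_leI)
   then show ?thesis using True by (intro add_increasing2 zero_le) simp
  next
   case False
   then have "norm (fgrad s G x) \<le> E * norm x powr (- (?d + s))" using D(2)[of x] by (simp add: E_def)
   then have "norm (fgrad s G x) powr p \<le> (E * norm x powr (- (?d + s))) powr p" using p by (intro powr_mono2) auto
   also have "\<dots> = E powr p * norm x powr (- ((?d + s) * p))" by (simp only: powr_mult powr_powr mult_minus_left)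
   finally have "ennreal (norm (fgrad s G x) powr p) \<le> ennreal (E powr p * norm x powr (- ((?d + s) * p)))" by (rule ennreal_leI)
   also have "\<dots> = ennreal (E powr p) * (indicator {y. 2 * R \<le> norm y} x * ennreal (norm x powr (- ((?d + s) * p))))"
    using False by (simp add: ennreal_mult')
   finally show ?thesis by (intro add_increasing zero_le)
  qed
 qed
 also have "\<dots> = ennreal (B powr p) * emeasure lborel (cball (0::'a) (2 * R))
   + ennreal (E powr p) * (\<integral>\<^sup>+x. indicator {y. 2 * R \<le> norm y} x * ennreal (norm (x::'a) powr (- ((?d + s) * p))) \<partial>lborel)"
 proof -
  have [measurable]: "{y::'a. 2 * R \<le> norm y} \<in> sets borel" by measurable
  show ?thesis by (subst nn_integral_add) (auto simp: nn_integral_cmult_indicator nn_integral_cmult)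
 qed
 also have "\<dots> < \<infinity>"
 proof -
  have "(\<integral>\<^sup>+x. indicator {y. 2 * R \<le> norm y} x * ennreal (norm (x::'a) powr (- ((?d + s) * p))) \<partial>lborel) < \<infinity>"
   using dp R by (intro le_less_trans[OF nn_integral_norm_powr_outside]) auto
  then show ?thesis using R by (simp add: emeasure_cball ennreal_mult_less_top)
 qed
 finally show ?thesis .
qed

lemma annulus_measure_pos: "measure lborel {w::'a::euclidean_space. 1 \<le> norm w \<and> norm w \<le> 2} > 0"
proof -
 let ?A = "{w::'a. 1 \<le> norm w \<and> norm w \<le> 2}"
 obtain e :: 'a where e: "norm e = 3/2" using vector_choose_size[of "3/2"] by auto
 have A: "?A \<in> sets lborel" by measurable
 have "?A \<subseteq> cball 0 2" by auto
 then have fin: "emeasure lborel ?A < \<infinity>"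
  using emeasure_mono[of ?A "cball 0 2" lborel] by (auto simp: emeasure_cball intro: le_less_trans)
 have "ball e (1/4) \<subseteq> ?A"
 proof
  fix w assume "w \<in> ball e (1/4)"
  then have "norm (e - w) < 1/4" by (simp add: dist_norm)
  then show "w \<in> ?A" using e norm_triangle_ineq2[of e w] norm_triangle_ineq2[of w e] by (auto simp: norm_minus_commute)
 qed
 then have "emeasure lborel (ball e (1/4)) \<le> emeasure lborel ?A" using A by (intro emeasure_mono)
 moreover have "emeasure lborel (ball e (1/4)) > 0" by (simp add: emeasure_ball ennreal_zero_less_mult_iff)
 ultimately have "emeasure lborel ?A > 0" by (rule less_le_trans[rotated])
 then show ?thesis using fin by (simp add: measure_def enn2real_positive_iff)
qed

text \<open>Up to constants, \<open>riesz_vec\<close> writes the kernel x |x|^(-d) of the gradient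
  representation as a superposition of kernels of order 1 - s. Exchanging the integrals moves these
  onto the gradient and forms the fractional gradient; the kernel that remains has size |w|^(s-d).
  For s = 1 the representation itself suffices.\<close>

lemma ex_pointwise_bound:
 assumes s: "0 < s" "s \<le> 1"
 shows "\<exists>C\<ge>0. \<forall>R \<phi> G. C1c R \<phi> G \<longrightarrow> (\<forall>x::'a::euclidean_space.
   ennreal \<bar>\<phi> x\<bar> \<le> ennreal C * (\<integral>\<^sup>+y. ennreal (norm (x - y) powr (- (real DIM('a) - s))) * ennreal (norm (fgrad s G y)) \<partial>lborel))"
proof -
 let ?d = "real DIM('a)"
 define c1 where "c1 = ?d * measure lborel {w::'a. 1 \<le> norm w \<and> norm w \<le> 2} / (2 powr ?d - 1)"
 have c1: "c1 > 0" unfolding c1_def using annulus_measure_pos[where 'a='a]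
  by (intro divide_pos_pos mult_pos_pos) auto
 have rep: "(\<integral>z. norm z powr (- ?d) * (G (x - z) \<bullet> z) \<partial>lborel) = c1 * \<phi> x" if "C1c R \<phi> G" for R \<phi> G and x :: 'a
  unfolding c1_def by (rule gradient_representation[OF that])
 show ?thesis
 proof (cases "s = 1")
  case True
  have "ennreal \<bar>\<phi> x\<bar> \<le> ennreal (1 / c1) * (\<integral>\<^sup>+y. ennreal (norm (x - y) powr (- (?d - s))) * ennreal (norm (fgrad s G y)) \<partial>lborel)"
   if C: "C1c R \<phi> G" for R \<phi> G and x :: 'a
  proof -
   have [measurable]: "G \<in> borel_measurable borel" using C1c_borel[OF C] by simp
   let ?J = "\<integral>\<^sup>+y. ennreal (norm (x - y) powr (- (?d - s))) * ennreal (norm (fgrad s G y)) \<partial>lborel"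
   have "ennreal (c1 * \<bar>\<phi> x\<bar>) = ennreal (norm (\<integral>z. norm z powr (- ?d) * (G (x - z) \<bullet> z) \<partial>lborel))"
    using c1 by (simp add: rep[OF C] abs_mult)
   also have "\<dots> \<le> (\<integral>\<^sup>+z. ennreal (norm (norm z powr (- ?d) * (G (x - z) \<bullet> z))) \<partial>lborel)"
   proof (cases "integrable lborel (\<lambda>z. norm z powr (- ?d) * (G (x - z) \<bullet> z))")
    case True then show ?thesis by (rule integral_norm_bound_ennreal)
   next
    \<comment> \<open>A non-integrable integrand has Bochner integral 0, so the bound is trivial in
      this case.\<close>
    case False then show ?thesis by (simp add: not_integrable_integral_eq)
   qed
   also have "\<dots> \<le> (\<integral>\<^sup>+z. ennreal (norm (x - (x - z)) powr (- (?d - s))) * ennreal (norm (fgrad s G (x - z))) \<partial>lborel)"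
   proof (rule nn_integral_mono)
    fix z
    have "norm (norm z powr (- ?d) * (G (x - z) \<bullet> z)) \<le> norm z powr (- ?d) * (norm (G (x - z)) * norm z)"
     using Cauchy_Schwarz_ineq2[of "G (x - z)" z] by (simp add: abs_mult mult_left_mono)
    also have "\<dots> = norm z powr (- (?d - s)) * norm (G (x - z))"
     using True by (cases "z = 0") (auto simp: powr_diff powr_minus divide_simps)
    finally show "ennreal (norm (norm z powr (- ?d) * (G (x - z) \<bullet> z))) \<le> ennreal (norm (x - (x - z)) powr (- (?d - s))) * ennreal (norm (fgrad s G (x - z)))"
     using True by (simp add: fgrad_def ennreal_mult'[symmetric] ennreal_leI)
   qed
   also have "\<dots> = ?J"
    using True by (intro nn_integral_lborel_reflect[of "\<lambda>y. ennreal (norm (x - y) powr (- (?d - s))) * ennreal (norm (fgrad s G y))"]) (simp add: fgrad_def)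
   finally have "ennreal (1 / c1) * ennreal (c1 * \<bar>\<phi> x\<bar>) \<le> ennreal (1 / c1) * ?J" by (rule mult_left_mono) simp
   moreover have "ennreal (1 / c1) * ennreal (c1 * \<bar>\<phi> x\<bar>) = ennreal \<bar>\<phi> x\<bar>"
    using c1 by (subst ennreal_mult'[symmetric]) simp_all
   ultimately show ?thesis by simp
  qed
  then show ?thesis using c1 by (intro exI[of _ "1 / c1"]) auto
 next
  case False
  with s have s1: "0 < s" "s < 1" by auto
  let ?a = "?d + s - 1" and ?cr = "riesz_const DIM('a) (1 - s)"
  note a = riesz_exponent[OF s1, where 'a='a]
  have cr: "?cr > 0" by (rule riesz_const_pos[OF s1])
  obtain c where c: "c > 0" "\<And>x::'a. riesz_vec s x = (c * norm x powr (- ?d)) *\<^sub>R x"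
   using ex_riesz_vec_eq[OF s1, where 'a='a] by blast
  obtain e :: 'a where e: "norm e = 1" using vector_choose_size[of 1] by auto
  \<comment> \<open>The factor 2 collects the equal contributions of x - w and x + w; the rest
    undoes the constants of the kernel identity, the representation and the Riesz potential.\<close>
  define K where "K = 2 / (c * c1 * ?cr)"
  have K: "K \<ge> 0" using c c1 cr by (simp add: K_def)
  have "ennreal \<bar>\<phi> x\<bar> \<le> ennreal K * (\<integral>\<^sup>+y. ennreal (norm (x - y) powr (- (?d - s))) * ennreal (norm (fgrad s G y)) \<partial>lborel)"
   if C: "C1c R \<phi> G" for R \<phi> G and x :: 'a
  proof -
   have [measurable]: "G \<in> borel_measurable borel" using C1c_borel[OF C] by simp
   obtain B where B: "B > 0" "\<And>x. norm (G x) \<le> B" using C1c_bounded[OF C] by metis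
   define F where "F x = (\<integral>z. norm z powr (- ?a) *\<^sub>R G (x - z) \<partial>lborel)" for x
   have F: "fgrad s G y = ?cr *\<^sub>R F y" for y using False by (simp only: fgrad_def riesz_grad_def F_def if_False)
   have [measurable]: "F \<in> borel_measurable borel"
   proof -
    have "fgrad s G \<in> borel_measurable borel" by (rule borel_measurable_fgrad) measurable
    moreover have "F = (\<lambda>y. (1 / ?cr) *\<^sub>R fgrad s G y)" using cr by (simp add: F)
    ultimately show ?thesis by simp
   qed
   have iF: "integrable lborel (\<lambda>z. norm z powr (- ?a) *\<^sub>R G (y - z))" for y
    by (rule integrable_powr_convolution[of ?a G B R]) (use a B C in \<open>auto simp: C1c_def\<close>)
   define f where "f = (\<lambda>(z, w). riesz_diff ?a z w * norm w powr (s - ?d - 1) * (w \<bullet> G (x - z)))"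
   have fm[measurable]: "f \<in> borel_measurable (lborel \<Otimes>\<^sub>M lborel)" unfolding f_def by measurable
   have fle: "\<bar>f (z, w)\<bar> \<le> norm (G (x - z)) * (norm w powr (s - ?d) * \<bar>riesz_diff ?a z w\<bar>)" for z w
   proof -
    have "\<bar>f (z, w)\<bar> = \<bar>((riesz_diff ?a z w * norm w powr (s - ?d - 1)) *\<^sub>R w) \<bullet> G (x - z)\<bar>" by (simp add: f_def)
    also have "\<dots> \<le> norm ((riesz_diff ?a z w * norm w powr (s - ?d - 1)) *\<^sub>R w) * norm (G (x - z))"
     by (rule Cauchy_Schwarz_ineq2)
    finally show ?thesis unfolding norm_riesz_vec_integrand by (simp only: mult.commute)
   qed
   \<comment> \<open>Integrating the absolute value over w first leaves at most |G(x - z)| |z|^(1-d)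
     times the finite mass of a unit vector; the exponent d - 1 is locally integrable, and
     \<open>G\<close> is bounded with bounded support.\<close>
   have fint: "integrable (lborel \<Otimes>\<^sub>M lborel) f"
   proof -
    have "(\<integral>\<^sup>+z. \<integral>\<^sup>+w. ennreal \<bar>f (z, w)\<bar> \<partial>lborel \<partial>lborel)
     \<le> (\<integral>\<^sup>+z. ennreal (norm (G (x - z))) * riesz_mass s z \<partial>lborel)"
    proof (rule nn_integral_mono)
     fix z
     have "(\<integral>\<^sup>+w. ennreal \<bar>f (z, w)\<bar> \<partial>lborel) \<le> (\<integral>\<^sup>+w. ennreal (norm (G (x - z))) * ennreal (norm w powr (s - ?d) * \<bar>riesz_diff ?a z w\<bar>) \<partial>lborel)"
      by (intro nn_integral_mono) (simp only: ennreal_mult'[OF norm_ge_zero, symmetric] ennreal_leI fle)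
     also have "\<dots> = ennreal (norm (G (x - z))) * riesz_mass s z"
      unfolding riesz_mass_def by (rule nn_integral_cmult) measurable
     finally show "(\<integral>\<^sup>+w. ennreal \<bar>f (z, w)\<bar> \<partial>lborel) \<le> ennreal (norm (G (x - z))) * riesz_mass s z" .
    qed
    also have "\<dots> \<le> (\<integral>\<^sup>+z. riesz_mass s e * ennreal (norm (norm z powr (- (?d - 1)) *\<^sub>R G (x - z))) \<partial>lborel)"
    proof (rule nn_integral_mono)
     fix z
     show "ennreal (norm (G (x - z))) * riesz_mass s z \<le> riesz_mass s e * ennreal (norm (norm z powr (- (?d - 1)) *\<^sub>R G (x - z)))"
     proof (cases "z = 0")
      case True then show ?thesis by (simp add: riesz_mass_def riesz_diff_def)
     next
      case False
      have "riesz_mass s z = ennreal (norm z powr (- (?d - 1))) * riesz_mass s e"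
       using riesz_mass_eq[OF False e, of s] by simp
      then show ?thesis by (simp add: ennreal_mult' mult_ac)
     qed
    qed
    also have "\<dots> = riesz_mass s e * (\<integral>\<^sup>+z. ennreal (norm (norm z powr (- (?d - 1)) *\<^sub>R G (x - z))) \<partial>lborel)"
     by (rule nn_integral_cmult) measurable
    also have "\<dots> < \<infinity>"
    proof -
     have "?d \<ge> 1" by (simp add: Suc_leI)
     then have "integrable lborel (\<lambda>z. norm z powr (- (?d - 1)) *\<^sub>R G (x - z))"
      by (intro integrable_powr_convolution[of "?d - 1" G B R]) (use B C in \<open>auto simp: C1c_def\<close>)
     then show ?thesis using riesz_mass_finite[OF s1 e]
      unfolding integrable_iff_bounded by (auto simp: ennreal_mult_less_top)
    qed
    finally show ?thesis by (simp add: integrable_iff_bounded lborel.nn_integral_fst[symmetric])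
   qed
   have "c * c1 * \<phi> x = c * (\<integral>z. norm z powr (- ?d) * (G (x - z) \<bullet> z) \<partial>lborel)" by (simp add: rep[OF C])
   also have "\<dots> = (\<integral>z. c * (norm z powr (- ?d) * (G (x - z) \<bullet> z)) \<partial>lborel)" by (rule integral_mult_right_zero[symmetric])
   also have "\<dots> = (\<integral>z. riesz_vec s z \<bullet> G (x - z) \<partial>lborel)"
    by (intro Bochner_Integration.integral_cong) (simp_all add: c(2) inner_commute)
   also have "\<dots> = (\<integral>z. (\<integral>w. f (z, w) \<partial>lborel) \<partial>lborel)"
   proof (rule Bochner_Integration.integral_cong)
    fix z
    show "riesz_vec s z \<bullet> G (x - z) = (\<integral>w. f (z, w) \<partial>lborel)"
     unfolding riesz_vec_def
     by (subst integral_inner_left[OF integrable_riesz_vec[OF s1], symmetric]) (simp add: f_def)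
   qed simp
   also have "\<dots> = (\<integral>w. (\<integral>z. f (z, w) \<partial>lborel) \<partial>lborel)"
    using lborel_pair.Fubini_integral[of "\<lambda>z w. f (z, w)"] fint by simp
   \<comment> \<open>Now z is integrated for fixed w: the two shifted kernels against G(x - z) give
     the potential of \<open>G\<close> at x - w and at x + w.\<close>
   also have "\<dots> = (\<integral>w. norm w powr (s - ?d - 1) * (w \<bullet> (F (x - w) - F (x + w))) \<partial>lborel)"
   proof (rule Bochner_Integration.integral_cong)
    fix w :: 'a
    have tr: "integrable lborel (\<lambda>z. norm (z - w) powr (- ?a) *\<^sub>R G (x - z))"
     "(\<integral>z. norm (z - w) powr (- ?a) *\<^sub>R G (x - z) \<partial>lborel) = F (x - w)" for w
    proof -
     have i: "integrable lborel (\<lambda>z. norm ((x - z) - w) powr (- ?a) *\<^sub>R G z)"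
      using integrable_lborel_reflect[OF iF[of "x - w"], of "x - w"] by (simp add: algebra_simps)
     show i2: "integrable lborel (\<lambda>z. norm (z - w) powr (- ?a) *\<^sub>R G (x - z))"
      using integrable_lborel_reflect[OF i, of x] by simp
     show "(\<integral>z. norm (z - w) powr (- ?a) *\<^sub>R G (x - z) \<partial>lborel) = F (x - w)"
      by (subst integral_lborel_affine[of _ 1 w]) (auto simp: F_def algebra_simps)
    qed
    have xw: "x - (- w) = x + w" by simp
    have fz: "f (z, w) = norm w powr (s - ?d - 1) * (w \<bullet> (norm (z - w) powr (- ?a) *\<^sub>R G (x - z) - norm (z - (- w)) powr (- ?a) *\<^sub>R G (x - z)))" for z
     by (simp add: f_def riesz_diff_def inner_diff_right left_diff_distrib right_diff_distrib mult_ac)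
    show "(\<integral>z. f (z, w) \<partial>lborel) = norm w powr (s - ?d - 1) * (w \<bullet> (F (x - w) - F (x + w)))"
     unfolding fz
     using tr(1)[of w] tr(1)[of "- w"] tr(2)[of w] tr(2)[of "- w"]
     by (simp del: minus_diff_eq diff_minus_eq_add add: integral_inner_right xw)
   qed simp
   finally have eq: "c * c1 * \<phi> x = (\<integral>w. norm w powr (s - ?d - 1) * (w \<bullet> (F (x - w) - F (x + w))) \<partial>lborel)" .
   let ?J = "\<integral>\<^sup>+y. ennreal (norm (x - y) powr (- (?d - s))) * ennreal (norm (fgrad s G y)) \<partial>lborel"
   let ?Z = "\<integral>\<^sup>+w. ennreal (norm w powr (- (?d - s))) * ennreal (norm (F (x - w))) \<partial>lborel"
   have "ennreal (c * c1 * \<bar>\<phi> x\<bar>) = ennreal (norm (\<integral>w. norm w powr (s - ?d - 1) * (w \<bullet> (F (x - w) - F (x + w))) \<partial>lborel))"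
    using c(1) c1 by (simp add: eq[symmetric] abs_mult)
   also have "\<dots> \<le> (\<integral>\<^sup>+w. ennreal (norm (norm w powr (s - ?d - 1) * (w \<bullet> (F (x - w) - F (x + w))))) \<partial>lborel)"
   proof (cases "integrable lborel (\<lambda>w. norm w powr (s - ?d - 1) * (w \<bullet> (F (x - w) - F (x + w))))")
    case True then show ?thesis by (rule integral_norm_bound_ennreal)
   next
    case False then show ?thesis by (simp add: not_integrable_integral_eq)
   qed
   also have "\<dots> \<le> (\<integral>\<^sup>+w. ennreal (norm w powr (- (?d - s))) * ennreal (norm (F (x - w))) + ennreal (norm w powr (- (?d - s))) * ennreal (norm (F (x + w))) \<partial>lborel)"
   proof (rule nn_integral_mono)
    fix w :: 'a
    have "\<bar>w \<bullet> (F (x - w) - F (x + w))\<bar> \<le> norm w * (norm (F (x - w)) + norm (F (x + w)))"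
     by (intro order_trans[OF Cauchy_Schwarz_ineq2] mult_left_mono norm_triangle_ineq4) simp
    then have "norm (norm w powr (s - ?d - 1) * (w \<bullet> (F (x - w) - F (x + w)))) \<le> norm w powr (s - ?d - 1) * (norm w * (norm (F (x - w)) + norm (F (x + w))))"
     by (simp add: abs_mult mult_left_mono)
    also have "\<dots> = norm w powr (- (?d - s)) * norm (F (x - w)) + norm w powr (- (?d - s)) * norm (F (x + w))"
    proof (cases "w = 0")
     case False
     then have "norm w powr (s - ?d - 1) * norm w = norm w powr (- (?d - s))"
      by (simp add: powr_diff)
     then show ?thesis by (metis mult.assoc distrib_left)
    qed simp
    finally show "ennreal (norm (norm w powr (s - ?d - 1) * (w \<bullet> (F (x - w) - F (x + w))))) \<le> ennreal (norm w powr (- (?d - s))) * ennreal (norm (F (x - w))) + ennreal (norm w powr (- (?d - s))) * ennreal (norm (F (x + w)))"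
     by (simp add: ennreal_mult'[symmetric] ennreal_plus[symmetric] ennreal_leI del: ennreal_plus)
   qed
   also have "\<dots> = ?Z + (\<integral>\<^sup>+w. ennreal (norm w powr (- (?d - s))) * ennreal (norm (F (x + w))) \<partial>lborel)"
    by (rule nn_integral_add) measurable
   also have "(\<integral>\<^sup>+w. ennreal (norm w powr (- (?d - s))) * ennreal (norm (F (x + w))) \<partial>lborel) = ?Z"
    using nn_integral_lborel_reflect[of "\<lambda>w. ennreal (norm w powr (- (?d - s))) * ennreal (norm (F (x + w)))" 0] by simp
   finally have le: "ennreal (c * c1 * \<bar>\<phi> x\<bar>) \<le> ?Z + ?Z" .
   have "?Z = (\<integral>\<^sup>+w. ennreal (norm (x - (x - w)) powr (- (?d - s))) * ennreal (norm (F (x - w))) \<partial>lborel)" by simp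
   also have "\<dots> = (\<integral>\<^sup>+y. ennreal (norm (x - y) powr (- (?d - s))) * ennreal (norm (F y)) \<partial>lborel)"
    by (rule nn_integral_lborel_reflect[of "\<lambda>y. ennreal (norm (x - y) powr (- (?d - s))) * ennreal (norm (F y))"]) measurable
   also have "\<dots> = (\<integral>\<^sup>+y. ennreal (1 / ?cr) * (ennreal (norm (x - y) powr (- (?d - s))) * ennreal (norm (fgrad s G y))) \<partial>lborel)"
   proof (rule nn_integral_cong)
    fix y
    have "norm (F y) = (1 / ?cr) * norm (fgrad s G y)" using cr by (simp add: F)
    then have "ennreal (norm (F y)) = ennreal (1 / ?cr) * ennreal (norm (fgrad s G y))"
     using cr by (simp only: ennreal_mult'[symmetric] zero_le_divide_1_iff less_imp_le)
    then show "ennreal (norm (x - y) powr (- (?d - s))) * ennreal (norm (F y)) = ennreal (1 / ?cr) * (ennreal (norm (x - y) powr (- (?d - s))) * ennreal (norm (fgrad s G y)))"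
     by (simp only: mult_ac)
   qed
   also have "\<dots> = ennreal (1 / ?cr) * ?J"
   proof (rule nn_integral_cmult)
    have [measurable]: "fgrad s G \<in> borel_measurable borel" by (rule borel_measurable_fgrad) measurable
    show "(\<lambda>y. ennreal (norm (x - y) powr (- (?d - s))) * ennreal (norm (fgrad s G y))) \<in> borel_measurable lborel" by measurable
   qed
   finally have "ennreal (c * c1 * \<bar>\<phi> x\<bar>) \<le> ennreal (1 / ?cr) * ?J + ennreal (1 / ?cr) * ?J"
    using le by (simp only:)
   then have "ennreal (1 / (c * c1)) * ennreal (c * c1 * \<bar>\<phi> x\<bar>) \<le> ennreal (1 / (c * c1)) * (ennreal (1 / ?cr) * ?J + ennreal (1 / ?cr) * ?J)"
    by (rule mult_left_mono) simp
   also have "\<dots> = (ennreal (1 / (c * c1)) * (ennreal (1 / ?cr) + ennreal (1 / ?cr))) * ?J"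
    by (simp only: distrib_left distrib_right mult.assoc)
   also have "ennreal (1 / (c * c1)) * (ennreal (1 / ?cr) + ennreal (1 / ?cr)) = ennreal K"
    using c(1) c1 cr by (simp add: K_def ennreal_plus[symmetric] ennreal_mult'[symmetric] del: ennreal_plus)
   also have "ennreal (1 / (c * c1)) * ennreal (c * c1 * \<bar>\<phi> x\<bar>) = ennreal \<bar>\<phi> x\<bar>"
    using c(1) c1 by (subst ennreal_mult'[symmetric]) simp_all
   finally show ?thesis .
  qed
  then show ?thesis using K by (intro exI[of _ K]) blast
 qed
qed

lemma C1c_abs_nn_integral:
 fixes \<phi> :: "'a::euclidean_space \<Rightarrow> real"
 assumes C: "C1c R \<phi> G"
 shows "ennreal (\<integral>x. \<bar>\<phi> x\<bar> \<partial>lborel) = (\<integral>\<^sup>+x. indicator (cball 0 R) x * ennreal \<bar>\<phi> x\<bar> \<partial>lborel)"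
proof -
 have "ennreal (\<integral>x. \<bar>\<phi> x\<bar> \<partial>lborel) = (\<integral>\<^sup>+x. ennreal \<bar>\<phi> x\<bar> \<partial>lborel)"
  using C1c_integrable[OF C] by (intro nn_integral_eq_integral[symmetric]) auto
 also have "\<dots> = (\<integral>\<^sup>+x. indicator (cball 0 R) x * ennreal \<bar>\<phi> x\<bar> \<partial>lborel)"
  using C by (intro nn_integral_cong) (auto simp: C1c_def split: split_indicator)
 finally show ?thesis .
qed

text \<open>The Riesz potential of order s of |F| restricted to a ball. On the ball, a set of finite
  measure, exponents below p become available for |F|.\<close>

definition near_potential :: "real \<Rightarrow> real \<Rightarrow> ('a::euclidean_space \<Rightarrow> 'a) \<Rightarrow> 'a \<Rightarrow> ennreal" where
 "near_potential s P F x = (\<integral>\<^sup>+y. ennreal (norm (x - y) powr (- (real DIM('a) - s))) * ennreal (indicator (cball 0 P) y * norm (F y)) \<partial>lborel)"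

lemma near_potential_measurable[measurable]:
 assumes [measurable]: "F \<in> borel_measurable borel"
 shows "near_potential s P F \<in> borel_measurable borel"
proof -
 have "(\<lambda>x. \<integral>\<^sup>+y. ennreal (norm (x - y) powr (- (real DIM('a) - s))) * ennreal (indicator (cball 0 P) y * norm (F y)) \<partial>lborel) \<in> borel_measurable (lborel :: 'a measure)"
  by measurable
 then show ?thesis by (simp add: near_potential_def[abs_def])
qed

text \<open>Tonelli, with the kernel integrated over a ball uniformly in its centre. In this way the
  integral of a function dominated by the potential is bounded by the mass of \<open>F\<close> in
  the ball of radius \<open>P\<close>.\<close>

lemma integral_near_potential_le:
 fixes F :: "'a::euclidean_space \<Rightarrow> 'a"
 assumes [measurable]: "F \<in> borel_measurable borel"
  and Q: "\<And>x::'a. (\<integral>\<^sup>+z. indicator (cball x R) z * ennreal (norm z powr (- (real DIM('a) - s))) \<partial>lborel) \<le> ennreal Q"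
 shows "(\<integral>\<^sup>+x. indicator (cball 0 R) x * near_potential s P F x \<partial>lborel)
  \<le> ennreal Q * (\<integral>\<^sup>+y. ennreal (indicator (cball 0 P) y * norm (F y)) \<partial>lborel)"
proof -
 let ?k = "\<lambda>z::'a. ennreal (norm z powr (- (real DIM('a) - s)))"
 let ?g = "\<lambda>y. ennreal (indicator (cball 0 P) y * norm (F y))"
 have "(\<integral>\<^sup>+x. indicator (cball 0 R) x * near_potential s P F x \<partial>lborel)
   = (\<integral>\<^sup>+x. (\<integral>\<^sup>+y. indicator (cball 0 R) x * (?k (x - y) * ?g y) \<partial>lborel) \<partial>lborel)"
  unfolding near_potential_def by (intro nn_integral_cong nn_integral_cmult[symmetric]) measurable
 also have "\<dots> = (\<integral>\<^sup>+y. (\<integral>\<^sup>+x. indicator (cball 0 R) x * (?k (x - y) * ?g y) \<partial>lborel) \<partial>lborel)"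
  by (rule lborel_pair.Fubini') measurable
 also have "\<dots> \<le> (\<integral>\<^sup>+y. ennreal Q * ?g y \<partial>lborel)"
 proof (rule nn_integral_mono)
  fix y
  have "(\<integral>\<^sup>+x. indicator (cball 0 R) x * (?k (x - y) * ?g y) \<partial>lborel) = (\<integral>\<^sup>+x. indicator (cball 0 R) x * ?k (x - y) \<partial>lborel) * ?g y"
   by (subst nn_integral_multc[symmetric]) (measurable, simp only: mult.assoc)
  also have "(\<integral>\<^sup>+x. indicator (cball 0 R) x * ?k (x - y) \<partial>lborel) = (\<integral>\<^sup>+z. indicator (cball 0 R) (y + z) * ?k (y + z - y) \<partial>lborel)"
   by (rule nn_integral_lborel_translate[symmetric]) measurable
  also have "\<dots> = (\<integral>\<^sup>+z. indicator (cball (- y) R) z * ?k z \<partial>lborel)"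
  proof -
   have "indicator (cball 0 R) (y + z) = (indicator (cball (- y) R) z :: ennreal)" for z
    using norm_minus_cancel[of "y + z"] by (simp add: indicator_def dist_norm)
   then show ?thesis by simp
  qed
  also have "\<dots> * ?g y \<le> ennreal Q * ?g y" by (intro mult_right_mono Q) simp
  finally show "(\<integral>\<^sup>+x. indicator (cball 0 R) x * (?k (x - y) * ?g y) \<partial>lborel) \<le> ennreal Q * ?g y" .
 qed
 also have "\<dots> = ennreal Q * (\<integral>\<^sup>+y. ?g y \<partial>lborel)" by (rule nn_integral_cmult) measurable
 finally show ?thesis .
qed

text \<open>The part of the potential away from the support is absorbed: it is at most a small multiple of the
 \<open>L\<^sup>1\<close> norm of the function, by the decay of its fractional gradient.\<close>

lemma ex_local_pointwise_bound:
 assumes s: "0 < s" "s \<le> 1" and R: "R > 0"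
 shows "\<exists>C P. C \<ge> 0 \<and> P > 0 \<and> (\<forall>\<phi> G. C1c R \<phi> G \<longrightarrow> (\<forall>x::'a::euclidean_space. norm x \<le> R \<longrightarrow>
   ennreal \<bar>\<phi> x\<bar> \<le> ennreal C * near_potential s P (fgrad s G) x))"
proof -
 let ?d = "real DIM('a)"
 have d1: "?d \<ge> 1" by (simp add: Suc_leI)
 with s have sd: "s \<le> ?d" by linarith
 obtain C0 where C0: "C0 \<ge> 0" "\<And>R \<phi> G x. C1c R \<phi> G \<Longrightarrow>
   ennreal \<bar>\<phi> x\<bar> \<le> ennreal C0 * (\<integral>\<^sup>+y. ennreal (norm (x - y) powr (- (?d - s))) * ennreal (norm (fgrad s G (y::'a))) \<partial>lborel)"
  using ex_pointwise_bound[OF s, where 'a='a] by blast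
 obtain C1 where C1: "C1 \<ge> 0" "\<And>\<phi> G y. C1c R \<phi> G \<Longrightarrow> 2 * R \<le> norm y \<Longrightarrow>
   norm (fgrad s G (y::'a)) \<le> C1 * (\<integral>x. \<bar>\<phi> x\<bar> \<partial>lborel) * norm y powr (- (?d + s))"
  using ex_fgrad_decay[OF s R, where 'a='a] by blast
 define C2 where "C2 = (?d + s) * unit_ball_vol ?d / (?d + s - ?d)"
 have C2: "C2 \<ge> 0" using s by (simp add: C2_def)
 obtain Q where Q: "Q \<ge> 0" "\<And>x::'a. (\<integral>\<^sup>+z. indicator (cball x R) z * ennreal (norm z powr (- (?d - s))) \<partial>lborel) \<le> ennreal Q"
  using ex_nn_integral_norm_powr_cball_bound[of "?d - s" R, where 'a='a] s d1 by auto
 define V where "V = unit_ball_vol ?d * R powr ?d"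
 have V: "V \<ge> 0" "emeasure lborel (cball (0::'a) R) = ennreal V"
  using R by (auto simp: V_def emeasure_cball_le)
 define C3 where "C3 = 2 powr (?d - s) * C1 * C2"
 have C3: "C3 \<ge> 0" using C1 C2 by (simp add: C3_def)
 \<comment> \<open>Beyond 2R the decay estimate holds; the second entry makes C0 C3 V P^(-d) at most
   1/2, so that the far part takes up at most half of the integral of |\<phi>|.\<close>
 define P where "P = max (2 * R) (2 * C0 * C3 * V + 1)"
 have P: "P \<ge> 2 * R" "P \<ge> 1" "P \<ge> 2 * C0 * C3 * V"
 proof -
  have "2 * C0 * C3 * V \<ge> 0" using C0(1) C3 V(1) by simp
  then show "P \<ge> 2 * R" "P \<ge> 1" "P \<ge> 2 * C0 * C3 * V" unfolding P_def by linarith+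
 qed
 have Pd: "C0 * C3 * V * P powr (- ?d) \<le> 1 / 2"
 proof -
  have "P powr 1 \<le> P powr ?d" using P d1 by (intro powr_mono) auto
  then have "2 * C0 * C3 * V \<le> P powr ?d" using P by simp
  moreover have "P powr ?d > 0" using P(2) by simp
  ultimately show ?thesis by (simp add: powr_minus field_simps)
 qed
 define K where "K = C0 + C0 * C3 * P powr (- ?d) * (2 * C0 * Q) * (R + P) powr (?d - s)"
 have K: "K \<ge> 0" using C0 C3 Q by (simp add: K_def)
 have "ennreal \<bar>\<phi> x\<bar> \<le> ennreal K * near_potential s P (fgrad s G) x"
  if C: "C1c R \<phi> G" and x: "norm x \<le> R" for \<phi> G and x :: 'a
 proof -
  let ?F = "fgrad s G"
  have [measurable]: "\<phi> \<in> borel_measurable borel" "G \<in> borel_measurable borel" using C1c_borel[OF C] .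
  have Fm[measurable]: "?F \<in> borel_measurable borel" by (rule borel_measurable_fgrad) measurable
  obtain B where B: "B \<ge> 0" "\<And>x. norm (?F x) \<le> B" using fgrad_bounded[OF C s] by blast
  define I where "I = (\<integral>x. \<bar>\<phi> x\<bar> \<partial>lborel)"
  have I0: "I \<ge> 0" by (simp add: I_def)
  define M where "M = (\<integral>\<^sup>+y. ennreal (indicator (cball 0 P) y * norm (?F y)) \<partial>lborel)"
  let ?N = "near_potential s P ?F"
  \<comment> \<open>Cuts the potential at radius \<open>P\<close>: the far part is bounded by the
    decay of the fractional gradient, hence by the integral \<open>I\<close> of |\<phi>|.\<close>
  have 1: "ennreal \<bar>\<phi> x\<bar> \<le> ennreal C0 * ?N x + ennreal (C0 * C3 * P powr (- ?d) * I)" if x: "norm x \<le> R" for x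
  proof -
   have "(\<integral>\<^sup>+y. ennreal (norm (x - y) powr (- (?d - s))) * ennreal (norm (?F y)) \<partial>lborel)
    \<le> (\<integral>\<^sup>+y. ennreal (norm (x - y) powr (- (?d - s))) * ennreal (indicator (cball 0 P) y * norm (?F y))
      + ennreal ((P / 2) powr (- (?d - s)) * (C1 * I)) * (indicator {y. P \<le> norm y} y * ennreal (norm y powr (- (?d + s)))) \<partial>lborel)"
   proof (rule nn_integral_mono)
    fix y :: 'a
    show "ennreal (norm (x - y) powr (- (?d - s))) * ennreal (norm (?F y)) \<le> ennreal (norm (x - y) powr (- (?d - s))) * ennreal (indicator (cball 0 P) y * norm (?F y))
      + ennreal ((P / 2) powr (- (?d - s)) * (C1 * I)) * (indicator {y. P \<le> norm y} y * ennreal (norm y powr (- (?d + s))))"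
    proof (cases "norm y \<le> P")
     case True
     then show ?thesis by (intro add_increasing2 zero_le) simp
    next
     case False
     have "norm (x - y) \<ge> P / 2" using False x P(1) norm_triangle_ineq2[of y x] by (simp add: norm_minus_commute)
     then have k: "norm (x - y) powr (- (?d - s)) \<le> (P / 2) powr (- (?d - s))"
      using P(2) sd by (intro powr_mono2') auto
     have F: "norm (?F y) \<le> C1 * I * norm y powr (- (?d + s))"
      unfolding I_def using False P(1) by (intro C1(2)[OF C]) linarith
     have "norm (x - y) powr (- (?d - s)) * norm (?F y) \<le> (P / 2) powr (- (?d - s)) * (C1 * I * norm y powr (- (?d + s)))"
      by (rule mult_mono[OF k F]) simp_all
     also have "\<dots> = ((P / 2) powr (- (?d - s)) * (C1 * I)) * norm y powr (- (?d + s))" by (simp only: mult.assoc)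
     finally have "ennreal (norm (x - y) powr (- (?d - s)) * norm (?F y)) \<le> ennreal (((P / 2) powr (- (?d - s)) * (C1 * I)) * norm y powr (- (?d + s)))"
      by (rule ennreal_leI)
     moreover have "ennreal (norm (x - y) powr (- (?d - s)) * norm (?F y)) = ennreal (norm (x - y) powr (- (?d - s))) * ennreal (norm (?F y))"
      by (rule ennreal_mult) simp_all
     moreover have "ennreal (((P / 2) powr (- (?d - s)) * (C1 * I)) * norm y powr (- (?d + s)))
      = ennreal ((P / 2) powr (- (?d - s)) * (C1 * I)) * ennreal (norm y powr (- (?d + s)))"
      using C1(1) I0 by (intro ennreal_mult) simp_all
     ultimately have "ennreal (norm (x - y) powr (- (?d - s))) * ennreal (norm (?F y)) \<le> ennreal ((P / 2) powr (- (?d - s)) * (C1 * I)) * (indicator {y. P \<le> norm y} y * ennreal (norm y powr (- (?d + s))))"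
      using False by simp
     then show ?thesis by (intro add_increasing zero_le)
    qed
   qed
   also have "\<dots> = ?N x + ennreal ((P / 2) powr (- (?d - s)) * (C1 * I)) * (\<integral>\<^sup>+y. indicator {y. P \<le> norm y} y * ennreal (norm (y::'a) powr (- (?d + s))) \<partial>lborel)"
   proof -
    have [measurable]: "{y::'a. P \<le> norm y} \<in> sets borel" by measurable
    show ?thesis unfolding near_potential_def by (subst nn_integral_add) (auto simp: nn_integral_cmult)
   qed
   also have "\<dots> \<le> ?N x + ennreal ((P / 2) powr (- (?d - s)) * (C1 * I)) * ennreal (C2 * P powr (?d - (?d + s)))"
    unfolding C2_def using s P(2) by (intro add_left_mono mult_left_mono nn_integral_norm_powr_outside) simp_all
   also have "ennreal ((P / 2) powr (- (?d - s)) * (C1 * I)) * ennreal (C2 * P powr (?d - (?d + s))) = ennreal (C3 * P powr (- ?d) * I)"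
   proof -
    have e: "P powr (- (?d - s)) * P powr (?d - (?d + s)) = P powr (- ?d)" by (simp add: powr_add[symmetric])
    have "(P / 2) powr (- (?d - s)) = P powr (- (?d - s)) * 2 powr (?d - s)"
     using P(2) by (intro powr_half_minus) simp
    then have "((P / 2) powr (- (?d - s)) * (C1 * I)) * (C2 * P powr (?d - (?d + s))) = C3 * (P powr (- (?d - s)) * P powr (?d - (?d + s))) * I"
     unfolding C3_def by (simp only: mult_ac)
    then have "((P / 2) powr (- (?d - s)) * (C1 * I)) * (C2 * P powr (?d - (?d + s))) = C3 * P powr (- ?d) * I" unfolding e .
    moreover have "ennreal ((P / 2) powr (- (?d - s)) * (C1 * I)) * ennreal (C2 * P powr (?d - (?d + s))) = ennreal (((P / 2) powr (- (?d - s)) * (C1 * I)) * (C2 * P powr (?d - (?d + s))))"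
     using C1(1) I0 C2 by (intro ennreal_mult[symmetric]) simp_all
    ultimately show ?thesis by (simp only:)
   qed
   finally have "ennreal C0 * (\<integral>\<^sup>+y. ennreal (norm (x - y) powr (- (?d - s))) * ennreal (norm (?F y)) \<partial>lborel) \<le> ennreal C0 * (?N x + ennreal (C3 * P powr (- ?d) * I))"
    by (rule mult_left_mono) simp
   also have "\<dots> = ennreal C0 * ?N x + ennreal (C0 * C3 * P powr (- ?d) * I)"
    using C0(1) C3 I0 by (simp add: distrib_left ennreal_mult'[symmetric] mult.assoc)
   finally show ?thesis by (rule order_trans[OF C0(2)[OF C, of x]])
  qed
  have Mfin: "M < \<infinity>"
  proof -
   have "M \<le> (\<integral>\<^sup>+y. ennreal B * indicator (cball (0::'a) P) y \<partial>lborel)"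
    unfolding M_def using B by (intro nn_integral_mono) (auto split: split_indicator intro!: ennreal_leI)
   also have "\<dots> < \<infinity>" using P(2) by (subst nn_integral_cmult_indicator) (auto simp: emeasure_cball ennreal_mult_less_top)
   finally show ?thesis .
  qed
  define m where "m = enn2real M"
  have m: "M = ennreal m" "m \<ge> 0" using Mfin by (auto simp: m_def)
  \<comment> \<open>Integrating the preceding bound over the support ball estimates \<open>I\<close>
    by the mass of the fractional gradient in the ball of radius \<open>P\<close>, plus a part of
    \<open>I\<close> that the choice of \<open>P\<close> makes at most half.\<close>
  have "ennreal I = (\<integral>\<^sup>+x. indicator (cball 0 R) x * ennreal \<bar>\<phi> x\<bar> \<partial>lborel)"
   unfolding I_def by (rule C1c_abs_nn_integral[OF C])
  also have "\<dots> \<le> (\<integral>\<^sup>+x. ennreal C0 * (indicator (cball 0 R) x * ?N x) + ennreal (C0 * C3 * P powr (- ?d) * I) * indicator (cball 0 R) x \<partial>lborel)"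
   using 1 by (intro nn_integral_mono) (auto split: split_indicator)
  also have "\<dots> = ennreal C0 * (\<integral>\<^sup>+x. indicator (cball 0 R) x * ?N x \<partial>lborel) + ennreal (C0 * C3 * P powr (- ?d) * I) * ennreal V"
   by (subst nn_integral_add) (auto simp: nn_integral_cmult nn_integral_cmult_indicator V(2))
  also have "\<dots> \<le> ennreal C0 * (ennreal Q * M) + ennreal (C0 * C3 * P powr (- ?d) * I) * ennreal V"
   unfolding M_def by (intro add_right_mono mult_left_mono integral_near_potential_le Q Fm) simp_all
  also have "\<dots> = ennreal (C0 * Q * m + C0 * C3 * V * P powr (- ?d) * I)"
   using C0(1) Q(1) C3 V(1) I0 m by (simp add: ennreal_mult'[symmetric] ennreal_plus[symmetric] mult_ac del: ennreal_plus)
  finally have "I \<le> C0 * Q * m + C0 * C3 * V * P powr (- ?d) * I"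
   using C0(1) Q(1) C3 V(1) I0 m by (subst (asm) ennreal_le_iff) auto
  also have "\<dots> \<le> C0 * Q * m + 1 / 2 * I" using mult_right_mono[OF Pd I0] by simp
  finally have Im: "I \<le> 2 * C0 * Q * m" by simp
  \<comment> \<open>Returns from the mass to the potential at x: for x in the support ball the
    kernel is at least (R + P)^(s-d) on the ball of radius \<open>P\<close>. The point y = x is
    removed, where the kernel is 0 by convention.\<close>
  have mN: "ennreal m \<le> ennreal ((R + P) powr (?d - s)) * ?N x"
  proof -
   have "M \<le> (\<integral>\<^sup>+y. ennreal ((R + P) powr (?d - s)) * (ennreal (norm (x - y) powr (- (?d - s))) * ennreal (indicator (cball 0 P) y * norm (?F y))) \<partial>lborel)"
    unfolding M_def
   proof (rule nn_integral_mono_AE)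
    show "AE y in lborel. ennreal (indicator (cball 0 P) y * norm (?F y)) \<le> ennreal ((R + P) powr (?d - s)) * (ennreal (norm (x - y) powr (- (?d - s))) * ennreal (indicator (cball 0 P) y * norm (?F y)))"
     using AE_lborel_singleton[of x]
    proof eventually_elim
     case (elim y)
     show ?case
     proof (cases "norm y \<le> P")
      case True
      have "norm (x - y) \<le> R + P" using norm_triangle_ineq4[of x y] x True by linarith
      then have "(R + P) powr (- (?d - s)) \<le> norm (x - y) powr (- (?d - s))"
       using elim sd by (intro powr_mono2') auto
      then have "(R + P) powr (?d - s) * (R + P) powr (- (?d - s)) \<le> (R + P) powr (?d - s) * norm (x - y) powr (- (?d - s))"
       by (rule mult_left_mono) simp
      moreover have "(R + P) powr (?d - s) * (R + P) powr (- (?d - s)) = 1"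
       using R P(2) by (simp add: powr_add[symmetric])
      ultimately have "1 \<le> (R + P) powr (?d - s) * norm (x - y) powr (- (?d - s))" by simp
      then have "ennreal 1 \<le> ennreal ((R + P) powr (?d - s) * norm (x - y) powr (- (?d - s)))" by (rule ennreal_leI)
      then have "ennreal 1 * ennreal (indicator (cball 0 P) y * norm (?F y)) \<le> ennreal ((R + P) powr (?d - s) * norm (x - y) powr (- (?d - s))) * ennreal (indicator (cball 0 P) y * norm (?F y))"
       by (rule mult_right_mono) simp
      then show ?thesis by (simp only: ennreal_mult[OF powr_ge_zero powr_ge_zero] mult.assoc ennreal_1 mult_1)
     qed simp
    qed
   qed
   also have "\<dots> = ennreal ((R + P) powr (?d - s)) * ?N x"
    unfolding near_potential_def by (rule nn_integral_cmult) measurable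
   finally show ?thesis by (simp only: m(1)[symmetric])
  qed
  have "ennreal (C0 * C3 * P powr (- ?d) * I) \<le> ennreal (C0 * C3 * P powr (- ?d) * (2 * C0 * Q) * m)"
   using mult_left_mono[OF Im, of "C0 * C3 * P powr (- ?d)"] C0(1) C3 by (intro ennreal_leI) (simp add: mult_ac)
  also have "\<dots> = ennreal (C0 * C3 * P powr (- ?d) * (2 * C0 * Q)) * ennreal m"
   using C0(1) C3 Q(1) m(2) by (intro ennreal_mult) simp_all
  also have "\<dots> \<le> ennreal (C0 * C3 * P powr (- ?d) * (2 * C0 * Q)) * (ennreal ((R + P) powr (?d - s)) * ?N x)"
   by (intro mult_left_mono mN) simp
  also have "\<dots> = ennreal (C0 * C3 * P powr (- ?d) * (2 * C0 * Q) * (R + P) powr (?d - s)) * ?N x"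
   using C0(1) C3 Q(1) by (subst ennreal_mult) (simp_all add: mult.assoc)
  finally have "ennreal \<bar>\<phi> x\<bar> \<le> ennreal C0 * ?N x + ennreal (C0 * C3 * P powr (- ?d) * (2 * C0 * Q) * (R + P) powr (?d - s)) * ?N x"
   using 1[OF x] by (meson add_left_mono order_trans)
  also have "\<dots> = ennreal K * ?N x"
   unfolding K_def using C0(1) C3 Q(1) by (subst ennreal_plus) (simp_all add: distrib_right)
  finally show ?thesis .
 qed
 then show ?thesis using K P(2) by (intro exI[of _ K] exI[of _ P]) auto
qed

subsection \<open>Sobolev and Poincare inequalities for the fractional gradient\<close>

text \<open>From t^a \<le> 1 + t^b with t = f/N: dividing by \<open>N\<close> first keeps the bound
  homogeneous, so that it acts as a norm inequality.\<close>

lemma nn_integral_powr_mono_bounded: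
 fixes f :: "'b \<Rightarrow> real"
 assumes [measurable]: "f \<in> borel_measurable M" "S \<in> sets M" and f0: "\<And>x. f x \<ge> 0"
  and ab: "0 < a" "a \<le> b" and V: "V \<ge> 0" "emeasure M S = ennreal V"
  and N: "N \<ge> 0" "(\<integral>\<^sup>+x. indicator S x * ennreal (f x powr b) \<partial>M) \<le> ennreal (N powr b)"
 shows "(\<integral>\<^sup>+x. indicator S x * ennreal (f x powr a) \<partial>M) \<le> ennreal ((V + 1) * N powr a)"
proof (cases "N = 0")
 case True
 then have "(\<integral>\<^sup>+x. indicator S x * ennreal (f x powr b) \<partial>M) = 0" using N ab by simp
 then have "AE x in M. indicator S x * ennreal (f x powr b) = 0" by (subst (asm) nn_integral_0_iff_AE) auto
 then have "AE x in M. indicator S x * ennreal (f x powr a) = 0"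
  by eventually_elim (use ab in \<open>auto simp: indicator_def\<close>)
 then have "(\<integral>\<^sup>+x. indicator S x * ennreal (f x powr a) \<partial>M) = 0" by (subst nn_integral_0_iff_AE) auto
 then show ?thesis by simp
next
 case False
 with N have N0: "N > 0" by simp
 have "(\<integral>\<^sup>+x. indicator S x * ennreal (f x powr a) \<partial>M)
  \<le> (\<integral>\<^sup>+x. ennreal (N powr a) * indicator S x + ennreal (N powr a / N powr b) * (indicator S x * ennreal (f x powr b)) \<partial>M)"
 proof (rule nn_integral_mono)
  fix x
  have "(f x / N) powr a \<le> 1 + (f x / N) powr b"
  proof (cases "f x / N \<le> 1")
   case True
   then have "(f x / N) powr a \<le> 1" using f0[of x] N0 ab by (intro powr_le1) auto
   then show ?thesis by (simp add: add_increasing2)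
  next
   case False
   then have "(f x / N) powr a \<le> (f x / N) powr b" using ab by (intro powr_mono) auto
   then show ?thesis by simp
  qed
  then have "f x powr a \<le> N powr a * (1 + f x powr b / N powr b)"
   using N0 f0[of x] by (simp add: powr_divide field_simps)
  then have "ennreal (f x powr a) \<le> ennreal (N powr a + N powr a / N powr b * f x powr b)"
   by (intro ennreal_leI) (simp add: distrib_left)
  also have "\<dots> = ennreal (N powr a) + ennreal (N powr a / N powr b) * ennreal (f x powr b)"
   by (subst ennreal_plus) (simp_all add: ennreal_mult'[symmetric])
  finally show "indicator S x * ennreal (f x powr a) \<le> ennreal (N powr a) * indicator S x + ennreal (N powr a / N powr b) * (indicator S x * ennreal (f x powr b))"
   by (cases "x \<in> S") simp_all
 qed
 also have "\<dots> = ennreal (N powr a) * ennreal V + ennreal (N powr a / N powr b) * (\<integral>\<^sup>+x. indicator S x * ennreal (f x powr b) \<partial>M)"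
  by (subst nn_integral_add) (auto simp: nn_integral_cmult nn_integral_cmult_indicator V(2))
 also have "\<dots> \<le> ennreal (N powr a) * ennreal V + ennreal (N powr a / N powr b) * ennreal (N powr b)"
  by (intro add_left_mono mult_left_mono N) simp
 also have "\<dots> = ennreal ((V + 1) * N powr a)"
  using V(1) N0 by (simp add: ennreal_mult'[symmetric] ennreal_plus[symmetric] algebra_simps del: ennreal_plus)
 finally show ?thesis .
qed

lemma maximal_bounded:
 fixes g :: "'a::euclidean_space \<Rightarrow> real"
 assumes "\<And>y. g y \<le> B" "B \<ge> 0"
 shows "maximal g x < \<infinity>"
proof -
 have "maximal g x \<le> ennreal (B * unit_ball_vol (real DIM('a)))"
  unfolding maximal_def
 proof (rule SUP_least)
  fix r :: real assume "r \<in> {r \<in> \<rat>. 0 < r}"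
  then have r: "r > 0" by simp
  have "ball_mass g x r \<le> (\<integral>\<^sup>+y. ennreal B * indicator (cball x r) y \<partial>lborel)"
   unfolding ball_mass_def using assms by (intro nn_integral_mono) (auto split: split_indicator intro!: ennreal_leI)
  also have "\<dots> = ennreal B * ennreal (unit_ball_vol (real DIM('a)) * r powr real DIM('a))"
   using r by (subst nn_integral_cmult_indicator) (auto simp: emeasure_cball_le)
  finally have "ball_mass g x r * ennreal (r powr (- real DIM('a))) \<le> ennreal B * ennreal (unit_ball_vol (real DIM('a)) * r powr real DIM('a)) * ennreal (r powr (- real DIM('a)))"
   by (rule mult_right_mono) simp
  also have "\<dots> = ennreal (B * unit_ball_vol (real DIM('a)))"
   using r assms(2) by (simp add: ennreal_mult'[symmetric] powr_minus mult.assoc)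
  finally show "ball_mass g x r * ennreal (r powr (- real DIM('a))) \<le> ennreal (B * unit_ball_vol (real DIM('a)))" .
 qed
 then show ?thesis by (rule le_less_trans) simp
qed

text \<open>\<open>N\<close> is any bound for the norm rather than the norm itself, which avoids
  taking roots of integrals and lets one bound serve a whole approximating sequence.\<close>

definition fgrad_le :: "real \<Rightarrow> real \<Rightarrow> ('a::euclidean_space \<Rightarrow> 'a) \<Rightarrow> real \<Rightarrow> bool" where
 "fgrad_le s p G N \<longleftrightarrow> N \<ge> 0 \<and> (\<integral>\<^sup>+x. ennreal (norm (fgrad s G x) powr p) \<partial>lborel) \<le> ennreal (N powr p)"

text \<open>The local pointwise bound followed by Hardy-Littlewood-Sobolev for an exponent p'
  possibly below p. The freedom in p' is what covers the critical case sp = d, where p itself is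
  excluded.\<close>

lemma ex_Sobolev:
 assumes s: "0 < s" "s \<le> 1" and R: "R > 0" and p: "1 < p'" "p' \<le> p" "s * p' < real DIM('a::euclidean_space)"
 defines "T \<equiv> real DIM('a) * p' / (real DIM('a) - s * p')"
 shows "\<exists>C\<ge>0. \<forall>(\<phi>::'a \<Rightarrow> real) G N. C1c R \<phi> G \<longrightarrow> fgrad_le s p G N \<longrightarrow>
   (\<integral>\<^sup>+x. ennreal (\<bar>\<phi> x\<bar> powr T) \<partial>lborel) \<le> ennreal (C * N powr T)"
proof -
 let ?d = "real DIM('a)"
 have T: "T > 0" using p s by (auto simp: T_def intro!: divide_pos_pos)
 obtain K P where K: "K \<ge> 0" "P > 0" and key: "\<And>\<phi> G x. C1c R \<phi> G \<Longrightarrow> norm (x::'a) \<le> R \<Longrightarrow>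
   ennreal \<bar>\<phi> x\<bar> \<le> ennreal K * near_potential s P (fgrad s G) x"
  using ex_local_pointwise_bound[OF s R, where 'a='a] by blast
 obtain H where H: "H \<ge> 0" "\<And>(g::'a \<Rightarrow> real) N. g \<in> borel_measurable borel \<Longrightarrow> (\<And>x. 0 \<le> g x) \<Longrightarrow> (\<And>x. maximal g x < \<infinity>) \<Longrightarrow>
   N \<ge> 0 \<Longrightarrow> (\<integral>\<^sup>+x. ennreal (g x powr p') \<partial>lborel) \<le> ennreal (N powr p') \<Longrightarrow>
   (\<integral>\<^sup>+x. ennreal (enn2real (\<integral>\<^sup>+y. ennreal (norm (x - y) powr (- (?d - s))) * ennreal (g y) \<partial>lborel) powr T) \<partial>lborel) \<le> ennreal (H * N powr T)"
  using Hardy_Littlewood_Sobolev[OF p(1) s(1) p(3)] unfolding T_def by blast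
 define V where "V = unit_ball_vol ?d * P powr ?d"
 have V: "V \<ge> 0" "emeasure lborel (cball (0::'a) P) = ennreal V" using K(2) by (auto simp: V_def emeasure_cball_le)
 define W where "W = (V + 1) powr (1 / p')"
 have W: "W \<ge> 0" "W powr p' = V + 1" using V(1) p(1) by (auto simp: W_def powr_powr)
 have "(\<integral>\<^sup>+x. ennreal (\<bar>\<phi> x\<bar> powr T) \<partial>lborel) \<le> ennreal (K powr T * H * W powr T * N powr T)"
  if C: "C1c R \<phi> G" and N: "fgrad_le s p G N" for \<phi> :: "'a \<Rightarrow> real" and G N
 proof -
  have [measurable]: "\<phi> \<in> borel_measurable borel" "G \<in> borel_measurable borel" using C1c_borel[OF C] .
  have [measurable]: "fgrad s G \<in> borel_measurable borel" by (rule borel_measurable_fgrad) measurable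
  obtain B where B: "B \<ge> 0" "\<And>x. norm (fgrad s G x) \<le> B" using fgrad_bounded[OF C s] by blast
  have N0: "N \<ge> 0" using N by (simp add: fgrad_le_def)
  define g where "g y = indicator (cball 0 P) y * norm (fgrad s G y)" for y
  have gm[measurable]: "g \<in> borel_measurable borel" unfolding g_def[abs_def] by measurable
  have g0: "g y \<ge> 0" for y by (simp add: g_def)
  have gfin: "maximal g x < \<infinity>" for x
   by (rule maximal_bounded[of g B]) (use B in \<open>auto simp: g_def split: split_indicator\<close>)
  have "(\<integral>\<^sup>+x. indicator (cball 0 P) x * ennreal (norm (fgrad s G x) powr p') \<partial>lborel) \<le> ennreal ((V + 1) * N powr p')"
  proof (rule nn_integral_powr_mono_bounded[where b=p])
   have "(\<integral>\<^sup>+x. indicator (cball 0 P) x * ennreal (norm (fgrad s G x) powr p) \<partial>lborel) \<le> (\<integral>\<^sup>+x. ennreal (norm (fgrad s G x) powr p) \<partial>lborel)"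
    by (intro nn_integral_mono) (auto split: split_indicator)
   also have "\<dots> \<le> ennreal (N powr p)" using N by (simp add: fgrad_le_def)
   finally show "(\<integral>\<^sup>+x. indicator (cball 0 P) x * ennreal (norm (fgrad s G x) powr p) \<partial>lborel) \<le> ennreal (N powr p)" .
  qed (use p V N0 in auto)
  moreover have "ennreal (g x powr p') = indicator (cball 0 P) x * ennreal (norm (fgrad s G x) powr p')" for x
   using p(1) by (auto simp: g_def split: split_indicator)
  ultimately have gp: "(\<integral>\<^sup>+x. ennreal (g x powr p') \<partial>lborel) \<le> ennreal ((W * N) powr p')"
   by (simp add: powr_mult W)
  let ?n = "near_potential s P (fgrad s G)"
  have nfin: "?n x < \<infinity>" for x
   using HLS_pointwise[OF gm g0 p(1) s(1) p(3) gfin[of x] _ gp] W N0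
   unfolding near_potential_def g_def by (auto intro: le_less_trans)
  have "(\<integral>\<^sup>+x. ennreal (\<bar>\<phi> x\<bar> powr T) \<partial>lborel) \<le> (\<integral>\<^sup>+x. ennreal (K powr T) * ennreal (enn2real (?n x) powr T) \<partial>lborel)"
  proof (rule nn_integral_mono)
   fix x
   show "ennreal (\<bar>\<phi> x\<bar> powr T) \<le> ennreal (K powr T) * ennreal (enn2real (?n x) powr T)"
   proof (cases "norm x \<le> R")
    case True
    have "ennreal \<bar>\<phi> x\<bar> \<le> ennreal K * ennreal (enn2real (?n x))"
     using key[OF C True] nfin[of x] by simp
    also have "\<dots> = ennreal (K * enn2real (?n x))" by (rule ennreal_mult[symmetric]) (simp_all add: K)
    finally have "\<bar>\<phi> x\<bar> \<le> K * enn2real (?n x)" using K(1) by simp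
    then have "\<bar>\<phi> x\<bar> powr T \<le> (K * enn2real (?n x)) powr T" using T by (intro powr_mono2) auto
    then have "ennreal (\<bar>\<phi> x\<bar> powr T) \<le> ennreal (K powr T * enn2real (?n x) powr T)" by (intro ennreal_leI) (simp add: powr_mult)
    then show ?thesis by (simp add: ennreal_mult)
   next
    case False
    then show ?thesis using C by (simp add: C1c_def)
   qed
  qed
  also have "\<dots> = ennreal (K powr T) * (\<integral>\<^sup>+x. ennreal (enn2real (?n x) powr T) \<partial>lborel)"
   by (rule nn_integral_cmult) measurable
  also have "\<dots> \<le> ennreal (K powr T) * ennreal (H * (W * N) powr T)"
  proof (rule mult_left_mono)
   show "(\<integral>\<^sup>+x. ennreal (enn2real (?n x) powr T) \<partial>lborel) \<le> ennreal (H * (W * N) powr T)"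
    using H(2)[OF gm g0 gfin _ gp] W(1) N0 unfolding near_potential_def g_def by simp
  qed simp
  also have "\<dots> = ennreal (K powr T * H * W powr T * N powr T)"
   using H(1) by (subst ennreal_mult[symmetric]) (simp_all add: powr_mult mult_ac)
  finally show ?thesis .
 qed
 then show ?thesis using H(1) by (intro exI[of _ "K powr T * H * W powr T"]) auto
qed

text \<open>For sp > d the kernel |z|^(-(d-s)) is locally in the conjugate space of L^p, as (d - s)
  p/(p - 1) < d; Hoelder in the local potential then bounds \<phi> uniformly.\<close>

lemma ex_Morrey:
 assumes s: "0 < s" "s \<le> 1" and R: "R > 0" and p: "1 < p" "real DIM('a::euclidean_space) < s * p"
 shows "\<exists>C\<ge>0. \<forall>(\<phi>::'a \<Rightarrow> real) G N. C1c R \<phi> G \<longrightarrow> fgrad_le s p G N \<longrightarrow> (\<forall>x. \<bar>\<phi> x\<bar> \<le> C * N)"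
proof -
 let ?d = "real DIM('a)"
 have "?d \<ge> 1" by (simp add: Suc_leI)
 with s have sd: "s \<le> ?d" by linarith
 define q where "q = p / (p - 1)"
 have q: "q > 1" "1 / q + 1 / p = 1" using p by (auto simp: q_def field_simps)
 obtain K P where K: "K \<ge> 0" "P > 0" and key: "\<And>\<phi> G x. C1c R \<phi> G \<Longrightarrow> norm (x::'a) \<le> R \<Longrightarrow>
   ennreal \<bar>\<phi> x\<bar> \<le> ennreal K * near_potential s P (fgrad s G) x"
  using ex_local_pointwise_bound[OF s R, where 'a='a] by blast
 let ?b = "(?d - s) * q"
 have b: "0 \<le> ?b" "?b < ?d" using s sd p by (auto simp: q_def field_simps)
 obtain Q where Q: "Q \<ge> 0" "\<And>x::'a. (\<integral>\<^sup>+z. indicator (cball x P) z * ennreal (norm z powr (- ?b)) \<partial>lborel) \<le> ennreal Q"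
  using ex_nn_integral_norm_powr_cball_bound[OF b, of P] by auto
 define W where "W = Q powr (1 / q)"
 have W: "W \<ge> 0" "W powr q = Q" using Q(1) q(1) by (auto simp: W_def powr_powr)
 have "\<bar>\<phi> x\<bar> \<le> K * W * N" if C: "C1c R \<phi> G" and N: "fgrad_le s p G N" for \<phi> :: "'a \<Rightarrow> real" and G N x
 proof (cases "norm x \<le> R")
  case True
  have N0: "N \<ge> 0" using N by (simp add: fgrad_le_def)
  have [measurable]: "\<phi> \<in> borel_measurable borel" "G \<in> borel_measurable borel" using C1c_borel[OF C] .
  have [measurable]: "fgrad s G \<in> borel_measurable borel" by (rule borel_measurable_fgrad) measurable
  have "near_potential s P (fgrad s G) x = (\<integral>\<^sup>+y. ennreal ((indicator (cball 0 P) y * norm (x - y) powr (- (?d - s))) * norm (fgrad s G y)) \<partial>lborel)"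
   unfolding near_potential_def by (intro nn_integral_cong) (auto simp: ennreal_mult split: split_indicator)
  also have "\<dots> \<le> ennreal (W * N)"
  proof (rule nn_integral_Holder[OF _ _ _ _ q(1) p(1) q(2)])
   have "(\<integral>\<^sup>+y. ennreal ((indicator (cball 0 P) y * norm (x - y) powr (- (?d - s))) powr q) \<partial>lborel)
    = (\<integral>\<^sup>+y. indicator (cball x P) (x - y) * ennreal (norm (x - y) powr (- ?b)) \<partial>lborel)"
   proof (rule nn_integral_cong)
    fix y
    have i: "indicator (cball x P) (x - y) = (indicator (cball 0 P) y :: ennreal)" by (simp add: indicator_def dist_norm)
    have e: "(a powr (- (?d - s))) powr q = a powr (- ?b)" for a by (simp only: powr_powr mult_minus_left)
    show "ennreal ((indicator (cball 0 P) y * norm (x - y) powr (- (?d - s))) powr q) = indicator (cball x P) (x - y) * ennreal (norm (x - y) powr (- ?b))"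
    proof (cases "y \<in> cball 0 P")
     case True
     then show ?thesis unfolding i by (simp only: indicator_simps mult_1 e)
    next
     case False
     then show ?thesis unfolding i by simp
    qed
   qed
   also have "\<dots> = (\<integral>\<^sup>+z. indicator (cball x P) z * ennreal (norm z powr (- ?b)) \<partial>lborel)"
    by (rule nn_integral_lborel_reflect) measurable
   also have "\<dots> \<le> ennreal (W powr q)" using Q(2)[of x] W by simp
   finally show "(\<integral>\<^sup>+y. ennreal ((indicator (cball 0 P) y * norm (x - y) powr (- (?d - s))) powr q) \<partial>lborel) \<le> ennreal (W powr q)" .
   show "(\<integral>\<^sup>+x. ennreal (norm (fgrad s G x) powr p) \<partial>lborel) \<le> ennreal (N powr p)" using N by (simp add: fgrad_le_def)
  qed (use W N0 in auto)
  finally have "ennreal K * near_potential s P (fgrad s G) x \<le> ennreal K * ennreal (W * N)" by (rule mult_left_mono) simp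
  also have "\<dots> = ennreal (K * (W * N))" using K W N0 by (intro ennreal_mult[symmetric]) auto
  finally have "ennreal \<bar>\<phi> x\<bar> \<le> ennreal (K * (W * N))" by (rule order_trans[OF key[OF C True]])
  then show ?thesis using K W N0 by (subst (asm) ennreal_le_iff) (auto simp: mult_ac)
 next
  case False
  then show ?thesis using C K W N by (simp add: C1c_def fgrad_le_def)
 qed
 then show ?thesis using K(1) W(1) by (intro exI[of _ "K * W"]) auto
qed

text \<open>Covers every exponent up to the Sobolev exponent, and for sp = d every finite one: below
  the exponent delivered by \<open>ex_Sobolev\<close>, the inclusion of Lebesgue spaces on the
  support ball takes over.\<close>

lemma ex_Lp_bound:
 assumes s: "0 < s" "s \<le> 1" and R: "R > 0" and p: "1 < p" and le: "s * p \<le> real DIM('a::euclidean_space)"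
  and T0: "0 < T0" "s * p < real DIM('a) \<Longrightarrow> T0 \<le> real DIM('a) * p / (real DIM('a) - s * p)"
 shows "\<exists>C\<ge>0. \<forall>(\<phi>::'a \<Rightarrow> real) G N. C1c R \<phi> G \<longrightarrow> fgrad_le s p G N \<longrightarrow>
   (\<integral>\<^sup>+x. ennreal (\<bar>\<phi> x\<bar> powr T0) \<partial>lborel) \<le> ennreal (C * N powr T0)"
proof -
 let ?d = "real DIM('a)"
 obtain p' where p': "1 < p'" "p' \<le> p" "s * p' < ?d" "T0 \<le> ?d * p' / (?d - s * p')"
 proof (cases "s * p < ?d")
  case True
  then show ?thesis using that[of p] p T0 by auto
 next
  case False
  then have eq: "s * p = ?d" using le by simp
  have "s * 1 < s * p" using s p by (intro mult_strict_left_mono) auto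
  then have sd: "s < ?d" using eq by linarith
  \<comment> \<open>In the critical case p' is found from the target exponent: T = d p'/(d - s p')
    is solved by p' = dT/(d + sT). Taking T at least 2d/(d - s) makes p' exceed 1.\<close>
  define T where "T = max T0 (2 * ?d / (?d - s))"
  have T: "T > 0" "T \<ge> T0" "T \<ge> 2 * ?d / (?d - s)" using T0 by (auto simp: T_def)
  define d where "d = ?d"
  have d: "d > 0" by (simp add: d_def)
  define D where "D = d + s * T"
  have D: "D > 0" unfolding D_def using s T d by (intro add_pos_pos mult_pos_pos) auto
  define p' where "p' = d * T / D"
  have "2 * d \<le> T * (d - s)" using T(3) sd by (simp add: d_def pos_divide_le_eq)
  then have "2 * d \<le> d * T - s * T" by (simp add: algebra_simps)
  then have "D < d * T" using d unfolding D_def by linarith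
  then have 1: "p' > 1" using D by (simp add: p'_def)
  have dsp: "d - s * p' = d * d / D"
  proof -
   have "d * D - s * (d * T) = d * d" by (simp add: D_def algebra_simps)
   then have "(d * D - s * (d * T)) / D = d * d / D" by simp
   then show ?thesis using D by (simp add: p'_def diff_divide_distrib)
  qed
  have "d * d / D > 0" using d D by simp
  then have 2: "s * p' < d" using dsp by linarith
  then have "s * p' < s * p" using eq by (simp add: d_def)
  then have 3: "p' \<le> p" using s by simp
  have "d * p' / (d - s * p') = T" unfolding dsp using D d by (simp add: p'_def)
  then show ?thesis using that[of p'] 1 2 3 T(2) by (simp add: d_def)
 qed
 define T where "T = ?d * p' / (?d - s * p')"
 obtain C where C: "C \<ge> 0" "\<And>(\<phi>::'a \<Rightarrow> real) G N. C1c R \<phi> G \<Longrightarrow> fgrad_le s p G N \<Longrightarrow>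
   (\<integral>\<^sup>+x. ennreal (\<bar>\<phi> x\<bar> powr T) \<partial>lborel) \<le> ennreal (C * N powr T)"
  using ex_Sobolev[OF s R p'(1-3)] unfolding T_def by blast
 have TT: "0 < T0" "T0 \<le> T" "T > 0" using T0 p' by (auto simp: T_def)
 define V where "V = unit_ball_vol ?d * R powr ?d"
 have V: "V \<ge> 0" "emeasure lborel (cball (0::'a) R) = ennreal V" using R by (auto simp: V_def emeasure_cball_le)
 define W where "W = C powr (1 / T)"
 have W: "W \<ge> 0" "W powr T = C" using C(1) TT by (auto simp: W_def powr_powr)
 have "(\<integral>\<^sup>+x. ennreal (\<bar>\<phi> x\<bar> powr T0) \<partial>lborel) \<le> ennreal ((V + 1) * W powr T0 * N powr T0)"
  if Cc: "C1c R \<phi> G" and N: "fgrad_le s p G N" for \<phi> :: "'a \<Rightarrow> real" and G N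
 proof -
  have [measurable]: "\<phi> \<in> borel_measurable borel" using C1c_borel[OF Cc] by simp
  have N0: "N \<ge> 0" using N by (simp add: fgrad_le_def)
  have ind: "ennreal (\<bar>\<phi> x\<bar> powr t) = indicator (cball 0 R) x * ennreal (\<bar>\<phi> x\<bar> powr t)" for x t
   using Cc by (auto simp: C1c_def split: split_indicator)
  have "(\<integral>\<^sup>+x. indicator (cball 0 R) x * ennreal (\<bar>\<phi> x\<bar> powr T0) \<partial>lborel) \<le> ennreal ((V + 1) * (W * N) powr T0)"
  proof (rule nn_integral_powr_mono_bounded[where b=T])
   show "(\<integral>\<^sup>+x. indicator (cball 0 R) x * ennreal (\<bar>\<phi> x\<bar> powr T) \<partial>lborel) \<le> ennreal ((W * N) powr T)"
    using C(2)[OF Cc N] unfolding ind[symmetric] by (simp add: powr_mult W)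
  qed (use TT V W N0 in auto)
  then show ?thesis unfolding ind[symmetric] by (simp add: powr_mult mult.assoc)
 qed
 then show ?thesis using V(1) by (intro exI[of _ "(V + 1) * W powr T0"]) auto
qed

text \<open>For sp \<le> d the exponent p is admissible in the integral bound; for sp > d the
  uniform bound is integrated over the support ball.\<close>

theorem ex_Poincare:
 assumes s: "0 < s" "s \<le> 1" and R: "R > 0" and p: "1 < p"
 shows "\<exists>C\<ge>0. \<forall>(\<phi>::'a::euclidean_space \<Rightarrow> real) G N. C1c R \<phi> G \<longrightarrow> fgrad_le s p G N \<longrightarrow>
   (\<integral>\<^sup>+x. ennreal (\<bar>\<phi> x\<bar> powr p) \<partial>lborel) \<le> ennreal (C * N powr p)"
proof (cases "s * p \<le> real DIM('a)")
 case True
 show ?thesis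
 proof (rule ex_Lp_bound[OF s R p True])
  assume *: "s * p < real DIM('a)"
  have "p * (real DIM('a) - s * p) \<le> p * real DIM('a)" using p s by (intro mult_left_mono) auto
  then show "p \<le> real DIM('a) * p / (real DIM('a) - s * p)" using * by (simp add: pos_le_divide_eq mult.commute)
 qed (use p in simp)
next
 case False
 then obtain C where C: "C \<ge> 0" "\<And>(\<phi>::'a \<Rightarrow> real) G N x. C1c R \<phi> G \<Longrightarrow> fgrad_le s p G N \<Longrightarrow> \<bar>\<phi> x\<bar> \<le> C * N"
  using ex_Morrey[OF s R p, where 'a='a] by (meson not_le)
 define V where "V = unit_ball_vol (real DIM('a)) * R powr real DIM('a)"
 have V: "V \<ge> 0" "emeasure lborel (cball (0::'a) R) = ennreal V" using R by (auto simp: V_def emeasure_cball_le)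
 have "(\<integral>\<^sup>+x. ennreal (\<bar>\<phi> x\<bar> powr p) \<partial>lborel) \<le> ennreal (C powr p * V * N powr p)"
  if Cc: "C1c R \<phi> G" and N: "fgrad_le s p G N" for \<phi> :: "'a \<Rightarrow> real" and G N
 proof -
  have "(\<integral>\<^sup>+x. ennreal (\<bar>\<phi> x\<bar> powr p) \<partial>lborel) \<le> (\<integral>\<^sup>+x. ennreal ((C * N) powr p) * indicator (cball (0::'a) R) x \<partial>lborel)"
  proof (rule nn_integral_mono)
   fix x
   show "ennreal (\<bar>\<phi> x\<bar> powr p) \<le> ennreal ((C * N) powr p) * indicator (cball (0::'a) R) x"
    using Cc C(2)[OF Cc N, of x] p by (cases "norm x \<le> R") (auto simp: C1c_def intro!: ennreal_leI powr_mono2)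
  qed
  also have "\<dots> = ennreal ((C * N) powr p) * ennreal V" by (subst nn_integral_cmult_indicator) (simp_all add: V(2))
  also have "\<dots> = ennreal (C powr p * V * N powr p)" using V(1) by (simp add: ennreal_mult[symmetric] powr_mult mult_ac)
  finally show ?thesis .
 qed
 then show ?thesis using V(1) by (intro exI[of _ "C powr p * V"]) auto
qed

text \<open>Hoelder with the exponent conjugate to \<open>pSharp\<close>: the Sobolev exponent for
  sp < d, a finite exponent for sp = d since r > 1, and the uniform bound for sp > d. This is the
  origin of the integrability threshold on the data.\<close>

theorem ex_dual_bound:
 fixes \<Omega> :: "'a::euclidean_space set"
 assumes s: "0 < s" "s \<le> 1" and R: "R > 0" and p: "1 < p" and r: "1 < r"
  and h: "Lp_on (pSharp DIM('a) s p r) \<Omega> h"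
 shows "\<exists>C\<ge>0. \<forall>(\<phi>::'a \<Rightarrow> real) G N. C1c R \<phi> G \<longrightarrow> fgrad_le s p G N \<longrightarrow>
   (\<integral>\<^sup>+x. ennreal \<bar>indicator \<Omega> x * h x * \<phi> x\<bar> \<partial>lebesgue) \<le> ennreal (C * N)"
proof -
 let ?d = "real DIM('a)" and ?t = "pSharp DIM('a) s p r"
 define k where "k x = \<bar>indicator \<Omega> x * h x\<bar>" for x
 have km[measurable]: "k \<in> borel_measurable lebesgue" using h by (auto simp: k_def[abs_def] Lp_on_def intro: borel_measurable_abs)
 have kt: "k x powr ?t = indicator \<Omega> x * \<bar>h x\<bar> powr ?t" for x
  by (auto simp: k_def split: split_indicator)
 define J where "J = (\<integral>x. indicator \<Omega> x * \<bar>h x\<bar> powr ?t \<partial>lebesgue)"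
 have J0: "J \<ge> 0" by (simp add: J_def)
 have J: "(\<integral>\<^sup>+x. ennreal (k x powr ?t) \<partial>lebesgue) = ennreal J"
  unfolding kt J_def using h by (intro nn_integral_eq_integral) (auto simp: Lp_on_def)
 have eq: "\<bar>indicator \<Omega> x * h x * \<phi> x\<bar> = k x * \<bar>\<phi> x\<bar>" for x \<phi> by (simp add: k_def abs_mult)
 show ?thesis
 proof (cases "s * p \<le> ?d")
  case False
  then obtain C where C: "C \<ge> 0" "\<And>(\<phi>::'a \<Rightarrow> real) G N x. C1c R \<phi> G \<Longrightarrow> fgrad_le s p G N \<Longrightarrow> \<bar>\<phi> x\<bar> \<le> C * N"
   using ex_Morrey[OF s R p, where 'a='a] by (meson not_le)
  have t: "?t = 1" using False by (simp add: pSharp_def)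
  have "(\<integral>\<^sup>+x. ennreal \<bar>indicator \<Omega> x * h x * \<phi> x\<bar> \<partial>lebesgue) \<le> ennreal (C * J * N)"
   if Cc: "C1c R \<phi> G" and N: "fgrad_le s p G N" for \<phi> :: "'a \<Rightarrow> real" and G N
  proof -
   have N0: "N \<ge> 0" using N by (simp add: fgrad_le_def)
   have "(\<integral>\<^sup>+x. ennreal \<bar>indicator \<Omega> x * h x * \<phi> x\<bar> \<partial>lebesgue) \<le> (\<integral>\<^sup>+x. ennreal (C * N) * ennreal (k x powr ?t) \<partial>lebesgue)"
   proof (rule nn_integral_mono)
    fix x
    have "k x * \<bar>\<phi> x\<bar> \<le> k x * (C * N)" using C(2)[OF Cc N] by (intro mult_left_mono) (auto simp: k_def)
    moreover have k0: "k x \<ge> 0" and kx: "k x powr ?t = k x" by (simp_all add: t k_def)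
    ultimately show "ennreal \<bar>indicator \<Omega> x * h x * \<phi> x\<bar> \<le> ennreal (C * N) * ennreal (k x powr ?t)"
     using C(1) N0 unfolding eq kx by (subst ennreal_mult[symmetric]) (auto simp: mult.commute intro!: ennreal_leI)
   qed
   also have "\<dots> = ennreal (C * N) * ennreal J" by (subst nn_integral_cmult) (auto simp: J)
   also have "\<dots> = ennreal (C * J * N)" using C(1) N0 J0 by (subst ennreal_mult[symmetric]) (auto simp: mult_ac)
   finally show ?thesis .
  qed
  then show ?thesis using C(1) J0 by (intro exI[of _ "C * J"]) auto
 next
  case True
  define E where "E = ?d * (p - 1) + s * p"
  have E: "E > 0" using p s unfolding E_def by (intro add_nonneg_pos mult_nonneg_nonneg mult_pos_pos) auto
  have tE: "?t = ?d * p / E" "?d * p - E = ?d - s * p" if "s * p < ?d"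
   using that by (simp_all add: pSharp_def E_def algebra_simps)
  have t1: "?t > 1"
  proof (cases "s * p < ?d")
   case True
   then have "E < ?d * p" using tE(2) by linarith
   then show ?thesis using E tE(1)[OF True] by simp
  next
   case False
   then show ?thesis using \<open>s * p \<le> ?d\<close> r by (simp add: pSharp_def)
  qed
  define T where "T = ?t / (?t - 1)"
  have conj: "t / (t - 1) > 1 \<and> 1 / t + 1 / (t / (t - 1)) = 1" if "t > 1" for t :: real
   using that by (auto simp: field_simps)
  have T: "T > 1" "1 / ?t + 1 / T = 1" using conj[OF t1] by (auto simp: T_def)
  have Tle: "T \<le> ?d * p / (?d - s * p)" if *: "s * p < ?d"
  proof -
   have "?t - 1 = (?d * p - E) / E" using E unfolding tE(1)[OF *] by (simp add: diff_divide_distrib)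
   then have "T = ?d * p / (?d - s * p)" using E unfolding T_def tE(2)[OF *] by (simp add: tE(1)[OF *])
   then show ?thesis by simp
  qed
  have "T > 0" using T(1) by simp
  from ex_Lp_bound[OF s R p True this Tle]
  obtain C where C: "C \<ge> 0" "\<And>(\<phi>::'a \<Rightarrow> real) G N. C1c R \<phi> G \<Longrightarrow> fgrad_le s p G N \<Longrightarrow>
    (\<integral>\<^sup>+x. ennreal (\<bar>\<phi> x\<bar> powr T) \<partial>lborel) \<le> ennreal (C * N powr T)"
   by blast
  define W where "W = C powr (1 / T)"
  have W: "W \<ge> 0" "W powr T = C" using C(1) T by (auto simp: W_def powr_powr)
  define A where "A = J powr (1 / ?t)"
  have A: "A \<ge> 0" "A powr ?t = J" using J0 t1 by (auto simp: A_def powr_powr)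
  have "(\<integral>\<^sup>+x. ennreal \<bar>indicator \<Omega> x * h x * \<phi> x\<bar> \<partial>lebesgue) \<le> ennreal (A * W * N)"
   if Cc: "C1c R \<phi> G" and N: "fgrad_le s p G N" for \<phi> :: "'a \<Rightarrow> real" and G N
  proof -
   have [measurable]: "\<phi> \<in> borel_measurable borel" using C1c_borel[OF Cc] by simp
   have \<phi>m: "(\<lambda>x. \<bar>\<phi> x\<bar>) \<in> borel_measurable lebesgue" by (rule measurable_completion) simp
   have N0: "N \<ge> 0" using N by (simp add: fgrad_le_def)
   have "(\<integral>\<^sup>+x. ennreal (k x * \<bar>\<phi> x\<bar>) \<partial>lebesgue) \<le> ennreal (A * (W * N))"
   proof (rule nn_integral_Holder[OF km \<phi>m _ _ t1 T])
    show "(\<integral>\<^sup>+x. ennreal (k x powr ?t) \<partial>lebesgue) \<le> ennreal (A powr ?t)" by (simp add: J A)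
    show "(\<integral>\<^sup>+x. ennreal (\<bar>\<phi> x\<bar> powr T) \<partial>lebesgue) \<le> ennreal ((W * N) powr T)"
     using C(2)[OF Cc N] by (simp add: nn_integral_completion powr_mult W)
   qed (use A W N0 in \<open>auto simp: k_def\<close>)
   then show ?thesis unfolding eq by (simp only: mult.assoc)
  qed
  then show ?thesis using A W by (intro exI[of _ "A * W"]) auto
 qed
qed

subsection \<open>\<open>L\<^sup>p\<close> convergence\<close>

lemma tendsto_0_le_ennreal:
 fixes f :: "nat \<Rightarrow> ennreal"
 assumes "\<And>d. d > 0 \<Longrightarrow> \<forall>\<^sub>F n in sequentially. f n \<le> ennreal d"
 shows "f \<longlonglongrightarrow> 0"
proof (rule order_tendstoI)
 fix a :: ennreal assume "0 < a"
 then obtain y where y: "0 < y" "y < a" using dense by blast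
 then obtain d where "y = ennreal d" "d \<ge> 0" by (cases y rule: ennreal_cases) auto
 with y have d: "d > 0" "ennreal d < a" by auto
 show "\<forall>\<^sub>F n in sequentially. f n < a"
  using assms[OF d(1)] by eventually_elim (use d in auto)
qed simp

text \<open>The p-th power of the norm, in extended reals: infinite integrals stay visible, and a
  quasi-triangle inequality with factor 2^p serves in place of Minkowski's.\<close>

definition pint :: "real \<Rightarrow> 'b measure \<Rightarrow> ('b \<Rightarrow> 'c::real_normed_vector) \<Rightarrow> ennreal" where
 "pint p M F = (\<integral>\<^sup>+x. ennreal (norm (F x) powr p) \<partial>M)"

lemma norm_add_powr_le:
 fixes a b :: "'c::real_normed_vector"
 assumes p: "p > 0"
 shows "norm (a + b) powr p \<le> 2 powr p * (norm a powr p + norm b powr p)"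
proof -
 have "norm (a + b) \<le> 2 * max (norm a) (norm b)" using norm_triangle_ineq[of a b] by linarith
 then have "norm (a + b) powr p \<le> (2 * max (norm a) (norm b)) powr p" using p by (intro powr_mono2) auto
 also have "\<dots> = 2 powr p * max (norm a) (norm b) powr p" by (simp add: powr_mult)
 also have "\<dots> \<le> 2 powr p * (norm a powr p + norm b powr p)"
  by (intro mult_left_mono) (auto simp: max_def)
 finally show ?thesis .
qed

lemma pint_add_le:
 fixes F G :: "'b \<Rightarrow> 'c::{banach, second_countable_topology}"
 assumes [measurable]: "F \<in> borel_measurable M" "G \<in> borel_measurable M" and p: "p > 0"
 shows "pint p M (\<lambda>x. F x + G x) \<le> ennreal (2 powr p) * (pint p M F + pint p M G)"
proof -
 have "pint p M (\<lambda>x. F x + G x) \<le> (\<integral>\<^sup>+x. ennreal (2 powr p) * (ennreal (norm (F x) powr p) + ennreal (norm (G x) powr p)) \<partial>M)"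
  unfolding pint_def
 proof (rule nn_integral_mono)
  fix x
  have "ennreal (norm (F x + G x) powr p) \<le> ennreal (2 powr p * (norm (F x) powr p + norm (G x) powr p))"
   by (intro ennreal_leI norm_add_powr_le p)
  then show "ennreal (norm (F x + G x) powr p) \<le> ennreal (2 powr p) * (ennreal (norm (F x) powr p) + ennreal (norm (G x) powr p))"
   by (simp add: ennreal_mult')
 qed
 also have "\<dots> = ennreal (2 powr p) * (pint p M F + pint p M G)"
  unfolding pint_def by (simp add: nn_integral_cmult nn_integral_add)
 finally show ?thesis .
qed

lemma pint_scale:
 fixes F :: "'b \<Rightarrow> 'c::{banach, second_countable_topology}"
 assumes [measurable]: "F \<in> borel_measurable M"
 shows "pint p M (\<lambda>x. c *\<^sub>R F x) = ennreal (\<bar>c\<bar> powr p) * pint p M F"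
 unfolding pint_def by (subst nn_integral_cmult[symmetric]) (auto simp: powr_mult ennreal_mult)

lemma pint_minus_commute: "pint p M (\<lambda>x. F x - G x) = pint p M (\<lambda>x. G x - F x)"
 by (simp add: pint_def norm_minus_commute)

lemma pint_triangle:
 fixes F G H :: "'b \<Rightarrow> 'c::{banach, second_countable_topology}"
 assumes [measurable]: "F \<in> borel_measurable M" "G \<in> borel_measurable M" "H \<in> borel_measurable M" and p: "p > 0"
 shows "pint p M (\<lambda>x. F x - H x) \<le> ennreal (2 powr p) * (pint p M (\<lambda>x. F x - G x) + pint p M (\<lambda>x. G x - H x))"
 using pint_add_le[of "\<lambda>x. F x - G x" M "\<lambda>x. G x - H x" p] p by simp

lemma pint_integrable:
 fixes F :: "'b \<Rightarrow> 'c::{banach, second_countable_topology}"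
 assumes [measurable]: "F \<in> borel_measurable M"
 shows "integrable M (\<lambda>x. norm (F x) powr p) \<longleftrightarrow> pint p M F < \<infinity>"
 by (simp add: integrable_iff_bounded pint_def)

lemma pint_eq_integral:
 fixes F :: "'b \<Rightarrow> 'c::{banach, second_countable_topology}"
 assumes [measurable]: "F \<in> borel_measurable M" and "pint p M F < \<infinity>"
 shows "pint p M F = ennreal (\<integral>x. norm (F x) powr p \<partial>M)"
 using assms by (subst pint_def, intro nn_integral_eq_integral) (auto simp: pint_integrable)

text \<open>Initial terms with possibly infinite distance are dropped; from then on it is the
  statement for L^1 applied to the p-th powers.\<close>

lemma pint_tendsto_AE_subseq:
 fixes F :: "nat \<Rightarrow> 'b \<Rightarrow> 'c::{banach, second_countable_topology}"
 assumes [measurable]: "\<And>n. F n \<in> borel_measurable M" "G \<in> borel_measurable M" and p: "p > 0"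
  and lim: "(\<lambda>n. pint p M (\<lambda>x. F n x - G x)) \<longlonglongrightarrow> 0"
 obtains r where "strict_mono r" "AE x in M. (\<lambda>n. F (r n) x) \<longlonglongrightarrow> G x"
proof -
 have "eventually (\<lambda>n. pint p M (\<lambda>x. F n x - G x) < 1) sequentially"
  using lim by (rule order_tendstoD) simp
 then obtain n0 where n0: "\<And>n. n \<ge> n0 \<Longrightarrow> pint p M (\<lambda>x. F n x - G x) < 1"
  by (auto simp: eventually_sequentially)
 have fin: "pint p M (\<lambda>x. F (n + n0) x - G x) < \<infinity>" for n
  using n0[of "n + n0"] by (simp add: less_trans[OF _ ennreal_one_less_top])
 have lim': "(\<lambda>n. \<integral>x. norm (norm (F (n + n0) x - G x) powr p) \<partial>M) \<longlonglongrightarrow> 0"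
 proof -
  have "(\<lambda>n. ennreal (\<integral>x. norm (F (n + n0) x - G x) powr p \<partial>M)) \<longlonglongrightarrow> ennreal 0"
   using LIMSEQ_ignore_initial_segment[OF lim, of n0] by (simp add: pint_eq_integral[OF _ fin])
  then show ?thesis by (subst (asm) tendsto_ennreal_iff) auto
 qed
 obtain r where r: "strict_mono r" "AE x in M. (\<lambda>n. norm (F (r n + n0) x - G x) powr p) \<longlonglongrightarrow> 0"
  using tendsto_L1_AE_subseq[OF _ lim'] fin by (auto simp: pint_integrable)
 show ?thesis
 proof (rule that[of "\<lambda>n. r n + n0"])
  show "strict_mono (\<lambda>n. r n + n0)" using r(1) by (simp add: strict_mono_def)
  show "AE x in M. (\<lambda>n. F (r n + n0) x) \<longlonglongrightarrow> G x"
   using r(2)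
  proof eventually_elim
   case (elim x)
   have "(\<lambda>n. (norm (F (r n + n0) x - G x) powr p) powr (1 / p)) \<longlonglongrightarrow> 0 powr (1 / p)"
    using elim p by (intro tendsto_powr') auto
   then have "(\<lambda>n. norm (F (r n + n0) x - G x)) \<longlonglongrightarrow> 0" using p by (simp add: powr_powr)
   then show ?case by (simp add: tendsto_norm_zero_iff LIM_zero_iff)
  qed
 qed
qed

lemma pint_Fatou:
 fixes F :: "nat \<Rightarrow> 'b \<Rightarrow> 'c::{banach, second_countable_topology}"
 assumes [measurable]: "\<And>n. F n \<in> borel_measurable M" "G \<in> borel_measurable M" and p: "p > 0"
  and ae: "AE x in M. (\<lambda>n. F n x) \<longlonglongrightarrow> G x"
  and le: "eventually (\<lambda>n. pint p M (F n) \<le> B) sequentially"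
 shows "pint p M G \<le> B"
proof -
 have "pint p M G = (\<integral>\<^sup>+x. liminf (\<lambda>n. ennreal (norm (F n x) powr p)) \<partial>M)"
  unfolding pint_def
 proof (rule nn_integral_cong_AE)
  show "AE x in M. ennreal (norm (G x) powr p) = liminf (\<lambda>n. ennreal (norm (F n x) powr p))"
   using ae
  proof eventually_elim
   case (elim x)
   have "(\<lambda>n. ennreal (norm (F n x) powr p)) \<longlonglongrightarrow> ennreal (norm (G x) powr p)"
    using elim p by (intro tendsto_ennrealI tendsto_powr' tendsto_norm) auto
   then show ?case by (rule lim_imp_Liminf[symmetric, rotated]) simp
  qed
 qed
 also have "\<dots> \<le> liminf (\<lambda>n. pint p M (F n))"
  unfolding pint_def by (rule nn_integral_liminf) measurable
 also have "\<dots> \<le> B"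
  by (rule order_trans[OF Liminf_le_Limsup Limsup_bounded[OF le]]) simp
 finally show ?thesis .
qed

text \<open>Riesz-Fischer. For a fast subsequence the increments, weighted by 2^(pk), have summable
  p-th power integrals; so almost everywhere they are O(2^(-k)) and telescope to a limit. Fatou then
  gives convergence of the whole sequence.\<close>

lemma Lp_complete:
 fixes F :: "nat \<Rightarrow> 'b \<Rightarrow> 'c::{banach, second_countable_topology}"
 assumes Fm[measurable]: "\<And>n. F n \<in> borel_measurable M" and p: "p > 0"
  and Cauchy: "\<And>e. e > 0 \<Longrightarrow> \<exists>N. \<forall>m\<ge>N. \<forall>n\<ge>N. pint p M (\<lambda>x. F m x - F n x) \<le> ennreal e"
 obtains G where "G \<in> borel_measurable M" "(\<lambda>n. pint p M (\<lambda>x. F n x - G x)) \<longlonglongrightarrow> 0"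
proof -
 \<comment> \<open>The tolerance 4^(-pk) pays twice: for the weights 2^(pk) and for the geometric
   sum that remains.\<close>
 define e where "e k = (1 / 4) powr (p * real k)" for k :: nat
 have e0: "e k > 0" for k by (simp add: e_def)
 have "\<forall>k. \<exists>N. \<forall>m\<ge>N. \<forall>n\<ge>N. pint p M (\<lambda>x. F m x - F n x) \<le> ennreal (e k)"
  using Cauchy e0 by blast
 then obtain N where N: "\<And>k m n. m \<ge> N k \<Longrightarrow> n \<ge> N k \<Longrightarrow> pint p M (\<lambda>x. F m x - F n x) \<le> ennreal (e k)"
  by metis
 \<comment> \<open>Summing all earlier thresholds puts both \<open>r k\<close> and
   \<open>r (Suc k)\<close> beyond \<open>N k\<close>; the summand k makes \<open>r\<close>
   unbounded.\<close>
 define r where "r k = (\<Sum>i\<le>k. N i) + k" for k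
 have rN: "r k \<ge> N k" for k unfolding r_def by (simp add: trans_le_add1 member_le_sum)
 have rS: "r (Suc k) \<ge> N k" for k
  using rN[of k] by (simp add: r_def)
 have rk: "r k \<ge> k" for k by (simp add: r_def)
 define D where "D k x = F (r (Suc k)) x - F (r k) x" for k x
 have Dm[measurable]: "D k \<in> borel_measurable M" for k unfolding D_def[abs_def] by measurable
 have D: "pint p M (D k) \<le> ennreal (e k)" for k
  unfolding D_def[abs_def] by (rule N[OF rS rN])
 have geo: "2 powr (p * real k) * e k = ((1/2) powr p) ^ k" for k
 proof -
  have "2 powr (p * real k) * e k = (2 * (1/4)) powr (p * real k)" unfolding e_def by (rule powr_mult[symmetric])
  also have "\<dots> = ((1/2) powr p) powr real k" by (simp add: powr_powr)
  also have "\<dots> = ((1/2) powr p) ^ k" by (simp add: powr_realpow)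
  finally show ?thesis .
 qed
 have q1: "(1/2::real) powr p < 1" using powr_less_mono2[of p "1/2" 1] p by simp
 have "(\<integral>\<^sup>+x. (\<Sum>k. ennreal (2 powr (p * real k)) * ennreal (norm (D k x) powr p)) \<partial>M)
  = (\<Sum>k. ennreal (2 powr (p * real k)) * pint p M (D k))"
  unfolding pint_def by (subst nn_integral_suminf) (simp_all add: nn_integral_cmult)
 also have "\<dots> \<le> (\<Sum>k. ennreal (((1/2) powr p) ^ k))"
 proof (rule suminf_le)
  fix k
  have "ennreal (2 powr (p * real k)) * pint p M (D k) \<le> ennreal (2 powr (p * real k)) * ennreal (e k)"
   by (intro mult_left_mono D) simp
  also have "\<dots> = ennreal (((1/2) powr p) ^ k)" using e0[of k] by (subst ennreal_mult[symmetric]) (simp_all only: geo, simp_all)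
  finally show "ennreal (2 powr (p * real k)) * pint p M (D k) \<le> ennreal (((1/2) powr p) ^ k)" .
 qed auto
 also have "\<dots> < \<infinity>"
  using q1 by (subst suminf_ennreal2) (auto intro!: summable_geometric)
 finally have "AE x in M. (\<Sum>k. ennreal (2 powr (p * real k)) * ennreal (norm (D k x) powr p)) \<noteq> \<infinity>"
  by (intro nn_integral_PInf_AE) auto
 then have conv: "AE x in M. convergent (\<lambda>k. F (r k) x)"
 proof eventually_elim
  case (elim x)
  define S where "S = enn2real (\<Sum>k. ennreal (2 powr (p * real k)) * ennreal (norm (D k x) powr p))"
  have S0: "S \<ge> 0" by (simp add: S_def)
  have "norm (D k x) \<le> S powr (1 / p) * (1/2) ^ k" for k
  proof -
   have "ennreal (2 powr (p * real k)) * ennreal (norm (D k x) powr p) \<le> ennreal S"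
    unfolding S_def using elim sum_le_suminf[of "\<lambda>k. ennreal (2 powr (p * real k)) * ennreal (norm (D k x) powr p)" "{k}"]
    by (simp add: less_top)
   then have "2 powr (p * real k) * norm (D k x) powr p \<le> S"
    using S0 by (subst (asm) ennreal_mult[symmetric]) auto
   then have "(2 powr real k * norm (D k x)) powr p \<le> S" by (simp add: powr_mult powr_powr mult.commute)
   then have "((2 powr real k * norm (D k x)) powr p) powr (1 / p) \<le> S powr (1 / p)" using p by (intro powr_mono2) auto
   then have "2 ^ k * norm (D k x) \<le> S powr (1 / p)" using p by (simp add: powr_powr powr_realpow)
   then show ?thesis by (simp add: power_divide field_simps)
  qed
  then have "summable (\<lambda>k. D k x)"
   by (rule summable_comparison_test'[rotated]) (auto intro!: summable_mult summable_geometric)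
  then have "convergent (\<lambda>n. \<Sum>k<n. D k x)" by (simp add: summable_iff_convergent)
  moreover have "(\<Sum>k<n. D k x) = F (r n) x - F (r 0) x" for n
   unfolding D_def by (rule sum_lessThan_telescope)
  ultimately have "convergent (\<lambda>n. F (r n) x - F (r 0) x)" by simp
  from convergent_add[OF this convergent_const[of "F (r 0) x"]] show ?case by simp
 qed
 define G where "G x = lim (\<lambda>k. F (r k) x)" for x
 have Gm[measurable]: "G \<in> borel_measurable M" unfolding G_def[abs_def] by (rule borel_measurable_lim_metric) measurable
 have lim: "AE x in M. (\<lambda>k. F (r k) x) \<longlonglongrightarrow> G x"
  using conv by eventually_elim (simp add: G_def convergent_LIMSEQ_iff)
 have "(\<lambda>n. pint p M (\<lambda>x. F n x - G x)) \<longlonglongrightarrow> 0"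
 proof (rule tendsto_0_le_ennreal)
  fix d :: real assume d: "d > 0"
  obtain n0 where n0: "\<And>m n. m \<ge> n0 \<Longrightarrow> n \<ge> n0 \<Longrightarrow> pint p M (\<lambda>x. F m x - F n x) \<le> ennreal d"
   using Cauchy[OF d] by blast
  have "pint p M (\<lambda>x. F n x - G x) \<le> ennreal d" if "n \<ge> n0" for n
  proof (rule pint_Fatou[where F="\<lambda>k x. F n x - F (r k) x", OF _ _ p])
   show "AE x in M. (\<lambda>k. F n x - F (r k) x) \<longlonglongrightarrow> F n x - G x"
    using lim by eventually_elim (intro tendsto_intros)
   show "\<forall>\<^sub>F k in sequentially. pint p M (\<lambda>x. F n x - F (r k) x) \<le> ennreal d"
    using eventually_ge_at_top[of n0] by eventually_elim (use n0 that rk order_trans in blast)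
  qed measurable
  then show "\<forall>\<^sub>F n in sequentially. pint p M (\<lambda>x. F n x - G x) \<le> ennreal d"
   by (auto simp: eventually_sequentially)
 qed
 with Gm show ?thesis by (rule that)
qed

subsection \<open>Uniform convexity\<close>

text \<open>The mean value theorem on the two halves of the interval: the derivative is strictly
  larger on the right half.\<close>

lemma powr_midpoint_strict:
 fixes a b :: real
 assumes p: "p > 1" and ab: "0 \<le> a" "a < b"
 shows "((a + b) / 2) powr p < (a powr p + b powr p) / 2"
proof -
 define m where "m = (a + b) / 2"
 have m: "a < m" "m < b" using ab by (auto simp: m_def)
 have der: "((\<lambda>x. x powr p) has_real_derivative p * z powr (p - 1)) (at z)" if "z > 0" for z
  using that by (auto intro!: derivative_eq_intros)
 have cont: "continuous_on {x..y} (\<lambda>t. t powr p)" if "0 \<le> x" for x y :: real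
  using that p by (intro continuous_on_powr' continuous_intros) auto
 have diff: "(\<lambda>x. x powr p) differentiable (at z)" if "z > 0" for z :: real
  using der[OF that] unfolding real_differentiable_def by blast
 have "\<exists>l z. a < z \<and> z < m \<and> DERIV (\<lambda>x. x powr p) z :> l \<and> m powr p - a powr p = (m - a) * l"
  by (rule MVT[OF m(1) cont[OF ab(1)]]) (use ab in \<open>auto intro!: diff\<close>)
 then obtain l z1 where z1: "a < z1" "z1 < m" "DERIV (\<lambda>x. x powr p) z1 :> l" "m powr p - a powr p = (m - a) * l"
  by blast
 have "0 \<le> m" using m ab by simp
 have "\<exists>l z. m < z \<and> z < b \<and> DERIV (\<lambda>x. x powr p) z :> l \<and> b powr p - m powr p = (b - m) * l"
  by (rule MVT[OF m(2) cont[OF \<open>0 \<le> m\<close>]]) (use \<open>0 \<le> m\<close> in \<open>auto intro!: diff\<close>)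
 then obtain l' z2 where z2: "m < z2" "z2 < b" "DERIV (\<lambda>x. x powr p) z2 :> l'" "b powr p - m powr p = (b - m) * l'"
  by blast
 have l: "l = p * z1 powr (p - 1)" "l' = p * z2 powr (p - 1)"
  using DERIV_unique[OF z1(3) der] DERIV_unique[OF z2(3) der] z1 z2 m ab by auto
 have "z1 powr (p - 1) < z2 powr (p - 1)" using z1 z2 m ab p by (intro powr_less_mono2) auto
 then have "l < l'" using l p by simp
 moreover have "m - a = b - m" by (simp add: m_def field_simps)
 moreover have "(b - m) * l < (b - m) * l'" using \<open>l < l'\<close> m by (intro mult_strict_left_mono) auto
 ultimately have "(m - a) * l < (b - m) * l'" by (simp only:)
 then show ?thesis using z1(4) z2(4) by (simp add: m_def)
qed

text \<open>The defect in the midpoint convexity of the p-th power of the norm; its integral is what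
  near-minimality of the energy controls.\<close>

definition cgap :: "real \<Rightarrow> 'a::real_normed_vector \<Rightarrow> 'a \<Rightarrow> real" where
 "cgap p a b = (norm a powr p + norm b powr p) / 2 - norm ((1/2) *\<^sub>R (a + b)) powr p"

text \<open>For equal norms strictness is the parallelogram law, for different norms the strict
  convexity of the power on the half-line.\<close>

lemma cgap_pos:
 fixes a b :: "'a::real_inner"
 assumes p: "p > 1" and ne: "a \<noteq> b"
 shows "cgap p a b > 0"
proof (cases "norm a = norm b")
 case True
 have "(norm (a + b))\<^sup>2 + (norm (a - b))\<^sup>2 = 2 * (norm a)\<^sup>2 + 2 * (norm b)\<^sup>2"
  by (simp add: power2_norm_eq_inner inner_diff_left inner_diff_right inner_add_left inner_add_right)
 moreover have "(norm (a - b))\<^sup>2 > 0" using ne by simp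
 ultimately have "(norm (a + b))\<^sup>2 < (2 * norm a)\<^sup>2" using True by (simp add: power2_eq_square)
 then have "norm (a + b) < 2 * norm a" by (rule power_less_imp_less_base) simp
 then have "norm ((1/2) *\<^sub>R (a + b)) < norm a" by simp
 then have "norm ((1/2) *\<^sub>R (a + b)) powr p < norm a powr p" using p by (intro powr_less_mono2) auto
 then show ?thesis using True by (simp add: cgap_def)
next
 case False
 have "((norm a + norm b) / 2) powr p < (norm a powr p + norm b powr p) / 2"
 proof (cases "norm a < norm b")
  case True then show ?thesis using powr_midpoint_strict[OF p, of "norm a" "norm b"] by simp
 next
  case F: False
  then have "norm b < norm a" using False by simp
  then show ?thesis using powr_midpoint_strict[OF p, of "norm b" "norm a"] by (simp add: add.commute)
 qed
 moreover have "norm ((1/2) *\<^sub>R (a + b)) powr p \<le> ((norm a + norm b) / 2) powr p"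
  using p norm_triangle_ineq[of a b] by (intro powr_mono2) auto
 ultimately show ?thesis by (simp add: cgap_def)
qed

lemma cgap_nonneg:
 fixes a b :: "'a::real_inner"
 assumes "p > 1"
 shows "cgap p a b \<ge> 0"
proof (cases "a = b")
 case True
 then have "(1/2) *\<^sub>R (a + b) = a" by (simp add: scaleR_2[symmetric])
 then show ?thesis using True by (simp add: cgap_def)
qed (use cgap_pos[OF assms] less_imp_le in blast)

text \<open>By homogeneity it suffices to compare both sides on a compact set.\<close>

lemma ex_uniform_convexity:
 assumes p: "p > 1" and e: "e > 0"
 shows "\<exists>C\<ge>0. \<forall>a b::'a::euclidean_space. norm (a - b) powr p \<le> e * (norm a powr p + norm b powr p) + C * cgap p a b"
proof -
 \<comment> \<open>Normalised pairs kept away from the diagonal: the gap is positive there, and by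
   compactness it has a positive minimum unless the set is empty.\<close>
 define S where "S = {z::'a \<times> 'a. norm (fst z) powr p + norm (snd z) powr p = 1 \<and> norm (fst z - snd z) powr p \<ge> e}"
 have p0: "p > 0" using p by simp
 have contn: "continuous_on UNIV (\<lambda>z::'a \<times> 'a. norm (f z) powr p)" if "continuous_on UNIV f" for f :: "'a \<times> 'a \<Rightarrow> 'a"
  using that p0 by (intro continuous_on_powr' continuous_intros) auto
 have cont: "continuous_on UNIV (\<lambda>z::'a \<times> 'a. cgap p (fst z) (snd z))"
  unfolding cgap_def by (intro continuous_intros contn) auto
 have "closed S" unfolding S_def
  by (intro closed_Collect_conj closed_Collect_eq closed_Collect_le continuous_on_add contn continuous_intros)
 moreover have "bounded S"
  unfolding bounded_iff
 proof (intro exI[of _ 2] ballI)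
  fix z assume z: "z \<in> S"
  have "norm x \<le> 1" if "norm x powr p \<le> 1" for x :: 'a
  proof (rule ccontr)
   assume "\<not> norm x \<le> 1"
   then have "1 powr p < norm x powr p" using p0 by (intro powr_less_mono2) auto
   then show False using that by simp
  qed
  moreover have "norm (fst z) powr p \<le> 1" "norm (snd z) powr p \<le> 1"
   using z powr_ge_zero[of "norm (fst z)" p] powr_ge_zero[of "norm (snd z)" p] unfolding S_def mem_Collect_eq by linarith+
  ultimately have "norm (fst z) \<le> 1" "norm (snd z) \<le> 1" by auto
  then show "norm z \<le> 2" using norm_Pair_le[of "fst z" "snd z"] by simp
 qed
 ultimately have comp: "compact S" by (simp add: compact_eq_bounded_closed)
 have pos: "cgap p (fst z) (snd z) > 0" if "z \<in> S" for z
 proof (rule cgap_pos[OF p])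
  show "fst z \<noteq> snd z" using that e by (auto simp: S_def)
 qed
 obtain \<delta> where \<delta>: "\<delta> > 0" "\<And>z. z \<in> S \<Longrightarrow> \<delta> \<le> cgap p (fst z) (snd z)"
 proof (cases "S = {}")
  case False
  then obtain z where z: "z \<in> S" "\<And>y. y \<in> S \<Longrightarrow> cgap p (fst z) (snd z) \<le> cgap p (fst y) (snd y)"
   using continuous_attains_inf[OF comp False continuous_on_subset[OF cont]] by auto
  then show ?thesis using that[of "cgap p (fst z) (snd z)"] pos by blast
 qed (use that[of 1] in auto)
 \<comment> \<open>On normalised pairs the left side is at most 2^p; dividing by the lower bound
   \<delta> of the gap turns this into a multiple of the gap.\<close>
 define C where "C = 2 powr p / \<delta>"
 have C: "C \<ge> 0" using \<delta> by (simp add: C_def)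
 have "norm (a - b) powr p \<le> e * (norm a powr p + norm b powr p) + C * cgap p a b" for a b :: 'a
 proof -
  define t where "t = norm a powr p + norm b powr p"
  have t0: "t \<ge> 0" by (simp add: t_def)
  show ?thesis
  proof (cases "t = 0")
   case True
   then have "a = 0 \<and> b = 0" unfolding t_def by (simp add: add_nonneg_eq_0_iff)
   then show ?thesis by (simp add: cgap_def)
  next
   case False
   then have t: "t > 0" using t0 by simp
   define c where "c = t powr (- (1 / p))"
   have "c powr p = t powr (- 1)" unfolding c_def powr_powr using p by simp
   then have c: "c > 0" "c powr p = 1 / t" using t by (simp_all add: c_def powr_minus_divide)
   have hom: "norm (c *\<^sub>R x) powr p = norm x powr p / t" for x :: 'a
    using c by (simp add: powr_mult)
   have 1: "norm (c *\<^sub>R a) powr p + norm (c *\<^sub>R b) powr p = 1"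
    unfolding hom add_divide_distrib[symmetric] using t by (simp add: t_def)
   have 2: "norm (c *\<^sub>R a - c *\<^sub>R b) powr p = norm (a - b) powr p / t"
    using hom[of "a - b"] by (simp add: scaleR_diff_right)
   have 3: "cgap p (c *\<^sub>R a) (c *\<^sub>R b) = cgap p a b / t"
   proof -
    have "(1/2) *\<^sub>R (c *\<^sub>R a + c *\<^sub>R b) = c *\<^sub>R ((1/2) *\<^sub>R (a + b))" by (simp add: scaleR_add_right mult.commute)
    then show ?thesis unfolding cgap_def by (simp only: hom diff_divide_distrib add_divide_distrib divide_divide_eq_left mult.commute)
   qed
   show ?thesis
   proof (cases "norm (a - b) powr p / t \<ge> e")
    case True
    then have "(c *\<^sub>R a, c *\<^sub>R b) \<in> S" using 1 2 by (simp add: S_def)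
    then have "\<delta> \<le> cgap p a b / t" using \<delta>(2) 3 by fastforce
    then have "C * \<delta> \<le> C * (cgap p a b / t)" using C by (rule mult_left_mono)
    then have "2 powr p \<le> C * (cgap p a b / t)" using \<delta>(1) by (simp add: C_def)
    then have "2 powr p * t \<le> C * cgap p a b" using t by (simp add: pos_le_divide_eq)
    moreover have "norm (a - b) powr p \<le> 2 powr p * t"
     using norm_add_powr_le[OF p0, of a "- b"] by (simp add: t_def)
    moreover have "e * t \<ge> 0" using e t by simp
    ultimately show ?thesis unfolding t_def[symmetric] by linarith
   next
    case False
    then have "norm (a - b) powr p \<le> e * t" using t by (simp add: not_le pos_divide_less_eq)
    then show ?thesis unfolding t_def[symmetric] using C cgap_nonneg[OF p, of a b] by (simp add: add_increasing2)
   qed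
  qed
 qed
 then show ?thesis using C by blast
qed

subsection \<open>The space of functions with fractional gradient\<close>

lemma partial_dir_lin:
 assumes "smooth_fun f" "smooth_fun g"
 shows "partial_dir b (\<lambda>x. c * f x + d * g x) = (\<lambda>x. c * partial_dir b f x + d * partial_dir b g x)"
proof
 fix x
 have "((\<lambda>x. c * f x + d * g x) has_derivative (\<lambda>h. c * (grad f x \<bullet> h) + d * (grad g x \<bullet> h))) (at x)"
  by (intro has_derivative_add has_derivative_mult_right smooth_fun_has_derivative assms)
 note D = frechet_derivative_at[OF this, symmetric]
  frechet_derivative_at[OF smooth_fun_has_derivative[OF assms(1)], of x, symmetric]
  frechet_derivative_at[OF smooth_fun_has_derivative[OF assms(2)], of x, symmetric]
 show "partial_dir b (\<lambda>x. c * f x + d * g x) x = c * partial_dir b f x + d * partial_dir b g x"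
  unfolding partial_dir_def D ..
qed

lemma smooth_fun_lin:
 assumes "smooth_fun f" "smooth_fun g"
 shows "smooth_fun (\<lambda>x. c * f x + d * g x)"
proof -
 have "fold partial_dir bs (\<lambda>x. c * f x + d * g x) differentiable (at x)"
  if "set bs \<subseteq> Basis" "smooth_fun f" "smooth_fun g" for bs f g x
  using that
 proof (induction bs arbitrary: f g)
  case Nil
  then show ?case using smooth_fun_differentiable by (auto intro!: derivative_intros)
 next
  case (Cons b bs)
  then show ?case by (simp add: partial_dir_lin smooth_fun_partial)
 qed
 then show ?thesis unfolding smooth_fun_def[of "\<lambda>x. c * f x + d * g x"] using assms by blast
qed

lemma grad_lin:
 assumes "smooth_fun f" "smooth_fun g"
 shows "grad (\<lambda>x. c * f x + d * g x) = (\<lambda>x. c *\<^sub>R grad f x + d *\<^sub>R grad g x)"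
proof (intro ext grad_eqI)
 fix x
 have "((\<lambda>x. c * f x + d * g x) has_derivative (\<lambda>h. c * (grad f x \<bullet> h) + d * (grad g x \<bullet> h))) (at x)"
  by (intro has_derivative_add has_derivative_mult_right smooth_fun_has_derivative assms)
 then show "((\<lambda>x. c * f x + d * g x) has_derivative (\<lambda>h. (c *\<^sub>R grad f x + d *\<^sub>R grad g x) \<bullet> h)) (at x)"
  by (simp add: inner_add_left)
qed

lemma test_fun_lin:
 assumes f: "test_fun \<Omega> f" and g: "test_fun \<Omega> g"
 shows "test_fun \<Omega> (\<lambda>x. c * f x + d * g x)"
proof -
 let ?S = "closure {x. c * f x + d * g x \<noteq> 0}" and ?F = "closure {x. f x \<noteq> 0}" and ?G = "closure {x. g x \<noteq> 0}"
 have sub: "?S \<subseteq> ?F \<union> ?G"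
  unfolding closure_Un[symmetric] by (rule closure_mono) auto
 have "compact (?F \<union> ?G)" using f g by (intro compact_Un) (auto simp: test_fun_def)
 then have "compact ((?F \<union> ?G) \<inter> ?S)" by (rule compact_Int_closed) simp
 moreover have "(?F \<union> ?G) \<inter> ?S = ?S" using sub by blast
 ultimately have "compact ?S" by (simp only:)
 then show ?thesis using f g sub by (auto simp: test_fun_def smooth_fun_lin)
qed

lemma riesz_grad_lin:
 fixes G H :: "'a::euclidean_space \<Rightarrow> 'a"
 assumes G: "C1c R f G" and H: "C1c R g H" and s: "0 < s" "s < 1"
 shows "riesz_grad s (\<lambda>x. c *\<^sub>R G x + d *\<^sub>R H x) x = c *\<^sub>R riesz_grad s G x + d *\<^sub>R riesz_grad s H x"
proof -
 let ?a = "real DIM('a) + s - 1"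
 note a = riesz_exponent[OF s, where 'a='a]
 have i: "integrable lborel (\<lambda>z. norm z powr (- ?a) *\<^sub>R G (x - z))" if CG: "C1c R f G" for f and G :: "'a \<Rightarrow> 'a"
 proof -
  obtain B where B: "B > 0" "\<And>x. norm (G x) \<le> B" using C1c_bounded[OF CG] by metis
  show ?thesis
   by (rule integrable_powr_convolution[of ?a G B R]) (use a B CG C1c_borel[OF CG] in \<open>auto simp: C1c_def\<close>)
 qed
 have "(\<integral>z. norm z powr (- ?a) *\<^sub>R (c *\<^sub>R G (x - z) + d *\<^sub>R H (x - z)) \<partial>lborel)
  = (\<integral>z. c *\<^sub>R (norm z powr (- ?a) *\<^sub>R G (x - z)) + d *\<^sub>R (norm z powr (- ?a) *\<^sub>R H (x - z)) \<partial>lborel)"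
  by (intro Bochner_Integration.integral_cong refl) (simp only: scaleR_add_right scaleR_scaleR mult.commute)
 also have "\<dots> = c *\<^sub>R (\<integral>z. norm z powr (- ?a) *\<^sub>R G (x - z) \<partial>lborel) + d *\<^sub>R (\<integral>z. norm z powr (- ?a) *\<^sub>R H (x - z) \<partial>lborel)"
  by (simp only: Bochner_Integration.integral_add[OF integrable_scaleR_right[OF i[OF G]] integrable_scaleR_right[OF i[OF H]]] integral_scaleR_right)
 finally show ?thesis unfolding riesz_grad_def by (simp only: scaleR_add_right scaleR_scaleR mult.commute)
qed

locale frac_space =
 fixes \<Omega> :: "'a::euclidean_space set" and s p R :: real
 assumes open_\<Omega>: "open \<Omega>" and \<Omega>_R: "\<Omega> \<subseteq> cball 0 R" and R: "R > 0"
  and s: "0 < s" "s \<le> 1" and p: "1 < p"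
begin

lemma p0: "p > 0" using p by simp

lemma test_C1c: "test_fun \<Omega> \<phi> \<Longrightarrow> C1c R \<phi> (grad \<phi>)"
 by (rule test_fun_C1c[OF _ \<Omega>_R])

lemma frac_grad_test: "test_fun \<Omega> \<phi> \<Longrightarrow> frac_grad s \<phi> = fgrad s (grad \<phi>)"
 using frac_grad_eq[OF test_C1c s] by (simp add: fgrad_def)

lemma test_measurable: "test_fun \<Omega> \<phi> \<Longrightarrow> \<phi> \<in> borel_measurable lebesgue"
 using C1c_borel(1)[OF test_C1c] by (intro measurable_completion) simp

lemma frac_grad_measurable: "test_fun \<Omega> \<phi> \<Longrightarrow> frac_grad s \<phi> \<in> borel_measurable lebesgue"
 using borel_measurable_fgrad[OF C1c_borel(2)[OF test_C1c]]
 by (intro measurable_completion) (simp add: frac_grad_test)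

lemma test_pint: assumes t: "test_fun \<Omega> \<phi>" shows "pint p lebesgue \<phi> < \<infinity>"
proof -
 note C = test_C1c[OF t]
 obtain B where B: "B > 0" "\<And>x. \<bar>\<phi> x\<bar> \<le> B" using C1c_bounded[OF C] by metis
 have "pint p lebesgue \<phi> \<le> (\<integral>\<^sup>+x. ennreal (B powr p) * indicator (cball (0::'a) R) x \<partial>lebesgue)"
  unfolding pint_def
 proof (rule nn_integral_mono)
  fix x
  show "ennreal (norm (\<phi> x) powr p) \<le> ennreal (B powr p) * indicator (cball (0::'a) R) x"
   using B C p by (cases "norm x \<le> R") (auto simp: C1c_def intro!: ennreal_leI powr_mono2)
 qed
 also have "\<dots> < \<infinity>" using R by (simp add: nn_integral_completion nn_integral_cmult_indicator emeasure_cball ennreal_mult_less_top)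
 finally show ?thesis .
qed

lemma frac_grad_pint: "test_fun \<Omega> \<phi> \<Longrightarrow> pint p lebesgue (frac_grad s \<phi>) < \<infinity>"
 using fgrad_Lp[OF test_C1c s R p] by (simp add: pint_def frac_grad_test nn_integral_completion)

lemma frac_grad_lin:
 assumes f: "test_fun \<Omega> f" and g: "test_fun \<Omega> g"
 shows "frac_grad s (\<lambda>x. c * f x + d * g x) = (\<lambda>x. c *\<^sub>R frac_grad s f x + d *\<^sub>R frac_grad s g x)"
proof -
 have sm: "smooth_fun f" "smooth_fun g" using f g by (auto simp: test_fun_def)
 have "fgrad s (\<lambda>x. c *\<^sub>R grad f x + d *\<^sub>R grad g x) = (\<lambda>x. c *\<^sub>R fgrad s (grad f) x + d *\<^sub>R fgrad s (grad g) x)"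
  using riesz_grad_lin[OF test_C1c[OF f] test_C1c[OF g], of s c d] s by (auto simp: fgrad_def)
 then show ?thesis
  by (simp add: frac_grad_test f g test_fun_lin grad_lin[OF sm])
qed

text \<open>\<open>Lambda0\<close> with extended-valued integrals: convergence to 0 then cannot be
  confused with the value 0 that a non-integrable function has as Bochner integral.\<close>

definition Lam :: "('a \<Rightarrow> real) \<Rightarrow> ('a \<Rightarrow> 'a) \<Rightarrow> bool" where
 "Lam u G \<longleftrightarrow> u \<in> borel_measurable lebesgue \<and> G \<in> borel_measurable lebesgue \<and>
  pint p lebesgue u < \<infinity> \<and> pint p lebesgue G < \<infinity> \<and>
  (\<exists>\<phi>. (\<forall>n::nat. test_fun \<Omega> (\<phi> n)) \<and> (\<lambda>n. pint p lebesgue (\<lambda>x. \<phi> n x - u x)) \<longlonglongrightarrow> 0 \<and>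
   (\<lambda>n. pint p lebesgue (\<lambda>x. frac_grad s (\<phi> n) x - G x)) \<longlonglongrightarrow> 0)"

lemma pint_diff_finite:
 fixes F G :: "'b \<Rightarrow> 'c::{banach, second_countable_topology}"
 assumes [measurable]: "F \<in> borel_measurable M" "G \<in> borel_measurable M" and "pint p M F < \<infinity>" "pint p M G < \<infinity>"
 shows "pint p M (\<lambda>x. F x - G x) < \<infinity>"
proof -
 have "pint p M (\<lambda>x. F x - G x) \<le> ennreal (2 powr p) * (pint p M (\<lambda>x. F x - 0) + pint p M (\<lambda>x. 0 - G x))"
  by (rule pint_triangle[OF _ _ _ p0]) auto
 also have "\<dots> < \<infinity>" using assms(3,4) by (simp add: ennreal_mult_less_top pint_def)
 finally show ?thesis .
qed

lemma integral_tendsto_0_iff_pint: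
 fixes F :: "nat \<Rightarrow> 'b \<Rightarrow> 'c::{banach, second_countable_topology}"
 assumes "\<And>n. F n \<in> borel_measurable M" "\<And>n. pint p M (F n) < \<infinity>"
 shows "(\<lambda>n. \<integral>x. norm (F n x) powr p \<partial>M) \<longlonglongrightarrow> 0 \<longleftrightarrow> (\<lambda>n. pint p M (F n)) \<longlonglongrightarrow> 0"
proof -
 have "(\<lambda>n. pint p M (F n)) = (\<lambda>n. ennreal (\<integral>x. norm (F n x) powr p \<partial>M))"
  using pint_eq_integral[OF assms] by auto
 moreover have "(\<lambda>n. ennreal (\<integral>x. norm (F n x) powr p \<partial>M)) \<longlonglongrightarrow> ennreal 0 \<longleftrightarrow> (\<lambda>n. \<integral>x. norm (F n x) powr p \<partial>M) \<longlonglongrightarrow> 0"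
  by (intro tendsto_ennreal_iff) auto
 ultimately show ?thesis by simp
qed

text \<open>The two forms agree because test functions and their fractional gradients have finite
  p-th power integrals, so every difference in the approximation is integrable and the default value
  never occurs.\<close>

lemma Lambda0_iff: "Lambda0 s p \<Omega> u G \<longleftrightarrow> Lam u G"
proof -
 have 1: "Lp_on p UNIV u \<longleftrightarrow> u \<in> borel_measurable lebesgue \<and> pint p lebesgue u < \<infinity>"
  using pint_integrable[of u lebesgue p] by (auto simp: Lp_on_def)
 have 2: "Lp_vec p G \<longleftrightarrow> G \<in> borel_measurable lebesgue \<and> pint p lebesgue G < \<infinity>"
  using pint_integrable[of G lebesgue p] by (auto simp: Lp_vec_def)
 show ?thesis
 proof (cases "u \<in> borel_measurable lebesgue \<and> G \<in> borel_measurable lebesgue \<and> pint p lebesgue u < \<infinity> \<and> pint p lebesgue G < \<infinity>")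
  case True
  then have [measurable]: "u \<in> borel_measurable lebesgue" "G \<in> borel_measurable lebesgue"
   and fin: "pint p lebesgue u < \<infinity>" "pint p lebesgue G < \<infinity>" by auto
  have "((\<lambda>n. LINT x|lebesgue. \<bar>\<phi> n x - u x\<bar> powr p) \<longlonglongrightarrow> 0 \<longleftrightarrow> (\<lambda>n. pint p lebesgue (\<lambda>x. \<phi> n x - u x)) \<longlonglongrightarrow> 0) \<and>
   ((\<lambda>n. LINT x|lebesgue. norm (frac_grad s (\<phi> n) x - G x) powr p) \<longlonglongrightarrow> 0 \<longleftrightarrow> (\<lambda>n. pint p lebesgue (\<lambda>x. frac_grad s (\<phi> n) x - G x)) \<longlonglongrightarrow> 0)"
   if t: "\<forall>n. test_fun \<Omega> (\<phi> n)" for \<phi> :: "nat \<Rightarrow> 'a \<Rightarrow> real"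
  proof -
   have [measurable]: "\<phi> n \<in> borel_measurable lebesgue" "frac_grad s (\<phi> n) \<in> borel_measurable lebesgue" for n
    using t test_measurable frac_grad_measurable by auto
   have "pint p lebesgue (\<lambda>x. \<phi> n x - u x) < \<infinity>" "pint p lebesgue (\<lambda>x. frac_grad s (\<phi> n) x - G x) < \<infinity>" for n
    by (rule pint_diff_finite[OF _ _ test_pint[OF t[rule_format]] fin(1)], measurable)
     (rule pint_diff_finite[OF _ _ frac_grad_pint[OF t[rule_format]] fin(2)], measurable)
   then show ?thesis
    using integral_tendsto_0_iff_pint[of "\<lambda>n x. \<phi> n x - u x" lebesgue] integral_tendsto_0_iff_pint[of "\<lambda>n x. frac_grad s (\<phi> n) x - G x" lebesgue]
    by simp
  qed
  note eqv = this
  have ex: "(\<exists>\<phi>. (\<forall>n. test_fun \<Omega> (\<phi> n)) \<and> (\<lambda>n. LINT x|lebesgue. \<bar>\<phi> n x - u x\<bar> powr p) \<longlonglongrightarrow> 0 \<and>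
    (\<lambda>n. LINT x|lebesgue. norm (frac_grad s (\<phi> n) x - G x) powr p) \<longlonglongrightarrow> 0) \<longleftrightarrow>
   (\<exists>\<phi>. (\<forall>n::nat. test_fun \<Omega> (\<phi> n)) \<and> (\<lambda>n. pint p lebesgue (\<lambda>x. \<phi> n x - u x)) \<longlonglongrightarrow> 0 \<and>
    (\<lambda>n. pint p lebesgue (\<lambda>x. frac_grad s (\<phi> n) x - G x)) \<longlonglongrightarrow> 0)"
  proof (rule iff_exI)
   fix \<phi> :: "nat \<Rightarrow> 'a \<Rightarrow> real"
   have taut: "(T \<and> A \<and> B) = (T \<and> A' \<and> B')" if "T \<Longrightarrow> (A \<longleftrightarrow> A') \<and> (B \<longleftrightarrow> B')" for T A A' B B'
    using that by blast
   show "((\<forall>n. test_fun \<Omega> (\<phi> n)) \<and> (\<lambda>n. LINT x|lebesgue. \<bar>\<phi> n x - u x\<bar> powr p) \<longlonglongrightarrow> 0 \<and>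
     (\<lambda>n. LINT x|lebesgue. norm (frac_grad s (\<phi> n) x - G x) powr p) \<longlonglongrightarrow> 0) =
    ((\<forall>n. test_fun \<Omega> (\<phi> n)) \<and> (\<lambda>n. pint p lebesgue (\<lambda>x. \<phi> n x - u x)) \<longlonglongrightarrow> 0 \<and>
     (\<lambda>n. pint p lebesgue (\<lambda>x. frac_grad s (\<phi> n) x - G x)) \<longlonglongrightarrow> 0)"
    by (rule taut) (rule eqv)
  qed
  have taut: "((a \<and> b) \<and> (c \<and> d) \<and> X) = (a \<and> c \<and> b \<and> d \<and> X)" for a b c d X by blast
  show ?thesis unfolding Lambda0_def Lam_def 1 2 ex by (rule taut)
 next
  case False
  have taut: "((a \<and> b) \<and> (c \<and> d) \<and> X) = (a \<and> c \<and> b \<and> d \<and> Y)" if "\<not> (a \<and> c \<and> b \<and> d)" for a b c d X Y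
   using that by blast
  show ?thesis unfolding Lambda0_def Lam_def 1 2 by (rule taut[OF False])
 qed
qed

lemma Lam_measurable: "Lam u G \<Longrightarrow> u \<in> borel_measurable lebesgue" "Lam u G \<Longrightarrow> G \<in> borel_measurable lebesgue"
 by (auto simp: Lam_def)

lemma Lam_pint: "Lam u G \<Longrightarrow> pint p lebesgue u < \<infinity>" "Lam u G \<Longrightarrow> pint p lebesgue G < \<infinity>"
 by (auto simp: Lam_def)

lemma Lam_test: "test_fun \<Omega> \<phi> \<Longrightarrow> Lam \<phi> (frac_grad s \<phi>)"
 unfolding Lam_def
 by (intro conjI exI[of _ "\<lambda>n. \<phi>"] test_measurable frac_grad_measurable test_pint frac_grad_pint) (simp_all add: pint_def)

lemma tendsto_ennreal_cmult_0:
 fixes f :: "nat \<Rightarrow> ennreal"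
 assumes "f \<longlonglongrightarrow> 0" "c < \<infinity>"
 shows "(\<lambda>n. c * f n) \<longlonglongrightarrow> 0"
 using ennreal_tendsto_cmult[of c f 0 sequentially] assms by simp

lemma pint_lin_tendsto:
 fixes F H :: "nat \<Rightarrow> 'b \<Rightarrow> 'c::{banach, second_countable_topology}"
 assumes [measurable]: "\<And>n. F n \<in> borel_measurable M" "\<And>n. H n \<in> borel_measurable M"
  and F: "(\<lambda>n. pint p M (F n)) \<longlonglongrightarrow> 0" and H: "(\<lambda>n. pint p M (H n)) \<longlonglongrightarrow> 0"
 shows "(\<lambda>n. pint p M (\<lambda>x. c *\<^sub>R F n x + d *\<^sub>R H n x)) \<longlonglongrightarrow> 0"
proof (rule tendsto_sandwich[OF _ _ tendsto_const])
 show "\<forall>\<^sub>F n in sequentially. pint p M (\<lambda>x. c *\<^sub>R F n x + d *\<^sub>R H n x)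
   \<le> ennreal (2 powr p) * (ennreal (\<bar>c\<bar> powr p) * pint p M (F n) + ennreal (\<bar>d\<bar> powr p) * pint p M (H n))"
 proof (intro always_eventually allI)
  fix n
  show "pint p M (\<lambda>x. c *\<^sub>R F n x + d *\<^sub>R H n x) \<le> ennreal (2 powr p) * (ennreal (\<bar>c\<bar> powr p) * pint p M (F n) + ennreal (\<bar>d\<bar> powr p) * pint p M (H n))"
   unfolding pint_scale[OF assms(1), symmetric] pint_scale[OF assms(2), symmetric]
   by (rule pint_add_le[OF _ _ p0]) measurable
 qed
 have "(\<lambda>n. ennreal (\<bar>c\<bar> powr p) * pint p M (F n) + ennreal (\<bar>d\<bar> powr p) * pint p M (H n)) \<longlonglongrightarrow> 0 + 0"
  by (intro tendsto_add tendsto_ennreal_cmult_0 F H) simp_all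
 then show "(\<lambda>n. ennreal (2 powr p) * (ennreal (\<bar>c\<bar> powr p) * pint p M (F n) + ennreal (\<bar>d\<bar> powr p) * pint p M (H n))) \<longlonglongrightarrow> 0"
  by (intro tendsto_ennreal_cmult_0) simp_all
qed simp

lemma pint_lin_finite:
 fixes F H :: "'b \<Rightarrow> 'c::{banach, second_countable_topology}"
 assumes [measurable]: "F \<in> borel_measurable M" "H \<in> borel_measurable M" and "pint p M F < \<infinity>" "pint p M H < \<infinity>"
 shows "pint p M (\<lambda>x. c *\<^sub>R F x + d *\<^sub>R H x) < \<infinity>"
proof -
 have "pint p M (\<lambda>x. c *\<^sub>R F x + d *\<^sub>R H x) \<le> ennreal (2 powr p) * (pint p M (\<lambda>x. c *\<^sub>R F x) + pint p M (\<lambda>x. d *\<^sub>R H x))"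
  by (rule pint_add_le[OF _ _ p0]) auto
 also have "\<dots> < \<infinity>" using assms(3,4) by (simp add: pint_scale ennreal_mult_less_top)
 finally show ?thesis .
qed

lemma Lam_lin:
 assumes u: "Lam u G" and w: "Lam w H"
 shows "Lam (\<lambda>x. c * u x + d * w x) (\<lambda>x. c *\<^sub>R G x + d *\<^sub>R H x)"
proof -
 note [measurable] = Lam_measurable[OF u] Lam_measurable[OF w]
 obtain \<phi> where \<phi>: "\<And>n::nat. test_fun \<Omega> (\<phi> n)" "(\<lambda>n. pint p lebesgue (\<lambda>x. \<phi> n x - u x)) \<longlonglongrightarrow> 0"
   "(\<lambda>n. pint p lebesgue (\<lambda>x. frac_grad s (\<phi> n) x - G x)) \<longlonglongrightarrow> 0"
  using u unfolding Lam_def by blast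
 obtain \<psi> where \<psi>: "\<And>n::nat. test_fun \<Omega> (\<psi> n)" "(\<lambda>n. pint p lebesgue (\<lambda>x. \<psi> n x - w x)) \<longlonglongrightarrow> 0"
   "(\<lambda>n. pint p lebesgue (\<lambda>x. frac_grad s (\<psi> n) x - H x)) \<longlonglongrightarrow> 0"
  using w unfolding Lam_def by blast
 note [measurable] = test_measurable[OF \<phi>(1)] test_measurable[OF \<psi>(1)] frac_grad_measurable[OF \<phi>(1)] frac_grad_measurable[OF \<psi>(1)]
 have "(\<lambda>n. pint p lebesgue (\<lambda>x. c *\<^sub>R (\<phi> n x - u x) + d *\<^sub>R (\<psi> n x - w x))) \<longlonglongrightarrow> 0"
  by (rule pint_lin_tendsto[OF _ _ \<phi>(2) \<psi>(2)]) measurable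
 then have A: "(\<lambda>n. pint p lebesgue (\<lambda>x. (c * \<phi> n x + d * \<psi> n x) - (c * u x + d * w x))) \<longlonglongrightarrow> 0"
  by (simp add: algebra_simps)
 have "(\<lambda>n. pint p lebesgue (\<lambda>x. c *\<^sub>R (frac_grad s (\<phi> n) x - G x) + d *\<^sub>R (frac_grad s (\<psi> n) x - H x))) \<longlonglongrightarrow> 0"
  by (rule pint_lin_tendsto[OF _ _ \<phi>(3) \<psi>(3)]) measurable
 then have B: "(\<lambda>n. pint p lebesgue (\<lambda>x. frac_grad s (\<lambda>x. c * \<phi> n x + d * \<psi> n x) x - (c *\<^sub>R G x + d *\<^sub>R H x))) \<longlonglongrightarrow> 0"
  by (simp add: frac_grad_lin[OF \<phi>(1) \<psi>(1)] algebra_simps)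
 have "pint p lebesgue (\<lambda>x. c * u x + d * w x) < \<infinity>"
  using pint_lin_finite[of u lebesgue w c d] Lam_pint[OF u] Lam_pint[OF w] by simp
 moreover have "pint p lebesgue (\<lambda>x. c *\<^sub>R G x + d *\<^sub>R H x) < \<infinity>"
  using pint_lin_finite[of G lebesgue H c d] Lam_pint[OF u] Lam_pint[OF w] by simp
 moreover have "(\<lambda>x. c * u x + d * w x) \<in> borel_measurable lebesgue" "(\<lambda>x. c *\<^sub>R G x + d *\<^sub>R H x) \<in> borel_measurable lebesgue"
  by measurable
 moreover have "\<forall>n. test_fun \<Omega> (\<lambda>x. c * \<phi> n x + d * \<psi> n x)" using \<phi>(1) \<psi>(1) by (auto intro: test_fun_lin)
 ultimately show ?thesis
  unfolding Lam_def using A B by (intro conjI exI[of _ "\<lambda>n x. c * \<phi> n x + d * \<psi> n x"]) auto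
qed

lemma Lam_diff: "Lam u G \<Longrightarrow> Lam w H \<Longrightarrow> Lam (\<lambda>x. u x - w x) (\<lambda>x. G x - H x)"
 using Lam_lin[of u G w H 1 "-1"] by simp

lemma Lam_zero: "Lam u G \<Longrightarrow> Lam (\<lambda>x. 0) (\<lambda>x. 0)"
 using Lam_diff[of u G u G] by simp

text \<open>Only test functions obey the pointwise estimates; the passage to the closure costs a constant factor.\<close>

lemma Lam_approx:
 assumes u: "Lam u G" and N: "N > 0" "pint p lebesgue G \<le> ennreal (N powr p)"
 obtains \<phi> where "\<And>n::nat. test_fun \<Omega> (\<phi> n)" "AE x in lebesgue. (\<lambda>n. \<phi> n x) \<longlonglongrightarrow> u x"
  "\<And>n. fgrad_le s p (grad (\<phi> n)) (2 powr (1 + 1 / p) * N)"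
proof -
 note [measurable] = Lam_measurable[OF u]
 obtain \<phi> where \<phi>: "\<And>n::nat. test_fun \<Omega> (\<phi> n)" "(\<lambda>n. pint p lebesgue (\<lambda>x. \<phi> n x - u x)) \<longlonglongrightarrow> 0"
   "(\<lambda>n. pint p lebesgue (\<lambda>x. frac_grad s (\<phi> n) x - G x)) \<longlonglongrightarrow> 0"
  using u unfolding Lam_def by blast
 note [measurable] = test_measurable[OF \<phi>(1)] frac_grad_measurable[OF \<phi>(1)]
 have "eventually (\<lambda>n. pint p lebesgue (\<lambda>x. frac_grad s (\<phi> n) x - G x) < ennreal (N powr p)) sequentially"
  using \<phi>(3) by (rule order_tendstoD) (use N in simp)
 then obtain n0 where n0: "\<And>n. n \<ge> n0 \<Longrightarrow> pint p lebesgue (\<lambda>x. frac_grad s (\<phi> n) x - G x) < ennreal (N powr p)"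
  by (auto simp: eventually_sequentially)
 have "(\<lambda>n. pint p lebesgue (\<lambda>x. \<phi> (n + n0) x - u x)) \<longlonglongrightarrow> 0"
  using \<phi>(2) by (rule LIMSEQ_ignore_initial_segment)
 then obtain r where r: "strict_mono r" "AE x in lebesgue. (\<lambda>n. \<phi> (r n + n0) x) \<longlonglongrightarrow> u x"
  by (rule pint_tendsto_AE_subseq[rotated 3]) (use p0 in auto)
 show ?thesis
 proof (rule that[of "\<lambda>n. \<phi> (r n + n0)"])
  fix n
  let ?\<phi> = "\<phi> (r n + n0)"
  have "pint p lebesgue (frac_grad s ?\<phi>) \<le> ennreal (2 powr p) * (pint p lebesgue (\<lambda>x. frac_grad s ?\<phi> x - G x) + pint p lebesgue G)"
   using pint_add_le[of "\<lambda>x. frac_grad s ?\<phi> x - G x" lebesgue G p] p0 by simp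
  also have "\<dots> \<le> ennreal (2 powr p) * (ennreal (N powr p) + ennreal (N powr p))"
   by (intro mult_left_mono add_mono N less_imp_le[OF n0]) simp_all
  \<comment> \<open>In 2^(p+1) N^p the power 2^p comes from the quasi-triangle inequality and one
    more factor 2 from the two equal summands.\<close>
  also have "\<dots> = ennreal ((2 powr (1 + 1 / p) * N) powr p)"
  proof -
   have "(2::real) powr ((1 + 1 / p) * p) = 2 powr p * 2"
    using p0 by (simp add: distrib_right powr_add)
   then show ?thesis by (simp add: ennreal_plus[symmetric] ennreal_mult[symmetric] powr_mult powr_powr del: ennreal_plus)
  qed
  finally show "fgrad_le s p (grad ?\<phi>) (2 powr (1 + 1 / p) * N)"
   using N(1) by (simp add: fgrad_le_def pint_def frac_grad_test[OF \<phi>(1)] nn_integral_completion)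
 qed (use \<phi> r in auto)
qed

text \<open>Fatou along an almost everywhere convergent sequence of test functions with controlled
  gradients. The constant is made positive because it is divided by later.\<close>

lemma ex_Lam_Poincare:
 "\<exists>C>0. \<forall>u G N. Lam u G \<longrightarrow> N > 0 \<longrightarrow> pint p lebesgue G \<le> ennreal (N powr p) \<longrightarrow> pint p lebesgue u \<le> ennreal (C * N powr p)"
proof -
 obtain C where C: "C \<ge> 0" "\<And>(\<phi>::'a \<Rightarrow> real) G N. C1c R \<phi> G \<Longrightarrow> fgrad_le s p G N \<Longrightarrow>
   (\<integral>\<^sup>+x. ennreal (\<bar>\<phi> x\<bar> powr p) \<partial>lborel) \<le> ennreal (C * N powr p)"
  using ex_Poincare[OF s R p, where 'a='a] by blast
 define K where "K = C * (2 powr (1 + 1 / p)) powr p"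
 have "pint p lebesgue u \<le> ennreal (K * N powr p)"
  if u: "Lam u G" and N: "N > 0" "pint p lebesgue G \<le> ennreal (N powr p)" for u G N
 proof -
  obtain \<phi> where \<phi>: "\<And>n::nat. test_fun \<Omega> (\<phi> n)" "AE x in lebesgue. (\<lambda>n. \<phi> n x) \<longlonglongrightarrow> u x"
   "\<And>n. fgrad_le s p (grad (\<phi> n)) (2 powr (1 + 1 / p) * N)"
   using Lam_approx[OF u N] by blast
  show ?thesis
  proof (rule pint_Fatou[OF test_measurable[OF \<phi>(1)] Lam_measurable(1)[OF u] p0 \<phi>(2)])
   show "\<forall>\<^sub>F n in sequentially. pint p lebesgue (\<phi> n) \<le> ennreal (K * N powr p)"
    using C(2)[OF test_C1c[OF \<phi>(1)] \<phi>(3)]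
    by (intro always_eventually allI) (simp add: pint_def nn_integral_completion K_def powr_mult mult.assoc)
  qed
 qed
 note bound = this
 have K0: "K \<ge> 0" using C(1) by (simp add: K_def)
 show ?thesis
 proof (intro exI[of _ "K + 1"] conjI allI impI)
  fix u G N assume a: "Lam u G" "0 < N" "pint p lebesgue G \<le> ennreal (N powr p)"
  have "pint p lebesgue u \<le> ennreal (K * N powr p)" by (rule bound[OF a])
  also have "\<dots> \<le> ennreal ((K + 1) * N powr p)" using a(2) by (intro ennreal_leI mult_right_mono) auto
  finally show "pint p lebesgue u \<le> ennreal ((K + 1) * N powr p)" .
 qed (use K0 in simp)
qed

text \<open>The same passage to the limit, Fatou being applied with exponent 1 to the products with
  \<open>h\<close>; the pairing with \<open>h\<close> is thus bounded on the whole closure.\<close>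

lemma ex_Lam_dual:
 assumes r: "1 < r" and h: "Lp_on (pSharp DIM('a) s p r) \<Omega> h"
 shows "\<exists>C>0. \<forall>u G N. Lam u G \<longrightarrow> N > 0 \<longrightarrow> pint p lebesgue G \<le> ennreal (N powr p) \<longrightarrow>
  (\<integral>\<^sup>+x. ennreal \<bar>indicator \<Omega> x * h x * u x\<bar> \<partial>lebesgue) \<le> ennreal (C * N)"
proof -
 obtain C where C: "C \<ge> 0" "\<And>(\<phi>::'a \<Rightarrow> real) G N. C1c R \<phi> G \<Longrightarrow> fgrad_le s p G N \<Longrightarrow>
   (\<integral>\<^sup>+x. ennreal \<bar>indicator \<Omega> x * h x * \<phi> x\<bar> \<partial>lebesgue) \<le> ennreal (C * N)"
  using ex_dual_bound[OF s R p r h] by blast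
 have [measurable]: "(\<lambda>x. indicator \<Omega> x * h x) \<in> borel_measurable lebesgue" using h by (simp add: Lp_on_def)
 define K where "K = C * 2 powr (1 + 1 / p)"
 have "(\<integral>\<^sup>+x. ennreal \<bar>indicator \<Omega> x * h x * u x\<bar> \<partial>lebesgue) \<le> ennreal (K * N)"
  if u: "Lam u G" and N: "N > 0" "pint p lebesgue G \<le> ennreal (N powr p)" for u G N
 proof -
  obtain \<phi> where \<phi>: "\<And>n::nat. test_fun \<Omega> (\<phi> n)" "AE x in lebesgue. (\<lambda>n. \<phi> n x) \<longlonglongrightarrow> u x"
   "\<And>n. fgrad_le s p (grad (\<phi> n)) (2 powr (1 + 1 / p) * N)"
   using Lam_approx[OF u N] by blast
  note [measurable] = test_measurable[OF \<phi>(1)] Lam_measurable(1)[OF u]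
  have "pint 1 lebesgue (\<lambda>x. indicator \<Omega> x * h x * u x) \<le> ennreal (K * N)"
  proof (rule pint_Fatou[where F="\<lambda>n x. indicator \<Omega> x * h x * \<phi> n x"])
   show "AE x in lebesgue. (\<lambda>n. indicator \<Omega> x * h x * \<phi> n x) \<longlonglongrightarrow> indicator \<Omega> x * h x * u x"
    using \<phi>(2) by eventually_elim (intro tendsto_intros)
   show "\<forall>\<^sub>F n in sequentially. pint 1 lebesgue (\<lambda>x. indicator \<Omega> x * h x * \<phi> n x) \<le> ennreal (K * N)"
    using C(2)[OF test_C1c[OF \<phi>(1)] \<phi>(3)]
    by (intro always_eventually allI) (simp add: pint_def K_def mult.assoc)
  qed auto
  then show ?thesis by (simp add: pint_def)
 qed
 note bound = this
 have K0: "K \<ge> 0" using C(1) by (simp add: K_def)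
 show ?thesis
 proof (intro exI[of _ "K + 1"] conjI allI impI)
  fix u G N assume a: "Lam u G" "0 < N" "pint p lebesgue G \<le> ennreal (N powr p)"
  have "(\<integral>\<^sup>+x. ennreal \<bar>indicator \<Omega> x * h x * u x\<bar> \<partial>lebesgue) \<le> ennreal (K * N)" by (rule bound[OF a])
  also have "\<dots> \<le> ennreal ((K + 1) * N)" using a(2) by (intro ennreal_leI mult_right_mono) auto
  finally show "(\<integral>\<^sup>+x. ennreal \<bar>indicator \<Omega> x * h x * u x\<bar> \<partial>lebesgue) \<le> ennreal ((K + 1) * N)" .
 qed (use K0 in simp)
qed

text \<open>Only the gradients are assumed Cauchy: the Poincare inequality carries this over to the
  functions. Each member is replaced by a test function within 1/(n+1), in both components, and
  these witness that the limit lies in the closure.\<close>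

lemma Lam_complete:
 assumes u: "\<And>n::nat. Lam (u n) (G n)"
  and Cauchy: "\<And>e. e > 0 \<Longrightarrow> \<exists>N. \<forall>m\<ge>N. \<forall>n\<ge>N. pint p lebesgue (\<lambda>x. G m x - G n x) \<le> ennreal e"
 obtains v H where "Lam v H" "(\<lambda>n. pint p lebesgue (\<lambda>x. u n x - v x)) \<longlonglongrightarrow> 0" "(\<lambda>n. pint p lebesgue (\<lambda>x. G n x - H x)) \<longlonglongrightarrow> 0"
proof -
 note [measurable] = Lam_measurable[OF u]
 obtain C where C: "C > 0" "\<And>u G N. Lam u G \<Longrightarrow> N > 0 \<Longrightarrow> pint p lebesgue G \<le> ennreal (N powr p) \<Longrightarrow> pint p lebesgue u \<le> ennreal (C * N powr p)"
  using ex_Lam_Poincare by blast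
 have Cu: "\<exists>N. \<forall>m\<ge>N. \<forall>n\<ge>N. pint p lebesgue (\<lambda>x. u m x - u n x) \<le> ennreal e" if e: "e > 0" for e
 proof -
  define N where "N = (e / C) powr (1 / p)"
  have N: "N > 0" "N powr p = e / C" using e C(1) p0 by (auto simp: N_def powr_powr)
  obtain n0 where n0: "\<And>m n. m \<ge> n0 \<Longrightarrow> n \<ge> n0 \<Longrightarrow> pint p lebesgue (\<lambda>x. G m x - G n x) \<le> ennreal (e / C)"
   using Cauchy[of "e / C"] e C(1) by auto
  have "pint p lebesgue (\<lambda>x. u m x - u n x) \<le> ennreal e" if "m \<ge> n0" "n \<ge> n0" for m n
   using C(2)[OF Lam_diff[OF u u] N(1)] n0[OF that] N(2) C(1) by simp
  then show ?thesis by blast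
 qed
 obtain v where v[measurable]: "v \<in> borel_measurable lebesgue" and lv: "(\<lambda>n. pint p lebesgue (\<lambda>x. u n x - v x)) \<longlonglongrightarrow> 0"
  by (rule Lp_complete[of u lebesgue p]) (use Cu p0 in auto)
 obtain H where H[measurable]: "H \<in> borel_measurable lebesgue" and lH: "(\<lambda>n. pint p lebesgue (\<lambda>x. G n x - H x)) \<longlonglongrightarrow> 0"
  by (rule Lp_complete[of G lebesgue p]) (use Cauchy p0 in auto)
 have fin: "pint p lebesgue V < \<infinity>" if [measurable]: "\<And>n. U n \<in> borel_measurable lebesgue" "V \<in> borel_measurable lebesgue"
  and U: "\<And>n. pint p lebesgue (U n) < \<infinity>" and l: "(\<lambda>n. pint p lebesgue (\<lambda>x. U n x - V x)) \<longlonglongrightarrow> 0"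
  for U :: "nat \<Rightarrow> 'a \<Rightarrow> 'c::{banach, second_countable_topology}" and V
 proof -
  have "eventually (\<lambda>n. pint p lebesgue (\<lambda>x. U n x - V x) < 1) sequentially"
   using l by (rule order_tendstoD) simp
  then obtain n where n: "pint p lebesgue (\<lambda>x. U n x - V x) < 1" by (auto simp: eventually_sequentially)
  have "pint p lebesgue (\<lambda>x. U n x - (U n x - V x)) < \<infinity>"
   by (rule pint_diff_finite) (use U n in \<open>auto intro: less_trans[OF _ ennreal_one_less_top]\<close>)
  then show ?thesis by simp
 qed
 have "\<exists>\<phi>. test_fun \<Omega> \<phi> \<and> pint p lebesgue (\<lambda>x. \<phi> x - u n x) \<le> ennreal (inverse (real (Suc n))) \<and>
   pint p lebesgue (\<lambda>x. frac_grad s \<phi> x - G n x) \<le> ennreal (inverse (real (Suc n)))" for n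
 proof -
  obtain \<phi> where \<phi>: "\<And>k::nat. test_fun \<Omega> (\<phi> k)" "(\<lambda>k. pint p lebesgue (\<lambda>x. \<phi> k x - u n x)) \<longlonglongrightarrow> 0"
   "(\<lambda>k. pint p lebesgue (\<lambda>x. frac_grad s (\<phi> k) x - G n x)) \<longlonglongrightarrow> 0"
   using u[of n] unfolding Lam_def by blast
  have "0 < ennreal (inverse (real (Suc n)))" by simp
  then have "eventually (\<lambda>k. pint p lebesgue (\<lambda>x. \<phi> k x - u n x) < ennreal (inverse (real (Suc n))) \<and>
    pint p lebesgue (\<lambda>x. frac_grad s (\<phi> k) x - G n x) < ennreal (inverse (real (Suc n)))) sequentially"
   using order_tendstoD(2)[OF \<phi>(2)] order_tendstoD(2)[OF \<phi>(3)] by (intro eventually_conj) auto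
  then obtain k where "pint p lebesgue (\<lambda>x. \<phi> k x - u n x) < ennreal (inverse (real (Suc n))) \<and>
    pint p lebesgue (\<lambda>x. frac_grad s (\<phi> k) x - G n x) < ennreal (inverse (real (Suc n)))"
   by (auto simp: eventually_sequentially)
  then show ?thesis using \<phi>(1) less_imp_le by blast
 qed
 then obtain \<phi> where \<phi>: "\<And>n. test_fun \<Omega> (\<phi> n)" "\<And>n. pint p lebesgue (\<lambda>x. \<phi> n x - u n x) \<le> ennreal (inverse (real (Suc n)))"
   "\<And>n. pint p lebesgue (\<lambda>x. frac_grad s (\<phi> n) x - G n x) \<le> ennreal (inverse (real (Suc n)))"
  by metis
 note [measurable] = test_measurable[OF \<phi>(1)] frac_grad_measurable[OF \<phi>(1)]
 have inv0: "(\<lambda>n. ennreal (inverse (real (Suc n)))) \<longlonglongrightarrow> 0"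
  using tendsto_ennrealI[OF LIMSEQ_inverse_real_of_nat] by simp
 have conv: "(\<lambda>n. pint p lebesgue (\<lambda>x. A n x - V x)) \<longlonglongrightarrow> 0"
  if [measurable]: "\<And>n. A n \<in> borel_measurable lebesgue" "\<And>n. U n \<in> borel_measurable lebesgue" "V \<in> borel_measurable lebesgue"
  and A: "\<And>n. pint p lebesgue (\<lambda>x. A n x - U n x) \<le> ennreal (inverse (real (Suc n)))"
  and l: "(\<lambda>n. pint p lebesgue (\<lambda>x. U n x - V x)) \<longlonglongrightarrow> 0"
  for A U :: "nat \<Rightarrow> 'a \<Rightarrow> 'c::{banach, second_countable_topology}" and V
 proof -
  have A0: "(\<lambda>n. pint p lebesgue (\<lambda>x. A n x - U n x)) \<longlonglongrightarrow> 0"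
   by (rule tendsto_sandwich[OF _ _ tendsto_const inv0]) (use A in auto)
  have "(\<lambda>n. pint p lebesgue (\<lambda>x. 1 *\<^sub>R (A n x - U n x) + 1 *\<^sub>R (U n x - V x))) \<longlonglongrightarrow> 0"
   by (rule pint_lin_tendsto[OF _ _ A0 l]) measurable
  then show ?thesis by simp
 qed
 have "Lam v H"
  unfolding Lam_def
  using fin[of u v] fin[of G H] lv lH Lam_pint[OF u] conv[of \<phi> u v] conv[of "\<lambda>n. frac_grad s (\<phi> n)" G H] \<phi> v H
  by (intro conjI exI[of _ \<phi>]) auto
 then show ?thesis using lv lH by (rule that)
qed

end

context frac_space begin

subsection \<open>Minimisation\<close>

lemma test_fun_zero: "test_fun \<Omega> (\<lambda>x. 0)"
proof -
 have "fold partial_dir bs (\<lambda>x::'a. 0 :: real) = (\<lambda>x. 0)" for bs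
  by (induction bs) (auto simp: partial_dir_def)
 then show ?thesis by (simp add: test_fun_def smooth_fun_def)
qed

lemma Lam_0: "Lam (\<lambda>x. 0) (\<lambda>x. 0)"
 using Lam_zero[OF Lam_test[OF test_fun_zero]] .

definition penergy :: "('a \<Rightarrow> 'a) \<Rightarrow> real" where
 "penergy G = (\<integral>x. norm (G x) powr p \<partial>lebesgue)"

lemma penergy_nonneg: "penergy G \<ge> 0"
 by (simp add: penergy_def)

lemma Lam_integrable: "Lam u G \<Longrightarrow> integrable lebesgue (\<lambda>x. norm (G x) powr p)"
 using Lam_measurable(2) Lam_pint(2) by (simp add: pint_integrable)

lemma pint_eq_penergy: "Lam u G \<Longrightarrow> pint p lebesgue G = ennreal (penergy G)"
 unfolding penergy_def using Lam_measurable(2) Lam_pint(2) by (rule pint_eq_integral)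

text \<open>Lipschitz with respect to the gradient norm alone, \<open>N\<close> being any bound for
  the distance. Minimisation is developed for an abstract lower-order term of this kind, since it is
  applied both to the regularised terms and to the limiting one.\<close>

definition Lipschitz_on_Lam :: "(('a \<Rightarrow> real) \<Rightarrow> real) \<Rightarrow> bool" where
 "Lipschitz_on_Lam F \<longleftrightarrow> (\<exists>L>0. \<forall>u G w H N. Lam u G \<longrightarrow> Lam w H \<longrightarrow> N > 0 \<longrightarrow>
   pint p lebesgue (\<lambda>x. G x - H x) \<le> ennreal (N powr p) \<longrightarrow> \<bar>F u - F w\<bar> \<le> L * N)"

definition midconvex_on_Lam :: "(('a \<Rightarrow> real) \<Rightarrow> real) \<Rightarrow> bool" where
 "midconvex_on_Lam F \<longleftrightarrow> (\<forall>u G w H. Lam u G \<longrightarrow> Lam w H \<longrightarrow> F (\<lambda>x. (1/2) * u x + (1/2) * w x) \<le> (F u + F w) / 2)"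

definition energy :: "(('a \<Rightarrow> real) \<Rightarrow> real) \<Rightarrow> ('a \<Rightarrow> real) \<Rightarrow> ('a \<Rightarrow> 'a) \<Rightarrow> real" where
 "energy F u G = penergy G / p + F u"

text \<open>The lower-order term grows at most like the gradient norm, which Young's inequality
  bounds by half of the p-energy term plus a constant.\<close>

lemma energy_coercive:
 assumes F: "Lipschitz_on_Lam F"
 shows "\<exists>m. \<forall>u G. Lam u G \<longrightarrow> m + penergy G / (2 * p) \<le> energy F u G"
proof -
 obtain L where L: "L > 0" "\<And>u G w H N. Lam u G \<Longrightarrow> Lam w H \<Longrightarrow> N > 0 \<Longrightarrow>
   pint p lebesgue (\<lambda>x. G x - H x) \<le> ennreal (N powr p) \<Longrightarrow> \<bar>F u - F w\<bar> \<le> L * N"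
  using F unfolding Lipschitz_on_Lam_def by blast
 define q where "q = p / (p - 1)"
 have q: "q > 1" "1 / p + 1 / q = 1" using p by (auto simp: q_def field_simps)
 \<comment> \<open>The constant in Young's inequality for the factors ((I+1)/2)^(1/p) and 2^(1/p) L,
   whose product is L N.\<close>
 define K where "K = (2 powr (1 / p) * L) powr q / q"
 define m where "m = F (\<lambda>x. 0) - 1 / (2 * p) - K"
 have "m + penergy G / (2 * p) \<le> energy F u G" if u: "Lam u G" for u G
 proof -
  define I where "I = penergy G"
  have I: "I \<ge> 0" by (simp add: I_def penergy_nonneg)
  define N where "N = (I + 1) powr (1 / p)"
  have N: "N > 0" "N powr p = I + 1" using I p by (auto simp: N_def powr_powr)
  have "\<bar>F u - F (\<lambda>x. 0)\<bar> \<le> L * N"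
  proof (rule L(2)[OF u Lam_0 N(1)])
   have "pint p lebesgue (\<lambda>x. G x - 0) = ennreal I" by (simp add: pint_eq_penergy[OF u] I_def)
   then show "pint p lebesgue (\<lambda>x. G x - 0) \<le> ennreal (N powr p)" using N(2) by (simp add: ennreal_leI)
  qed
  moreover have "L * N \<le> (I + 1) / (2 * p) + K"
  proof -
   have "(((I + 1) / 2) powr (1 / p)) * (2 powr (1 / p) * L)
    \<le> (((I + 1) / 2) powr (1 / p)) powr p / p + (2 powr (1 / p) * L) powr q / q"
    by (rule Youngs_inequality) (use p q L(1) in auto)
   also have "(((I + 1) / 2) powr (1 / p)) powr p / p = (I + 1) / (2 * p)"
    using p I by (simp add: powr_powr)
   also have "(((I + 1) / 2) powr (1 / p)) * (2 powr (1 / p) * L) = L * N"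
   proof -
    have "((I + 1) / 2) powr (1 / p) * 2 powr (1 / p) = N"
     unfolding N_def by (subst powr_mult[symmetric]) (rule arg_cong[of _ _ "\<lambda>t. t powr (1 / p)"], simp)
    then show ?thesis by (metis mult.assoc mult.commute)
   qed
   finally show ?thesis by (simp add: K_def)
  qed
  ultimately have "F u \<ge> F (\<lambda>x. 0) - (I + 1) / (2 * p) - K" by linarith
  moreover have "I / p = I / (2 * p) + I / (2 * p)" "(I + 1) / (2 * p) = I / (2 * p) + 1 / (2 * p)"
   using p by (simp_all add: field_simps)
  ultimately show ?thesis unfolding energy_def m_def I_def[symmetric] by linarith
 qed
 then show ?thesis by blast
qed

text \<open>The midpoint of two members is admissible, so its energy is at least m; by midpoint
  convexity of \<open>F\<close> the excess energy of the two bounds the integral of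
  \<open>cgap\<close>. Uniform convexity turns this into a Cauchy condition for the gradients. The
  limit attains m by continuity of \<open>F\<close> and Fatou for the p-energy.\<close>

lemma minimizing_sequence:
 assumes Lip: "Lipschitz_on_Lam F" and mid: "midconvex_on_Lam F"
  and u: "\<And>n::nat. Lam (u n) (G n)" and lim: "(\<lambda>n. energy F (u n) (G n)) \<longlonglongrightarrow> m"
  and lower: "\<And>u G. Lam u G \<Longrightarrow> m \<le> energy F u G"
 obtains v H where "Lam v H" "(\<lambda>n. pint p lebesgue (\<lambda>x. u n x - v x)) \<longlonglongrightarrow> 0"
  "(\<lambda>n. pint p lebesgue (\<lambda>x. G n x - H x)) \<longlonglongrightarrow> 0" "energy F v H \<le> m"
proof -
 note [measurable] = Lam_measurable[OF u]
 let ?E = "\<lambda>n. energy F (u n) (G n)"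
 obtain m0 where m0: "\<And>u G. Lam u G \<Longrightarrow> m0 + penergy G / (2 * p) \<le> energy F u G"
  using energy_coercive[OF Lip] by blast
 obtain M where M': "\<And>x. x \<in> range ?E \<Longrightarrow> norm x \<le> M"
  using convergent_imp_bounded[OF lim] unfolding bounded_iff by blast
 have M: "?E n \<le> M" for n using M'[OF rangeI, of n] by simp
 define B where "B = 2 * p * (M - m0)"
 have B: "penergy (G n) \<le> B" for n
 proof -
  have "penergy (G n) / (2 * p) \<le> M - m0" using m0[OF u, of n] M[of n] by linarith
  then show ?thesis using p by (simp add: B_def pos_divide_le_eq mult.commute)
 qed
 have B0: "B \<ge> 0" using B[of 0] penergy_nonneg[of "G 0"] by linarith
 have gap: "(\<integral>x. cgap p (G k x) (G n x) \<partial>lebesgue) \<le> p * ((?E k + ?E n) / 2 - m)"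
  and gapi: "integrable lebesgue (\<lambda>x. cgap p (G k x) (G n x))" for k n
 proof -
  define Z where "Z x = (1/2) *\<^sub>R G k x + (1/2) *\<^sub>R G n x" for x
  have Z: "Lam (\<lambda>x. (1/2) * u k x + (1/2) * u n x) Z" unfolding Z_def by (rule Lam_lin[OF u u])
  have eq: "cgap p (G k x) (G n x) = (norm (G k x) powr p + norm (G n x) powr p) / 2 - norm (Z x) powr p" for x
   by (simp add: cgap_def Z_def scaleR_add_right)
  show "integrable lebesgue (\<lambda>x. cgap p (G k x) (G n x))"
   unfolding eq by (intro Bochner_Integration.integrable_diff integrable_divide Bochner_Integration.integrable_add Lam_integrable[OF u] Lam_integrable[OF Z])
  have "(\<integral>x. cgap p (G k x) (G n x) \<partial>lebesgue) = (penergy (G k) + penergy (G n)) / 2 - penergy Z"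
   unfolding eq penergy_def
   by (subst Bochner_Integration.integral_diff)
    (simp_all add: Lam_integrable[OF u] Lam_integrable[OF Z])
  moreover have "p * m \<le> penergy Z + p * ((F (u k) + F (u n)) / 2)"
  proof -
   have "F (\<lambda>x. (1/2) * u k x + (1/2) * u n x) \<le> (F (u k) + F (u n)) / 2"
    using mid u unfolding midconvex_on_Lam_def by blast
   then have "m \<le> penergy Z / p + (F (u k) + F (u n)) / 2"
    using lower[OF Z] unfolding energy_def by linarith
   then have "p * m \<le> p * (penergy Z / p + (F (u k) + F (u n)) / 2)" using p0 by (intro mult_left_mono) auto
   also have "\<dots> = p * (penergy Z / p) + p * ((F (u k) + F (u n)) / 2)" by (rule distrib_left)
   also have "p * (penergy Z / p) = penergy Z" using p0 by simp
   finally show ?thesis .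
  qed
  moreover have "p * ((?E k + ?E n) / 2 - m) = (penergy (G k) + penergy (G n)) / 2 + p * ((F (u k) + F (u n)) / 2) - p * m"
  proof -
   have "p * (a / p) = a" for a using p0 by simp
   then have "p * ?E k = penergy (G k) + p * F (u k)" "p * ?E n = penergy (G n) + p * F (u n)"
    unfolding energy_def distrib_left by (simp_all only:)
   moreover have "p * ((?E k + ?E n) / 2 - m) = (p * ?E k + p * ?E n) / 2 - p * m"
    by (simp only: right_diff_distrib times_divide_eq_right distrib_left)
   moreover have "p * ((F (u k) + F (u n)) / 2) = (p * F (u k) + p * F (u n)) / 2"
    by (simp only: times_divide_eq_right distrib_left)
   ultimately show ?thesis by (simp only: add_divide_distrib)
  qed
  ultimately show "(\<integral>x. cgap p (G k x) (G n x) \<partial>lebesgue) \<le> p * ((?E k + ?E n) / 2 - m)" by linarith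
 qed
 have Cauchy: "\<exists>N. \<forall>k\<ge>N. \<forall>n\<ge>N. pint p lebesgue (\<lambda>x. G k x - G n x) \<le> ennreal e" if e: "e > 0" for e
 proof -
  \<comment> \<open>The first term of the uniform convexity inequality contributes at most 2 d B,
    where \<open>B\<close> bounds the p-energies; the second is made small by near-minimality
    through \<open>c\<close>.\<close>
  define d where "d = e / (4 * B + 4)"
  have "d * (4 * B + 4) = e" "d > 0" using e B0 by (simp_all add: d_def)
  then have d: "d > 0" "d * (B + B) \<le> e / 2" by (simp_all add: distrib_left)
  obtain C where C: "C \<ge> 0" "\<And>a b::'a. norm (a - b) powr p \<le> d * (norm a powr p + norm b powr p) + C * cgap p a b"
   using ex_uniform_convexity[OF p d(1)] by blast
  define c where "c = e / (2 * (C * p + 1))"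
  have Cp: "C * p + 1 > 0" using C(1) p0 by (simp add: add_nonneg_pos)
  have c: "c > 0" "C * (p * c) \<le> e / 2"
  proof -
   show "c > 0" using e Cp by (simp add: c_def)
   have "C * p * c \<le> (C * p + 1) * c" using \<open>c > 0\<close> by (intro mult_right_mono) auto
   also have "\<dots> = e / 2"
   proof -
    have "K * (e / (2 * K)) = e / 2" if "K > 0" for K using that by simp
    then show ?thesis unfolding c_def using Cp by blast
   qed
   finally show "C * (p * c) \<le> e / 2" by (simp add: mult.assoc)
  qed
  have "eventually (\<lambda>n. ?E n < m + c) sequentially" using lim c(1) by (intro order_tendstoD(2)) auto
  then obtain N where N: "\<And>n. n \<ge> N \<Longrightarrow> ?E n < m + c" by (auto simp: eventually_sequentially)
  have "pint p lebesgue (\<lambda>x. G k x - G n x) \<le> ennreal e" if kn: "k \<ge> N" "n \<ge> N" for k n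
  proof -
   have D: "Lam (\<lambda>x. u k x - u n x) (\<lambda>x. G k x - G n x)" by (rule Lam_diff[OF u u])
   have "penergy (\<lambda>x. G k x - G n x) \<le> (\<integral>x. d * (norm (G k x) powr p + norm (G n x) powr p) + C * cgap p (G k x) (G n x) \<partial>lebesgue)"
    unfolding penergy_def
    by (intro integral_mono Lam_integrable[OF D] Bochner_Integration.integrable_add integrable_mult_right gapi Lam_integrable[OF u] C(2))
   also have "\<dots> = d * (penergy (G k) + penergy (G n)) + C * (\<integral>x. cgap p (G k x) (G n x) \<partial>lebesgue)"
    unfolding penergy_def
    by (subst Bochner_Integration.integral_add) (auto intro!: integrable_mult_right gapi Bochner_Integration.integrable_add Lam_integrable[OF u] simp: Bochner_Integration.integral_add Lam_integrable[OF u])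
   also have "\<dots> \<le> d * (B + B) + C * (p * c)"
   proof (intro add_mono mult_left_mono)
    show "(\<integral>x. cgap p (G k x) (G n x) \<partial>lebesgue) \<le> p * c"
    proof (rule order_trans[OF gap mult_left_mono])
     show "(?E k + ?E n) / 2 - m \<le> c" using N[OF kn(1)] N[OF kn(2)] by (simp add: field_simps)
    qed (use p0 in simp)
   qed (use B d C in auto)
   also have "\<dots> \<le> e" using d(2) c(2) by linarith
   finally show ?thesis unfolding pint_eq_penergy[OF D] by (rule ennreal_leI)
  qed
  then show ?thesis by blast
 qed
 obtain v H where v: "Lam v H" and lv: "(\<lambda>n. pint p lebesgue (\<lambda>x. u n x - v x)) \<longlonglongrightarrow> 0"
  and lH: "(\<lambda>n. pint p lebesgue (\<lambda>x. G n x - H x)) \<longlonglongrightarrow> 0"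
  by (rule Lam_complete[OF u Cauchy])
 note [measurable] = Lam_measurable[OF v]
 obtain L where L: "L > 0" "\<And>u G w H N. Lam u G \<Longrightarrow> Lam w H \<Longrightarrow> N > 0 \<Longrightarrow>
   pint p lebesgue (\<lambda>x. G x - H x) \<le> ennreal (N powr p) \<Longrightarrow> \<bar>F u - F w\<bar> \<le> L * N"
  using Lip unfolding Lipschitz_on_Lam_def by blast
 have FL: "(\<lambda>n. F (u n)) \<longlonglongrightarrow> F v"
 proof (rule LIMSEQ_I)
  fix e :: real assume e: "e > 0"
  define N where "N = e / (2 * L)"
  have N: "N > 0" "L * N < e" using e L(1) by (auto simp: N_def)
  have "eventually (\<lambda>n. pint p lebesgue (\<lambda>x. G n x - H x) < ennreal (N powr p)) sequentially"
   using lH N(1) by (intro order_tendstoD(2)) auto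
  then obtain n0 where n0: "\<And>n. n \<ge> n0 \<Longrightarrow> pint p lebesgue (\<lambda>x. G n x - H x) < ennreal (N powr p)"
   by (auto simp: eventually_sequentially)
  have "norm (F (u n) - F v) < e" if "n \<ge> n0" for n
   using L(2)[OF u v N(1) less_imp_le[OF n0[OF that]]] N(2) by simp
  then show "\<exists>n0. \<forall>n\<ge>n0. norm (F (u n) - F v) < e" by blast
 qed
 have IL: "(\<lambda>n. penergy (G n)) \<longlonglongrightarrow> p * (m - F v)"
 proof -
  have "(\<lambda>n. p * (?E n - F (u n))) \<longlonglongrightarrow> p * (m - F v)" by (intro tendsto_intros lim FL)
  then show ?thesis using p0 by (simp add: energy_def)
 qed
 have nn: "0 \<le> p * (m - F v)"
  by (rule LIMSEQ_le_const[OF IL]) (simp add: penergy_nonneg)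
 obtain r where r: "strict_mono r" "AE x in lebesgue. (\<lambda>n. G (r n) x) \<longlonglongrightarrow> H x"
  by (rule pint_tendsto_AE_subseq[OF _ _ p0 lH]) auto
 have "penergy H \<le> p * (m - F v)"
 proof (rule field_le_epsilon)
  fix e :: real assume e: "e > 0"
  have "eventually (\<lambda>n. penergy (G (r n)) < p * (m - F v) + e) sequentially"
   using LIMSEQ_subseq_LIMSEQ[OF IL r(1)] e by (intro order_tendstoD(2)) (auto simp: o_def)
  then have "eventually (\<lambda>n. pint p lebesgue (G (r n)) \<le> ennreal (p * (m - F v) + e)) sequentially"
   by eventually_elim (simp add: pint_eq_penergy[OF u] ennreal_leI)
  then have "pint p lebesgue H \<le> ennreal (p * (m - F v) + e)"
   by (intro pint_Fatou[OF _ _ p0 r(2)]) auto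
  then have "ennreal (penergy H) \<le> ennreal (p * (m - F v) + e)" unfolding pint_eq_penergy[OF v] .
  then show "penergy H \<le> p * (m - F v) + e"
   by (subst (asm) ennreal_le_iff) (use nn e in simp)
 qed
 then have "penergy H / p \<le> m - F v" using p0 by (simp add: pos_divide_le_eq mult.commute)
 then have "energy F v H \<le> m" by (simp add: energy_def)
 with v lv lH show ?thesis by (rule that)
qed

lemma ex_minimizer:
 assumes Lip: "Lipschitz_on_Lam F" and mid: "midconvex_on_Lam F"
 obtains u G where "Lam u G" "\<And>w H. Lam w H \<Longrightarrow> energy F u G \<le> energy F w H"
proof -
 define S where "S = {energy F u G | u G. Lam u G}"
 obtain m0 where m0: "\<And>u G. Lam u G \<Longrightarrow> m0 + penergy G / (2 * p) \<le> energy F u G"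
  using energy_coercive[OF Lip] by blast
 have bdd: "bdd_below S"
 proof (rule bdd_belowI)
  fix x assume "x \<in> S"
  then obtain u G where "x = energy F u G" "Lam u G" by (auto simp: S_def)
  moreover have "penergy G / (2 * p) \<ge> 0" using penergy_nonneg[of G] p0 by simp
  ultimately show "m0 \<le> x" using m0[of u G] by linarith
 qed
 have ne: "S \<noteq> {}" using Lam_0 by (auto simp: S_def)
 have lower: "Inf S \<le> energy F u G" if "Lam u G" for u G
  using that by (intro cInf_lower bdd) (auto simp: S_def)
 have "\<exists>u G. Lam u G \<and> energy F u G < Inf S + inverse (real (Suc n))" for n
 proof -
  have "Inf S < Inf S + inverse (real (Suc n))" by simp
  then obtain x where "x \<in> S" "x < Inf S + inverse (real (Suc n))"
   using cInf_less_iff[OF ne bdd] by blast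
  then show ?thesis by (auto simp: S_def)
 qed
 then obtain u G where u: "\<And>n. Lam (u n) (G n)" "\<And>n. energy F (u n) (G n) < Inf S + inverse (real (Suc n))"
  by metis
 have "(\<lambda>n. energy F (u n) (G n)) \<longlonglongrightarrow> Inf S"
 proof (rule tendsto_sandwich[OF _ _ tendsto_const])
  show "(\<lambda>n. Inf S + inverse (real (Suc n))) \<longlonglongrightarrow> Inf S"
   using tendsto_add[OF tendsto_const LIMSEQ_inverse_real_of_nat, of "Inf S"] by simp
  show "\<forall>\<^sub>F n in sequentially. Inf S \<le> energy F (u n) (G n)" by (intro always_eventually allI lower u(1))
  show "\<forall>\<^sub>F n in sequentially. energy F (u n) (G n) \<le> Inf S + inverse (real (Suc n))"
   by (intro always_eventually allI less_imp_le u(2))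
 qed
 then obtain v H where "Lam v H" "energy F v H \<le> Inf S"
  by (rule minimizing_sequence[OF Lip mid u(1) _ lower])
 then show ?thesis using lower by (intro that[of v H]) (auto intro: order_trans)
qed

end

subsection \<open>The vector field of the \<open>p\<close>-Laplacian\<close>

lemma scaleR_half_double_cancel: "(1/2) *\<^sub>R (2 *\<^sub>R x) = (x :: 'a::real_vector)"
 by simp

text \<open>The tangent inequality for |x|^p / p, from Cauchy-Schwarz and Young with the exponents p
  and p/(p - 1). It also holds at x = 0, where the power with possibly negative exponent is 0 by
  convention.\<close>

lemma norm_powr_gradient_inequality:
 fixes x y :: "'a::real_inner"
 assumes p: "p > 1"
 shows "norm x powr p / p + norm x powr (p - 2) * (x \<bullet> (y - x)) \<le> norm y powr p / p"
proof -
 define q where "q = p / (p - 1)"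
 have q: "q > 1" "1 / p + 1 / q = 1" using p by (auto simp: q_def field_simps)
 have xx: "norm x powr (p - 2) * (x \<bullet> x) = norm x powr p"
 proof (cases "x = 0")
  case False
  have "norm x powr (p - 2) * norm x powr 2 = norm x powr (p - 2 + 2)" by (rule powr_add[symmetric])
  moreover have "norm x powr 2 = x \<bullet> x" unfolding power2_norm_eq_inner[symmetric] by (rule powr_numeral) (use False in simp)
  ultimately show ?thesis by simp
 qed simp
 have "norm x powr (p - 2) * (x \<bullet> y) \<le> norm x powr (p - 2) * (norm x * norm y)"
  by (intro mult_left_mono norm_cauchy_schwarz) simp
 also have "\<dots> = norm y * norm x powr (p - 1)"
 proof (cases "x = 0")
  case False
  have "norm x * norm x powr (p - 2) = norm x powr (1 + (p - 2))" by (rule powr_mult_base) simp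
  moreover have "1 + (p - 2) = p - 1" by simp
  ultimately have "norm x powr (p - 2) * norm x = norm x powr (p - 1)" by (simp only: mult.commute)
  moreover have "norm x powr (p - 2) * (norm x * norm y) = norm y * (norm x powr (p - 2) * norm x)" by (simp only: mult_ac)
  ultimately show ?thesis by (simp only:)
 qed simp
 also have "\<dots> \<le> norm y powr p / p + (norm x powr (p - 1)) powr q / q"
  by (rule Youngs_inequality) (use p q in auto)
 also have "(norm x powr (p - 1)) powr q = norm x powr p"
 proof -
  have "(p - 1) * q = p" using p by (simp add: q_def)
  then show ?thesis unfolding powr_powr by (simp only:)
 qed
 finally have "norm x powr (p - 2) * (x \<bullet> y) \<le> norm y powr p / p + norm x powr p / q" .
 moreover have "norm x powr p / q = norm x powr p - norm x powr p / p"
 proof -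
  have e: "1 / q = 1 - 1 / p" using q(2) by linarith
  have "norm x powr p / q = norm x powr p * (1 / q)" by simp
  also have "\<dots> = norm x powr p * (1 - 1 / p)" by (simp only: e)
  also have "\<dots> = norm x powr p * 1 - norm x powr p * (1 / p)" by (rule right_diff_distrib)
  finally show ?thesis by simp
 qed
 moreover have "norm x powr (p - 2) * (x \<bullet> (y - x)) = norm x powr (p - 2) * (x \<bullet> y) - norm x powr p"
  unfolding inner_diff_right right_diff_distrib xx ..
 ultimately show ?thesis by linarith
qed

definition pfield :: "real \<Rightarrow> 'a::real_inner \<Rightarrow> 'a" where
 "pfield p x = norm x powr (p - 2) *\<^sub>R x"

lemma norm_pfield: "p > 1 \<Longrightarrow> norm (pfield p x) = norm x powr (p - 1)"
 using powr_mult_base[of "norm x" "p - 2"] by (cases "x = 0") (auto simp: pfield_def mult.commute)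

text \<open>Only the origin is delicate, since the scalar factor blows up there for p < 2; but the
  norm of the field is the power p - 1 of the norm of its argument and tends to 0.\<close>

lemma tendsto_pfield:
 fixes x :: "'a::real_inner"
 assumes p: "p > 1" and l: "(f \<longlongrightarrow> x) F"
 shows "((\<lambda>n. pfield p (f n)) \<longlongrightarrow> pfield p x) F"
proof (cases "x = 0")
 case False
 then show ?thesis unfolding pfield_def by (intro tendsto_intros l) auto
next
 case True
 have "((\<lambda>n. norm (f n) powr (p - 1)) \<longlongrightarrow> norm x powr (p - 1)) F"
  using p by (intro tendsto_powr' tendsto_norm l tendsto_const) auto
 then have "((\<lambda>n. norm (pfield p (f n))) \<longlongrightarrow> 0) F" using p True by (simp add: norm_pfield)
 then have "((\<lambda>n. pfield p (f n)) \<longlongrightarrow> 0) F" by (rule tendsto_norm_zero_cancel)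
 moreover have "pfield p x = 0" using True by (simp add: pfield_def)
 ultimately show ?thesis by (simp only:)
qed

text \<open>A crude substitute for Young's inequality, obtained by replacing both norms by their
  maximum; it supplies integrability and dominating functions.\<close>

lemma pfield_inner_le:
 fixes x y :: "'a::real_inner"
 assumes p: "p > 1"
 shows "\<bar>pfield p x \<bullet> y\<bar> \<le> norm x powr p + norm y powr p"
proof -
 have "\<bar>pfield p x \<bullet> y\<bar> \<le> norm x powr (p - 1) * norm y"
  using Cauchy_Schwarz_ineq2[of "pfield p x" y] by (simp add: norm_pfield[OF p])
 also have "\<dots> \<le> max (norm x) (norm y) powr (p - 1) * max (norm x) (norm y)"
  using p by (intro mult_mono powr_mono2) auto
 also have "\<dots> = max (norm x) (norm y) powr p"
  using powr_mult_base[of "max (norm x) (norm y)" "p - 1"] by (simp add: mult.commute le_max_iff_disj)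
 also have "\<dots> \<le> norm x powr p + norm y powr p" by (auto simp: max_def)
 finally show ?thesis .
qed

lemma plap_pair_eq: "plap_pair p G H = (\<integral>x. pfield p (G x) \<bullet> H x \<partial>lebesgue)"
 by (simp add: plap_pair_def pfield_def)

text \<open>The tangent inequalities at x and at y, both evaluated at the midpoint, add up to a
  lower bound by a multiple of the convexity gap, which is positive for x \<noteq> y.\<close>

lemma pfield_strictly_monotone:
 fixes x y :: "'a::real_inner"
 assumes p: "p > 1" and ne: "x \<noteq> y"
 shows "(pfield p x - pfield p y) \<bullet> (x - y) > 0"
proof -
 define z where "z = (1/2) *\<^sub>R (x + y)"
 have zx: "z - x = (1/2) *\<^sub>R (y - x)" "z - y = (1/2) *\<^sub>R (x - y)"
 proof -
  have 1: "2 *\<^sub>R (z - x) = y - x" "2 *\<^sub>R (z - y) = x - y"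
   by (simp_all add: z_def scaleR_right_diff_distrib scaleR_2)
  show "z - x = (1/2) *\<^sub>R (y - x)" "z - y = (1/2) *\<^sub>R (x - y)"
   unfolding 1[symmetric] scaleR_half_double_cancel by (rule refl)+
 qed
 have "norm x powr p / p + (1/2) * (pfield p x \<bullet> (y - x)) \<le> norm z powr p / p"
  "norm y powr p / p + (1/2) * (pfield p y \<bullet> (x - y)) \<le> norm z powr p / p"
  using norm_powr_gradient_inequality[OF p, of x z] norm_powr_gradient_inequality[OF p, of y z]
  unfolding zx by (simp_all add: pfield_def)
 have "pfield p x \<bullet> (y - x) = - (pfield p x \<bullet> (x - y))" by (simp add: inner_diff_right)
 then have "(norm x powr p + norm y powr p) / p - 2 * (norm z powr p / p) \<le> (1/2) * ((pfield p x - pfield p y) \<bullet> (x - y))"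
 proof -
  have "A + B - 2 * Z \<le> (1/2) * (S - Q)"
   if "A + (1/2) * P \<le> Z" "B + (1/2) * Q \<le> Z" "P = - S" for A B Z P Q S :: real
   using that by (simp add: field_simps)
  then show ?thesis unfolding inner_diff_left add_divide_distrib
   using \<open>norm x powr p / p + _ \<le> _\<close> \<open>norm y powr p / p + _ \<le> _\<close> \<open>pfield p x \<bullet> (y - x) = _\<close> by blast
 qed
 moreover have "(norm x powr p + norm y powr p) / p - 2 * (norm z powr p / p) = 2 * cgap p x y / p"
 proof -
  have "S / p - 2 * (Z / p) = 2 * (S / 2 - Z) / p" for S Z :: real
   by (simp add: right_diff_distrib diff_divide_distrib)
  then show ?thesis unfolding cgap_def z_def by blast
 qed
 moreover have "2 * cgap p x y / p > 0" using cgap_pos[OF p ne] p by simp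
 ultimately show ?thesis by linarith
qed

context frac_space begin

lemma borel_measurable_pfield: "pfield p \<in> borel_measurable (borel :: 'a measure)"
 unfolding pfield_def[abs_def] by measurable

lemma integrable_pfield_inner:
 assumes u: "Lam u G" and w: "Lam w H"
 shows "integrable lebesgue (\<lambda>x. pfield p (G x) \<bullet> H x)"
proof (rule Bochner_Integration.integrable_bound[OF Bochner_Integration.integrable_add[OF Lam_integrable[OF u] Lam_integrable[OF w]]])
 note [measurable] = Lam_measurable[OF u] Lam_measurable[OF w] borel_measurable_pfield
 show "(\<lambda>x. pfield p (G x) \<bullet> H x) \<in> borel_measurable lebesgue" by measurable
qed (intro AE_I2, use pfield_inner_le[OF p] in simp)

end

subsection \<open>Subsequences and convex combinations\<close>

lemma norm_powr_2: "norm (t::real) powr 2 = t\<^sup>2"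
 by (cases "t = 0") auto

lemma ennreal_le_suminf: "f k \<le> (\<Sum>k. f k)" for f :: "nat \<Rightarrow> ennreal"
proof -
 have "sum f {k} \<le> suminf f" by (rule sum_le_suminf) simp_all
 then show ?thesis by simp
qed

lemma ex_fast_subsequence:
 fixes f :: "nat \<Rightarrow> ennreal"
 assumes f: "f \<longlonglongrightarrow> 0"
 obtains r where "strict_mono r" "\<And>k. f (r k) \<le> ennreal ((1/2) ^ k)"
proof -
 have ev: "eventually (\<lambda>n. f n < ennreal ((1/2) ^ k)) sequentially" for k
  using f by (rule order_tendstoD) simp
 have "\<exists>r. strict_mono r \<and> (\<forall>k. f (r k) < ennreal ((1/2) ^ k))"
 proof -
  have "\<exists>n. f n < ennreal ((1/2) ^ 0)" using ev[of 0] by (auto simp: eventually_sequentially)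
  moreover have "\<exists>y>x. f y < ennreal ((1/2) ^ Suc k)" for x k
  proof -
   obtain N where N: "\<And>n. n \<ge> N \<Longrightarrow> f n < ennreal ((1/2) ^ Suc k)"
    using ev[of "Suc k"] unfolding eventually_sequentially by blast
   show ?thesis by (rule exI[of _ "max N (Suc x)"]) (use N[of "max N (Suc x)"] in auto)
  qed
  ultimately obtain r where "\<And>k. f (r k) < ennreal ((1/2) ^ k)" "\<And>k. r k < r (Suc k)"
   using dependent_nat_choice[of "\<lambda>k n. f n < ennreal ((1/2) ^ k)" "\<lambda>k x y. x < y"] by blast
  then show ?thesis by (auto simp: strict_mono_Suc_iff)
 qed
 then show ?thesis using that less_imp_le by blast
qed

text \<open>Along a subsequence with errors at most 2^(-k) the sum of all errors is integrable. It
  dominates each of them and, being finite almost everywhere, forces convergence; both serve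
  dominated convergence in the nonlinear term.\<close>

lemma pint_dominated_subseq:
 fixes F :: "nat \<Rightarrow> 'b \<Rightarrow> 'c::{banach, second_countable_topology}"
 assumes [measurable]: "\<And>n. F n \<in> borel_measurable M" "G \<in> borel_measurable M" and p: "p > 0"
  and lim: "(\<lambda>n. pint p M (\<lambda>x. F n x - G x)) \<longlonglongrightarrow> 0"
 obtains r S where "strict_mono r" "integrable M (S :: 'b \<Rightarrow> real)"
  "AE x in M. \<forall>k. norm (F (r k) x - G x) powr p \<le> S x" "AE x in M. (\<lambda>k. F (r k) x) \<longlonglongrightarrow> G x"
proof -
 obtain r where r: "strict_mono r" "\<And>k. pint p M (\<lambda>x. F (r k) x - G x) \<le> ennreal ((1/2) ^ k)"
  using ex_fast_subsequence[OF lim] by blast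
 define T where "T x = (\<Sum>k. ennreal (norm (F (r k) x - G x) powr p))" for x
 have Tm[measurable]: "T \<in> borel_measurable M" unfolding T_def[abs_def] by measurable
 have "(\<integral>\<^sup>+x. T x \<partial>M) = (\<Sum>k. pint p M (\<lambda>x. F (r k) x - G x))"
  unfolding T_def pint_def by (rule nn_integral_suminf) measurable
 also have "\<dots> \<le> (\<Sum>k. ennreal ((1/2) ^ k))" by (rule suminf_le[OF r(2)]) simp_all
 also have "\<dots> < \<infinity>" by (subst suminf_ennreal2) (auto intro!: summable_geometric)
 finally have Tfin: "(\<integral>\<^sup>+x. T x \<partial>M) < \<infinity>" .
 then have AET: "AE x in M. T x \<noteq> \<infinity>" by (intro nn_integral_PInf_AE) auto
 define S where "S x = enn2real (T x)" for x
 have S0: "S x \<ge> 0" for x by (simp add: S_def)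
 have [measurable]: "S \<in> borel_measurable M" unfolding S_def[abs_def] by measurable
 have "(\<integral>\<^sup>+x. ennreal (norm (S x)) \<partial>M) = (\<integral>\<^sup>+x. T x \<partial>M)"
 proof (rule nn_integral_cong_AE)
  show "AE x in M. ennreal (norm (S x)) = T x"
   using AET
  proof eventually_elim
   case (elim x)
   then show ?case by (cases "T x") (auto simp: S_def)
  qed
 qed
 then have Si: "integrable M S" using Tfin by (simp add: integrable_iff_bounded)
 show ?thesis
 proof (rule that[OF r(1) Si])
  show "AE x in M. \<forall>k. norm (F (r k) x - G x) powr p \<le> S x"
   using AET
  proof eventually_elim
   case (elim x)
   have "ennreal (norm (F (r k) x - G x) powr p) \<le> T x" for k
    unfolding T_def by (rule ennreal_le_suminf)
   then have "ennreal (norm (F (r k) x - G x) powr p) \<le> ennreal (S x)" for k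
    using elim by (cases "T x") (auto simp: S_def)
   then show ?case unfolding ennreal_le_iff[OF S0] by blast
  qed
  show "AE x in M. (\<lambda>k. F (r k) x) \<longlonglongrightarrow> G x"
   using AET
  proof eventually_elim
   case (elim x)
   have "summable (\<lambda>k. norm (F (r k) x - G x) powr p)"
    by (rule summable_suminf_not_top) (use elim in \<open>simp_all add: T_def\<close>)
   then have "(\<lambda>k. norm (F (r k) x - G x) powr p) \<longlonglongrightarrow> 0" by (rule summable_LIMSEQ_zero)
   then have "(\<lambda>k. (norm (F (r k) x - G x) powr p) powr (1 / p)) \<longlonglongrightarrow> 0 powr (1 / p)"
    using p by (intro tendsto_powr') auto
   then have "(\<lambda>k. norm (F (r k) x - G x)) \<longlonglongrightarrow> 0" using p by (simp add: powr_powr)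
   then show ?case by (simp add: tendsto_norm_zero_iff LIM_zero_iff)
  qed
 qed
qed

text \<open>Finite convex weights on indices from n on. The same weights can be applied to the
  slopes at a point and to the integrals in which they occur.\<close>

definition tail_weights :: "nat \<Rightarrow> (nat \<Rightarrow> real) \<Rightarrow> bool" where
 "tail_weights n c \<longleftrightarrow> (\<forall>k. c k \<ge> 0) \<and> (\<forall>k<n. c k = 0) \<and> finite {k. c k \<noteq> 0} \<and> (\<Sum>k\<in>{k. c k \<noteq> 0}. c k) = 1"

definition wsum :: "(nat \<Rightarrow> real) \<Rightarrow> (nat \<Rightarrow> real) \<Rightarrow> real" where
 "wsum c y = (\<Sum>k\<in>{k. c k \<noteq> 0}. c k * y k)"

lemma wsum_superset: "finite A \<Longrightarrow> {k. c k \<noteq> 0} \<subseteq> A \<Longrightarrow> wsum c y = (\<Sum>k\<in>A. c k * y k)"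
 unfolding wsum_def by (rule sum.mono_neutral_left) auto

lemma tail_weights_mid:
 assumes c: "tail_weights n c" and d: "tail_weights m d" and nm: "n \<le> m"
 shows "tail_weights n (\<lambda>k. (c k + d k) / 2)" "wsum (\<lambda>k. (c k + d k) / 2) y = (wsum c y + wsum d y) / 2"
proof -
 let ?A = "{k. c k \<noteq> 0} \<union> {k. d k \<noteq> 0}"
 have A: "finite ?A" using c d by (auto simp: tail_weights_def)
 have sub: "{k. (c k + d k) / 2 \<noteq> 0} \<subseteq> ?A" by auto
 have s: "wsum (\<lambda>k. (c k + d k) / 2) z = (wsum c z + wsum d z) / 2" for z
 proof -
  have "wsum c z = (\<Sum>k\<in>?A. c k * z k)" "wsum d z = (\<Sum>k\<in>?A. d k * z k)"
   by (rule wsum_superset[OF A], blast)+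
  moreover have "(\<Sum>k\<in>?A. (c k + d k) / 2 * z k) = ((\<Sum>k\<in>?A. c k * z k) + (\<Sum>k\<in>?A. d k * z k)) / 2"
   unfolding sum.distrib[symmetric] sum_divide_distrib by (intro sum.cong refl) (simp add: field_simps)
  ultimately show ?thesis using wsum_superset[OF A sub, of z] by (simp only:)
 qed
 then show "wsum (\<lambda>k. (c k + d k) / 2) y = (wsum c y + wsum d y) / 2" .
 have "finite {k. (c k + d k) / 2 \<noteq> 0}" by (rule finite_subset[OF sub A])
 moreover have "wsum c (\<lambda>_. 1) = 1" "wsum d (\<lambda>_. 1) = 1" using c d by (auto simp: wsum_def tail_weights_def)
 then have "wsum (\<lambda>k. (c k + d k) / 2) (\<lambda>_. 1) = 1" unfolding s by simp
 then have "(\<Sum>k\<in>{k. (c k + d k) / 2 \<noteq> 0}. (c k + d k) / 2) = 1" unfolding wsum_def mult_1_right .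
 ultimately show "tail_weights n (\<lambda>k. (c k + d k) / 2)"
  using c d nm by (auto simp: tail_weights_def)
qed

lemma wsum_bounds:
 assumes c: "tail_weights n c" and y: "\<And>k. k \<ge> n \<Longrightarrow> a \<le> y k \<and> y k \<le> b"
 shows "a \<le> wsum c y" "wsum c y \<le> b"
proof -
 have n: "k \<ge> n" if "c k \<noteq> 0" for k using c that unfolding tail_weights_def by (meson not_le)
 have one: "(\<Sum>k\<in>{k. c k \<noteq> 0}. c k) = 1" "\<And>k. c k \<ge> 0" using c by (auto simp: tail_weights_def)
 have "(\<Sum>k\<in>{k. c k \<noteq> 0}. c k * a) \<le> wsum c y"
  unfolding wsum_def using one n y by (intro sum_mono mult_left_mono) auto
 then show "a \<le> wsum c y" using one by (simp add: sum_distrib_right[symmetric])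
 have "wsum c y \<le> (\<Sum>k\<in>{k. c k \<noteq> 0}. c k * b)"
  unfolding wsum_def using one n y by (intro sum_mono mult_left_mono) auto
 then show "wsum c y \<le> b" using one by (simp add: sum_distrib_right[symmetric])
qed

text \<open>Since the n-th weights vanish before n, convex combinations keep the limit of every
  convergent sequence. Hence those terms of an equation that already converge are unaffected by the
  averaging.\<close>

lemma wsum_tendsto:
 assumes c: "\<And>n. tail_weights n (c n)" and y: "y \<longlonglongrightarrow> l"
 shows "(\<lambda>n. wsum (c n) y) \<longlonglongrightarrow> l"
proof (rule LIMSEQ_I)
 fix e :: real assume e: "e > 0"
 obtain N where N: "\<And>k. k \<ge> N \<Longrightarrow> \<bar>y k - l\<bar> < e / 2"
  using LIMSEQ_D[OF y, of "e / 2"] e by auto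
 have "norm (wsum (c n) y - l) < e" if n: "n \<ge> N" for n
 proof -
  have b: "l - e / 2 \<le> y k \<and> y k \<le> l + e / 2" if "k \<ge> n" for k using N[of k] n that by linarith
  have "l - e / 2 \<le> wsum (c n) y" "wsum (c n) y \<le> l + e / 2" using wsum_bounds[OF c b] by auto
  then show ?thesis using e unfolding real_norm_def by linarith
 qed
 then show "\<exists>N. \<forall>n\<ge>N. norm (wsum (c n) y - l) < e" by blast
qed

text \<open>Elements of almost minimal \<open>L\<^sup>2\<close> norm in the convex hulls of the tails form a Cauchy sequence,
 by the parallelogram law.\<close>

lemma ex_convergent_tail_combinations:
 fixes X :: "nat \<Rightarrow> 'b \<Rightarrow> real"
 assumes Xm[measurable]: "\<And>k. X k \<in> borel_measurable M" and S[measurable]: "S \<in> sets M" "emeasure M S < \<infinity>"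
  and X: "\<And>k x. \<bar>X k x\<bar> \<le> indicator S x"
 obtains c Y where "\<And>n::nat. tail_weights n (c n)" "Y \<in> borel_measurable M"
  "AE x in M. (\<lambda>n. wsum (c n) (\<lambda>k. X k x)) \<longlonglongrightarrow> Y x"
proof -
 define Q where "Q c = (\<integral>x. (wsum c (\<lambda>k. X k x))\<^sup>2 \<partial>M)" for c
 have Wm[measurable]: "(\<lambda>x. wsum c (\<lambda>k. X k x)) \<in> borel_measurable M" for c
  unfolding wsum_def by measurable
 have Wb: "\<bar>wsum c (\<lambda>k. X k x)\<bar> \<le> indicator S x" if c: "tail_weights n c" for c n x
 proof -
  have "- indicator S x \<le> X k x \<and> X k x \<le> indicator S x" for k using X[of k x] by linarith
  from wsum_bounds[OF c, of "- indicator S x" "\<lambda>k. X k x", OF this] show ?thesis by linarith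
 qed
 have Si: "integrable M (indicator S :: 'b \<Rightarrow> real)" using S by (intro integrable_real_indicator) auto
 have W2: "(wsum c (\<lambda>k. X k x))\<^sup>2 \<le> indicator S x" if c: "tail_weights n c" for c n x
  using Wb[OF c, of x] by (cases "x \<in> S") (simp_all add: abs_square_le_1)
 have Wi: "integrable M (\<lambda>x. (wsum c (\<lambda>k. X k x))\<^sup>2)" if c: "tail_weights n c" for c n
  by (rule Bochner_Integration.integrable_bound[OF Si]) (use W2[OF c] in auto)
 have Q0: "Q c \<ge> 0" for c by (simp add: Q_def)
 \<comment> \<open>The infimum over the n-th tail. Tails shrink, so it increases with n and is
   bounded; the resulting limit is what makes near-minimisers Cauchy.\<close>
 define d where "d n = Inf {Q c | c. tail_weights n c}" for n
 have bdd: "bdd_below {Q c | c. tail_weights n c}" for n using Q0 by (auto intro: bdd_belowI[of _ 0])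
 have unit: "tail_weights n (\<lambda>k. if k = n then 1 else 0)" for n
  by (auto simp: tail_weights_def)
 have ne: "{Q c | c. tail_weights n c} \<noteq> {}" for n using unit by blast
 have dl: "d n \<le> Q c" if "tail_weights n c" for n c unfolding d_def using that by (intro cInf_lower bdd) auto
 have "\<exists>c. tail_weights n c \<and> Q c < d n + inverse (real (Suc n))" for n
 proof -
  have "Inf {Q c | c. tail_weights n c} < d n + inverse (real (Suc n))" by (simp add: d_def)
  then show ?thesis using cInf_less_iff[OF ne bdd] by blast
 qed
 then obtain c where c: "\<And>n. tail_weights n (c n)" "\<And>n. Q (c n) < d n + inverse (real (Suc n))" by metis
 have mono: "d n \<le> d m" if "n \<le> m" for n m
  unfolding d_def
 proof (rule cInf_superset_mono[OF ne bdd])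
  show "{Q c | c. tail_weights m c} \<subseteq> {Q c | c. tail_weights n c}" using that by (fastforce simp: tail_weights_def)
 qed
 have dB: "d n \<le> measure M S" for n
 proof -
  have "d n \<le> Q (c n)" by (rule dl[OF c(1)])
  also have "\<dots> \<le> (\<integral>x. indicator S x \<partial>M)"
   unfolding Q_def using Wi[OF c(1)] Si W2[OF c(1)] by (intro integral_mono) auto
  also have "\<dots> = measure M S" using sets.sets_into_space[OF S(1)] by (simp add: Int_absorb2)
  finally show ?thesis .
 qed
 have "incseq d" using mono by (auto simp: incseq_def)
 then obtain l where dlim: "d \<longlonglongrightarrow> l" "\<And>n. d n \<le> l"
  using incseq_convergent[of d "measure M S"] dB by blast
 let ?W = "\<lambda>n x. wsum (c n) (\<lambda>k. X k x)"
 \<comment> \<open>The midpoint of the two combinations still uses weights of the n-th tail, so its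
   square integral is at least \<open>d n\<close>.\<close>
 have key: "pint 2 M (\<lambda>x. ?W n x - ?W m x) \<le> ennreal (4 * (l - d n) + 4 * inverse (real (Suc n)))" if nm: "n \<le> m" for n m
 proof -
  have mid: "d n \<le> (\<integral>x. ((?W n x + ?W m x) / 2)\<^sup>2 \<partial>M)"
   using dl[OF tail_weights_mid(1)[OF c(1) c(1) nm]] unfolding Q_def tail_weights_mid(2)[OF c(1) c(1) nm] .
  have midi: "integrable M (\<lambda>x. ((?W n x + ?W m x) / 2)\<^sup>2)"
   using Wi[OF tail_weights_mid(1)[OF c(1) c(1) nm]] unfolding tail_weights_mid(2)[OF c(1) c(1) nm] .
  have par: "(?W n x - ?W m x)\<^sup>2 = (2 * (?W n x)\<^sup>2 + 2 * (?W m x)\<^sup>2) - 4 * ((?W n x + ?W m x) / 2)\<^sup>2" for x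
  proof -
   have "(a - b)\<^sup>2 = (2 * a\<^sup>2 + 2 * b\<^sup>2) - 4 * ((a + b) / 2)\<^sup>2" for a b :: real
    by (simp add: power2_eq_square field_simps)
   then show ?thesis .
  qed
  have i: "integrable M (\<lambda>x. (?W n x - ?W m x)\<^sup>2)"
   unfolding par by (intro Bochner_Integration.integrable_diff Bochner_Integration.integrable_add integrable_mult_right Wi[OF c(1)] midi)
  have "(\<integral>x. (?W n x - ?W m x)\<^sup>2 \<partial>M) = 2 * Q (c n) + 2 * Q (c m) - 4 * (\<integral>x. ((?W n x + ?W m x) / 2)\<^sup>2 \<partial>M)"
   unfolding par Q_def
   by (subst Bochner_Integration.integral_diff) (auto intro!: Bochner_Integration.integrable_add integrable_mult_right Wi[OF c(1)] midi simp: Bochner_Integration.integral_add Wi[OF c(1)])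
  also have "\<dots> \<le> 4 * (l - d n) + 4 * inverse (real (Suc n))"
  proof -
   have "inverse (real (Suc m)) \<le> inverse (real (Suc n))" using nm by (simp add: le_imp_inverse_le)
   moreover have "2 * q + 2 * q' - 4 * a \<le> 4 * (l - b) + 4 * i"
    if "j \<le> i" "q < b + i" "q' < b' + j" "b \<le> a" "b' \<le> l" "b \<le> l" for q q' a b b' i j :: real
    using that by argo
   ultimately show ?thesis using c(2)[of n] c(2)[of m] mid dlim(2)[of m] dlim(2)[of n] by blast
  qed
  finally have le: "(\<integral>x. (?W n x - ?W m x)\<^sup>2 \<partial>M) \<le> 4 * (l - d n) + 4 * inverse (real (Suc n))" .
  have "pint 2 M (\<lambda>x. ?W n x - ?W m x) = (\<integral>\<^sup>+x. ennreal ((?W n x - ?W m x)\<^sup>2) \<partial>M)"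
   unfolding pint_def norm_powr_2 ..
  also have "\<dots> = ennreal (\<integral>x. (?W n x - ?W m x)\<^sup>2 \<partial>M)" by (rule nn_integral_eq_integral[OF i]) simp
  finally show ?thesis using le by (simp add: ennreal_leI)
 qed
 have lim0: "(\<lambda>n. 4 * (l - d n) + 4 * inverse (real (Suc n))) \<longlonglongrightarrow> 0"
 proof -
  have "(\<lambda>n. 4 * (l - d n) + 4 * inverse (real (Suc n))) \<longlonglongrightarrow> 4 * (l - l) + 4 * 0"
   by (intro tendsto_intros dlim(1) LIMSEQ_inverse_real_of_nat)
  then show ?thesis by simp
 qed
 have Cauchy: "\<exists>N. \<forall>m\<ge>N. \<forall>n\<ge>N. pint 2 M (\<lambda>x. ?W m x - ?W n x) \<le> ennreal e" if e: "e > 0" for e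
 proof -
  have "eventually (\<lambda>n. 4 * (l - d n) + 4 * inverse (real (Suc n)) < e) sequentially"
   using lim0 e by (intro order_tendstoD(2)) auto
  then obtain N where N: "\<And>n. n \<ge> N \<Longrightarrow> 4 * (l - d n) + 4 * inverse (real (Suc n)) < e"
   unfolding eventually_sequentially by blast
  have le: "pint 2 M (\<lambda>x. ?W n x - ?W m x) \<le> ennreal e" if "n \<ge> N" "n \<le> m" for n m
   using key[OF that(2)] N[OF that(1)] by (meson ennreal_leI less_imp_le order_trans)
  have "pint 2 M (\<lambda>x. ?W m x - ?W n x) \<le> ennreal e" if "m \<ge> N" "n \<ge> N" for m n
  proof (cases "m \<le> n")
   case False
   then show ?thesis using le[of n m] that by (subst pint_minus_commute) simp
  qed (use le that in blast)
  then show ?thesis by blast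
 qed
 obtain Y where Y: "Y \<in> borel_measurable M" "(\<lambda>n. pint 2 M (\<lambda>x. ?W n x - Y x)) \<longlonglongrightarrow> 0"
  by (rule Lp_complete[of ?W M 2, OF Wm _ Cauchy]) simp
 obtain r where r: "strict_mono r" "AE x in M. (\<lambda>n. ?W (r n) x) \<longlonglongrightarrow> Y x"
  by (rule pint_tendsto_AE_subseq[OF Wm Y(1) _ Y(2)]) simp
 show ?thesis
 proof (rule that[of "\<lambda>n. c (r n)", OF _ Y(1) r(2)])
  fix n
  have "n \<le> r n" using r(1) by (rule seq_suble)
  then show "tail_weights n (c (r n))" using c(1)[of "r n"] by (auto simp: tail_weights_def)
 qed
qed

subsection \<open>Convex integrands with slopes in the unit interval\<close>

text \<open>A function with a chosen subgradient in the unit interval at every point. The pair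
  encodes convexity without derivatives, so one interface serves \<open>max t 0\<close> and its
  smooth approximations.\<close>

definition subgrad01 :: "(real \<Rightarrow> real) \<Rightarrow> (real \<Rightarrow> real) \<Rightarrow> bool" where
 "subgrad01 \<theta> \<sigma> \<longleftrightarrow> (\<forall>x y. \<theta> x + \<sigma> x * (y - x) \<le> \<theta> y) \<and> (\<forall>x. 0 \<le> \<sigma> x \<and> \<sigma> x \<le> 1)"

text \<open>The second bound concerns \<theta> minus the identity, which for \<open>max t 0\<close>
  is the negative part: both phases are governed by one \<theta>, with slopes \<sigma> and \<sigma>
  - 1.\<close>

lemma subgrad01_increment:
 assumes "subgrad01 \<theta> \<sigma>"
 shows "\<bar>\<theta> y - \<theta> x\<bar> \<le> \<bar>y - x\<bar>" "\<bar>(\<theta> y - y) - (\<theta> x - x)\<bar> \<le> \<bar>y - x\<bar>"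
proof -
 have t: "\<theta> x + \<sigma> x * (y - x) \<le> \<theta> y" "\<theta> y + \<sigma> y * (x - y) \<le> \<theta> x" and b: "0 \<le> \<sigma> x" "\<sigma> x \<le> 1" "0 \<le> \<sigma> y" "\<sigma> y \<le> 1"
  using assms by (auto simp: subgrad01_def)
 have m: "min 0 z \<le> s * z" if "0 \<le> s" "s \<le> 1" for s z :: real
 proof (cases "z \<ge> 0")
  case True
  then have "0 \<le> s * z" using that by simp
  then show ?thesis by simp
 next
  case False
  then have "1 * z \<le> s * z" using that by (intro mult_right_mono_neg) auto
  then show ?thesis by simp
 qed
 note mm = m[OF b(1,2), of "y - x"] m[OF b(3,4), of "x - y"]
 show "\<bar>\<theta> y - \<theta> x\<bar> \<le> \<bar>y - x\<bar>" using t mm by linarith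
 show "\<bar>(\<theta> y - y) - (\<theta> x - x)\<bar> \<le> \<bar>y - x\<bar>" using t mm by linarith
qed

lemma subgrad01_continuous:
 assumes "subgrad01 \<theta> \<sigma>"
 shows "continuous_on UNIV \<theta>"
 unfolding continuous_on_iff dist_real_def
proof (intro ballI allI impI)
 fix x e :: real assume "e > 0"
 then show "\<exists>d>0. \<forall>y\<in>UNIV. \<bar>y - x\<bar> < d \<longrightarrow> \<bar>\<theta> y - \<theta> x\<bar> < e"
  using le_less_trans[OF subgrad01_increment(1)[OF assms]] by (intro exI[of _ e]) blast
qed

lemma subgrad01_borel: "subgrad01 \<theta> \<sigma> \<Longrightarrow> \<theta> \<in> borel_measurable borel"
 by (intro borel_measurable_continuous_onI subgrad01_continuous)

lemma subgrad01_bound: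
 assumes "subgrad01 \<theta> \<sigma>"
 shows "\<bar>\<theta> t\<bar> \<le> \<bar>\<theta> 0\<bar> + \<bar>t\<bar>" "\<bar>\<theta> t - t\<bar> \<le> \<bar>\<theta> 0\<bar> + \<bar>t\<bar>"
 using subgrad01_increment[OF assms, of t 0] by auto

lemma subgrad01_mid:
 assumes "subgrad01 \<theta> \<sigma>"
 shows "\<theta> ((x + y) / 2) \<le> (\<theta> x + \<theta> y) / 2"
proof -
 let ?m = "(x + y) / 2"
 have "\<theta> ?m + \<sigma> ?m * (x - ?m) \<le> \<theta> x" "\<theta> ?m + \<sigma> ?m * (y - ?m) \<le> \<theta> y"
  using assms by (auto simp: subgrad01_def)
 moreover have "x - ?m = - (y - ?m)" by (simp add: field_simps)
 then have "\<sigma> ?m * (x - ?m) = - (\<sigma> ?m * (y - ?m))" by (simp only: mult_minus_right)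
 ultimately have "\<theta> ?m + \<theta> ?m \<le> \<theta> x + \<theta> y" by linarith
 then show ?thesis by (simp add: field_simps)
qed

lemma subgrad01_pos: "subgrad01 (\<lambda>t. max t 0) (\<lambda>t. if t > 0 then 1 else 0)"
 by (auto simp: subgrad01_def)

definition smooth_pos :: "real \<Rightarrow> real \<Rightarrow> real" where
 "smooth_pos e t = (t + sqrt (t\<^sup>2 + e\<^sup>2)) / 2"

text \<open>The derivative of \<open>smooth_pos e\<close> for e \<noteq> 0. Its continuity is what
  the Euler-Lagrange equation asks for.\<close>

definition smooth_step :: "real \<Rightarrow> real \<Rightarrow> real" where
 "smooth_step e t = (1 + t / sqrt (t\<^sup>2 + e\<^sup>2)) / 2"

lemma sqrt_sum_gt: "e \<noteq> 0 \<Longrightarrow> sqrt (t\<^sup>2 + e\<^sup>2) > \<bar>t\<bar>"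
 by (rule real_less_rsqrt) simp

text \<open>Cauchy-Schwarz in the plane for the vectors (x, e) and (y, e), that is, the tangent
  inequality for their Euclidean norm.\<close>

lemma subgrad01_smooth:
 assumes e: "e \<noteq> 0"
 shows "subgrad01 (smooth_pos e) (smooth_step e)"
 unfolding subgrad01_def
proof (intro conjI allI)
 fix x y :: real
 let ?X = "sqrt (x\<^sup>2 + e\<^sup>2)" and ?Y = "sqrt (y\<^sup>2 + e\<^sup>2)"
 have "?X > \<bar>x\<bar>" using sqrt_sum_gt[OF e, of x] .
 then have X: "?X > 0" "?X > \<bar>x\<bar>" using abs_ge_zero[of x] by linarith+
 have XX: "?X * ?X = x\<^sup>2 + e\<^sup>2" by simp
 have "x * y + e\<^sup>2 \<le> ?X * ?Y"
 proof -
  have "(x * y + e * e)\<^sup>2 \<le> (x\<^sup>2 + e\<^sup>2) * (y\<^sup>2 + e\<^sup>2)"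
   using sum_squares_ge_zero[of "x * e - e * y" 0] by (simp add: power2_eq_square algebra_simps)
  then have "x * y + e * e \<le> sqrt ((x\<^sup>2 + e\<^sup>2) * (y\<^sup>2 + e\<^sup>2))" by (rule real_le_rsqrt)
  then show ?thesis by (simp add: real_sqrt_mult power2_eq_square)
 qed
 then have "?X * ?X + x * (y - x) \<le> ?X * ?Y" unfolding XX by (simp add: power2_eq_square algebra_simps)
 then have "(?X * ?X + x * (y - x)) / ?X \<le> ?Y" using X(1) by (simp add: pos_divide_le_eq mult.commute)
 moreover have "(a * a + x * (y - x)) / a = a + x / a * (y - x)" if "a > 0" for a using that by (simp add: add_divide_distrib)
 ultimately have "?X + x / ?X * (y - x) \<le> ?Y" using X(1) by metis
 moreover have "smooth_step e x * (y - x) = ((y - x) + x / ?X * (y - x)) / 2"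
  by (simp add: smooth_step_def add_divide_distrib distrib_right)
 moreover have "(x + a) / 2 + ((y - x) + b) / 2 \<le> (y + c) / 2" if "a + b \<le> c" for a b c :: real
  using that by (simp add: field_simps)
 ultimately show "smooth_pos e x + smooth_step e x * (y - x) \<le> smooth_pos e y"
  unfolding smooth_pos_def by (simp only:)
 have "\<bar>x / ?X\<bar> \<le> 1" using X by simp
 then have "- 1 \<le> x / ?X" "x / ?X \<le> 1" unfolding abs_le_iff by linarith+
 then show "0 \<le> smooth_step e x" "smooth_step e x \<le> 1" unfolding smooth_step_def by (simp_all add: field_simps)
qed

lemma smooth_pos_approx:
 assumes e: "e > 0"
 shows "max t 0 \<le> smooth_pos e t" "smooth_pos e t \<le> max t 0 + e"
proof -
 have "sqrt (t\<^sup>2 + e\<^sup>2) > \<bar>t\<bar>" using e by (intro sqrt_sum_gt) simp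
 then show "max t 0 \<le> smooth_pos e t" by (auto simp: smooth_pos_def max_def field_simps)
 have "sqrt (t\<^sup>2 + e\<^sup>2) \<le> \<bar>t\<bar> + e" using sqrt_sum_squares_le_sum_abs[of t e] e by simp
 then show "smooth_pos e t \<le> max t 0 + e" using e by (auto simp: smooth_pos_def max_def field_simps)
qed

text \<open>Off the contact set the slopes are forced towards a phase indicator; at l = 0 the
  outcome would depend on how t and e approach 0.\<close>

lemma smooth_step_tendsto:
 assumes t: "t \<longlonglongrightarrow> l" and l: "l \<noteq> 0" and e: "e \<longlonglongrightarrow> 0"
 shows "(\<lambda>n. smooth_step (e n) (t n)) \<longlonglongrightarrow> (if l > 0 then 1 else 0)"
proof -
 have "(\<lambda>n. smooth_step (e n) (t n)) \<longlonglongrightarrow> (1 + l / sqrt (l\<^sup>2 + 0\<^sup>2)) / 2"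
  unfolding smooth_step_def using l by (intro tendsto_intros t e) auto
 also have "(1 + l / sqrt (l\<^sup>2 + 0\<^sup>2)) / 2 = (if l > 0 then 1 else 0)" using l by auto
 finally show ?thesis .
qed

lemma continuous_smooth_step: "e \<noteq> 0 \<Longrightarrow> continuous_on UNIV (smooth_step e)"
 unfolding smooth_step_def[abs_def] by (intro continuous_intros) (auto simp: sum_power2_eq_zero_iff)

subsection \<open>The obstacle functional\<close>

lemma slope_bound:
 fixes a b s w :: real
 assumes "0 \<le> s \<and> s \<le> 1"
 shows "\<bar>(a * s - b * (1 - s)) * w\<bar> \<le> \<bar>a * w\<bar> + \<bar>b * w\<bar>"
proof -
 have "\<bar>s * (a * w)\<bar> \<le> \<bar>a * w\<bar>" "\<bar>(1 - s) * (b * w)\<bar> \<le> \<bar>b * w\<bar>"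
  using assms unfolding abs_mult[of s] abs_mult[of "1 - s"] by (auto intro!: mult_left_le_one_le)
 moreover have "(a * s - b * (1 - s)) * w = s * (a * w) - (1 - s) * (b * w)" by (simp add: algebra_simps)
 ultimately show ?thesis by linarith
qed

text \<open>Stands for the data extended by zero: a and b are the two coefficients, \<open>g\<close>
  the force, \<open>V\<close> the obstacle. Of the exponents, \<open>dual\<close> retains that
  pairing with a, b and \<open>g\<close> is bounded by the L^p norm of the gradient.\<close>

locale obstacle = frac_space +
 fixes a b g V :: "'a \<Rightarrow> real"
 assumes meas: "a \<in> borel_measurable lebesgue" "b \<in> borel_measurable lebesgue" "g \<in> borel_measurable lebesgue" "V \<in> borel_measurable lebesgue"
  and nonneg: "AE x in lebesgue. 0 \<le> a x \<and> 0 \<le> b x"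
  and supp: "\<And>x. x \<notin> \<Omega> \<Longrightarrow> a x = 0 \<and> b x = 0"
  and ab_int: "integrable lebesgue a" "integrable lebesgue b"
  and abV_int: "integrable lebesgue (\<lambda>x. a x * V x)" "integrable lebesgue (\<lambda>x. b x * V x)"
  and dual: "\<exists>L>0. \<forall>u G N. Lam u G \<longrightarrow> N > 0 \<longrightarrow> pint p lebesgue G \<le> ennreal (N powr p) \<longrightarrow>
   (\<integral>\<^sup>+x. ennreal (\<bar>a x * u x\<bar> + \<bar>b x * u x\<bar> + \<bar>g x * u x\<bar>) \<partial>lebesgue) \<le> ennreal (L * N)"
begin

declare meas[measurable]

lemma Lam_mult_integrable:
 assumes u: "Lam u G"
 shows "integrable lebesgue (\<lambda>x. a x * u x)" "integrable lebesgue (\<lambda>x. b x * u x)" "integrable lebesgue (\<lambda>x. g x * u x)"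
proof -
 note [measurable] = Lam_measurable(1)[OF u]
 define N where "N = (penergy G + 1) powr (1 / p)"
 have N: "N > 0" "N powr p = penergy G + 1" using penergy_nonneg[of G] p0 by (auto simp: N_def powr_powr)
 have "pint p lebesgue G \<le> ennreal (N powr p)" unfolding pint_eq_penergy[OF u] N(2) by (rule ennreal_leI) simp
 then obtain L where "(\<integral>\<^sup>+x. ennreal (\<bar>a x * u x\<bar> + \<bar>b x * u x\<bar> + \<bar>g x * u x\<bar>) \<partial>lebesgue) \<le> ennreal (L * N)"
  using dual u N(1) by blast
 then have fin: "(\<integral>\<^sup>+x. ennreal (\<bar>a x * u x\<bar> + \<bar>b x * u x\<bar> + \<bar>g x * u x\<bar>) \<partial>lebesgue) < \<infinity>"
  by (rule le_less_trans) simp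
 have "integrable lebesgue (\<lambda>x. \<bar>a x * u x\<bar> + \<bar>b x * u x\<bar> + \<bar>g x * u x\<bar>)"
  unfolding integrable_iff_bounded using fin by simp
 note i = Bochner_Integration.integrable_bound[OF this]
 show "integrable lebesgue (\<lambda>x. a x * u x)" by (rule i, measurable)
 show "integrable lebesgue (\<lambda>x. b x * u x)" by (rule i, measurable)
 show "integrable lebesgue (\<lambda>x. g x * u x)" by (rule i, measurable)
qed

text \<open>One \<theta> generates both phases: it replaces the positive part, and \<theta> minus
  the identity the negative part. The force is included, so that adding the p-energy gives the whole
  variational problem.\<close>

definition obst :: "(real \<Rightarrow> real) \<Rightarrow> ('a \<Rightarrow> real) \<Rightarrow> real" where
 "obst \<theta> u = (\<integral>x. a x * \<theta> (u x - V x) + b x * (\<theta> (u x - V x) - (u x - V x)) - g x * u x \<partial>lebesgue)"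

lemma mult_bounded_integrable:
 fixes k f :: "'a \<Rightarrow> real"
 assumes [measurable]: "k \<in> borel_measurable lebesgue" "f \<in> borel_measurable lebesgue"
  and k: "integrable lebesgue (\<lambda>x. k x * u x)" "integrable lebesgue k" "integrable lebesgue (\<lambda>x. k x * V x)"
  and f: "\<And>x. \<bar>f x\<bar> \<le> C + \<bar>u x - V x\<bar>"
 shows "integrable lebesgue (\<lambda>x. k x * f x)"
proof (rule Bochner_Integration.integrable_bound)
 show "integrable lebesgue (\<lambda>x. C * \<bar>k x\<bar> + (\<bar>k x * u x\<bar> + \<bar>k x * V x\<bar>))"
  by (intro Bochner_Integration.integrable_add integrable_mult_right integrable_abs k)
 show "AE x in lebesgue. norm (k x * f x) \<le> norm (C * \<bar>k x\<bar> + (\<bar>k x * u x\<bar> + \<bar>k x * V x\<bar>))"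
 proof (rule AE_I2)
  fix x
  have "\<bar>f x\<bar> \<le> C + (\<bar>u x\<bar> + \<bar>V x\<bar>)" using f[of x] abs_triangle_ineq4[of "u x" "V x"] by linarith
  then have "\<bar>k x\<bar> * \<bar>f x\<bar> \<le> \<bar>k x\<bar> * (C + (\<bar>u x\<bar> + \<bar>V x\<bar>))" by (intro mult_left_mono) auto
  also have "\<dots> = C * \<bar>k x\<bar> + (\<bar>k x * u x\<bar> + \<bar>k x * V x\<bar>)" by (simp add: abs_mult distrib_left mult.commute)
  finally show "norm (k x * f x) \<le> norm (C * \<bar>k x\<bar> + (\<bar>k x * u x\<bar> + \<bar>k x * V x\<bar>))"
   unfolding real_norm_def abs_mult[of "k x" "f x"] by (rule order_trans[OF _ abs_ge_self])
 qed
qed measurable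

lemma obst_integrable:
 assumes th: "subgrad01 \<theta> \<sigma>" and u: "Lam u G"
 shows "integrable lebesgue (\<lambda>x. a x * \<theta> (u x - V x))" "integrable lebesgue (\<lambda>x. b x * (\<theta> (u x - V x) - (u x - V x)))"
  "integrable lebesgue (\<lambda>x. a x * \<theta> (u x - V x) + b x * (\<theta> (u x - V x) - (u x - V x)) - g x * u x)"
proof -
 note [measurable] = Lam_measurable(1)[OF u] subgrad01_borel[OF th]
 note i = Lam_mult_integrable[OF u]
 show 1: "integrable lebesgue (\<lambda>x. a x * \<theta> (u x - V x))"
  by (rule mult_bounded_integrable[OF _ _ i(1) ab_int(1) abV_int(1) subgrad01_bound(1)[OF th]]) measurable
 show 2: "integrable lebesgue (\<lambda>x. b x * (\<theta> (u x - V x) - (u x - V x)))"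
  by (rule mult_bounded_integrable[OF _ _ i(2) ab_int(2) abV_int(2) subgrad01_bound(2)[OF th]]) measurable
 show "integrable lebesgue (\<lambda>x. a x * \<theta> (u x - V x) + b x * (\<theta> (u x - V x) - (u x - V x)) - g x * u x)"
  by (intro Bochner_Integration.integrable_diff Bochner_Integration.integrable_add 1 2 i(3))
qed

text \<open>Both integrand increments are 1-Lipschitz in u, so the difference is bounded by the
  pairing that \<open>dual\<close> estimates through the gradient.\<close>

lemma obst_Lipschitz:
 assumes th: "subgrad01 \<theta> \<sigma>"
 shows "Lipschitz_on_Lam (obst \<theta>)"
proof -
 obtain L where L: "L > 0" "\<And>u G N. Lam u G \<Longrightarrow> N > 0 \<Longrightarrow> pint p lebesgue G \<le> ennreal (N powr p) \<Longrightarrow>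
   (\<integral>\<^sup>+x. ennreal (\<bar>a x * u x\<bar> + \<bar>b x * u x\<bar> + \<bar>g x * u x\<bar>) \<partial>lebesgue) \<le> ennreal (L * N)"
  using dual by blast
 have "\<bar>obst \<theta> u - obst \<theta> w\<bar> \<le> L * N"
  if u: "Lam u G" and w: "Lam w H" and N: "N > 0" "pint p lebesgue (\<lambda>x. G x - H x) \<le> ennreal (N powr p)" for u G w H N
 proof -
  let ?f = "\<lambda>u x. a x * \<theta> (u x - V x) + b x * (\<theta> (u x - V x) - (u x - V x)) - g x * u x"
  let ?h = "\<lambda>x. \<bar>a x * (u x - w x)\<bar> + \<bar>b x * (u x - w x)\<bar> + \<bar>g x * (u x - w x)\<bar>"
  have D: "Lam (\<lambda>x. u x - w x) (\<lambda>x. G x - H x)" by (rule Lam_diff[OF u w])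
  have hi: "integrable lebesgue ?h"
   by (intro Bochner_Integration.integrable_add integrable_abs Lam_mult_integrable[OF D])
  have "\<bar>obst \<theta> u - obst \<theta> w\<bar> = \<bar>\<integral>x. ?f u x - ?f w x \<partial>lebesgue\<bar>"
   unfolding obst_def by (subst Bochner_Integration.integral_diff[OF obst_integrable(3)[OF th u] obst_integrable(3)[OF th w]]) (rule refl)
  also have "\<dots> \<le> (\<integral>x. ?h x \<partial>lebesgue)"
  proof (rule abs_integral_le[OF _ hi])
   show "integrable lebesgue (\<lambda>x. ?f u x - ?f w x)"
    by (rule Bochner_Integration.integrable_diff[OF obst_integrable(3)[OF th u] obst_integrable(3)[OF th w]])
   fix x
   let ?y = "u x - V x" and ?z = "w x - V x"
   have yz: "?y - ?z = u x - w x" by simp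
   have "\<bar>a x * (\<theta> ?y - \<theta> ?z)\<bar> \<le> \<bar>a x * (u x - w x)\<bar>"
    using subgrad01_increment(1)[OF th, of ?y ?z] unfolding yz abs_mult by (intro mult_left_mono) auto
   moreover have "\<bar>b x * ((\<theta> ?y - ?y) - (\<theta> ?z - ?z))\<bar> \<le> \<bar>b x * (u x - w x)\<bar>"
    using subgrad01_increment(2)[OF th, of ?y ?z] unfolding yz abs_mult by (intro mult_left_mono) auto
   moreover have "?f u x - ?f w x = a x * (\<theta> ?y - \<theta> ?z) + b x * ((\<theta> ?y - ?y) - (\<theta> ?z - ?z)) - g x * (u x - w x)"
    by (simp add: algebra_simps)
   ultimately show "\<bar>?f u x - ?f w x\<bar> \<le> ?h x" by linarith
  qed
  also have "\<dots> \<le> L * N"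
  proof -
   have "ennreal (\<integral>x. ?h x \<partial>lebesgue) = (\<integral>\<^sup>+x. ennreal (?h x) \<partial>lebesgue)"
    by (rule nn_integral_eq_integral[OF hi, symmetric]) simp
   also have "\<dots> \<le> ennreal (L * N)" by (rule L(2)[OF D N])
   finally show ?thesis using L(1) N(1) by (subst (asm) ennreal_le_iff) auto
  qed
  finally show ?thesis .
 qed
 then show ?thesis unfolding Lipschitz_on_Lam_def using L(1) by (intro exI[of _ L]) blast
qed

lemma obst_midconvex:
 assumes th: "subgrad01 \<theta> \<sigma>"
 shows "midconvex_on_Lam (obst \<theta>)"
 unfolding midconvex_on_Lam_def
proof (intro allI impI)
 fix u G w H assume u: "Lam u G" and w: "Lam w H"
 let ?m = "\<lambda>x. (1/2) * u x + (1/2) * w x"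
 let ?f = "\<lambda>u x. a x * \<theta> (u x - V x) + b x * (\<theta> (u x - V x) - (u x - V x)) - g x * u x"
 have m: "Lam ?m (\<lambda>x. (1/2) *\<^sub>R G x + (1/2) *\<^sub>R H x)" by (rule Lam_lin[OF u w])
 have "obst \<theta> ?m \<le> (\<integral>x. (?f u x + ?f w x) / 2 \<partial>lebesgue)"
  unfolding obst_def
 proof (rule integral_mono_AE)
  show "integrable lebesgue (?f ?m)" by (rule obst_integrable(3)[OF th m])
  show "integrable lebesgue (\<lambda>x. (?f u x + ?f w x) / 2)"
   by (intro integrable_divide Bochner_Integration.integrable_add obst_integrable(3)[OF th u] obst_integrable(3)[OF th w])
  show "AE x in lebesgue. ?f ?m x \<le> (?f u x + ?f w x) / 2"
   using nonneg
  proof eventually_elim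
   case (elim x)
   let ?y = "u x - V x" and ?z = "w x - V x"
   have e: "?m x - V x = (?y + ?z) / 2" by (simp add: field_simps)
   have th': "2 * \<theta> ((?y + ?z) / 2) \<le> \<theta> ?y + \<theta> ?z" using subgrad01_mid[OF th, of ?y ?z] by (simp add: field_simps)
   have 1: "a x * (2 * \<theta> ((?y + ?z) / 2)) \<le> a x * (\<theta> ?y + \<theta> ?z)" using elim th' by (intro mult_left_mono) auto
   have 2: "b x * (2 * \<theta> ((?y + ?z) / 2) - (?y + ?z)) \<le> b x * ((\<theta> ?y + \<theta> ?z) - (?y + ?z))" using elim th' by (intro mult_left_mono) auto
   have "2 * ?f ?m x \<le> ?f u x + ?f w x"
   proof -
    have "2 * (A * M + B * (M - s / 2) - k * ((1/2) * y + (1/2) * z)) = A * (2 * M) + B * (2 * M - s) - k * (y + z)" for A B M s k y z :: real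
     by (simp add: algebra_simps)
    moreover have "(A * y + B * (y - c) - k * c') + (A * z + B * (z - d) - k * d') = A * (y + z) + B * ((y + z) - (c + d)) - k * (c' + d')"
     for A B k y z c d c' d' :: real
     by (simp add: algebra_simps)
    ultimately show ?thesis unfolding e using 1 2 by (simp only: diff_right_mono add_mono)
   qed
   then show ?case by (simp only: le_divide_eq_numeral1 mult.commute)
  qed
 qed
 also have "\<dots> = (obst \<theta> u + obst \<theta> w) / 2"
  unfolding obst_def
  by (simp only: integral_divide_zero Bochner_Integration.integral_add[OF obst_integrable(3)[OF th u] obst_integrable(3)[OF th w]])
 finally show "obst \<theta> ?m \<le> (obst \<theta> u + obst \<theta> w) / 2" .
qed

lemma slope_integrable:
 assumes u: "Lam w H" and [measurable]: "f \<in> borel_measurable lebesgue" and f: "\<And>x. 0 \<le> f x \<and> f x \<le> 1"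
 shows "integrable lebesgue (\<lambda>x. (a x * f x - b x * (1 - f x)) * w x)"
proof (rule Bochner_Integration.integrable_bound)
 note [measurable] = Lam_measurable(1)[OF u]
 show "integrable lebesgue (\<lambda>x. \<bar>a x * w x\<bar> + \<bar>b x * w x\<bar>)"
  by (intro Bochner_Integration.integrable_add integrable_abs Lam_mult_integrable[OF u])
 show "(\<lambda>x. (a x * f x - b x * (1 - f x)) * w x) \<in> borel_measurable lebesgue" by measurable
 show "AE x in lebesgue. norm ((a x * f x - b x * (1 - f x)) * w x) \<le> norm (\<bar>a x * w x\<bar> + \<bar>b x * w x\<bar>)"
  by (rule AE_I2) (use slope_bound[OF f] in \<open>simp add: abs_mult\<close>)
qed

text \<open>Convexity bounds the difference quotients of the energy from above by the integrand at the shifted point,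
 so that the Euler--Lagrange equation follows by dominated convergence without differentiating the energy.\<close>

lemma Euler_Lagrange_ge:
 assumes th: "subgrad01 \<theta> \<sigma>" and cont: "continuous_on UNIV \<sigma>"
  and u: "Lam u G" and min: "\<And>w H. Lam w H \<Longrightarrow> energy (obst \<theta>) u G \<le> energy (obst \<theta>) w H"
  and w: "Lam w H"
 shows "0 \<le> (\<integral>x. pfield p (G x) \<bullet> H x + ((a x * \<sigma> (u x - V x) - b x * (1 - \<sigma> (u x - V x))) * w x - g x * w x) \<partial>lebesgue)"
proof -
 note [measurable] = Lam_measurable[OF u] Lam_measurable[OF w] borel_measurable_pfield
 have \<sigma>m[measurable]: "\<sigma> \<in> borel_measurable borel" using cont by (rule borel_measurable_continuous_onI)
 have \<sigma>: "0 \<le> \<sigma> t \<and> \<sigma> t \<le> 1" for t using th by (auto simp: subgrad01_def)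
 let ?q = "\<lambda>t x. (a x * \<sigma> (u x + t * w x - V x) - b x * (1 - \<sigma> (u x + t * w x - V x))) * w x"
 let ?D = "\<lambda>t x. pfield p (G x + t *\<^sub>R H x) \<bullet> H x + (?q t x - g x * w x)"
 have ut: "Lam (\<lambda>x. u x + t * w x) (\<lambda>x. G x + t *\<^sub>R H x)" for t using Lam_lin[OF u w, of 1 t] by simp
 have qi: "integrable lebesgue (?q t)" for t by (rule slope_integrable[OF w _ \<sigma>]) measurable
 have Pi: "integrable lebesgue (\<lambda>x. pfield p (G x + t *\<^sub>R H x) \<bullet> H x)" for t by (rule integrable_pfield_inner[OF ut w])
 have Di: "integrable lebesgue (?D t)" for t
  by (intro Bochner_Integration.integrable_add Bochner_Integration.integrable_diff Pi qi Lam_mult_integrable(3)[OF w])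
 have Dt: "0 \<le> (\<integral>x. ?D t x \<partial>lebesgue)" if t: "t > 0" for t
 proof -
  let ?f = "\<lambda>u x. a x * \<theta> (u x - V x) + b x * (\<theta> (u x - V x) - (u x - V x)) - g x * u x"
  let ?ut = "\<lambda>x. u x + t * w x" and ?Gt = "\<lambda>x. G x + t *\<^sub>R H x"
  have i1: "integrable lebesgue (\<lambda>x. norm (G x) powr p / p + ?f u x)"
   by (intro Bochner_Integration.integrable_add integrable_divide Lam_integrable[OF u] obst_integrable(3)[OF th u])
  have i2: "integrable lebesgue (\<lambda>x. norm (?Gt x) powr p / p + ?f ?ut x)"
   by (intro Bochner_Integration.integrable_add integrable_divide Lam_integrable[OF ut] obst_integrable(3)[OF th ut])
  have E: "energy (obst \<theta>) v K = (\<integral>x. norm (K x) powr p / p + ?f v x \<partial>lebesgue)" if v: "Lam v K" for v K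
   unfolding energy_def penergy_def obst_def
   by (subst Bochner_Integration.integral_add[OF integrable_divide[OF Lam_integrable[OF v]] obst_integrable(3)[OF th v]]) (simp only: integral_divide_zero)
  have "(\<integral>x. norm (G x) powr p / p + ?f u x \<partial>lebesgue) \<le> (\<integral>x. norm (?Gt x) powr p / p + ?f ?ut x \<partial>lebesgue)"
   using min[OF ut] unfolding E[OF u] E[OF ut] .
  also have "\<dots> \<le> (\<integral>x. (norm (G x) powr p / p + ?f u x) + t * ?D t x \<partial>lebesgue)"
  proof (rule integral_mono_AE[OF i2])
   show "integrable lebesgue (\<lambda>x. (norm (G x) powr p / p + ?f u x) + t * ?D t x)"
    by (intro Bochner_Integration.integrable_add[OF i1] integrable_mult_right Di)
   show "AE x in lebesgue. norm (?Gt x) powr p / p + ?f ?ut x \<le> (norm (G x) powr p / p + ?f u x) + t * ?D t x"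
    using nonneg
   proof eventually_elim
    case (elim x)
    let ?y = "u x - V x" and ?z = "u x + t * w x - V x"
    have G: "norm (?Gt x) powr p / p \<le> norm (G x) powr p / p + t * (pfield p (?Gt x) \<bullet> H x)"
     using norm_powr_gradient_inequality[OF p, of "?Gt x" "G x"] by (simp add: pfield_def mult_ac)
    have yz: "?y - ?z = - (t * w x)" by simp
    have th1: "\<theta> ?z - \<theta> ?y \<le> t * (\<sigma> ?z * w x)"
    proof -
     have "\<theta> ?z + \<sigma> ?z * (?y - ?z) \<le> \<theta> ?y" using th unfolding subgrad01_def by blast
     moreover have "\<sigma> ?z * (?y - ?z) = - (t * (\<sigma> ?z * w x))" unfolding yz by (simp add: mult_ac)
     ultimately show ?thesis by linarith
    qed
    have A: "a x * (\<theta> ?z - \<theta> ?y) \<le> a x * (t * (\<sigma> ?z * w x))" using elim th1 by (intro mult_left_mono) auto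
    have B: "b x * (\<theta> ?z - \<theta> ?y) \<le> b x * (t * (\<sigma> ?z * w x))" using elim th1 by (intro mult_left_mono) auto
    have f1: "?f ?ut x - ?f u x = a x * (\<theta> ?z - \<theta> ?y) + b x * (\<theta> ?z - \<theta> ?y) - b x * (t * w x) - g x * (t * w x)"
     by (simp add: algebra_simps)
    have f2: "t * (?q t x - g x * w x) = a x * (t * (\<sigma> ?z * w x)) + b x * (t * (\<sigma> ?z * w x)) - b x * (t * w x) - g x * (t * w x)"
     by (simp add: algebra_simps)
    have "t * ?D t x = t * (pfield p (?Gt x) \<bullet> H x) + t * (?q t x - g x * w x)" by (rule distrib_left)
    moreover have "N + f' \<le> N' + f + t * D"
     if "N \<le> N' + T" "f' - f = A1 + B1 - C - E" "Q = A2 + B2 - C - E" "A1 \<le> A2" "B1 \<le> B2" "t * D = T + Q"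
     for N N' T f f' A1 A2 B1 B2 C E Q D :: real
     using that by linarith
    ultimately show ?case using G f1 f2 A B by blast
   qed
  qed
  also have "\<dots> = (\<integral>x. norm (G x) powr p / p + ?f u x \<partial>lebesgue) + t * (\<integral>x. ?D t x \<partial>lebesgue)"
   by (simp only: Bochner_Integration.integral_add[OF i1 integrable_mult_right[OF Di]] integral_mult_right_zero)
  finally have "0 \<le> t * (\<integral>x. ?D t x \<partial>lebesgue)" by linarith
  then show ?thesis using t by (simp only: zero_le_mult_iff) auto
 qed
 define \<tau> where "\<tau> n = inverse (real (Suc n))" for n
 have \<tau>: "\<tau> n > 0" "\<tau> n \<le> 1" for n
  by (simp_all add: \<tau>_def inverse_le_1_iff)
 have \<tau>0: "\<tau> \<longlonglongrightarrow> 0" unfolding \<tau>_def[abs_def] by (rule LIMSEQ_inverse_real_of_nat)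
 let ?dom = "\<lambda>x. (2 powr p * (norm (G x) powr p + norm (H x) powr p) + norm (H x) powr p) + (\<bar>a x * w x\<bar> + \<bar>b x * w x\<bar> + \<bar>g x * w x\<bar>)"
 have "(\<lambda>n. \<integral>x. ?D (\<tau> n) x \<partial>lebesgue) \<longlonglongrightarrow> (\<integral>x. ?D 0 x \<partial>lebesgue)"
 proof (rule integral_dominated_convergence[where w="?dom"])
  show "integrable lebesgue ?dom"
   by (intro Bochner_Integration.integrable_add integrable_mult_right integrable_abs Lam_integrable[OF u] Lam_integrable[OF w] Lam_mult_integrable[OF w])
  show "?D 0 \<in> borel_measurable lebesgue" "?D (\<tau> n) \<in> borel_measurable lebesgue" for n
   by measurable
  show "AE x in lebesgue. (\<lambda>n. ?D (\<tau> n) x) \<longlonglongrightarrow> ?D 0 x"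
  proof (rule AE_I2)
   fix x
   have s: "(\<lambda>n. \<sigma> (u x + \<tau> n * w x - V x)) \<longlonglongrightarrow> \<sigma> (u x + 0 * w x - V x)"
    using cont by (intro continuous_on_tendsto_compose[of UNIV \<sigma>] tendsto_intros \<tau>0) auto
   have P: "(\<lambda>n. pfield p (G x + \<tau> n *\<^sub>R H x)) \<longlonglongrightarrow> pfield p (G x + 0 *\<^sub>R H x)"
    by (intro tendsto_pfield p tendsto_intros \<tau>0)
   show "(\<lambda>n. ?D (\<tau> n) x) \<longlonglongrightarrow> ?D 0 x" by (intro tendsto_intros s P)
  qed
  show "AE x in lebesgue. norm (?D (\<tau> n) x) \<le> ?dom x" for n
  proof (rule AE_I2)
   fix x
   have "\<bar>pfield p (G x + \<tau> n *\<^sub>R H x) \<bullet> H x\<bar> \<le> norm (G x + \<tau> n *\<^sub>R H x) powr p + norm (H x) powr p" by (rule pfield_inner_le[OF p])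
   also have "norm (G x + \<tau> n *\<^sub>R H x) powr p \<le> 2 powr p * (norm (G x) powr p + norm (\<tau> n *\<^sub>R H x) powr p)" by (rule norm_add_powr_le[OF p0])
   also have "\<dots> \<le> 2 powr p * (norm (G x) powr p + norm (H x) powr p)"
    using \<tau>[of n] p0 by (intro mult_left_mono add_left_mono powr_mono2) (auto intro: mult_left_le_one_le)
   finally have 1: "\<bar>pfield p (G x + \<tau> n *\<^sub>R H x) \<bullet> H x\<bar> \<le> 2 powr p * (norm (G x) powr p + norm (H x) powr p) + norm (H x) powr p" by simp
   have 2: "\<bar>?q (\<tau> n) x\<bar> \<le> \<bar>a x * w x\<bar> + \<bar>b x * w x\<bar>" by (rule slope_bound[OF \<sigma>])
   show "norm (?D (\<tau> n) x) \<le> ?dom x" using 1 2 unfolding real_norm_def by linarith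
  qed
 qed
 then have "0 \<le> (\<integral>x. ?D 0 x \<partial>lebesgue)"
  by (rule LIMSEQ_le_const) (use Dt \<tau>(1) in blast)
 then show ?thesis by simp
qed

text \<open>The inequality is applied to w and to -w. Continuity of \<sigma> enters through the
  limit of the shifted slopes; \<open>max t 0\<close> has no continuous slope, which is the reason
  for the regularisation.\<close>

lemma Euler_Lagrange:
 assumes th: "subgrad01 \<theta> \<sigma>" and cont: "continuous_on UNIV \<sigma>"
  and u: "Lam u G" and min: "\<And>w H. Lam w H \<Longrightarrow> energy (obst \<theta>) u G \<le> energy (obst \<theta>) w H"
  and w: "Lam w H"
 shows "(\<integral>x. pfield p (G x) \<bullet> H x \<partial>lebesgue) + (\<integral>x. (a x * \<sigma> (u x - V x) - b x * (1 - \<sigma> (u x - V x))) * w x \<partial>lebesgue)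
   = (\<integral>x. g x * w x \<partial>lebesgue)"
proof -
 note [measurable] = Lam_measurable[OF u]
 have [measurable]: "\<sigma> \<in> borel_measurable borel" using cont by (rule borel_measurable_continuous_onI)
 have \<sigma>: "0 \<le> \<sigma> t \<and> \<sigma> t \<le> 1" for t using th by (auto simp: subgrad01_def)
 let ?q = "\<lambda>x. (a x * \<sigma> (u x - V x) - b x * (1 - \<sigma> (u x - V x)))"
 have w': "Lam (\<lambda>x. - w x) (\<lambda>x. - H x)" using Lam_lin[OF w w, of "-1" 0] by simp
 have eq: "(\<integral>x. pfield p (G x) \<bullet> H x + (?q x * w x - g x * w x) \<partial>lebesgue)
  = (\<integral>x. pfield p (G x) \<bullet> H x \<partial>lebesgue) + ((\<integral>x. ?q x * w x \<partial>lebesgue) - (\<integral>x. g x * w x \<partial>lebesgue))"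
 proof -
  have qi: "integrable lebesgue (\<lambda>x. ?q x * w x)" by (rule slope_integrable[OF w _ \<sigma>]) measurable
  note gi = Lam_mult_integrable(3)[OF w]
  show ?thesis
   by (simp only: Bochner_Integration.integral_add[OF integrable_pfield_inner[OF u w] Bochner_Integration.integrable_diff[OF qi gi]] Bochner_Integration.integral_diff[OF qi gi])
 qed
 have "0 \<le> (\<integral>x. pfield p (G x) \<bullet> H x + (?q x * w x - g x * w x) \<partial>lebesgue)"
  by (rule Euler_Lagrange_ge[OF th cont u min w])
 moreover have "0 \<le> (\<integral>x. - (pfield p (G x) \<bullet> H x + (?q x * w x - g x * w x)) \<partial>lebesgue)"
 proof -
  have e: "- (pfield p (G x) \<bullet> H x + (?q x * w x - g x * w x)) = pfield p (G x) \<bullet> (- H x) + (?q x * (- w x) - g x * (- w x))" for x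
   by (simp only: inner_minus_right mult_minus_right minus_add_distrib minus_diff_minus)
  show ?thesis unfolding e by (rule Euler_Lagrange_ge[OF th cont u min w'])
 qed
 ultimately show ?thesis unfolding integral_minus eq by linarith
qed

end

context obstacle begin

abbreviation (input) eps :: "nat \<Rightarrow> real" where "eps k \<equiv> inverse (real (Suc k))"

text \<open>The error is e times the integral of a + b, the same for all u; this uniformity makes
  the minimisers of the regularised energies a minimising sequence of the limiting one.\<close>

lemma obst_smooth_approx:
 assumes u: "Lam u G" and e: "e > 0"
 shows "obst (\<lambda>t. max t 0) u \<le> obst (smooth_pos e) u"
  "obst (smooth_pos e) u \<le> obst (\<lambda>t. max t 0) u + e * (\<integral>x. a x + b x \<partial>lebesgue)"
proof -
 have e0: "e \<noteq> 0" using e by simp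
 note i0 = obst_integrable(3)[OF subgrad01_pos u] and i1 = obst_integrable(3)[OF subgrad01_smooth[OF e0] u]
 show "obst (\<lambda>t. max t 0) u \<le> obst (smooth_pos e) u"
  unfolding obst_def
 proof (rule integral_mono_AE[OF i0 i1])
  show "AE x in lebesgue. a x * max (u x - V x) 0 + b x * (max (u x - V x) 0 - (u x - V x)) - g x * u x
    \<le> a x * smooth_pos e (u x - V x) + b x * (smooth_pos e (u x - V x) - (u x - V x)) - g x * u x"
   using nonneg
  proof eventually_elim
   case (elim x)
   show ?case
    using elim smooth_pos_approx(1)[OF e, of "u x - V x"]
    by (intro diff_right_mono add_mono mult_left_mono) auto
  qed
 qed
 have abi: "integrable lebesgue (\<lambda>x. e * (a x + b x))" by (intro integrable_mult_right Bochner_Integration.integrable_add ab_int)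
 have "obst (smooth_pos e) u \<le> (\<integral>x. (a x * max (u x - V x) 0 + b x * (max (u x - V x) 0 - (u x - V x)) - g x * u x) + e * (a x + b x) \<partial>lebesgue)"
  unfolding obst_def
 proof (rule integral_mono_AE[OF i1 Bochner_Integration.integrable_add[OF i0 abi]])
  show "AE x in lebesgue. a x * smooth_pos e (u x - V x) + b x * (smooth_pos e (u x - V x) - (u x - V x)) - g x * u x
   \<le> (a x * max (u x - V x) 0 + b x * (max (u x - V x) 0 - (u x - V x)) - g x * u x) + e * (a x + b x)"
   using nonneg
  proof eventually_elim
   case (elim x)
   let ?z = "u x - V x"
   have A: "a x * smooth_pos e ?z \<le> a x * (max ?z 0 + e)" using elim smooth_pos_approx(2)[OF e] by (intro mult_left_mono) auto
   have B: "b x * (smooth_pos e ?z - ?z) \<le> b x * ((max ?z 0 + e) - ?z)" using elim smooth_pos_approx(2)[OF e] by (intro mult_left_mono) auto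
   have "A * (m + e) + B * ((m + e) - z) - k = (A * m + B * (m - z) - k) + e * (A + B)" for A B m z k :: real
    by (simp add: algebra_simps)
   then show ?case using add_mono[OF A B] by (metis diff_right_mono)
  qed
 qed
 also have "\<dots> = obst (\<lambda>t. max t 0) u + e * (\<integral>x. a x + b x \<partial>lebesgue)"
  unfolding obst_def by (simp only: Bochner_Integration.integral_add[OF i0 abi] integral_mult_right_zero)
 finally show "obst (smooth_pos e) u \<le> obst (\<lambda>t. max t 0) u + e * (\<integral>x. a x + b x \<partial>lebesgue)" .
qed

text \<open>Each regularised minimiser has limiting energy within \<open>eps n\<close> times a
  constant of the minimum. So the statement on minimising sequences applies and yields strong
  convergence of the functions and of their gradients.\<close>

lemma ex_smooth_solutions:
 obtains u G v H where "\<And>n. Lam (u n) (G n)" "Lam v H"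
  "(\<lambda>n. pint p lebesgue (\<lambda>x. u n x - v x)) \<longlonglongrightarrow> 0" "(\<lambda>n. pint p lebesgue (\<lambda>x. G n x - H x)) \<longlonglongrightarrow> 0"
  "\<And>n w K. Lam w K \<Longrightarrow> (\<integral>x. pfield p (G n x) \<bullet> K x \<partial>lebesgue)
    + (\<integral>x. (a x * smooth_step (eps n) (u n x - V x) - b x * (1 - smooth_step (eps n) (u n x - V x))) * w x \<partial>lebesgue)
    = (\<integral>x. g x * w x \<partial>lebesgue)"
proof -
 let ?F = "obst (\<lambda>t. max t 0)"
 have e0: "eps n > 0" "eps n \<noteq> 0" for n by simp_all
 note th = subgrad01_smooth[OF e0(2)]
 have "\<exists>u G. Lam u G \<and> (\<forall>w H. Lam w H \<longrightarrow> energy (obst (smooth_pos (eps n))) u G \<le> energy (obst (smooth_pos (eps n))) w H)" for n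
  using ex_minimizer[OF obst_Lipschitz[OF th[of n]] obst_midconvex[OF th[of n]]] by metis
 then obtain u G where u: "\<And>n. Lam (u n) (G n)"
  and min: "\<And>n w H. Lam w H \<Longrightarrow> energy (obst (smooth_pos (eps n))) (u n) (G n) \<le> energy (obst (smooth_pos (eps n))) w H"
  by metis
 note Lip = obst_Lipschitz[OF subgrad01_pos] and mid = obst_midconvex[OF subgrad01_pos]
 obtain w0 K0 where w0: "Lam w0 K0" "\<And>w H. Lam w H \<Longrightarrow> energy ?F w0 K0 \<le> energy ?F w H"
  using ex_minimizer[OF Lip mid] by metis
 define C where "C = (\<integral>x. a x + b x \<partial>lebesgue)"
 have le: "energy ?F (u n) (G n) \<le> energy ?F w0 K0 + eps n * C" for n
 proof -
  have "energy ?F (u n) (G n) \<le> energy (obst (smooth_pos (eps n))) (u n) (G n)"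
   unfolding energy_def by (rule add_left_mono[OF obst_smooth_approx(1)[OF u e0(1)]])
  also have "\<dots> \<le> energy (obst (smooth_pos (eps n))) w0 K0" by (rule min[OF w0(1)])
  also have "\<dots> \<le> energy ?F w0 K0 + eps n * C"
   unfolding energy_def C_def add.assoc by (rule add_left_mono[OF obst_smooth_approx(2)[OF w0(1) e0(1)]])
  finally show ?thesis .
 qed
 have lim: "(\<lambda>n. energy ?F (u n) (G n)) \<longlonglongrightarrow> energy ?F w0 K0"
 proof (rule tendsto_sandwich[OF _ _ tendsto_const])
  show "\<forall>\<^sub>F n in sequentially. energy ?F w0 K0 \<le> energy ?F (u n) (G n)" by (intro always_eventually allI w0(2) u)
  show "\<forall>\<^sub>F n in sequentially. energy ?F (u n) (G n) \<le> energy ?F w0 K0 + eps n * C" by (intro always_eventually allI le)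
  have "(\<lambda>n. energy ?F w0 K0 + eps n * C) \<longlonglongrightarrow> energy ?F w0 K0 + 0 * C"
   by (intro tendsto_intros LIMSEQ_inverse_real_of_nat)
  then show "(\<lambda>n. energy ?F w0 K0 + eps n * C) \<longlonglongrightarrow> energy ?F w0 K0" by simp
 qed
 obtain v H where v: "Lam v H" "(\<lambda>n. pint p lebesgue (\<lambda>x. u n x - v x)) \<longlonglongrightarrow> 0" "(\<lambda>n. pint p lebesgue (\<lambda>x. G n x - H x)) \<longlonglongrightarrow> 0"
  by (rule minimizing_sequence[OF Lip mid u lim w0(2)])
 show ?thesis
  by (rule that[OF u v Euler_Lagrange[OF th continuous_smooth_step[OF e0(2)] u min]])
qed

text \<open>Linearity moves the weights inside the integral; dominated convergence with |a w| + |b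
  w| applies since convex combinations of values in the unit interval stay there.\<close>

lemma combination_tendsto:
 assumes w: "Lam w K" and c: "\<And>n. tail_weights n (c n)"
  and Xm[measurable]: "\<And>k. X k \<in> borel_measurable lebesgue" and X: "\<And>k x. 0 \<le> X k x \<and> X k x \<le> 1"
  and Ym[measurable]: "Y \<in> borel_measurable lebesgue"
  and Y: "AE x in lebesgue. (\<lambda>n. wsum (c n) (\<lambda>k. X k x)) \<longlonglongrightarrow> Y x"
 shows "(\<lambda>n. wsum (c n) (\<lambda>k. \<integral>x. (a x + b x) * (X k x * w x) \<partial>lebesgue)) \<longlonglongrightarrow> (\<integral>x. (a x + b x) * (Y x * w x) \<partial>lebesgue)"
proof -
 note [measurable] = Lam_measurable(1)[OF w]
 let ?dom = "\<lambda>x. \<bar>a x * w x\<bar> + \<bar>b x * w x\<bar>"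
 have domi: "integrable lebesgue ?dom" by (intro Bochner_Integration.integrable_add integrable_abs Lam_mult_integrable[OF w])
 have bd: "\<bar>(a x + b x) * (f * w x)\<bar> \<le> ?dom x" if "0 \<le> f" "f \<le> 1" for f x
 proof -
  have "\<bar>(a x + b x) * (f * w x)\<bar> = f * \<bar>a x * w x + b x * w x\<bar>"
   using that by (simp add: abs_mult distrib_right[symmetric] mult_ac)
  also have "\<dots> \<le> \<bar>a x * w x + b x * w x\<bar>" using that by (intro mult_left_le_one_le) auto
  also have "\<dots> \<le> ?dom x" by (rule abs_triangle_ineq)
  finally show ?thesis .
 qed
 have Xi: "integrable lebesgue (\<lambda>x. (a x + b x) * (X k x * w x))" for k
 proof (rule Bochner_Integration.integrable_bound[OF domi])
  show "AE x in lebesgue. norm ((a x + b x) * (X k x * w x)) \<le> norm (?dom x)"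
   by (rule AE_I2) (use bd X in simp)
 qed measurable
 have Wm[measurable]: "(\<lambda>x. wsum (c n) (\<lambda>k. X k x)) \<in> borel_measurable lebesgue" for n unfolding wsum_def by measurable
 have W01: "0 \<le> wsum (c n) (\<lambda>k. X k x)" "wsum (c n) (\<lambda>k. X k x) \<le> 1" for n x
  using wsum_bounds[OF c[of n], of 0 "\<lambda>k. X k x" 1] X by auto
 have eq: "wsum (c n) (\<lambda>k. \<integral>x. (a x + b x) * (X k x * w x) \<partial>lebesgue) = (\<integral>x. (a x + b x) * (wsum (c n) (\<lambda>k. X k x) * w x) \<partial>lebesgue)" for n
 proof -
  have "wsum (c n) (\<lambda>k. \<integral>x. (a x + b x) * (X k x * w x) \<partial>lebesgue) = (\<integral>x. (\<Sum>k | c n k \<noteq> 0. c n k * ((a x + b x) * (X k x * w x))) \<partial>lebesgue)"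
   unfolding wsum_def integral_mult_right_zero[symmetric]
   by (rule Bochner_Integration.integral_sum[symmetric]) (intro integrable_mult_right Xi)
  also have "\<dots> = (\<integral>x. (a x + b x) * (wsum (c n) (\<lambda>k. X k x) * w x) \<partial>lebesgue)"
   unfolding wsum_def by (intro Bochner_Integration.integral_cong refl) (simp add: sum_distrib_left sum_distrib_right mult_ac)
  finally show ?thesis .
 qed
 show ?thesis
  unfolding eq
 proof (rule integral_dominated_convergence[OF _ _ domi])
  show "AE x in lebesgue. (\<lambda>n. (a x + b x) * (wsum (c n) (\<lambda>k. X k x) * w x)) \<longlonglongrightarrow> (a x + b x) * (Y x * w x)"
   using Y by eventually_elim (intro tendsto_intros)
  show "AE x in lebesgue. norm ((a x + b x) * (wsum (c n) (\<lambda>k. X k x) * w x)) \<le> ?dom x" for n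
   by (rule AE_I2) (use bd[OF W01] in simp)
 qed measurable
qed

text \<open>Along the sequence, the nonlinear term and the slope term add up to a number depending
  on the test function only. Averaging leaves this number unchanged, the nonlinear term keeps its
  limit, and the averaged slopes converge almost everywhere, so the equation holds in the
  limit.\<close>

theorem ex_solution:
 assumes \<Omega>m: "emeasure lebesgue \<Omega> < \<infinity>"
 obtains v H \<theta> where "Lam v H" "\<theta> \<in> borel_measurable lebesgue" "\<And>x. 0 \<le> \<theta> x \<and> \<theta> x \<le> 1"
  "AE x in lebesgue. x \<in> \<Omega> \<longrightarrow> (V x < v x \<longrightarrow> \<theta> x = 1) \<and> (v x < V x \<longrightarrow> \<theta> x = 0)"
  "\<And>w K. Lam w K \<Longrightarrow> (\<integral>x. pfield p (H x) \<bullet> K x \<partial>lebesgue) + (\<integral>x. (a x * \<theta> x - b x * (1 - \<theta> x)) * w x \<partial>lebesgue)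
    = (\<integral>x. g x * w x \<partial>lebesgue)"
proof -
 obtain u G v H where u: "\<And>n. Lam (u n) (G n)" and v: "Lam v H"
  and lu: "(\<lambda>n. pint p lebesgue (\<lambda>x. u n x - v x)) \<longlonglongrightarrow> 0" and lG: "(\<lambda>n. pint p lebesgue (\<lambda>x. G n x - H x)) \<longlonglongrightarrow> 0"
  and EL: "\<And>n w K. Lam w K \<Longrightarrow> (\<integral>x. pfield p (G n x) \<bullet> K x \<partial>lebesgue)
    + (\<integral>x. (a x * smooth_step (eps n) (u n x - V x) - b x * (1 - smooth_step (eps n) (u n x - V x))) * w x \<partial>lebesgue)
    = (\<integral>x. g x * w x \<partial>lebesgue)"
  by (rule ex_smooth_solutions, rule that)
 note [measurable] = Lam_measurable[OF u] Lam_measurable[OF v] borel_measurable_pfield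
 obtain r S where r: "strict_mono r" and S: "integrable lebesgue (S :: 'a \<Rightarrow> real)"
  and dom: "AE x in lebesgue. \<forall>k. norm (G (r k) x - H x) powr p \<le> S x" and Gr: "AE x in lebesgue. (\<lambda>k. G (r k) x) \<longlonglongrightarrow> H x"
  by (rule pint_dominated_subseq[OF _ _ p0 lG]) auto
 have lur: "(\<lambda>n. pint p lebesgue (\<lambda>x. u (r n) x - v x)) \<longlonglongrightarrow> 0"
  using LIMSEQ_subseq_LIMSEQ[OF lu r] by (simp add: o_def)
 obtain r' where r': "strict_mono r'" "AE x in lebesgue. (\<lambda>n. u (r (r' n)) x) \<longlonglongrightarrow> v x"
  by (rule pint_tendsto_AE_subseq[OF _ _ p0 lur]) auto
 define \<rho> where "\<rho> n = r (r' n)" for n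
 have \<rho>: "strict_mono \<rho>" unfolding \<rho>_def using r r'(1) by (simp add: strict_mono_def)
 have e\<rho>: "(\<lambda>n. eps (\<rho> n)) \<longlonglongrightarrow> 0" using LIMSEQ_subseq_LIMSEQ[OF LIMSEQ_inverse_real_of_nat \<rho>] by (simp only: o_def)
 have e0: "eps n \<noteq> 0" for n by simp
 define \<sigma> where "\<sigma> n x = smooth_step (eps (\<rho> n)) (u (\<rho> n) x - V x)" for n x
 have \<sigma>01: "0 \<le> \<sigma> n x \<and> \<sigma> n x \<le> 1" for n x
  using subgrad01_smooth[OF e0[of "\<rho> n"]] unfolding subgrad01_def \<sigma>_def by blast
 have stm: "smooth_step (eps n) \<in> borel_measurable borel" for n by (intro borel_measurable_continuous_onI continuous_smooth_step e0)
 have \<sigma>m[measurable]: "\<sigma> n \<in> borel_measurable lebesgue" for n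
  unfolding \<sigma>_def[abs_def] by (rule measurable_compose[OF _ stm]) measurable
 have \<Omega>s[measurable]: "\<Omega> \<in> sets lebesgue" using open_\<Omega> by simp
 \<comment> \<open>Restricted to \<Omega>, a set of finite measure, as the L^2 argument for convex
   combinations requires; the equation is unchanged because a and b vanish outside.\<close>
 define X where "X n x = indicator \<Omega> x * \<sigma> n x" for n x
 have Xm[measurable]: "X n \<in> borel_measurable lebesgue" for n unfolding X_def[abs_def] by measurable
 have X01: "0 \<le> X n x \<and> X n x \<le> 1" for n x using \<sigma>01[of n x] by (auto simp: X_def split: split_indicator)
 have Xb: "\<bar>X n x\<bar> \<le> indicator \<Omega> x" for n x using \<sigma>01[of n x] by (auto simp: X_def split: split_indicator)
 obtain c Y where c: "\<And>n. tail_weights n (c n)" and Ym[measurable]: "Y \<in> borel_measurable lebesgue"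
  and Y: "AE x in lebesgue. (\<lambda>n. wsum (c n) (\<lambda>k. X k x)) \<longlonglongrightarrow> Y x"
  by (rule ex_convergent_tail_combinations[where X=X, OF Xm \<Omega>s \<Omega>m Xb], rule that)
 \<comment> \<open>The limit is known to lie in the unit interval only almost everywhere; clamping
   gives the bounds at every point.\<close>
 define \<theta> where "\<theta> x = max 0 (min 1 (Y x))" for x
 have \<theta>m[measurable]: "\<theta> \<in> borel_measurable lebesgue" unfolding \<theta>_def[abs_def] by measurable
 have \<theta>01: "0 \<le> \<theta> x \<and> \<theta> x \<le> 1" for x by (simp add: \<theta>_def)
 have W01: "0 \<le> wsum (c n) (\<lambda>k. X k x)" "wsum (c n) (\<lambda>k. X k x) \<le> 1" for n x
  using wsum_bounds[OF c[of n], of 0 "\<lambda>k. X k x" 1] X01 by auto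
 have Y\<theta>: "AE x in lebesgue. Y x = \<theta> x"
  using Y
 proof eventually_elim
  case (elim x)
  have "0 \<le> Y x" by (rule LIMSEQ_le_const[OF elim]) (use W01 in blast)
  moreover have "Y x \<le> 1" by (rule LIMSEQ_le_const2[OF elim]) (use W01 in blast)
  ultimately show ?case by (simp add: \<theta>_def)
 qed
 have u\<rho>: "AE x in lebesgue. (\<lambda>n. u (\<rho> n) x) \<longlonglongrightarrow> v x" unfolding \<rho>_def by (rule r'(2))
 have phase: "AE x in lebesgue. x \<in> \<Omega> \<longrightarrow> (V x < v x \<longrightarrow> \<theta> x = 1) \<and> (v x < V x \<longrightarrow> \<theta> x = 0)"
  using Y Y\<theta> u\<rho>
 proof eventually_elim
  case (elim x)
  \<comment> \<open>Off the contact set the slopes themselves converge to 1 or 0, and the averages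
    follow them.\<close>
  have "\<theta> x = (if v x - V x > 0 then 1 else 0)" if x: "x \<in> \<Omega>" and ne: "v x - V x \<noteq> 0"
  proof -
   have "(\<lambda>n. u (\<rho> n) x - V x) \<longlonglongrightarrow> v x - V x" by (intro tendsto_intros elim(3))
   from smooth_step_tendsto[OF this ne e\<rho>] have "(\<lambda>n. X n x) \<longlonglongrightarrow> (if v x - V x > 0 then 1 else 0)"
    using x by (simp only: X_def \<sigma>_def indicator_simps mult_1)
   from wsum_tendsto[OF c this] have "(\<lambda>n. wsum (c n) (\<lambda>k. X k x)) \<longlonglongrightarrow> (if v x - V x > 0 then 1 else 0)" .
   from LIMSEQ_unique[OF elim(1) this] elim(2) show ?thesis by simp
  qed
  then show ?case by fastforce
 qed
 have eqn: "(\<integral>x. pfield p (H x) \<bullet> K x \<partial>lebesgue) + (\<integral>x. (a x * \<theta> x - b x * (1 - \<theta> x)) * w x \<partial>lebesgue) = (\<integral>x. g x * w x \<partial>lebesgue)"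
  if w: "Lam w K" for w K
 proof -
  note [measurable] = Lam_measurable[OF w]
  have lp: "(\<lambda>n. \<integral>x. pfield p (G (\<rho> n) x) \<bullet> K x \<partial>lebesgue) \<longlonglongrightarrow> (\<integral>x. pfield p (H x) \<bullet> K x \<partial>lebesgue)"
  proof (rule integral_dominated_convergence[where w="\<lambda>x. 2 powr p * (S x + norm (H x) powr p) + norm (K x) powr p"])
   show "integrable lebesgue (\<lambda>x. 2 powr p * (S x + norm (H x) powr p) + norm (K x) powr p)"
    by (intro Bochner_Integration.integrable_add integrable_mult_right S Lam_integrable[OF v] Lam_integrable[OF w])
   show "AE x in lebesgue. (\<lambda>n. pfield p (G (\<rho> n) x) \<bullet> K x) \<longlonglongrightarrow> pfield p (H x) \<bullet> K x"
    using Gr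
   proof eventually_elim
    case (elim x)
    have "(\<lambda>n. G (\<rho> n) x) \<longlonglongrightarrow> H x" using LIMSEQ_subseq_LIMSEQ[OF elim r'(1)] by (simp only: o_def \<rho>_def)
    then show ?case by (intro tendsto_intros tendsto_pfield p)
   qed
   show "AE x in lebesgue. norm (pfield p (G (\<rho> n) x) \<bullet> K x) \<le> 2 powr p * (S x + norm (H x) powr p) + norm (K x) powr p" for n
    using dom
   proof eventually_elim
    case (elim x)
    have "norm (G (\<rho> n) x) powr p = norm ((G (\<rho> n) x - H x) + H x) powr p" by simp
    also have "\<dots> \<le> 2 powr p * (norm (G (\<rho> n) x - H x) powr p + norm (H x) powr p)" by (rule norm_add_powr_le[OF p0])
    also have "\<dots> \<le> 2 powr p * (S x + norm (H x) powr p)" using elim unfolding \<rho>_def by (intro mult_left_mono add_right_mono) auto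
    finally show ?case using pfield_inner_le[OF p, of "G (\<rho> n) x" "K x"] unfolding real_norm_def by linarith
   qed
  qed measurable
  have bw: "integrable lebesgue (\<lambda>x. b x * w x)" by (rule Lam_mult_integrable(2)[OF w])
  \<comment> \<open>Separates the slope, so that one integral is linear in it and the other is
    independent of it.\<close>
  have split: "(\<integral>x. (a x * f x - b x * (1 - f x)) * w x \<partial>lebesgue) = (\<integral>x. (a x + b x) * (f x * w x) \<partial>lebesgue) - (\<integral>x. b x * w x \<partial>lebesgue)"
   if [measurable]: "f \<in> borel_measurable lebesgue" and f: "\<And>x. 0 \<le> f x \<and> f x \<le> 1" for f
  proof -
   have e: "(a x + b x) * (f x * w x) = (a x * f x - b x * (1 - f x)) * w x + b x * w x" for x by (simp add: algebra_simps)
   show ?thesis unfolding e Bochner_Integration.integral_add[OF slope_integrable[OF w that] bw] by simp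
  qed
  have X\<sigma>: "(\<integral>x. (a x + b x) * (\<sigma> n x * w x) \<partial>lebesgue) = (\<integral>x. (a x + b x) * (X n x * w x) \<partial>lebesgue)" for n
  proof (intro Bochner_Integration.integral_cong refl)
   fix x
   show "(a x + b x) * (\<sigma> n x * w x) = (a x + b x) * (X n x * w x)"
    using supp[of x] by (cases "x \<in> \<Omega>") (simp_all add: X_def)
  qed
  define K0 where "K0 = (\<integral>x. g x * w x \<partial>lebesgue) + (\<integral>x. b x * w x \<partial>lebesgue)"
  have sumK: "(\<integral>x. pfield p (G (\<rho> n) x) \<bullet> K x \<partial>lebesgue) + (\<integral>x. (a x + b x) * (X n x * w x) \<partial>lebesgue) = K0" for n
   using EL[OF w, of "\<rho> n"] split[OF \<sigma>m \<sigma>01, of n] X\<sigma>[of n] unfolding \<sigma>_def[symmetric] K0_def by linarith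
  have "(\<lambda>n. wsum (c n) (\<lambda>k. \<integral>x. pfield p (G (\<rho> k) x) \<bullet> K x \<partial>lebesgue) + wsum (c n) (\<lambda>k. \<integral>x. (a x + b x) * (X k x * w x) \<partial>lebesgue))
   \<longlonglongrightarrow> (\<integral>x. pfield p (H x) \<bullet> K x \<partial>lebesgue) + (\<integral>x. (a x + b x) * (Y x * w x) \<partial>lebesgue)"
   by (intro tendsto_add wsum_tendsto[OF c lp] combination_tendsto[OF w c Xm X01 Ym Y])
  moreover have "wsum (c n) y + wsum (c n) z = wsum (c n) (\<lambda>k. y k + z k)" for n y z
   unfolding wsum_def by (simp add: sum.distrib distrib_left)
  ultimately have "(\<lambda>n. wsum (c n) (\<lambda>k. K0)) \<longlonglongrightarrow> (\<integral>x. pfield p (H x) \<bullet> K x \<partial>lebesgue) + (\<integral>x. (a x + b x) * (Y x * w x) \<partial>lebesgue)"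
   by (simp only: sumK)
  from LIMSEQ_unique[OF this wsum_tendsto[OF c tendsto_const]]
  have "(\<integral>x. pfield p (H x) \<bullet> K x \<partial>lebesgue) + (\<integral>x. (a x + b x) * (Y x * w x) \<partial>lebesgue) = K0" .
  moreover have "(\<integral>x. (a x + b x) * (Y x * w x) \<partial>lebesgue) = (\<integral>x. (a x + b x) * (\<theta> x * w x) \<partial>lebesgue)"
  proof (rule integral_cong_AE)
   show "AE x in lebesgue. (a x + b x) * (Y x * w x) = (a x + b x) * (\<theta> x * w x)"
    using Y\<theta> by eventually_elim simp
  qed measurable
  ultimately show ?thesis using split[OF \<theta>m \<theta>01] unfolding K0_def by linarith
 qed
 show ?thesis by (rule that[OF v \<theta>m \<theta>01 phase eqn])
qed

end

section \<open>Smooth bump functions and the vanishing of functions orthogonal to all test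
  functions\<close>

text \<open>A recursion that exposes one derivative at each level; it is stable under the sums,
  products and affine substitutions from which bumps are built.\<close>

primrec Cn :: "nat \<Rightarrow> (real \<Rightarrow> real) \<Rightarrow> bool" where
 "Cn 0 f \<longleftrightarrow> True"
| "Cn (Suc n) f \<longleftrightarrow> (\<exists>f'. (\<forall>t. (f has_real_derivative f' t) (at t)) \<and> Cn n f')"

lemma Cn_SucI: "(\<And>t. (f has_real_derivative f' t) (at t)) \<Longrightarrow> Cn n f' \<Longrightarrow> Cn (Suc n) f"
 unfolding Cn.simps by blast

lemma Cn_SucD: "Cn (Suc n) f \<Longrightarrow> Cn n f"
proof (induction n arbitrary: f)
 case (Suc n)
 then obtain f' where "\<forall>t. (f has_real_derivative f' t) (at t)" "Cn (Suc n) f'" using Cn.simps(2) by blast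
 with Suc.IH show ?case using Cn.simps(2) by blast
qed simp

lemma Cn_const: "Cn n (\<lambda>t. c)"
proof (induction n arbitrary: c)
 case (Suc n)
 show ?case by (rule Cn_SucI[OF _ Suc[of 0]]) simp
qed simp

lemma Cn_add: "Cn n f \<Longrightarrow> Cn n g \<Longrightarrow> Cn n (\<lambda>t. f t + g t)"
proof (induction n arbitrary: f g)
 case (Suc n)
 then obtain f' g' where d: "\<forall>t. (f has_real_derivative f' t) (at t)" "Cn n f'" "\<forall>t. (g has_real_derivative g' t) (at t)" "Cn n g'"
  unfolding Cn.simps by blast
 show ?case by (rule Cn_SucI[OF _ Suc.IH[OF d(2,4)]], rule DERIV_add) (use d in auto)
qed simp

lemma Cn_mult: "Cn n f \<Longrightarrow> Cn n g \<Longrightarrow> Cn n (\<lambda>t. f t * g t)"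
proof (induction n arbitrary: f g)
 case (Suc n)
 then obtain f' g' where d: "\<And>t. (f has_real_derivative f' t) (at t)" "Cn n f'" "\<And>t. (g has_real_derivative g' t) (at t)" "Cn n g'"
  unfolding Cn.simps by blast
 show ?case
  by (rule Cn_SucI[OF DERIV_mult[OF d(1,3)] Cn_add[OF Suc.IH[OF d(2) Cn_SucD[OF Suc.prems(2)]] Suc.IH[OF d(4) Cn_SucD[OF Suc.prems(1)]]]])
qed simp

lemma Cn_affine: "Cn n f \<Longrightarrow> Cn n (\<lambda>t. f (c * t + d))"
proof (induction n arbitrary: f)
 case (Suc n)
 then obtain f' where f': "\<forall>t. (f has_real_derivative f' t) (at t)" "Cn n f'" unfolding Cn.simps by blast
 have "((\<lambda>t. f (c * t + d)) has_real_derivative f' (c * t + d) * c) (at t)" for t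
  by (rule DERIV_chain2[where g="\<lambda>t. c * t + d"]) (use f' in \<open>auto intro!: derivative_eq_intros\<close>)
 moreover have "Cn n (\<lambda>t. f' (c * t + d) * c)" by (intro Cn_mult Cn_const Suc.IH f')
 ultimately show ?case by (rule Cn_SucI)
qed simp

lemma Cn_deriv:
 assumes "\<And>n. Cn n f"
 shows "(f has_real_derivative deriv f t) (at t)" "Cn n (deriv f)"
proof -
 obtain f' where f': "\<forall>t. (f has_real_derivative f' t) (at t)" "Cn n f'" using assms[of "Suc n"] unfolding Cn.simps by blast
 then have "deriv f = f'" using DERIV_imp_deriv by blast
 with f' show "(f has_real_derivative deriv f t) (at t)" "Cn n (deriv f)" by auto
qed

text \<open>t^(-k) exp(-1/t), continued by 0. The derivative of a member is a combination of two
  other members, so smoothness of all of them follows by one induction with k free.\<close>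

definition flat_exp :: "nat \<Rightarrow> real \<Rightarrow> real" where
 "flat_exp k t = (if t > 0 then (1 / t) ^ k * exp (- (1 / t)) else 0)"

lemma flat_exp_tendsto_0: "(flat_exp k \<longlongrightarrow> 0) (at 0)"
proof (rule filterlim_split_at)
 show "(flat_exp k \<longlongrightarrow> 0) (at_left 0)"
  by (rule tendsto_eventually) (auto simp: flat_exp_def eventually_at_left_field intro!: exI[of _ "-1"])
 have "((\<lambda>t::real. (inverse t) ^ k / exp (inverse t)) \<longlongrightarrow> 0) (at_right 0)"
  by (rule filterlim_compose[OF tendsto_power_div_exp_0 filterlim_inverse_at_top_right])
 moreover have "\<forall>\<^sub>F t in at_right 0. inverse t ^ k / exp (inverse t) = flat_exp k t"
  by (auto simp: flat_exp_def eventually_at_right_field exp_minus field_simps intro!: exI[of _ 1])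
 ultimately show "(flat_exp k \<longlongrightarrow> 0) (at_right 0)" by (rule Lim_transform_eventually)
qed

text \<open>At t = 0 the difference quotient of the k-th function is the function with index k + 1,
  which tends to 0.\<close>

lemma flat_exp_has_derivative:
 "(flat_exp k has_real_derivative flat_exp (k + 2) t + - real k * flat_exp (k + 1) t) (at t)"
proof (cases t "0::real" rule: linorder_cases)
 case less
 have "((\<lambda>t. 0) has_real_derivative 0) (at t)" by simp
 then have "(flat_exp k has_real_derivative 0) (at t)"
  by (rule has_field_derivative_transform_within_open[where S="{..<0}"]) (use less in \<open>auto simp: flat_exp_def\<close>)
 then show ?thesis using less by (simp add: flat_exp_def)
next
 case equal
 have "((\<lambda>h. (flat_exp k (0 + h) - flat_exp k 0) / h) \<longlongrightarrow> 0) (at 0)"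
  by (rule Lim_transform_eventually[OF flat_exp_tendsto_0[of "Suc k"]])
   (auto simp: flat_exp_def eventually_at_filter intro!: always_eventually)
 then show ?thesis using equal by (simp add: DERIV_def flat_exp_def)
next
 case greater
 have "((\<lambda>t. (1 / t) ^ k * exp (- (1 / t))) has_real_derivative
   real k * (1 / t) ^ (k - Suc 0) * (- (1 / t ^ 2)) * exp (- (1 / t)) + (exp (- (1 / t)) * (1 / t ^ 2)) * (1 / t) ^ k) (at t)"
  using greater by (auto intro!: derivative_eq_intros simp: power2_eq_square divide_inverse)
 then have "(flat_exp k has_real_derivative
   real k * (1 / t) ^ (k - Suc 0) * (- (1 / t ^ 2)) * exp (- (1 / t)) + (exp (- (1 / t)) * (1 / t ^ 2)) * (1 / t) ^ k) (at t)"
  by (rule has_field_derivative_transform_within_open[where S="{0<..}"]) (use greater in \<open>auto simp: flat_exp_def\<close>)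
 moreover have "real k * (1 / t) ^ (k - Suc 0) * (- (1 / t ^ 2)) * exp (- (1 / t)) + (exp (- (1 / t)) * (1 / t ^ 2)) * (1 / t) ^ k
   = flat_exp (k + 2) t + - real k * flat_exp (k + 1) t"
  using greater by (cases k) (simp_all add: flat_exp_def power2_eq_square algebra_simps divide_inverse)
 ultimately show ?thesis by simp
qed

lemma Cn_flat_exp: "Cn n (flat_exp k)"
proof (induction n arbitrary: k)
 case (Suc n)
 have "Cn n (\<lambda>t. flat_exp (k + 2) t + - real k * flat_exp (k + 1) t)" by (intro Cn_add Cn_mult Cn_const Suc.IH)
 then show ?case by (rule Cn_SucI[OF flat_exp_has_derivative])
qed simp

definition bump :: "real \<Rightarrow> real" where "bump = flat_exp 0"

lemma bump_nonneg: "0 \<le> bump t" and bump_le_1: "bump t \<le> 1" and bump_eq_0_iff: "bump t = 0 \<longleftrightarrow> t \<le> 0"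
 by (auto simp: bump_def flat_exp_def)

text \<open>Scaling pushes a positive argument to infinity and keeps a nonpositive one nonpositive,
  so scaled bumps approximate the indicator of an open half-line.\<close>

lemma bump_tendsto: "(\<lambda>n. bump (real (Suc n) * t)) \<longlonglongrightarrow> (if t > 0 then 1 else 0)"
proof (cases "t > 0")
 case True
 have "(\<lambda>n. inverse (real (Suc n)) * inverse t) \<longlonglongrightarrow> 0 * inverse t" by (intro tendsto_mult LIMSEQ_inverse_real_of_nat tendsto_const)
 then have "(\<lambda>n. exp (- (inverse (real (Suc n)) * inverse t))) \<longlonglongrightarrow> exp (- (0 * inverse t))" by (intro tendsto_exp tendsto_minus)
 moreover have "exp (- (inverse (real (Suc n)) * inverse t)) = bump (real (Suc n) * t)" for n
 proof -
  have "0 < real (Suc n) * t" using True by simp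
  then show ?thesis unfolding bump_def flat_exp_def by (simp only: if_True power_0 mult_1 divide_inverse inverse_mult_distrib)
 qed
 ultimately show ?thesis using True by simp
next
 case False
 then have "real (Suc n) * t \<le> 0" for n by (simp add: mult_nonneg_nonpos)
 then have "bump (real (Suc n) * t) = 0" for n unfolding bump_eq_0_iff .
 then show ?thesis using False by (simp only: if_False tendsto_const)
qed

lemma Cn_component_has_derivative:
 assumes "\<And>n. Cn n f"
 shows "((\<lambda>x. f (x \<bullet> b)) has_derivative (\<lambda>h. (h \<bullet> b) * deriv f (x \<bullet> b))) (at x)"
proof -
 have "(*) (deriv f (x \<bullet> b)) = (\<lambda>h. h * deriv f (x \<bullet> b))" by (simp add: fun_eq_iff)
 then have "(f has_derivative (\<lambda>h. h * deriv f (x \<bullet> b))) (at (x \<bullet> b))"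
  using Cn_deriv(1)[OF assms, of "x \<bullet> b"] by (simp only: has_field_derivative_def)
 then show ?thesis
  by (rule has_derivative_compose[rotated]) (auto intro: bounded_linear_imp_has_derivative bounded_linear_inner_left)
qed

text \<open>A partial derivative of a product of one-variable functions replaces one factor by its
  derivative and is again such a product; hence the induction over the list of directions with
  \<tau> free.\<close>

lemma smooth_fun_prod_Basis:
 fixes \<tau> :: "'a::euclidean_space \<Rightarrow> real \<Rightarrow> real"
 assumes "\<And>b n. Cn n (\<tau> b)"
 shows "smooth_fun (\<lambda>x::'a. \<Prod>b\<in>Basis. \<tau> b (x \<bullet> b))"
proof -
 have "fold partial_dir bs (\<lambda>x::'a. \<Prod>b\<in>Basis. \<tau> b (x \<bullet> b)) differentiable (at x)"
  if "set bs \<subseteq> Basis" "\<And>b n. Cn n (\<tau> b)" for bs x and \<tau> :: "'a \<Rightarrow> real \<Rightarrow> real"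
  using that
 proof (induction bs arbitrary: \<tau>)
  case Nil
  have "(\<lambda>x. \<tau> b (x \<bullet> b)) differentiable (at x)" for b
   unfolding differentiable_def using Cn_component_has_derivative[OF Nil(2)] by blast
  note d = this
  have "(\<lambda>x. \<Prod>b\<in>B. \<tau> b (x \<bullet> b)) differentiable (at x)" if "finite B" for B
   using that by (induction B rule: finite_induct) (auto intro!: differentiable_mult d)
  then show ?case by simp
 next
  case (Cons c bs)
  then have c: "c \<in> Basis" by simp
  let ?\<sigma> = "\<lambda>b. if b = c then deriv (\<tau> c) else \<tau> b"
  have \<sigma>: "Cn n (?\<sigma> b)" for n b using Cons.prems(2) Cn_deriv(2)[OF Cons.prems(2)] by simp
  have "partial_dir c (\<lambda>x. \<Prod>b\<in>Basis. \<tau> b (x \<bullet> b)) = (\<lambda>x. \<Prod>b\<in>Basis. ?\<sigma> b (x \<bullet> b))"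
  proof
   fix x :: 'a
   have d: "((\<lambda>x. \<tau> b (x \<bullet> b)) has_derivative (\<lambda>h. (h \<bullet> b) * deriv (\<tau> b) (x \<bullet> b))) (at x)" for b
    by (rule Cn_component_has_derivative[OF Cons.prems(2)])
   have "((\<lambda>x. \<Prod>b\<in>Basis. \<tau> b (x \<bullet> b)) has_derivative
     (\<lambda>h. \<Sum>b\<in>Basis. (h \<bullet> b) * deriv (\<tau> b) (x \<bullet> b) * (\<Prod>e\<in>Basis - {b}. \<tau> e (x \<bullet> e)))) (at x)"
    by (rule has_derivative_prod[OF d])
   then have "partial_dir c (\<lambda>x. \<Prod>b\<in>Basis. \<tau> b (x \<bullet> b)) x
    = (\<Sum>b\<in>Basis. (c \<bullet> b) * deriv (\<tau> b) (x \<bullet> b) * (\<Prod>e\<in>Basis - {b}. \<tau> e (x \<bullet> e)))"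
    unfolding partial_dir_def by (simp add: frechet_derivative_at[symmetric])
   also have "\<dots> = (\<Sum>b\<in>Basis. if b = c then deriv (\<tau> c) (x \<bullet> c) * (\<Prod>e\<in>Basis - {c}. \<tau> e (x \<bullet> e)) else 0)"
    using c by (intro sum.cong) (auto simp: inner_Basis)
   also have "\<dots> = deriv (\<tau> c) (x \<bullet> c) * (\<Prod>e\<in>Basis - {c}. \<tau> e (x \<bullet> e))" using c by simp
   also have "\<dots> = (\<Prod>b\<in>Basis. ?\<sigma> b (x \<bullet> b))"
    using c by (subst prod.remove[of _ c]) auto
   finally show "partial_dir c (\<lambda>x. \<Prod>b\<in>Basis. \<tau> b (x \<bullet> b)) x = (\<Prod>b\<in>Basis. ?\<sigma> b (x \<bullet> b))" .
  qed
  with Cons.IH[of ?\<sigma>] Cons.prems(1) \<sigma> show ?case by simp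
 qed
 then show ?thesis unfolding smooth_fun_def using assms by blast
qed

text \<open>In every coordinate two scaled bumps face each other. The product vanishes off the open
  box, so its support lies in the closed box, which is compact and inside \<Omega>.\<close>

lemma ex_test_fun_box:
 fixes \<alpha> \<beta> :: "'a::euclidean_space"
 assumes C: "cbox \<alpha> \<beta> \<subseteq> \<Omega>"
 obtains \<phi> where "\<And>n. test_fun \<Omega> (\<phi> n)" "\<And>n x. \<bar>\<phi> n x\<bar> \<le> (1::real)" "\<And>x. (\<lambda>n. \<phi> n x) \<longlonglongrightarrow> indicator (box \<alpha> \<beta>) x"
proof
 let ?\<tau> = "\<lambda>n b t. bump (real (Suc n) * (t - \<alpha> \<bullet> b)) * bump (real (Suc n) * (\<beta> \<bullet> b - t))"
 let ?\<phi> = "\<lambda>n x. \<Prod>b\<in>Basis. ?\<tau> n b (x \<bullet> b)"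
 have Cn: "Cn m (?\<tau> n b)" for m n b
 proof (rule Cn_mult)
  have "Cn m (\<lambda>t. bump (real (Suc n) * t + real (Suc n) * - (\<alpha> \<bullet> b)))" unfolding bump_def by (rule Cn_affine[OF Cn_flat_exp])
  then show "Cn m (\<lambda>t. bump (real (Suc n) * (t - \<alpha> \<bullet> b)))" by (simp only: distrib_left[symmetric] add_uminus_conv_diff)
  have "Cn m (\<lambda>t. bump (- real (Suc n) * t + real (Suc n) * (\<beta> \<bullet> b)))" unfolding bump_def by (rule Cn_affine[OF Cn_flat_exp])
  moreover have "- real (Suc n) * t + real (Suc n) * (\<beta> \<bullet> b) = real (Suc n) * (\<beta> \<bullet> b - t)" for t by (simp add: algebra_simps)
  ultimately show "Cn m (\<lambda>t. bump (real (Suc n) * (\<beta> \<bullet> b - t)))" by simp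
 qed
 have \<tau>0: "?\<tau> n b t = 0 \<longleftrightarrow> \<not> (\<alpha> \<bullet> b < t \<and> t < \<beta> \<bullet> b)" for n b t
  by (auto simp: bump_eq_0_iff mult_le_0_iff not_less)
 have sup: "{x. ?\<phi> n x \<noteq> 0} \<subseteq> box \<alpha> \<beta>" for n
  unfolding prod_zero_iff[OF finite_Basis] \<tau>0 by (auto simp: mem_box)
 show "test_fun \<Omega> (?\<phi> n)" for n
  unfolding test_fun_def
 proof (intro conjI smooth_fun_prod_Basis Cn)
  have cl: "closure {x. ?\<phi> n x \<noteq> 0} \<subseteq> cbox \<alpha> \<beta>" using sup[of n] box_subset_cbox[of \<alpha> \<beta>] by (intro closure_minimal) auto
  then show "closure {x. ?\<phi> n x \<noteq> 0} \<subseteq> \<Omega>" using C by blast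
  show "compact (closure {x. ?\<phi> n x \<noteq> 0})"
   using bounded_subset[OF bounded_box sup[of n]] by (simp only: compact_closure)
 qed
 have \<tau>1: "0 \<le> ?\<tau> n b t" "?\<tau> n b t \<le> 1" for n b t
  by (intro mult_nonneg_nonneg bump_nonneg mult_le_one bump_le_1)+
 show "\<bar>?\<phi> n x\<bar> \<le> 1" for n x
  unfolding abs_prod by (rule prod_le_1) (use \<tau>1 in \<open>auto simp only: abs_of_nonneg abs_ge_zero\<close>)
 show "(\<lambda>n. ?\<phi> n x) \<longlonglongrightarrow> indicator (box \<alpha> \<beta>) x" for x
 proof -
  have "(\<lambda>n. ?\<phi> n x) \<longlonglongrightarrow> (\<Prod>b\<in>Basis. (if x \<bullet> b - \<alpha> \<bullet> b > 0 then 1 else 0) * (if \<beta> \<bullet> b - x \<bullet> b > 0 then 1 else 0))"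
   by (intro tendsto_prod tendsto_mult bump_tendsto)
  moreover have "(\<Prod>b\<in>Basis. (if x \<bullet> b - \<alpha> \<bullet> b > 0 then 1 else 0) * (if \<beta> \<bullet> b - x \<bullet> b > 0 then 1 else 0)) = (indicator (box \<alpha> \<beta>) x :: real)"
  proof (cases "x \<in> box \<alpha> \<beta>")
   case True
   then show ?thesis by (auto simp: mem_box intro!: prod.neutral)
  next
   case False
   then obtain b where b: "b \<in> Basis" "\<not> (\<alpha> \<bullet> b < x \<bullet> b \<and> x \<bullet> b < \<beta> \<bullet> b)" by (auto simp: mem_box)
   have "(\<Prod>b\<in>Basis. (if x \<bullet> b - \<alpha> \<bullet> b > 0 then 1 else 0) * (if \<beta> \<bullet> b - x \<bullet> b > 0 then 1 else 0)) = (0 :: real)"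
    by (rule prod_zero) (use b in \<open>auto intro!: bexI[of _ b]\<close>)
   then show ?thesis using False by simp
  qed
  ultimately show ?thesis by simp
 qed
qed

text \<open>Open boxes are stable under intersection and generate the Borel sets, so the integral
  vanishes over all Borel sets; the step to complements uses that the total integral is 0.\<close>

lemma AE_eq_0_of_integral_box:
 fixes k :: "'a::euclidean_space \<Rightarrow> real"
 assumes k: "integrable lborel k" and k0: "(\<integral>x. k x \<partial>lborel) = 0"
  and box: "\<And>a b. (\<integral>x. indicator (box a b) x * k x \<partial>lborel) = 0"
 shows "AE x in lborel. k x = 0"
proof (rule sigma_finite_measure.density_zero[OF lborel.sigma_finite_measure_axioms k])
 have ki: "integrable lborel (\<lambda>x. indicator A x * k x)" if "A \<in> sets borel" for A
  using integrable_mult_indicator[OF _ k, of A] that by simp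
 let ?G = "range (\<lambda>(a, b). box a b :: 'a set)"
 fix A :: "'a set" assume "A \<in> sets lborel"
 then have sig: "A \<in> sigma_sets UNIV ?G" by (simp add: borel_eq_box)
 have stable: "Int_stable ?G"
 proof (rule Int_stableI)
  fix A B assume "A \<in> ?G" "B \<in> ?G"
  then obtain a b c d where AB: "A = box a b" "B = box c d" by auto
  have "box p q \<in> ?G" for p q by (rule range_eqI[of _ _ "(p, q)"]) simp
  then show "A \<inter> B \<in> ?G" unfolding AB box_Int_box .
 qed
 have "(\<integral>x. indicator A x * k x \<partial>lborel) = 0 \<and> A \<in> sets borel"
  using stable subset_UNIV[of ?G, folded Pow_UNIV] sig
 proof (induction rule: sigma_sets_induct_disjoint)
  case (basic A)
  then show ?case using box by auto
 next
  case (compl A)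
  have "indicator (UNIV - A) x * k x = k x - indicator A x * k x" for x by (simp split: split_indicator)
  moreover have "UNIV - A \<in> sets borel" using compl by (simp add: borel_comp Compl_eq_Diff_UNIV[symmetric])
  ultimately show ?case using compl k0 Bochner_Integration.integral_diff[OF k ki, of A] by simp
 next
  case (union A)
  have U: "(\<Union>i. A i) \<in> sets borel" using union by (intro sets.countable_UN) auto
  have "set_lebesgue_integral lborel (\<Union>i. A i) k = (\<Sum>i. set_lebesgue_integral lborel (A i) k)"
   by (rule lebesgue_integral_countable_add)
    (use union ki[OF U] in \<open>auto simp: disjoint_family_on_def set_integrable_def\<close>)
  then show ?case using union U by (auto simp: set_lebesgue_integral_def)
 qed auto
 then show "set_lebesgue_integral lborel A k = 0" by (simp add: set_lebesgue_integral_def)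
qed

text \<open>Dominated convergence along box approximations kills the integral over every open box
  whose closed box lies in \<Omega>. Localised to one such box this gives h = 0 on it, its frontier
  being null, and countably many closed boxes exhaust \<Omega>.\<close>

theorem AE_eq_0_of_test_fun:
 fixes h :: "'a::euclidean_space \<Rightarrow> real"
 assumes h: "integrable lebesgue h" and \<Omega>: "open \<Omega>"
  and test: "\<And>\<phi>. test_fun \<Omega> \<phi> \<Longrightarrow> (\<integral>x. h x * \<phi> x \<partial>lebesgue) = 0"
 shows "AE x in lebesgue. x \<in> \<Omega> \<longrightarrow> h x = 0"
proof -
 note [measurable] = borel_measurable_integrable[OF h]
 have [measurable]: "box \<alpha> \<beta> \<in> sets lebesgue" for \<alpha> \<beta> :: 'a by simp
 have box0: "(\<integral>x. indicator (box \<alpha> \<beta>) x * h x \<partial>lebesgue) = 0" if C: "cbox \<alpha> \<beta> \<subseteq> \<Omega>" for \<alpha> \<beta>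
 proof -
  obtain \<phi> where \<phi>: "\<And>n. test_fun \<Omega> (\<phi> n)" "\<And>n x. \<bar>\<phi> n x\<bar> \<le> (1::real)" "\<And>x. (\<lambda>n. \<phi> n x) \<longlonglongrightarrow> indicator (box \<alpha> \<beta>) x"
   by (rule ex_test_fun_box[OF C], rule that)
  have \<phi>m[measurable]: "\<phi> n \<in> borel_measurable lebesgue" for n
  proof -
   have "continuous_on UNIV (\<phi> n)"
    using \<phi>(1)[of n] unfolding test_fun_def
    by (auto intro!: continuous_at_imp_continuous_on differentiable_imp_continuous_within smooth_fun_differentiable)
   then have "\<phi> n \<in> borel_measurable borel" by (rule borel_measurable_continuous_onI)
   then show ?thesis by (simp add: measurable_completion)
  qed
  have "(\<lambda>n. \<integral>x. h x * \<phi> n x \<partial>lebesgue) \<longlonglongrightarrow> (\<integral>x. h x * indicator (box \<alpha> \<beta>) x \<partial>lebesgue)"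
  proof (rule integral_dominated_convergence[where w="\<lambda>x. \<bar>h x\<bar>"])
   show "AE x in lebesgue. (\<lambda>n. h x * \<phi> n x) \<longlonglongrightarrow> h x * indicator (box \<alpha> \<beta>) x"
    by (intro AE_I2 tendsto_intros \<phi>(3))
   show "AE x in lebesgue. norm (h x * \<phi> n x) \<le> \<bar>h x\<bar>" for n
    using \<phi>(2) by (intro AE_I2) (simp add: abs_mult mult_left_le)
   show "integrable lebesgue (\<lambda>x. \<bar>h x\<bar>)" using h by simp
  qed measurable
  then have "(\<lambda>n::nat. 0) \<longlonglongrightarrow> (\<integral>x. h x * indicator (box \<alpha> \<beta>) x \<partial>lebesgue)" by (simp only: test[OF \<phi>(1)])
  then have "(\<integral>x. h x * indicator (box \<alpha> \<beta>) x \<partial>lebesgue) = 0" by (rule LIMSEQ_unique[OF _ tendsto_const])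
  then show ?thesis by (simp only: mult.commute)
 qed
 \<comment> \<open>A Borel representative, because the argument with generating sets runs on the
   Borel measure.\<close>
 obtain h' where h'm[measurable]: "h' \<in> borel_measurable lborel" and hh: "AE x in lborel. h x = h' x"
  using completion_ex_borel_measurable_real[OF borel_measurable_integrable[OF h]] by blast
 have hh': "AE x in lebesgue. h x = h' x" using hh by (rule AE_completion)
 have h'i: "integrable lborel h'"
 proof -
  have "integrable lebesgue h'"
   by (rule integrable_cong_AE_imp[OF h _ hh']) (use h'm in \<open>simp add: measurable_completion\<close>)
  then show ?thesis using integrable_completion[of h' lborel] h'm by simp
 qed
 have zero: "AE x in lebesgue. x \<in> cbox \<alpha> \<beta> \<longrightarrow> h x = 0" if C: "cbox \<alpha> \<beta> \<subseteq> \<Omega>" for \<alpha> \<beta>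
 proof -
  have b0: "(\<integral>x. indicator (box a b) x * h' x \<partial>lborel) = 0" if "cbox a b \<subseteq> \<Omega>" for a b
  proof -
   have "(\<integral>x. indicator (box a b) x * h' x \<partial>lborel) = (\<integral>x. indicator (box a b) x * h' x \<partial>lebesgue)"
    by (rule borel_integral_lebesgue[symmetric]) (use h'm in \<open>simp add: borel_measurable_times\<close>)
   also have "\<dots> = (\<integral>x. indicator (box a b) x * h x \<partial>lebesgue)"
   proof (rule integral_cong_AE)
    show "AE x in lebesgue. indicator (box a b) x * h' x = indicator (box a b) x * h x" using hh' by eventually_elim simp
    have "h' \<in> borel_measurable lebesgue" using h'm by (simp add: measurable_completion)
    then show "(\<lambda>x. indicator (box a b) x * h' x) \<in> borel_measurable lebesgue" by measurable
   qed measurable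
   finally show ?thesis using box0[OF that] by simp
  qed
  have "AE x in lborel. indicator (box \<alpha> \<beta>) x * h' x = 0"
  proof (rule AE_eq_0_of_integral_box)
   show "integrable lborel (\<lambda>x. indicator (box \<alpha> \<beta>) x * h' x)"
    using integrable_mult_indicator[OF _ h'i, of "box \<alpha> \<beta>"] by simp
   show "(\<integral>x. indicator (box \<alpha> \<beta>) x * h' x \<partial>lborel) = 0" by (rule b0[OF C])
   fix a b :: 'a
   \<comment> \<open>An arbitrary box may leave \<Omega>, but its intersection with the fixed one is
     a box whose closed version stays inside.\<close>
   obtain c d where cd: "box a b \<inter> box \<alpha> \<beta> = box c d" "cbox c d \<subseteq> cbox \<alpha> \<beta>"
   proof
    let ?c = "\<Sum>i\<in>Basis. max (a \<bullet> i) (\<alpha> \<bullet> i) *\<^sub>R i" and ?d = "\<Sum>i\<in>Basis. min (b \<bullet> i) (\<beta> \<bullet> i) *\<^sub>R i"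
    show "box a b \<inter> box \<alpha> \<beta> = box ?c ?d" by (auto simp: mem_box)
    show "cbox ?c ?d \<subseteq> cbox \<alpha> \<beta>" by (auto simp: mem_box)
   qed
   have e: "indicator (box a b) x * (indicator (box \<alpha> \<beta>) x * h' x) = indicator (box c d) x * h' x" for x
    unfolding cd(1)[symmetric] by (simp split: split_indicator)
   show "(\<integral>x. indicator (box a b) x * (indicator (box \<alpha> \<beta>) x * h' x) \<partial>lborel) = 0"
    unfolding e by (rule b0) (use cd(2) C in blast)
  qed
  then have z: "AE x in lebesgue. indicator (box \<alpha> \<beta>) x * h' x = 0" by (rule AE_completion)
  have n: "AE x in lebesgue. x \<notin> cbox \<alpha> \<beta> - box \<alpha> \<beta>"
   using negligible_frontier_interval[of \<alpha> \<beta>] by (simp only: negligible_iff_null_sets AE_not_in)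
  show ?thesis using z n hh'
  proof eventually_elim
   case (elim x)
   then show ?case by (auto split: split_indicator_asm)
  qed
 qed
 obtain \<D> where D: "countable \<D>" "\<D> \<subseteq> Pow \<Omega>" "\<And>X. X \<in> \<D> \<Longrightarrow> \<exists>a b. X = cbox a b" "\<Union>\<D> = \<Omega>"
  using open_countable_Union_open_cbox[OF \<Omega>] by metis
 have "AE x in lebesgue. \<forall>X\<in>\<D>. x \<in> X \<longrightarrow> h x = 0"
  unfolding AE_ball_countable[OF D(1)]
 proof
  fix X assume X: "X \<in> \<D>"
  then obtain a b where ab: "X = cbox a b" using D(3) by blast
  show "AE x in lebesgue. x \<in> X \<longrightarrow> h x = 0" unfolding ab by (rule zero) (use X D(2) ab in blast)
 qed
 then show ?thesis by eventually_elim (use D(4) in blast)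
qed

section \<open>Exponents and Lebesgue classes on a bounded domain\<close>

lemma pSharp_ge_1:
 assumes "1 < p" "0 < s" "1 < r" "0 < d"
 shows "1 \<le> pSharp d s p r"
proof -
 have "1 \<le> real d * p / (real d * (p - 1) + s * p)" if "s * p < real d"
 proof -
  have "0 < real d * (p - 1) + s * p" using assms by (simp add: add_pos_pos)
  moreover have "real d * (p - 1) + s * p \<le> real d * p" using that by (simp add: algebra_simps)
  ultimately show ?thesis by simp
 qed
 then show ?thesis using assms by (simp add: pSharp_def)
qed

lemma integrable_indicator_bounded:
 fixes \<Omega> :: "'a::euclidean_space set"
 assumes "bounded \<Omega>" "open \<Omega>"
 shows "integrable lebesgue (\<lambda>x. indicator \<Omega> x * (c::real))"
proof -
 have "emeasure lebesgue \<Omega> < \<infinity>" using emeasure_bounded_finite[OF assms(1)] assms(2) by simp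
 then show ?thesis using assms(2) by (intro integrable_mult_left integrable_real_indicator) simp_all
qed

text \<open>The classes assert measurability only after cutting off to the set; F 0 = 0 lets
  \<open>F\<close> pass through the cut-off.\<close>

lemma indicator_mult_measurable:
 fixes f :: "'a \<Rightarrow> real" and F :: "real \<Rightarrow> real"
 assumes "(\<lambda>x. indicator S x * f x) \<in> borel_measurable M" "F 0 = 0" "F \<in> borel_measurable borel"
 shows "(\<lambda>x. indicator S x * F (f x)) \<in> borel_measurable M"
proof -
 have "indicator S x * F (f x) = F (indicator S x * f x)" for x using assms(2) by (cases "x \<in> S") simp_all
 then show ?thesis using measurable_compose[OF assms(1,3)] by simp
qed

lemma Lq_on_measurable: "Lq_on q \<Omega> f \<Longrightarrow> (\<lambda>x. indicator \<Omega> x * f x) \<in> borel_measurable lebesgue"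
 by (auto simp: Lq_on_def Linf_on_def Lp_on_def split: if_splits)

lemma Lq_on_imp_Lp_on:
 fixes \<Omega> :: "'a::euclidean_space set"
 assumes \<Omega>: "bounded \<Omega>" "open \<Omega>" and f: "Lq_on q \<Omega> f" and t: "0 \<le> t" "ereal t < q"
 shows "Lp_on t \<Omega> f"
 unfolding Lp_on_def
proof
 show m: "(\<lambda>x. indicator \<Omega> x * f x) \<in> borel_measurable lebesgue" by (rule Lq_on_measurable[OF f])
 have [measurable]: "(\<lambda>x. indicator \<Omega> x * \<bar>f x\<bar> powr t) \<in> borel_measurable lebesgue"
  by (rule indicator_mult_measurable[OF m, where F="\<lambda>y. \<bar>y\<bar> powr t"]) simp_all
 show "integrable lebesgue (\<lambda>x. indicator \<Omega> x * \<bar>f x\<bar> powr t)"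
 proof (cases "q = \<infinity>")
  case True
  then obtain C where C: "AE x in lebesgue. x \<in> \<Omega> \<longrightarrow> \<bar>f x\<bar> \<le> C" using f by (auto simp: Lq_on_def Linf_on_def)
  show ?thesis
  proof (rule Bochner_Integration.integrable_bound[OF integrable_indicator_bounded[OF \<Omega>, of "C powr t"]])
   show "AE x in lebesgue. norm (indicator \<Omega> x * \<bar>f x\<bar> powr t) \<le> norm (indicator \<Omega> x * C powr t)"
    using C by eventually_elim (auto split: split_indicator intro: powr_mono2 t)
  qed measurable
 next
  case False
  then obtain q' where q': "q = ereal q'" "t < q'" using t by (cases q) auto
  then have fi: "integrable lebesgue (\<lambda>x. indicator \<Omega> x * \<bar>f x\<bar> powr q')" using f by (simp add: Lq_on_def Lp_on_def)
  have b: "y powr t \<le> 1 + y powr q'" if "0 \<le> y" for y :: real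
  proof (cases "y \<le> 1")
   case True
   then have "y powr t \<le> 1" using that t powr_mono2[of t y 1] by simp
   then show ?thesis by (simp add: add_increasing2)
  next
   case False
   then have "y powr t \<le> y powr q'" using q' by (intro powr_mono) auto
   then show ?thesis by simp
  qed
  show ?thesis
  proof (rule Bochner_Integration.integrable_bound[OF Bochner_Integration.integrable_add[OF integrable_indicator_bounded[OF \<Omega>, of 1] fi]])
   show "AE x in lebesgue. norm (indicator \<Omega> x * \<bar>f x\<bar> powr t) \<le> norm (indicator \<Omega> x * 1 + indicator \<Omega> x * \<bar>f x\<bar> powr q')"
    by (intro AE_I2) (simp add: b split: split_indicator)
  qed measurable
 qed
qed

lemma Lp_on_1_integrable:
 assumes "Lp_on 1 \<Omega> f"
 shows "integrable lebesgue (\<lambda>x. indicator \<Omega> x * f x)"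
proof (rule Bochner_Integration.integrable_bound)
 show "integrable lebesgue (\<lambda>x. indicator \<Omega> x * \<bar>f x\<bar> powr 1)" "(\<lambda>x. indicator \<Omega> x * f x) \<in> borel_measurable lebesgue"
  using assms by (simp_all add: Lp_on_def)
qed (simp add: abs_mult)

text \<open>Young's inequality pointwise, or the essential bound when q is infinite. It makes the
  products of coefficients and obstacle integrable, so that the functional is finite although v lies
  only in the conjugate class.\<close>

lemma Lq_on_mult_integrable:
 assumes q: "1 < q" and l: "Lq_on q \<Omega> l" and v: "Lq_on (conj_exp q) \<Omega> v"
 shows "integrable lebesgue (\<lambda>x. indicator \<Omega> x * l x * (indicator \<Omega> x * v x))"
proof -
 note [measurable] = Lq_on_measurable[OF l] Lq_on_measurable[OF v]
 show ?thesis
 proof (cases "q = \<infinity>")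
  case True
  then obtain C where C: "AE x in lebesgue. x \<in> \<Omega> \<longrightarrow> \<bar>l x\<bar> \<le> C" using l by (auto simp: Lq_on_def Linf_on_def)
  have "Lp_on 1 \<Omega> v" using v True by (simp add: conj_exp_def Lq_on_def one_ereal_def)
  then have vi: "integrable lebesgue (\<lambda>x. C * (indicator \<Omega> x * \<bar>v x\<bar> powr 1))" by (intro integrable_mult_right) (simp add: Lp_on_def)
  show ?thesis
  proof (rule Bochner_Integration.integrable_bound[OF vi])
   show "AE x in lebesgue. norm (indicator \<Omega> x * l x * (indicator \<Omega> x * v x)) \<le> norm (C * (indicator \<Omega> x * \<bar>v x\<bar> powr 1))"
    using C
   proof eventually_elim
    case (elim x)
    then have "x \<in> \<Omega> \<Longrightarrow> \<bar>l x\<bar> * \<bar>v x\<bar> \<le> \<bar>C\<bar> * \<bar>v x\<bar>" by (intro mult_right_mono) auto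
    then show ?case by (auto simp: abs_mult split: split_indicator)
   qed
  qed measurable
 next
  case False
  then obtain t where t: "q = ereal t" "1 < t" using q by (cases q) auto
  define t' where "t' = t / (t - 1)"
  have t': "1 < t'" "1 / t + 1 / t' = 1" using t by (auto simp: t'_def field_simps)
  have "integrable lebesgue (\<lambda>x. indicator \<Omega> x * \<bar>l x\<bar> powr t)" "integrable lebesgue (\<lambda>x. indicator \<Omega> x * \<bar>v x\<bar> powr t')"
   using l v t by (simp_all add: Lq_on_def Lp_on_def conj_exp_def t'_def)
  then have i: "integrable lebesgue (\<lambda>x. indicator \<Omega> x * \<bar>l x\<bar> powr t / t + indicator \<Omega> x * \<bar>v x\<bar> powr t' / t')"
   by (intro Bochner_Integration.integrable_add integrable_divide)
  show ?thesis
  proof (rule Bochner_Integration.integrable_bound[OF i])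
   have "\<bar>l x\<bar> * \<bar>v x\<bar> \<le> \<bar>\<bar>l x\<bar> powr t / t + \<bar>v x\<bar> powr t' / t'\<bar>" for x
    by (rule order_trans[OF Youngs_inequality[OF t(2) t'] abs_ge_self]) simp_all
   then show "AE x in lebesgue. norm (indicator \<Omega> x * l x * (indicator \<Omega> x * v x)) \<le> norm (indicator \<Omega> x * \<bar>l x\<bar> powr t / t + indicator \<Omega> x * \<bar>v x\<bar> powr t' / t')"
    by (intro AE_I2) (simp add: abs_mult split: split_indicator)
  qed measurable
 qed
qed

lemma Lq_on_bounded_combination:
 assumes q: "1 < q" and l: "Lq_on q \<Omega> l" and m: "Lq_on q \<Omega> m"
  and meas: "(\<lambda>x. indicator \<Omega> x * z x) \<in> borel_measurable lebesgue"
  and z: "\<And>x. \<bar>z x\<bar> \<le> \<bar>l x\<bar> + \<bar>m x\<bar>"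
 shows "Lq_on q \<Omega> z"
proof (cases "q = \<infinity>")
 case True
 then obtain C D where "AE x in lebesgue. x \<in> \<Omega> \<longrightarrow> \<bar>l x\<bar> \<le> C" "AE x in lebesgue. x \<in> \<Omega> \<longrightarrow> \<bar>m x\<bar> \<le> D"
  using l m by (auto simp: Lq_on_def Linf_on_def)
 then have "AE x in lebesgue. x \<in> \<Omega> \<longrightarrow> \<bar>z x\<bar> \<le> C + D"
 proof eventually_elim
  case (elim x)
  then show ?case using z[of x] by auto
 qed
 then show ?thesis using True meas by (auto simp: Lq_on_def Linf_on_def)
next
 case False
 then obtain t where t: "q = ereal t" "1 < t" using q by (cases q) auto
 have "integrable lebesgue (\<lambda>x. indicator \<Omega> x * \<bar>l x\<bar> powr t)" "integrable lebesgue (\<lambda>x. indicator \<Omega> x * \<bar>m x\<bar> powr t)"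
  using l m t by (simp_all add: Lq_on_def Lp_on_def)
 then have i: "integrable lebesgue (\<lambda>x. 2 powr t * (indicator \<Omega> x * \<bar>l x\<bar> powr t + indicator \<Omega> x * \<bar>m x\<bar> powr t))"
  by (intro Bochner_Integration.integrable_add integrable_mult_right)
 have "integrable lebesgue (\<lambda>x. indicator \<Omega> x * \<bar>z x\<bar> powr t)"
 proof (rule Bochner_Integration.integrable_bound[OF i])
  show "(\<lambda>x. indicator \<Omega> x * \<bar>z x\<bar> powr t) \<in> borel_measurable lebesgue"
   by (rule indicator_mult_measurable[OF meas, where F="\<lambda>y. \<bar>y\<bar> powr t"]) simp_all
  have "\<bar>z x\<bar> powr t \<le> 2 powr t * (\<bar>l x\<bar> powr t + \<bar>m x\<bar> powr t)" for x
  proof -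
   have "\<bar>z x\<bar> powr t \<le> (\<bar>l x\<bar> + \<bar>m x\<bar>) powr t" using z t by (intro powr_mono2) auto
   also have "\<dots> = norm (\<bar>l x\<bar> + \<bar>m x\<bar>) powr t" by simp
   also have "\<dots> \<le> 2 powr t * (norm \<bar>l x\<bar> powr t + norm \<bar>m x\<bar> powr t)" using t by (intro norm_add_powr_le) simp
   finally show ?thesis by simp
  qed
  then show "AE x in lebesgue. norm (indicator \<Omega> x * \<bar>z x\<bar> powr t) \<le> norm (2 powr t * (indicator \<Omega> x * \<bar>l x\<bar> powr t + indicator \<Omega> x * \<bar>m x\<bar> powr t))"
   by (intro AE_I2) (simp add: abs_mult split: split_indicator)
 qed
 then show ?thesis using t meas by (simp add: Lq_on_def Lp_on_def)
qed

section \<open>The convex functional, its subdifferential and the variational inequality\<close>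

text \<open>On the contact set u = v every c in the unit interval is a slope of the positive part,
  and c - 1 one of the negative part; off it c is forced. Integrated, this is the membership in the
  subdifferential.\<close>

lemma two_phase_subgradient:
 fixes a b c :: real
 assumes "0 \<le> a" "0 \<le> b" "0 \<le> c" "c \<le> 1" and hi: "v < u \<Longrightarrow> c = 1" and lo: "u < v \<Longrightarrow> c = 0"
 shows "(a * c - b * (1 - c)) * (w - u) \<le> a * max (w - v) 0 + b * max (- (w - v)) 0 - (a * max (u - v) 0 + b * max (- (u - v)) 0)"
proof -
 have 1: "c * (w - u) \<le> max (w - v) 0 - max (u - v) 0"
 proof (cases u v rule: linorder_cases)
  case equal
  then show ?thesis using assms(3,4) mult_right_mono[of c 1 "w - u"] mult_nonneg_nonpos[of c "w - u"]
   by (cases "w \<ge> u") (auto simp: max_def)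
 qed (use hi lo in \<open>auto simp: max_def\<close>)
 have 2: "(1 - c) * (u - w) \<le> max (v - w) 0 - max (v - u) 0"
 proof (cases u v rule: linorder_cases)
  case equal
  then show ?thesis using assms(3,4) mult_right_mono[of "1 - c" 1 "u - w"] mult_nonneg_nonpos[of "1 - c" "u - w"]
   by (cases "u \<ge> w") (auto simp: max_def)
 qed (use hi lo in \<open>auto simp: max_def\<close>)
 have "a * (c * (w - u)) + b * ((1 - c) * (u - w))
  \<le> a * (max (w - v) 0 - max (u - v) 0) + b * (max (v - w) 0 - max (v - u) 0)"
  by (intro add_mono mult_left_mono 1 2 assms)
 then show ?thesis by (simp add: algebra_simps)
qed

context obstacle
begin

definition psi :: "('a \<Rightarrow> real) \<Rightarrow> 'a \<Rightarrow> real" where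
 "psi w x = a x * max (w x - V x) 0 + b x * max (- (w x - V x)) 0"

lemma psi_integrable:
 assumes "Lam w K"
 shows "integrable lebesgue (psi w)"
proof -
 have e: "max (- t) 0 = max t 0 - t" for t :: real by (simp add: max_def)
 show ?thesis
  unfolding psi_def[abs_def] e by (rule Bochner_Integration.integrable_add[OF obst_integrable(1,2)[OF subgrad01_pos assms]])
qed

lemma integral_psi_subgradient:
 assumes u: "Lam u G" and w: "Lam w K" and [measurable]: "c \<in> borel_measurable lebesgue" and c: "\<And>x. 0 \<le> c x \<and> c x \<le> 1"
  and phase: "AE x in lebesgue. x \<in> \<Omega> \<longrightarrow> (V x < u x \<longrightarrow> c x = 1) \<and> (u x < V x \<longrightarrow> c x = 0)"
 shows "(\<integral>x. (a x * c x - b x * (1 - c x)) * (w x - u x) \<partial>lebesgue) \<le> (\<integral>x. psi w x \<partial>lebesgue) - (\<integral>x. psi u x \<partial>lebesgue)"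
proof -
 have "(\<integral>x. (a x * c x - b x * (1 - c x)) * (w x - u x) \<partial>lebesgue) \<le> (\<integral>x. psi w x - psi u x \<partial>lebesgue)"
 proof (rule integral_mono_AE)
  show "integrable lebesgue (\<lambda>x. (a x * c x - b x * (1 - c x)) * (w x - u x))"
   by (rule slope_integrable[OF Lam_diff[OF w u]]) (use c in auto)
  show "integrable lebesgue (\<lambda>x. psi w x - psi u x)"
   by (intro Bochner_Integration.integrable_diff psi_integrable[OF u] psi_integrable[OF w])
  show "AE x in lebesgue. (a x * c x - b x * (1 - c x)) * (w x - u x) \<le> psi w x - psi u x"
   using nonneg phase
  proof eventually_elim
   case (elim x)
   show ?case
   proof (cases "x \<in> \<Omega>")
    case True
    then show ?thesis unfolding psi_def using elim c[of x] by (intro two_phase_subgradient) auto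
   next
    case False
    then show ?thesis using supp[of x] by (simp add: psi_def)
   qed
  qed
 qed
 then show ?thesis using Bochner_Integration.integral_diff[OF psi_integrable[OF w] psi_integrable[OF u]] by simp
qed

definition solves_VI :: "('a \<Rightarrow> real) \<Rightarrow> ('a \<Rightarrow> 'a) \<Rightarrow> bool" where
 "solves_VI u G \<longleftrightarrow> Lam u G \<and> (\<forall>w K. Lam w K \<longrightarrow>
   (\<integral>x. psi w x \<partial>lebesgue) - (\<integral>x. psi u x \<partial>lebesgue)
    \<ge> (\<integral>x. g x * (w x - u x) \<partial>lebesgue) - (\<integral>x. pfield p (G x) \<bullet> (K x - G x) \<partial>lebesgue))"

text \<open>Each solution is tested with the other and the inequalities are added: the convex and
  the linear terms cancel, so the integral of the monotone term is at most 0. The gradients agree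
  almost everywhere, and the Poincare inequality carries this over to the functions.\<close>

lemma solves_VI_unique:
 assumes u: "solves_VI u G" and w: "solves_VI w K"
 shows "AE x in lebesgue. w x = u x"
proof -
 have L: "Lam u G" "Lam w K" using u w by (auto simp: solves_VI_def)
 note d = Lam_diff[OF L] Lam_diff[OF L(2,1)]
 note [measurable] = Lam_measurable[OF L(1)] Lam_measurable[OF L(2)] borel_measurable_pfield
 have 1: "(\<integral>x. psi w x \<partial>lebesgue) - (\<integral>x. psi u x \<partial>lebesgue) \<ge> (\<integral>x. g x * (w x - u x) \<partial>lebesgue) - (\<integral>x. pfield p (G x) \<bullet> (K x - G x) \<partial>lebesgue)"
  using u L(2) by (auto simp: solves_VI_def)
 have 2: "(\<integral>x. psi u x \<partial>lebesgue) - (\<integral>x. psi w x \<partial>lebesgue) \<ge> (\<integral>x. g x * (u x - w x) \<partial>lebesgue) - (\<integral>x. pfield p (K x) \<bullet> (G x - K x) \<partial>lebesgue)"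
  using w L(1) by (auto simp: solves_VI_def)
 have g: "(\<integral>x. g x * (u x - w x) \<partial>lebesgue) = - (\<integral>x. g x * (w x - u x) \<partial>lebesgue)"
  unfolding Bochner_Integration.integral_minus[symmetric] by (simp add: algebra_simps)
 have PG: "(\<integral>x. pfield p (G x) \<bullet> (K x - G x) \<partial>lebesgue) = - (\<integral>x. pfield p (G x) \<bullet> (G x - K x) \<partial>lebesgue)"
  unfolding Bochner_Integration.integral_minus[symmetric] by (simp add: inner_diff_right)
 let ?m = "\<lambda>x. (pfield p (G x) - pfield p (K x)) \<bullet> (G x - K x)"
 have mi: "integrable lebesgue ?m" unfolding inner_diff_left
  by (intro Bochner_Integration.integrable_diff integrable_pfield_inner[OF L(1) d(1)] integrable_pfield_inner[OF L(2) d(1)])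
 have "(\<integral>x. ?m x \<partial>lebesgue) \<le> 0"
  unfolding inner_diff_left Bochner_Integration.integral_diff[OF integrable_pfield_inner[OF L(1) d(1)] integrable_pfield_inner[OF L(2) d(1)]]
  using 1 2 g PG by linarith
 moreover have m0: "0 \<le> ?m x" for x using pfield_strictly_monotone[OF p, of "G x" "K x"] by (cases "G x = K x") auto
 ultimately have "(\<integral>x. ?m x \<partial>lebesgue) = 0" by (intro antisym integral_nonneg_AE AE_I2)
 then have "AE x in lebesgue. ?m x = 0" using integral_nonneg_eq_0_iff_AE[OF mi AE_I2[OF m0]] by blast
 then have GK: "AE x in lebesgue. G x - K x = 0"
 proof eventually_elim
  case (elim x)
  then show ?case using pfield_strictly_monotone[OF p, of "G x" "K x"] by (cases "G x = K x") auto
 qed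
 have "pint p lebesgue (\<lambda>x. G x - K x) = (\<integral>\<^sup>+x. 0 \<partial>(lebesgue :: 'a measure))"
  unfolding pint_def by (rule nn_integral_cong_AE) (use GK in \<open>eventually_elim, simp\<close>)
 then have G0: "pint p lebesgue (\<lambda>x. G x - K x) = 0" by simp
 obtain C where C: "C > 0" "\<And>u G N. Lam u G \<Longrightarrow> N > 0 \<Longrightarrow> pint p lebesgue G \<le> ennreal (N powr p) \<Longrightarrow> pint p lebesgue u \<le> ennreal (C * N powr p)"
  using ex_Lam_Poincare by blast
 \<comment> \<open>The Poincare inequality asks for a positive bound \<open>N\<close> on the
   gradient; a vanishing gradient admits every such \<open>N\<close>, taken arbitrarily
   small.\<close>
 have "pint p lebesgue (\<lambda>x. u x - w x) \<le> 0"
 proof (rule ennreal_le_epsilon)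
  fix e :: real assume e: "0 < e"
  define N where "N = (e / C) powr (1 / p)"
  have "N > 0" "N powr p = e / C" using e C(1) p0 by (auto simp: N_def powr_powr)
  then have "pint p lebesgue (\<lambda>x. u x - w x) \<le> ennreal (C * (e / C))" using C(2)[OF d(1), of N] G0 by simp
  then show "pint p lebesgue (\<lambda>x. u x - w x) \<le> 0 + ennreal e" using C(1) by simp
 qed
 then have "(\<integral>\<^sup>+x. ennreal (norm (u x - w x) powr p) \<partial>lebesgue) = 0" by (simp add: pint_def)
 then have "AE x in lebesgue. ennreal (norm (u x - w x) powr p) = 0" by (subst (asm) nn_integral_0_iff_AE) measurable
 then show ?thesis by eventually_elim (simp add: ennreal_eq_0_iff)
qed

end

theorem theorem3p3:
  fixes \<Omega> :: "'a::euclidean_space set"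
    and p s r :: real and q :: ereal
    and f v lp lm :: "'a \<Rightarrow> real"
  assumes "bounded \<Omega>" and "open \<Omega>"
    and "1 < p" and "0 < s" and "s \<le> 1"
    and "1 < r"
    and "ereal (pSharp DIM('a) s p r) < q"
    and "Lq_on (conj_exp q) \<Omega> v"
    and "Lq_on q \<Omega> lp" and "Lq_on q \<Omega> lm"
    and "AE x in lebesgue. x \<in> \<Omega> \<longrightarrow> lp x \<ge> 0 \<and> lm x \<ge> 0"
    and "Lp_on (pSharp DIM('a) s p r) \<Omega> f"
  shows "\<exists>u Gu cg cl.
           two_phase_solution s p \<Omega> f lp lm v u Gu cg cl \<and>
           var_ineq s p \<Omega> f lp lm v u Gu \<and>
           (\<forall>u' Gu'. var_ineq s p \<Omega> f lp lm v u' Gu' \<longrightarrow> (AE x in lebesgue. u' x = u x)) \<and>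
           Lq_on q \<Omega> (\<lambda>x. lp x * cg x - lm x * cl x) \<and>
           in_subdiff s p \<Omega> lp lm v u (\<lambda>x. lp x * cg x - lm x * cl x) \<and>
           (\<forall>w Gw. Lambda0 s p \<Omega> w Gw \<longrightarrow>
              (LINT x|lebesgue. indicator \<Omega> x * ((lp x * cg x - lm x * cl x) * w x))
                = (LINT x|lebesgue. indicator \<Omega> x * (f x * w x)) - plap_pair p Gu Gw) \<and>
           (\<forall>\<zeta>. Lq_on q \<Omega> \<zeta> \<and> in_subdiff s p \<Omega> lp lm v u \<zeta> \<and>
              (\<forall>w Gw. Lambda0 s p \<Omega> w Gw \<longrightarrow>
                 (LINT x|lebesgue. indicator \<Omega> x * (\<zeta> x * w x))
                   = (LINT x|lebesgue. indicator \<Omega> x * (f x * w x)) - plap_pair p Gu Gw)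
              \<longrightarrow> (AE x in lebesgue. x \<in> \<Omega> \<longrightarrow> \<zeta> x = lp x * cg x - lm x * cl x))"
proof -
 note \<Omega> = assms(1,2) and lp = assms(9) and lm = assms(10) and v = assms(8)
 let ?t = "pSharp DIM('a) s p r"
 have t1: "1 \<le> ?t" by (rule pSharp_ge_1) (use assms in auto)
 have tq: "ereal ?t < q" by (rule assms(7))
 have q1: "1 < q" using t1 tq by (metis ereal_less_eq(3) one_ereal_def order_le_less_trans)
 \<comment> \<open>As q exceeds both 1 and the threshold exponent, boundedness of \<Omega> puts the
   coefficients in L^1 and in the class whose pairing with the space is bounded.\<close>
 have L1: "Lp_on 1 \<Omega> h" "Lp_on ?t \<Omega> h" if "Lq_on q \<Omega> h" for h
  using Lq_on_imp_Lp_on[OF \<Omega> that, of 1] Lq_on_imp_Lp_on[OF \<Omega> that _ tq] q1 t1 by (auto simp: one_ereal_def)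
 have [measurable]: "\<Omega> \<in> sets lebesgue" using \<Omega> by simp
 obtain R where R: "R > 0" "\<Omega> \<subseteq> cball 0 R" using \<Omega>(1) unfolding bounded_pos by force
 interpret frac_space \<Omega> s p R using assms R by unfold_locales auto
 \<comment> \<open>Extension by zero turns integrals over \<Omega> into integrals over the whole
   space and makes the data measurable there; the obstacle becomes 0 outside, where both
   coefficients vanish.\<close>
 define a b g V where "a x = indicator \<Omega> x * lp x" and "b x = indicator \<Omega> x * lm x"
  and "g x = indicator \<Omega> x * f x" and "V x = indicator \<Omega> x * v x" for x :: 'a
 note defs = a_def b_def g_def V_def
 have dual: "\<exists>C>0. \<forall>u G N. Lam u G \<longrightarrow> N > 0 \<longrightarrow> pint p lebesgue G \<le> ennreal (N powr p) \<longrightarrow>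
  (\<integral>\<^sup>+x. ennreal \<bar>indicator \<Omega> x * h x * u x\<bar> \<partial>lebesgue) \<le> ennreal (C * N)" if "Lp_on ?t \<Omega> h" for h
  using ex_Lam_dual[OF assms(6) that] .
 interpret obstacle \<Omega> s p R a b g V
 proof
  show m: "a \<in> borel_measurable lebesgue" "b \<in> borel_measurable lebesgue" "g \<in> borel_measurable lebesgue" "V \<in> borel_measurable lebesgue"
   unfolding defs[abs_def] using Lq_on_measurable[OF lp] Lq_on_measurable[OF lm] Lq_on_measurable[OF v] assms(12) by (auto simp: Lp_on_def)
  show "AE x in lebesgue. 0 \<le> a x \<and> 0 \<le> b x"
   using assms(11) by eventually_elim (auto simp: defs split: split_indicator)
  show "x \<notin> \<Omega> \<Longrightarrow> a x = 0 \<and> b x = 0" for x by (simp add: defs)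
  show "integrable lebesgue a" "integrable lebesgue b"
   unfolding defs[abs_def] by (intro Lp_on_1_integrable L1 lp lm)+
  show "integrable lebesgue (\<lambda>x. a x * V x)" "integrable lebesgue (\<lambda>x. b x * V x)"
   unfolding defs by (intro Lq_on_mult_integrable[OF q1 _ v] lp lm)+
  obtain A where A: "A > 0" "\<And>u G N. Lam u G \<Longrightarrow> N > 0 \<Longrightarrow> pint p lebesgue G \<le> ennreal (N powr p) \<Longrightarrow> (\<integral>\<^sup>+x. ennreal \<bar>a x * u x\<bar> \<partial>lebesgue) \<le> ennreal (A * N)"
   using dual[OF L1(2)[OF lp]] unfolding a_def by blast
  obtain B where B: "B > 0" "\<And>u G N. Lam u G \<Longrightarrow> N > 0 \<Longrightarrow> pint p lebesgue G \<le> ennreal (N powr p) \<Longrightarrow> (\<integral>\<^sup>+x. ennreal \<bar>b x * u x\<bar> \<partial>lebesgue) \<le> ennreal (B * N)"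
   using dual[OF L1(2)[OF lm]] unfolding b_def by blast
  obtain D where D: "D > 0" "\<And>u G N. Lam u G \<Longrightarrow> N > 0 \<Longrightarrow> pint p lebesgue G \<le> ennreal (N powr p) \<Longrightarrow> (\<integral>\<^sup>+x. ennreal \<bar>g x * u x\<bar> \<partial>lebesgue) \<le> ennreal (D * N)"
   using dual[OF assms(12)] unfolding g_def by blast
  have "(\<integral>\<^sup>+x. ennreal (\<bar>a x * u x\<bar> + \<bar>b x * u x\<bar> + \<bar>g x * u x\<bar>) \<partial>lebesgue) \<le> ennreal ((A + B + D) * N)"
   if u: "Lam u G" and N: "N > 0" "pint p lebesgue G \<le> ennreal (N powr p)" for u G N
  proof -
   note [measurable] = m Lam_measurable(1)[OF u]
   have "(\<integral>\<^sup>+x. ennreal (\<bar>a x * u x\<bar> + \<bar>b x * u x\<bar> + \<bar>g x * u x\<bar>) \<partial>lebesgue)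
    = (\<integral>\<^sup>+x. ennreal \<bar>a x * u x\<bar> \<partial>lebesgue) + (\<integral>\<^sup>+x. ennreal \<bar>b x * u x\<bar> \<partial>lebesgue) + (\<integral>\<^sup>+x. ennreal \<bar>g x * u x\<bar> \<partial>lebesgue)"
    by (simp add: ennreal_plus nn_integral_add)
   also have "\<dots> \<le> ennreal (A * N) + ennreal (B * N) + ennreal (D * N)" by (intro add_mono A(2)[OF u N] B(2)[OF u N] D(2)[OF u N])
   also have "\<dots> = ennreal ((A + B + D) * N)" using A(1) B(1) D(1) N(1) by (simp add: ennreal_plus[symmetric] distrib_right del: ennreal_plus)
   finally show ?thesis .
  qed
  then show "\<exists>L>0. \<forall>u G N. Lam u G \<longrightarrow> N > 0 \<longrightarrow> pint p lebesgue G \<le> ennreal (N powr p) \<longrightarrow>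
   (\<integral>\<^sup>+x. ennreal (\<bar>a x * u x\<bar> + \<bar>b x * u x\<bar> + \<bar>g x * u x\<bar>) \<partial>lebesgue) \<le> ennreal (L * N)"
   using A(1) B(1) D(1) by (intro exI[of _ "A + B + D"]) auto
 qed
 have \<Omega>fin: "emeasure lebesgue \<Omega> < \<infinity>" using emeasure_bounded_finite[OF \<Omega>(1)] \<Omega>(2) by simp
 obtain u G c where u: "Lam u G" and cm[measurable]: "c \<in> borel_measurable lebesgue" and c01: "\<And>x. 0 \<le> c x \<and> c x \<le> 1"
  and phase: "AE x in lebesgue. x \<in> \<Omega> \<longrightarrow> (V x < u x \<longrightarrow> c x = 1) \<and> (u x < V x \<longrightarrow> c x = 0)"
  and eqn: "\<And>w K. Lam w K \<Longrightarrow> (\<integral>x. pfield p (G x) \<bullet> K x \<partial>lebesgue) + (\<integral>x. (a x * c x - b x * (1 - c x)) * w x \<partial>lebesgue)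
    = (\<integral>x. g x * w x \<partial>lebesgue)"
  by (rule ex_solution[OF \<Omega>fin], rule that)
 let ?z = "\<lambda>x. lp x * c x - lm x * (1 - c x)"
 have z_eq: "indicator \<Omega> x * (?z x * y) = (a x * c x - b x * (1 - c x)) * y" for x y by (simp add: defs split: split_indicator)
 have f_eq: "indicator \<Omega> x * (f x * y) = g x * y" for x y by (simp add: defs)
 have Psi_eq: "Psi \<Omega> lp lm v w = (\<integral>x. psi w x \<partial>lebesgue)" for w
  unfolding Psi_def psi_def by (intro Bochner_Integration.integral_cong refl) (simp add: defs split: split_indicator)
 have VI_eq: "var_ineq s p \<Omega> f lp lm v w K \<longleftrightarrow> solves_VI w K" for w K
  unfolding var_ineq_def solves_VI_def Lambda0_iff Psi_eq plap_pair_eq f_eq ..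
 have zsub: "(\<integral>x. (a x * c x - b x * (1 - c x)) * (w x - u x) \<partial>lebesgue) \<le> (\<integral>x. psi w x \<partial>lebesgue) - (\<integral>x. psi u x \<partial>lebesgue)"
  if "Lam w K" for w K
  by (rule integral_psi_subgradient[OF u that cm c01 phase])
 \<comment> \<open>The subgradient inequality for the multiplier, whose integral against w - u is
   rewritten by the equation tested with w - u.\<close>
 have VI: "solves_VI u G"
  unfolding solves_VI_def
 proof (intro conjI allI impI u)
  fix w K assume w: "Lam w K"
  show "(\<integral>x. psi w x \<partial>lebesgue) - (\<integral>x. psi u x \<partial>lebesgue)
    \<ge> (\<integral>x. g x * (w x - u x) \<partial>lebesgue) - (\<integral>x. pfield p (G x) \<bullet> (K x - G x) \<partial>lebesgue)"
   using eqn[OF Lam_diff[OF w u]] zsub[OF w] by linarith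
 qed
 have zLq: "Lq_on q \<Omega> ?z"
 proof (rule Lq_on_bounded_combination[OF q1 lp lm])
  have "(\<lambda>x. (a x * c x - b x * (1 - c x)) * 1) \<in> borel_measurable lebesgue" using meas by measurable
  then show "(\<lambda>x. indicator \<Omega> x * ?z x) \<in> borel_measurable lebesgue" unfolding z_eq[symmetric] by simp
  show "\<bar>?z x\<bar> \<le> \<bar>lp x\<bar> + \<bar>lm x\<bar>" for x
  proof -
   have "\<bar>lp x * c x\<bar> \<le> \<bar>lp x\<bar>" "\<bar>lm x * (1 - c x)\<bar> \<le> \<bar>lm x\<bar>" using c01[of x] by (simp_all add: abs_mult mult_left_le)
   then show ?thesis by linarith
  qed
 qed
 have eqn': "(\<integral>x. indicator \<Omega> x * (?z x * w x) \<partial>lebesgue) = (\<integral>x. indicator \<Omega> x * (f x * w x) \<partial>lebesgue) - plap_pair p G K"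
  if "Lambda0 s p \<Omega> w K" for w K
  using eqn[of w K] that unfolding z_eq f_eq plap_pair_eq Lambda0_iff by linarith
 \<comment> \<open>All four bounds reduce to the phase condition on c: where u > v one has c = 1 and
   1 - c = 0, where u < v the reverse, and on u = v the bounds are 0 and 1.\<close>
 have "two_phase_solution s p \<Omega> f lp lm v u G c (\<lambda>x. 1 - c x)"
  unfolding two_phase_solution_def
 proof (intro conjI allI impI)
  show "Lambda0 s p \<Omega> u G" unfolding Lambda0_iff by (rule u)
  show "Linf_on \<Omega> c" "Linf_on \<Omega> (\<lambda>x. 1 - c x)"
   unfolding Linf_on_def using c01 by (auto intro!: exI[of _ 1] AE_I2 simp: abs_le_iff)
  show "AE x in lebesgue. x \<in> \<Omega> \<longrightarrow>
    indicator {y. u y > v y} x \<le> c x \<and> c x \<le> indicator {y. u y \<ge> v y} x \<and>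
    indicator {y. u y < v y} x \<le> 1 - c x \<and> 1 - c x \<le> indicator {y. u y \<le> v y} x"
   using phase
  proof eventually_elim
   case (elim x)
   then show ?case using c01[of x] by (auto simp: V_def split: split_indicator)
  qed
  show "plap_pair p G K + (\<integral>x. indicator \<Omega> x * (?z x * w x) \<partial>lebesgue) = (\<integral>x. indicator \<Omega> x * (f x * w x) \<partial>lebesgue)"
   if "Lambda0 s p \<Omega> w K" for w K using eqn'[OF that] by linarith
 qed
 moreover have "in_subdiff s p \<Omega> lp lm v u ?z"
  unfolding in_subdiff_def Lambda0_iff Psi_eq z_eq using zsub by blast
 \<comment> \<open>Two multipliers satisfying the equation have the same integral against every test
   function; both are integrable over \<Omega>, so their difference vanishes there almost
   everywhere.\<close>
 moreover have "AE x in lebesgue. x \<in> \<Omega> \<longrightarrow> \<zeta> x = ?z x"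
  if \<zeta>: "Lq_on q \<Omega> \<zeta>" and eq: "\<And>w K. Lambda0 s p \<Omega> w K \<Longrightarrow>
   (\<integral>x. indicator \<Omega> x * (\<zeta> x * w x) \<partial>lebesgue) = (\<integral>x. indicator \<Omega> x * (f x * w x) \<partial>lebesgue) - plap_pair p G K" for \<zeta>
 proof -
  have i: "integrable lebesgue (\<lambda>x. indicator \<Omega> x * \<zeta> x)" "integrable lebesgue (\<lambda>x. indicator \<Omega> x * ?z x)"
   by (intro Lp_on_1_integrable L1 \<zeta> zLq)+
  have "AE x in lebesgue. x \<in> \<Omega> \<longrightarrow> indicator \<Omega> x * \<zeta> x - indicator \<Omega> x * ?z x = 0"
  proof (rule AE_eq_0_of_test_fun[OF Bochner_Integration.integrable_diff[OF i] \<Omega>(2)])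
   fix \<phi> assume \<phi>: "test_fun \<Omega> \<phi>"
   obtain B where B: "\<And>x. \<bar>\<phi> x\<bar> \<le> B" using C1c_bounded[OF test_C1c[OF \<phi>]] by blast
   have ii: "integrable lebesgue (\<lambda>x. h x * \<phi> x)" if h: "integrable lebesgue h" for h
   proof (rule Bochner_Integration.integrable_bound)
    show "integrable lebesgue (\<lambda>x. h x * B)" using h by (rule integrable_mult_left)
    show "(\<lambda>x. h x * \<phi> x) \<in> borel_measurable lebesgue"
     using borel_measurable_integrable[OF h] test_measurable[OF \<phi>] by measurable
    show "AE x in lebesgue. norm (h x * \<phi> x) \<le> norm (h x * B)"
    proof (rule AE_I2)
     fix x
     have "\<bar>h x\<bar> * \<bar>\<phi> x\<bar> \<le> \<bar>h x\<bar> * \<bar>B\<bar>" using B[of x] by (intro mult_left_mono) auto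
     then show "norm (h x * \<phi> x) \<le> norm (h x * B)" by (simp add: abs_mult)
    qed
   qed
   have "(\<integral>x. (indicator \<Omega> x * \<zeta> x - indicator \<Omega> x * ?z x) * \<phi> x \<partial>lebesgue)
    = (\<integral>x. indicator \<Omega> x * \<zeta> x * \<phi> x \<partial>lebesgue) - (\<integral>x. indicator \<Omega> x * ?z x * \<phi> x \<partial>lebesgue)"
    unfolding left_diff_distrib by (rule Bochner_Integration.integral_diff[OF ii[OF i(1)] ii[OF i(2)]])
   also have "\<dots> = 0"
    using eq[unfolded Lambda0_iff, OF Lam_test[OF \<phi>]] eqn'[unfolded Lambda0_iff, OF Lam_test[OF \<phi>]] unfolding mult.assoc by linarith
   finally show "(\<integral>x. (indicator \<Omega> x * \<zeta> x - indicator \<Omega> x * ?z x) * \<phi> x \<partial>lebesgue) = 0" .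
  qed
  then show ?thesis by eventually_elim simp
 qed
 ultimately show ?thesis
  using VI solves_VI_unique[OF VI] zLq eqn' unfolding VI_eq
  by (intro exI[of _ u] exI[of _ G] exI[of _ c] exI[of _ "\<lambda>x. 1 - c x"] conjI allI impI) blast+
qed

end
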